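(* Let $W:\mathbb{R}\to\mathbb{R}$ be a double-well potential such that: (1) $W$ is continuous; (2) $W\ge0$ and $W(z)=0$ if and only if $z=\pm1$; (3) $\liminf_{z\to\pm\infty}W(z)>0$. For $\varepsilon\in(0,1)$ and $s\in[\frac12,1)$ let $$\lambda(\varepsilon,s)=\begin{cases}\dfrac{1}{|\log\varepsilon|} & s=\frac12,\\[2mm] \dfrac{1-2s}{\varepsilon^{2s-1}-1} & s\in(\frac12,1),\end{cases}\qquad \mathcal{F}^s_\varepsilon(u)=\lambda(\varepsilon,s)\left(\frac1\varepsilon\int_{(0,1)}W(u)\,dt+\varepsilon^{2s-1}[u]_s^2\right).$$ Then every $s_0\in[\frac12,1)$ is a regular point: for any pair of sequences $(s_j,\varepsilon_j)\to(s_0,0)$ and $(s_j',\varepsilon_j')\to(s_0,0)$ with $s_j,s_j'\in[\frac12,1)$ and $\varepsilon_j,\varepsilon_j'\in(0,1)$, the following $\Gamma$-limits exist and coincide: $$\Gamma\text{-}\lim_{j\to+\infty}\mathcal{F}^{s_j}_{\varepsilon_j}=\Gamma\text{-}\lim_{j\to+\infty}\mathcal{F}^{s_j'}_{\varepsilon_j'}.$$ Moreover, for each fixed $s\in[\frac12,1)$, $$\Gamma\text{-}\lim_{\varepsilon\to0}\mathcal{F}^s_\varepsilon(u)=\begin{cases} m_{\frac12}\,F_0(u) & \text{if } s=\frac12,\\ (2s-1)\,m_s\,F_0(u) & \text{if } s\in(\frac12,1),\end{cases}$$ where $m_{\frac12}=8$, and $F_0(u)=\#S(u)$ if $u\in BV((0,1),\{-1,1\})$,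 $F_0(u)=+\infty$ otherwise.
   Context: For $s\in(0,1)$ and measurable $v:(0,1)\to\mathbb{R}$, $[v]_s^2=\iint_{(0,1)\times(0,1)}\frac{|v(x)-v(y)|^2}{|x-y|^{1+2s}}\,dx\,dy\in[0,+\infty]$. For $s\in(\frac12,1)$, $$m_s=\inf\left\{\int_{\mathbb{R}}W(u)\,dt+\iint_{\mathbb{R}\times\mathbb{R}}\frac{|u(x)-u(y)|^2}{|x-y|^{1+2s}}\,dx\,dy\ :\ u\in H^s_{\mathrm{loc}}(\mathbb{R}),\ u(\pm\infty)=\pm1\right\},$$ where $u(\pm\infty)=\pm1$ means $\lim_{x\to\pm\infty}u(x)=\pm1$ (for the continuous representative). $BV((0,1),\{-1,1\})$ is the set of functions of bounded variation on $(0,1)$ taking only the values $\pm1$ a.e.; $\#S(u)$ is the number of jump points of $u$. Functionals are defined on measurable real-valued functions on $(0,1)$ with values in $[0,+\infty]$, and $\Gamma$-limits are taken with respect to convergence in measure on $(0,1)$: $G_j$ $\Gamma$-converges to $G$ if for every $u$, $\liminf_jG_j(u_j)\ge G(u)$ whenever $u_j\to u$ in measure, and there exist $u_j\to u$ in measure with $\limsup_jG_j(u_j)\le G(u)$; for a family indexed by $\varepsilon\to0$ this is required along every sequence $\varepsilon_j\to0$. *)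

theory Defs
  imports "HOL-Analysis.Analysis"
begin

text \<open>Functions on \<open>(0,1)\<close> are total functions \<open>real \<Rightarrow> real\<close> of which only the values on
  \<open>{0<..<1}\<close> matter: everything below refers to \<open>lebesgue_on {0<..<1}\<close>.\<close>

abbreviation unit_ivl :: "real set" where
  "unit_ivl \<equiv> {0<..<1}"

definition double_well :: "(real \<Rightarrow> real) \<Rightarrow> bool" where
  "double_well W \<longleftrightarrow>
     continuous_on UNIV W \<and>
     (\<forall>z. W z \<ge> 0) \<and> (\<forall>z. W z = 0 \<longleftrightarrow> z = 1 \<or> z = -1) \<and>
     Liminf at_top (\<lambda>z. ereal (W z)) > 0 \<and> Liminf at_bot (\<lambda>z. ereal (W z)) > 0"

text \<open>The squared Gagliardo seminorm on \<open>A \<times> A\<close>. On the diagonal, a null set, the integrand is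
  \<open>0 / 0 = 0\<close>.\<close>

definition gagliardo_sq :: "real \<Rightarrow> real set \<Rightarrow> (real \<Rightarrow> real) \<Rightarrow> ennreal" where
  "gagliardo_sq s A u =
     (\<integral>\<^sup>+ (x, y). ennreal (\<bar>u x - u y\<bar>\<^sup>2 / \<bar>x - y\<bar> powr (1 + 2 * s))
        \<partial>(lebesgue_on A \<Otimes>\<^sub>M lebesgue_on A))"

definition H_space :: "real \<Rightarrow> real set \<Rightarrow> (real \<Rightarrow> real) set" where
  "H_space s A = {u \<in> borel_measurable (lebesgue_on A).
     (\<integral>\<^sup>+ x. ennreal (\<bar>u x\<bar>\<^sup>2) \<partial>lebesgue_on A) < \<infinity> \<and> gagliardo_sq s A u < \<infinity>}"

definition H_loc :: "real \<Rightarrow> (real \<Rightarrow> real) set" where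
  "H_loc s = {u. \<forall>a b. a < b \<longrightarrow> u \<in> H_space s {a<..<b}}"

definition limits_pm1 :: "(real \<Rightarrow> real) \<Rightarrow> bool" where
  "limits_pm1 u \<longleftrightarrow>
     (\<exists>v. continuous_on UNIV v \<and> (AE x in lebesgue. u x = v x) \<and>
          (v \<longlongrightarrow> 1) at_top \<and> (v \<longlongrightarrow> -1) at_bot)"

definition m_const :: "(real \<Rightarrow> real) \<Rightarrow> real \<Rightarrow> ennreal" where
  "m_const W s =
     (INF u \<in> {u \<in> H_loc s. limits_pm1 u}.
        (\<integral>\<^sup>+ t. ennreal (W (u t)) \<partial>lebesgue) + gagliardo_sq s UNIV u)"

definition scale_factor :: "real \<Rightarrow> real \<Rightarrow> real" where
  "scale_factor \<epsilon> s =
     (if s = 1/2 then 1 / \<bar>ln \<epsilon>\<bar> else (1 - 2 * s) / (\<epsilon> powr (2 * s - 1) - 1))"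

definition energy :: "(real \<Rightarrow> real) \<Rightarrow> real \<Rightarrow> real \<Rightarrow> (real \<Rightarrow> real) \<Rightarrow> ennreal" where
  "energy W s \<epsilon> u =
     ennreal (scale_factor \<epsilon> s) *
       (ennreal (1 / \<epsilon>) * (\<integral>\<^sup>+ t. ennreal (W (u t)) \<partial>lebesgue_on unit_ivl) +
        ennreal (\<epsilon> powr (2 * s - 1)) * gagliardo_sq s unit_ivl u)"

definition test_functions :: "real set \<Rightarrow> (real \<Rightarrow> real) set" where
  "test_functions A = {\<phi>. \<phi> C1_differentiable_on UNIV \<and>
     compact (closure {x. \<phi> x \<noteq> 0}) \<and> closure {x. \<phi> x \<noteq> 0} \<subseteq> A}"

definition total_variation :: "real set \<Rightarrow> (real \<Rightarrow> real) \<Rightarrow> ereal" where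
  "total_variation A u =
     (SUP \<phi> \<in> {\<phi> \<in> test_functions A. \<forall>x. \<bar>\<phi> x\<bar> \<le> 1}.
        ereal (\<integral>x. u x * deriv \<phi> x \<partial>lebesgue_on A))"

definition BV :: "real set \<Rightarrow> (real \<Rightarrow> real) set" where
  "BV A = {u. integrable (lebesgue_on A) u \<and> total_variation A u < \<infinity>}"

definition BV_pm1 :: "(real \<Rightarrow> real) set" where
  "BV_pm1 = {u \<in> BV unit_ivl. AE x in lebesgue_on unit_ivl. u x \<in> {-1, 1}}"

text \<open>Approximate jump points: the one-sided limits are taken in the mean, so that the notion
  depends only on the almost-everywhere class of \<open>u\<close>.\<close>

definition jump_set :: "(real \<Rightarrow> real) \<Rightarrow> real set" where
  "jump_set u = {x \<in> unit_ivl. \<exists>a b. a \<noteq> b \<and>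
     ((\<lambda>r. (\<integral>\<^sup>+ y. ennreal \<bar>u y - a\<bar> \<partial>lebesgue_on {x - r<..<x}) / ennreal r) \<longlongrightarrow> 0) (at_right 0) \<and>
     ((\<lambda>r. (\<integral>\<^sup>+ y. ennreal \<bar>u y - b\<bar> \<partial>lebesgue_on {x<..<x + r}) / ennreal r) \<longlongrightarrow> 0) (at_right 0)}"

text \<open>The number of jumps is counted by counting measure, as \<open>card\<close> is \<open>0\<close> on infinite sets.\<close>

definition F0 :: "(real \<Rightarrow> real) \<Rightarrow> ennreal" where
  "F0 u = (if u \<in> BV_pm1 then emeasure (count_space UNIV) (jump_set u) else \<infinity>)"

abbreviation measurable_functions :: "(real \<Rightarrow> real) set" where
  "measurable_functions \<equiv> borel_measurable (lebesgue_on unit_ivl)"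

definition tendsto_in_measure :: "(nat \<Rightarrow> real \<Rightarrow> real) \<Rightarrow> (real \<Rightarrow> real) \<Rightarrow> bool" where
  "tendsto_in_measure v u \<longleftrightarrow>
     (\<forall>\<delta>>0. (\<lambda>j. measure (lebesgue_on unit_ivl) {x \<in> unit_ivl. \<bar>v j x - u x\<bar> > \<delta>}) \<longlonglongrightarrow> 0)"

definition Gamma_converges ::
    "(nat \<Rightarrow> (real \<Rightarrow> real) \<Rightarrow> ennreal) \<Rightarrow> ((real \<Rightarrow> real) \<Rightarrow> ennreal) \<Rightarrow> bool" where
  "Gamma_converges G G' \<longleftrightarrow>
     (\<forall>u \<in> measurable_functions.
        (\<forall>v. (\<forall>j. v j \<in> measurable_functions) \<and> tendsto_in_measure v u \<longrightarrow>
             G' u \<le> liminf (\<lambda>j. G j (v j))) \<and>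
        (\<exists>v. (\<forall>j. v j \<in> measurable_functions) \<and> tendsto_in_measure v u \<and>
             limsup (\<lambda>j. G j (v j)) \<le> G' u))"

definition Gamma_converges_at_0 ::
    "(real \<Rightarrow> (real \<Rightarrow> real) \<Rightarrow> ennreal) \<Rightarrow> ((real \<Rightarrow> real) \<Rightarrow> ennreal) \<Rightarrow> bool" where
  "Gamma_converges_at_0 G G' \<longleftrightarrow>
     (\<forall>\<epsilon> :: nat \<Rightarrow> real. (\<forall>j. \<epsilon> j \<in> {0<..<1}) \<and> \<epsilon> \<longlonglongrightarrow> 0 \<longrightarrow>
        Gamma_converges (\<lambda>j. G (\<epsilon> j)) G')"

text \<open>A \<open>\<Gamma>\<close>-limit is unique on measurable functions, so a common \<open>G\<close> expresses that both
  \<open>\<Gamma>\<close>-limits exist and coincide.\<close>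

definition regular_point :: "(real \<Rightarrow> real) \<Rightarrow> real \<Rightarrow> bool" where
  "regular_point W s\<^sub>0 \<longleftrightarrow>
     (\<forall>(s :: nat \<Rightarrow> real) \<epsilon> (s' :: nat \<Rightarrow> real) \<epsilon>'.
        (\<forall>j. s j \<in> {1/2..<1} \<and> \<epsilon> j \<in> {0<..<1}) \<and> s \<longlonglongrightarrow> s\<^sub>0 \<and> \<epsilon> \<longlonglongrightarrow> 0 \<and>
        (\<forall>j. s' j \<in> {1/2..<1} \<and> \<epsilon>' j \<in> {0<..<1}) \<and> s' \<longlonglongrightarrow> s\<^sub>0 \<and> \<epsilon>' \<longlonglongrightarrow> 0 \<longrightarrow>
        (\<exists>G. Gamma_converges (\<lambda>j. energy W (s j) (\<epsilon> j)) G \<and>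
             Gamma_converges (\<lambda>j. energy W (s' j) (\<epsilon>' j)) G))"

end

theory Submission
  imports Defs "HOL-Complex_Analysis.Great_Picard" "HOL-Real_Asymp.Real_Asymp"
begin

text \<open>The scale factor satisfies
  \<open>1 / scale_factor \<epsilon> s = \<epsilon> powr (2 * s - 1) * (\<integral> h from \<epsilon> to 1. h powr (- 2 * s))\<close>, also for \<open>s = 1/2\<close>, so that it
  exactly normalises the interaction of two plateaus of \<open>\<plusminus>1\<close> seen at distances between \<open>\<epsilon>\<close> and \<open>1\<close>,
  and it tends to \<open>2 * s\<^sub>0 - 1\<close>.

  Lower bound near a jump. If \<open>s\<^sub>0 = 1/2\<close>, a small energy forces the functions onto \<open>\<plusminus>1\<close> outside a set of
  measure of order \<open>\<epsilon> / scale_factor\<close>, and counting the pairs of opposite sign along arithmetic progressions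
  gives \<open>8\<close> from the logarithmic divergence of the kernel alone. If \<open>s\<^sub>0 > 1/2\<close>, rescaling by \<open>\<epsilon>\<close> turns the energy into
  \<open>scale_factor\<close> times the energy of a function on a long interval; a Morrey estimate that is uniform for \<open>s\<close>
  near \<open>s\<^sub>0\<close> yields compactness, and a transition between long plateaus costs at least \<open>m_const W s\<^sub>0\<close> in the limit.

  Upper bound. A profile with exact tails, scaled by \<open>\<epsilon>\<close>, is glued into every jump; the interaction of
  different jumps stays bounded and is killed by the prefactor. For \<open>s\<^sub>0 = 1/2\<close> the profile is a linear ramp, for
  \<open>s\<^sub>0 > 1/2\<close> a near-minimiser of \<open>m_const W s\<^sub>0\<close> whose tails are cut off and which is then averaged, so that it is
  Lipschitz and has finite seminorm for all exponents near \<open>s\<^sub>0\<close>.\<close>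

subsection \<open>The Gagliardo seminorm as an iterated Borel integral\<close>

text \<open>The value \<open>8\<close> is \<open>2 * (1 - (-1))\<^sup>2\<close>: increments in both
  directions are counted, and a pair of opposite sign contributes \<open>4\<close>. The obstacle
  near \<open>s = 1/2\<close> is that the Hoelder constant of the embedding blows up there, so along
  \<open>s j\<close> tending to \<open>1/2\<close> neither continuity nor compactness is available;
  hence the purely measure-theoretic counting in that case. It can start only at distances of order
  \<open>\<epsilon> / \<lambda>\<close>, with \<lambda> the scale factor, instead of \<epsilon>; the
  missing piece of the logarithm has size \<open>ln (K / \<lambda>)\<close> and is multiplied by
  \<lambda>, which tends to \<open>0\<close>. For \<open>s0 > 1/2\<close> a near-minimiser for the
  exponent \<open>s0\<close> may have infinite seminorm for slightly larger exponents, by lack of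
  smoothness, or for slightly smaller ones, by slow tails; cutting repairs the second defect and
  averaging the first. All bounds on the scale factor are uniform in \<open>s \<ge> 1/2\<close>, so
  no relation between the rates of \<open>s j\<close> and \<open>\<epsilon> j\<close>
  enters.\<close>

definition kern :: "real \<Rightarrow> (real \<Rightarrow> real) \<Rightarrow> real \<Rightarrow> real \<Rightarrow> ennreal" where
  "kern s u x y = ennreal ((u x - u y)\<^sup>2 / \<bar>x - y\<bar> powr (1 + 2 * s))"

text \<open>Iterating over \<open>lborel\<close> and carrying the domain in indicators keeps the
  integrands Borel, so Tonelli and affine substitutions apply without any discussion of completions;
  \<open>gagliardo_sq_eq\<close> is the link to the seminorm of the statement.\<close>

definition gsq :: "real \<Rightarrow> real set \<Rightarrow> (real \<Rightarrow> real) \<Rightarrow> ennreal" where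
  "gsq s A u = (\<integral>\<^sup>+ x. (\<integral>\<^sup>+ y. kern s u x y * indicator A x * indicator A y \<partial>lborel) \<partial>lborel)"

lemma kern_measurable [measurable (raw)]:
  assumes [measurable]: "u \<in> borel_measurable borel" "f \<in> borel_measurable M" "g \<in> borel_measurable M"
  shows "(\<lambda>x. kern s u (f x) (g x)) \<in> borel_measurable M"
  unfolding kern_def by measurable

lemma AE_lborel_of_lebesgue: 
  assumes "AE x in lebesgue. P x" shows "AE x in lborel. P x"
  using assms by (simp add: AE_completion_iff)

lemma AE_lebesgue_on_iff:
  assumes "A \<in> sets borel"
  shows "(AE x in lebesgue_on A. P x) \<longleftrightarrow> (AE x in lborel. x \<in> A \<longrightarrow> P x)"
  using assms by (subst AE_restrict_space_iff) (auto simp: AE_completion_iff)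

lemma nn_integral_lebesgue_on:
  assumes "A \<in> sets borel"
  shows "(\<integral>\<^sup>+ x. f x \<partial>lebesgue_on A) = (\<integral>\<^sup>+ x. f x * indicator A x \<partial>lborel)"
  using assms by (subst nn_integral_restrict_space) (auto simp: nn_integral_completion)

text \<open>Extension by zero gives a Lebesgue measurable function on the line, and such a function
  agrees almost everywhere with a Borel one. The whole argument is run on these
  representatives.\<close>

lemma borel_rep_lebesgue_on:
  fixes u :: "real \<Rightarrow> real"
  assumes "A \<in> sets borel" "u \<in> borel_measurable (lebesgue_on A)"
  obtains u' where "u' \<in> borel_measurable borel" "AE x in lborel. x \<in> A \<longrightarrow> u x = u' x"
proof -
  have "(\<lambda>x. indicator A x *\<^sub>R u x) \<in> borel_measurable lebesgue"
    using assms by (subst (asm) borel_measurable_restrict_space_iff) (auto simp: indicator_def)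
  from completion_ex_borel_measurable_real[OF this[simplified]]
  obtain g where g: "g \<in> borel_measurable lborel" "AE x in lborel. indicator A x * u x = g x"
    by auto
  show ?thesis
  proof (rule that[of g])
    show "g \<in> borel_measurable borel" using g(1) by simp
    show "AE x in lborel. x \<in> A \<longrightarrow> u x = g x" using g(2) by eventually_elim auto
  qed
qed

lemma sigma_finite_lebesgue_on:
  assumes "A \<in> sets borel" shows "sigma_finite_measure (lebesgue_on A :: real measure)"
proof -
  have "sigma_finite_measure (lebesgue :: real measure)"
  proof
    have "(\<Union>n. {- real n..real n}) = UNIV"
    proof (intro set_eqI iffI UNIV_I)
      fix x :: real
      obtain n where "\<bar>x\<bar> \<le> real n" using real_arch_simple by blast
      then show "x \<in> (\<Union>n. {- real n..real n})" by (intro UN_I[of n]) auto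
    qed
    then show "\<exists>A::real set set. countable A \<and> A \<subseteq> sets lebesgue \<and> \<Union> A = space lebesgue \<and> (\<forall>a\<in>A. emeasure lebesgue a \<noteq> \<infinity>)"
      by (intro exI[of _ "range (\<lambda>n. {- real n..real n})"]) auto
  qed
  then show ?thesis using assms by (intro sigma_finite_measure_restrict_space) auto
qed

text \<open>If \<open>N\<close> is the null set where the two functions differ, the integrands
  differ only on the cross \<open>N \<times> A \<union> A \<times> N\<close>, which is null for the
  product measure. With the Borel function in place, Tonelli turns the product integral into the
  iterated one.\<close>

lemma gagliardo_sq_eq:
  fixes u u' :: "real \<Rightarrow> real"
  assumes A: "A \<in> sets borel" and u': "u' \<in> borel_measurable borel"
    and ae: "AE x in lborel. x \<in> A \<longrightarrow> u x = u' x"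
  shows "gagliardo_sq s A u = gsq s A u'"
proof -
  interpret L: sigma_finite_measure "lebesgue_on A :: real measure"
    by (rule sigma_finite_lebesgue_on[OF A])
  interpret P: pair_sigma_finite "lebesgue_on A :: real measure" "lebesgue_on A :: real measure" ..
  have [measurable]: "u' \<in> borel_measurable (lebesgue_on A)"
    using u' by (intro measurable_restrict_space1 measurable_completion) simp
  have [measurable]: "(\<lambda>x::real. x) \<in> borel_measurable (lebesgue_on A)"
    by (intro measurable_restrict_space1) (simp add: measurable_completion)
  have "AE x in lebesgue_on A. u x = u' x"
    using ae by (simp add: AE_lebesgue_on_iff[OF A])
  then obtain N where N: "N \<in> null_sets (lebesgue_on A)" "{x \<in> space (lebesgue_on A). u x \<noteq> u' x} \<subseteq> N"
    by (auto simp: eventually_ae_filter)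
  have "N \<times> space (lebesgue_on A) \<in> null_sets (lebesgue_on A \<Otimes>\<^sub>M lebesgue_on A)"
       "space (lebesgue_on A) \<times> N \<in> null_sets (lebesgue_on A \<Otimes>\<^sub>M lebesgue_on A)"
    by (rule L.times_in_null_sets1[OF N(1) sets.top], rule L.times_in_null_sets2[OF sets.top N(1)])
  then have "AE p in lebesgue_on A \<Otimes>\<^sub>M lebesgue_on A. p \<notin> N \<times> space (lebesgue_on A) \<union> space (lebesgue_on A) \<times> N"
    by (intro AE_not_in) auto
  then have "AE p in lebesgue_on A \<Otimes>\<^sub>M lebesgue_on A. u (fst p) = u' (fst p) \<and> u (snd p) = u' (snd p)"
    using AE_space by eventually_elim (use N(2) in \<open>auto simp: space_pair_measure\<close>)
  then have "gagliardo_sq s A u = (\<integral>\<^sup>+ p. kern s u' (fst p) (snd p) \<partial>(lebesgue_on A \<Otimes>\<^sub>M lebesgue_on A))"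
    unfolding gagliardo_sq_def
    by (intro nn_integral_cong_AE, elim eventually_mono) (simp add: kern_def case_prod_beta)
  also have "\<dots> = (\<integral>\<^sup>+ x. \<integral>\<^sup>+ y. kern s u' x y \<partial>lebesgue_on A \<partial>lebesgue_on A)"
  proof (rule L.nn_integral_fst[symmetric, where f = "\<lambda>p. kern s u' (fst p) (snd p)", unfolded fst_conv snd_conv])
    show "(\<lambda>p. kern s u' (fst p) (snd p)) \<in> borel_measurable (lebesgue_on A \<Otimes>\<^sub>M lebesgue_on A)"
      by (intro kern_measurable u' measurable_compose[OF measurable_fst] measurable_compose[OF measurable_snd]) measurable
  qed
  also have "\<dots> = gsq s A u'"
    unfolding gsq_def nn_integral_lebesgue_on[OF A]
    by (intro nn_integral_cong) (auto simp: mult_ac indicator_def)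
  finally show ?thesis .
qed

lemma gsq_mono:
  assumes "\<And>x y. x \<in> A \<Longrightarrow> y \<in> A \<Longrightarrow> (u x - u y)\<^sup>2 \<le> (v x - v y)\<^sup>2" "A \<subseteq> B"
  shows "gsq s A u \<le> gsq s B v"
  unfolding gsq_def kern_def using assms
  by (intro nn_integral_mono) (auto simp: indicator_def intro!: ennreal_leI divide_right_mono)

lemma gsq_mono_set: "A \<subseteq> B \<Longrightarrow> gsq s A u \<le> gsq s B u"
  by (rule gsq_mono) auto

lemma gsq_cong_AE:
  assumes "AE x in lborel. x \<in> A \<longrightarrow> u x = v x"
  shows "gsq s A u = gsq s A v"
  unfolding gsq_def
proof (rule nn_integral_cong_AE, use assms in eventually_elim)
  fix x assume x: "x \<in> A \<longrightarrow> u x = v x"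
  show "(\<integral>\<^sup>+ y. kern s u x y * indicator A x * indicator A y \<partial>lborel) = 
        (\<integral>\<^sup>+ y. kern s v x y * indicator A x * indicator A y \<partial>lborel)"
  proof (rule nn_integral_cong_AE, use assms in eventually_elim)
    fix y assume "y \<in> A \<longrightarrow> u y = v y"
    with x show "kern s u x y * indicator A x * indicator A y = kern s v x y * indicator A x * indicator A y"
      by (auto simp: indicator_def kern_def)
  qed
qed

text \<open>A pair \<open>(x, y)\<close> lies in \<open>A i \<times> A i\<close> for at most one
  \<open>i\<close>, so the left side merely forgets the nonnegative interactions between different
  pieces. This localises the lower bound to one jump at a time.\<close>

lemma gsq_superadd:
  assumes u [measurable]: "u \<in> borel_measurable borel" and fin: "finite I"
    and A [measurable]: "\<And>i. i \<in> I \<Longrightarrow> A i \<in> sets borel" and disj: "disjoint_family_on A I"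
    and sub: "\<And>i. i \<in> I \<Longrightarrow> A i \<subseteq> B"
  shows "(\<Sum>i\<in>I. gsq s (A i) u) \<le> gsq s B u"
proof -
  have "(\<Sum>i\<in>I. gsq s (A i) u) = 
    (\<integral>\<^sup>+ x. \<integral>\<^sup>+ y. (\<Sum>i\<in>I. kern s u x y * indicator (A i) x * indicator (A i) y) \<partial>lborel \<partial>lborel)"
    unfolding gsq_def by (subst nn_integral_sum[symmetric]; (subst nn_integral_sum)?; measurable)
  also have "\<dots> \<le> gsq s B u" unfolding gsq_def
  proof (intro nn_integral_mono)
    fix x y :: real
    show "(\<Sum>i\<in>I. kern s u x y * indicator (A i) x * indicator (A i) y) \<le> kern s u x y * indicator B x * indicator B y"
    proof (cases "\<exists>i\<in>I. x \<in> A i \<and> y \<in> A i")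
      case True
      then obtain i where i: "i \<in> I" "x \<in> A i" "y \<in> A i" by auto
      then have "x \<notin> A j" if "j \<in> I" "j \<noteq> i" for j
        using disj that unfolding disjoint_family_on_def by auto
      then have "(\<Sum>i\<in>I. kern s u x y * indicator (A i) x * indicator (A i) y) = 
         (\<Sum>j\<in>{i}. kern s u x y * indicator (A j) x * indicator (A j) y)"
        using i fin by (intro sum.mono_neutral_right) auto
      also have "\<dots> \<le> kern s u x y * indicator B x * indicator B y"
        using i sub[of i] by (auto simp: indicator_def)
      finally show ?thesis .
    next
      case False
      then have "(\<Sum>i\<in>I. kern s u x y * indicator (A i) x * indicator (A i) y) = 0"
        by (intro sum.neutral) (auto simp: indicator_def)
      then show ?thesis by simp
    qed
  qed
  finally show ?thesis .
qed

text \<open>The kernel scales with \<open>\<bar>c\<bar> powr (1 + 2 * s)\<close> and the two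
  substitutions cost \<open>\<bar>c\<bar>\<close> each, which leaves the exponent
  \<open>2 * s - 1\<close>. With \<open>c = \<epsilon>\<close> this is the weight in front of the
  seminorm in the energy.\<close>

lemma gsq_affine:
  assumes u [measurable]: "u \<in> borel_measurable borel" and A [measurable]: "A \<in> sets borel" and c: "c \<noteq> 0"
  shows "gsq s ((\<lambda>x. t + c * x) -` A) (\<lambda>x. u (t + c * x)) = ennreal (\<bar>c\<bar> powr (2 * s - 1)) * gsq s A u"
proof -
  have k: "kern s (\<lambda>x. u (t + c * x)) x y = ennreal (\<bar>c\<bar> powr (1 + 2 * s)) * kern s u (t + c * x) (t + c * y)" for x y
  proof -
    have "\<bar>t + c * x - (t + c * y)\<bar> powr (1 + 2 * s) = \<bar>c\<bar> powr (1 + 2 * s) * \<bar>x - y\<bar> powr (1 + 2 * s)"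
      by (simp add: powr_mult[symmetric] abs_mult[symmetric] algebra_simps)
    then show ?thesis unfolding kern_def using c
      by (subst ennreal_mult[symmetric]) (auto simp: field_simps)
  qed
  have "ennreal (\<bar>c\<bar> powr (2 * s - 1)) * gsq s A u = 
    ennreal (\<bar>c\<bar> powr (2 * s - 1)) * (\<bar>c\<bar> * (\<integral>\<^sup>+ x. \<bar>c\<bar> * (\<integral>\<^sup>+ y. kern s u (t + c * x) (t + c * y) * indicator A (t + c * x) * indicator A (t + c * y) \<partial>lborel) \<partial>lborel))"
    unfolding gsq_def
  proof (subst nn_integral_real_affine[where f = "\<lambda>x. \<integral>\<^sup>+ y. kern s u x y * indicator A x * indicator A y \<partial>lborel", OF _ c, of t])
    have "(\<integral>\<^sup>+ y. kern s u (t + c * x) y * indicator A (t + c * x) * indicator A y \<partial>lborel) = 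
        ennreal \<bar>c\<bar> * (\<integral>\<^sup>+ y. kern s u (t + c * x) (t + c * y) * indicator A (t + c * x) * indicator A (t + c * y) \<partial>lborel)" for x
      by (rule nn_integral_real_affine[OF _ c, of _ t]) measurable
    then show "ennreal (\<bar>c\<bar> powr (2 * s - 1)) * (ennreal \<bar>c\<bar> * (\<integral>\<^sup>+ x. (\<integral>\<^sup>+ y. kern s u (t + c * x) y * indicator A (t + c * x) * indicator A y \<partial>lborel) \<partial>lborel)) = 
      ennreal (\<bar>c\<bar> powr (2 * s - 1)) * (\<bar>c\<bar> * (\<integral>\<^sup>+ x. \<bar>c\<bar> * (\<integral>\<^sup>+ y. kern s u (t + c * x) (t + c * y) * indicator A (t + c * x) * indicator A (t + c * y) \<partial>lborel) \<partial>lborel))"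
      by simp
  qed measurable
  also have "\<dots> = ennreal (\<bar>c\<bar> powr (2 * s - 1)) * (ennreal \<bar>c\<bar> * ennreal \<bar>c\<bar>) * (\<integral>\<^sup>+ x. (\<integral>\<^sup>+ y. kern s u (t + c * x) (t + c * y) * indicator A (t + c * x) * indicator A (t + c * y) \<partial>lborel) \<partial>lborel)"
    by (subst nn_integral_cmult) (auto simp: mult_ac)
  also have "ennreal (\<bar>c\<bar> powr (2 * s - 1)) * (ennreal \<bar>c\<bar> * ennreal \<bar>c\<bar>) = ennreal (\<bar>c\<bar> powr (1 + 2 * s))"
  proof -
    have "\<bar>c\<bar> powr (1 + 2 * s) = \<bar>c\<bar> powr ((2 * s - 1) + 2)" by simp
    also have "\<dots> = \<bar>c\<bar> powr (2 * s - 1) * \<bar>c\<bar> powr 2" by (rule powr_add)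
    also have "\<bar>c\<bar> powr 2 = \<bar>c\<bar> * \<bar>c\<bar>" using c by (simp add: power2_eq_square)
    finally have "\<bar>c\<bar> powr (2 * s - 1) * (\<bar>c\<bar> * \<bar>c\<bar>) = \<bar>c\<bar> powr (1 + 2 * s)" ..
    then show ?thesis by (simp add: ennreal_mult[symmetric] del: abs_mult_self_eq)
  qed
  also have "ennreal (\<bar>c\<bar> powr (1 + 2 * s)) * (\<integral>\<^sup>+ x. (\<integral>\<^sup>+ y. kern s u (t + c * x) (t + c * y) * indicator A (t + c * x) * indicator A (t + c * y) \<partial>lborel) \<partial>lborel)
    = gsq s ((\<lambda>x. t + c * x) -` A) (\<lambda>x. u (t + c * x))"
    unfolding gsq_def k
    apply (subst nn_integral_cmult[symmetric]) apply measurable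
    apply (intro nn_integral_cong)
    apply (subst nn_integral_cmult[symmetric]) apply measurable
    apply (intro nn_integral_cong) apply (simp add: indicator_def)
    done
  finally show ?thesis by simp
qed

section \<open>Increments over a fixed distance\<close>

text \<open>The squared \<open>L\<^sup>2\<close> modulus of translation, restricted to those
  \<open>x\<close> for which both end points lie in \<open>A\<close>. The lower bound at
  \<open>1/2\<close> and the estimates of profiles are made for fixed \<open>h\<close> and
  integrated afterwards.\<close>

definition diff_sq :: "real set \<Rightarrow> (real \<Rightarrow> real) \<Rightarrow> real \<Rightarrow> ennreal" where
  "diff_sq A u h = (\<integral>\<^sup>+ x. ennreal ((u (x + h) - u x)\<^sup>2) * indicator A x * indicator A (x + h) \<partial>lborel)"

lemma diff_sq_measurable [measurable]:
  assumes [measurable]: "u \<in> borel_measurable borel" "A \<in> sets borel"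
  shows "diff_sq A u \<in> borel_measurable borel"
  unfolding diff_sq_def by measurable

lemma diff_sq_minus:
  assumes [measurable]: "u \<in> borel_measurable borel" "A \<in> sets borel"
  shows "diff_sq A u (- h) = diff_sq A u h"
  unfolding diff_sq_def
  apply (subst nn_integral_real_affine[where c = 1 and t = h])
    apply measurable
   apply (auto intro!: nn_integral_cong simp: add.commute power2_commute mult_ac indicator_def)
  done

text \<open>Substituting \<open>y = x + h\<close> and exchanging the integrals separates the kernel
  from the increments; the integrand is even in \<open>h\<close>, which gives the factor
  \<open>2\<close>.\<close>

lemma gsq_eq_diff_sq:
  assumes u [measurable]: "u \<in> borel_measurable borel" and A [measurable]: "A \<in> sets borel"
  shows "gsq s A u = 2 * (\<integral>\<^sup>+ h. ennreal (h powr (- (1 + 2 * s))) * diff_sq A u h * indicator {0<..} h \<partial>lborel)"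
proof -
  define F where "F h = ennreal (\<bar>h\<bar> powr (- (1 + 2 * s))) * diff_sq A u h" for h
  have [measurable]: "F \<in> borel_measurable borel" unfolding F_def by measurable
  have "gsq s A u = (\<integral>\<^sup>+ x. (\<integral>\<^sup>+ h. kern s u x (x + h) * indicator A x * indicator A (x + h) \<partial>lborel) \<partial>lborel)"
    unfolding gsq_def
  proof (rule nn_integral_cong)
    fix x :: real
    have "(\<integral>\<^sup>+ y. kern s u x y * indicator A x * indicator A y \<partial>lborel) =
      ennreal \<bar>1\<bar> * (\<integral>\<^sup>+ h. kern s u x (x + 1 * h) * indicator A x * indicator A (x + 1 * h) \<partial>lborel)"
      by (rule nn_integral_real_affine[where f = "\<lambda>y. kern s u x y * indicator A x * indicator A y" and c = 1 and t = x])
        measurable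
    then show "(\<integral>\<^sup>+ y. kern s u x y * indicator A x * indicator A y \<partial>lborel) =
      (\<integral>\<^sup>+ h. kern s u x (x + h) * indicator A x * indicator A (x + h) \<partial>lborel)"
      by (simp only: abs_one ennreal_1 mult_1_left)
  qed
  also have "\<dots> = (\<integral>\<^sup>+ h. (\<integral>\<^sup>+ x. kern s u x (x + h) * indicator A x * indicator A (x + h) \<partial>lborel) \<partial>lborel)"
    by (intro lborel_pair.Fubini'[symmetric]) measurable
  also have "\<dots> = (\<integral>\<^sup>+ h. F h \<partial>lborel)"
  proof (intro nn_integral_cong)
    fix h :: real
    have "kern s u x (x + h) = ennreal (\<bar>h\<bar> powr (- (1 + 2 * s))) * ennreal ((u (x + h) - u x)\<^sup>2)" for x
      unfolding kern_def 
      by (subst ennreal_mult[symmetric]) (auto simp: powr_minus divide_inverse power2_commute mult_ac simp del: minus_add_distrib)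
    then show "(\<integral>\<^sup>+ x. kern s u x (x + h) * indicator A x * indicator A (x + h) \<partial>lborel) = F h"
      unfolding F_def diff_sq_def by (subst nn_integral_cmult[symmetric]) (auto simp: mult_ac)
  qed
  also have "\<dots> = (\<integral>\<^sup>+ h. F h * indicator {0<..} h + F h * indicator {..<0} h \<partial>lborel)"
  proof (rule nn_integral_cong_AE)
    have "AE h in lborel. h \<noteq> (0::real)" by (rule AE_lborel_singleton)
    then show "AE h in lborel. F h = F h * indicator {0<..} h + F h * indicator {..<0} h"
      by eventually_elim (auto simp: indicator_def)
  qed
  also have "\<dots> = (\<integral>\<^sup>+ h. F h * indicator {0<..} h \<partial>lborel) + (\<integral>\<^sup>+ h. F h * indicator {..<0} h \<partial>lborel)"
    by (rule nn_integral_add) measurable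
  also have "(\<integral>\<^sup>+ h. F h * indicator {..<0} h \<partial>lborel) = (\<integral>\<^sup>+ h. F h * indicator {0<..} h \<partial>lborel)"
    apply (subst nn_integral_real_affine[where c = "-1" and t = 0])
      apply measurable
    apply (auto intro!: nn_integral_cong simp: F_def diff_sq_minus indicator_def)
    done
  also have "(\<integral>\<^sup>+ h. F h * indicator {0<..} h \<partial>lborel) = (\<integral>\<^sup>+ h. ennreal (h powr (- (1 + 2 * s))) * diff_sq A u h * indicator {0<..} h \<partial>lborel)"
    by (intro nn_integral_cong) (auto simp: F_def indicator_def)
  finally show ?thesis by (simp only: mult_2)
qed

subsection \<open>Continuous representatives\<close>

definition avg :: "real \<Rightarrow> real \<Rightarrow> (real \<Rightarrow> real) \<Rightarrow> real" where
  "avg a b u = (\<integral>x. indicator {a<..<b} x * u x \<partial>lborel) / (b - a)"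

text \<open>Jensen's inequality, from expanding the nonnegative integral of
  \<open>(f - m * I)\<^sup>2\<close>. A finite right side makes \<open>u\<close> integrable on the
  interval, so the default value \<open>0\<close> of the integral in \<open>avg\<close> can occur
  only when the right side is infinite.\<close>

lemma avg_variance:
  assumes u [measurable]: "u \<in> borel_measurable borel" and ab: "a < b"
  shows "ennreal ((avg a b u - c)\<^sup>2) * ennreal (b - a) \<le> (\<integral>\<^sup>+ x. ennreal ((u x - c)\<^sup>2) * indicator {a<..<b} x \<partial>lborel)"
    (is "_ \<le> ?R")
proof (cases "?R = \<infinity>")
  case False
  define I where "I x = (indicator {a<..<b} x :: real)" for x
  have [measurable]: "I \<in> borel_measurable borel" unfolding I_def by measurable
  define f where "f x = I x * (u x - c)" for x
  have [measurable]: "f \<in> borel_measurable borel" unfolding f_def by measurable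
  have intI: "integrable lborel I" and valI: "integral\<^sup>L lborel I = b - a"
    unfolding I_def using ab by (auto simp: integrable_indicator_iff)
  have eq: "(\<integral>\<^sup>+ x. ennreal ((f x)\<^sup>2) \<partial>lborel) = ?R"
    by (intro nn_integral_cong) (auto simp: f_def I_def indicator_def)
  have int2: "integrable lborel (\<lambda>x. (f x)\<^sup>2)"
    using False eq by (intro integrableI_nonneg) (auto simp: top.not_eq_extremum less_top)
  have "integrable lborel (\<lambda>x. I x + (f x)\<^sup>2)" using intI int2 by simp
  then have intf: "integrable lborel f"
  proof (rule Bochner_Integration.integrable_bound, measurable, intro AE_I2)
    fix x
    have "\<bar>t\<bar> \<le> 1 + t\<^sup>2" for t :: real
    proof (cases "\<bar>t\<bar> \<le> 1")
      case False
      then have "\<bar>t\<bar> * 1 \<le> \<bar>t\<bar> * \<bar>t\<bar>" by (intro mult_left_mono) auto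
      then show ?thesis by (simp add: power2_eq_square)
    qed (use zero_le_power2[of t] in linarith)
    then show "norm (f x) \<le> norm (I x + (f x)\<^sup>2)"
      by (auto simp: f_def I_def indicator_def)
  qed
  define m where "m = avg a b u - c"
  have "(\<integral>x. indicator {a<..<b} x * u x \<partial>lborel) = (\<integral>x. f x + c * I x \<partial>lborel)"
    by (intro Bochner_Integration.integral_cong) (auto simp: f_def I_def indicator_def)
  also have "\<dots> = (\<integral>x. f x \<partial>lborel) + c * (b - a)"
    using intf intI valI by simp
  finally have mf: "(\<integral>x. f x \<partial>lborel) = m * (b - a)"
    using ab unfolding m_def avg_def by (simp add: field_simps)
  have "0 \<le> (\<integral>x. (f x - m * I x)\<^sup>2 \<partial>lborel)" by (intro integral_nonneg_AE) auto
  also have "\<dots> = (\<integral>x. (f x)\<^sup>2 - 2 * m * f x + m\<^sup>2 * I x \<partial>lborel)"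
    by (intro Bochner_Integration.integral_cong) (auto simp: f_def I_def indicator_def power2_eq_square algebra_simps)
  also have "\<dots> = (\<integral>x. (f x)\<^sup>2 \<partial>lborel) - 2 * m * (m * (b - a)) + m\<^sup>2 * (b - a)"
    using intf intI valI int2 mf by simp
  finally have "m\<^sup>2 * (b - a) \<le> (\<integral>x. (f x)\<^sup>2 \<partial>lborel)"
    by (simp add: power2_eq_square algebra_simps)
  then have "ennreal (m\<^sup>2 * (b - a)) \<le> ennreal (\<integral>x. (f x)\<^sup>2 \<partial>lborel)" by (rule ennreal_leI)
  also have "\<dots> = ?R" unfolding eq[symmetric] by (intro nn_integral_eq_integral[symmetric] int2) auto
  finally show ?thesis using ab by (simp add: ennreal_mult m_def)
qed simp

lemma sq_le_kern:
  assumes "\<bar>z - w\<bar> \<le> d" "s > 0"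
  shows "ennreal ((u z - u w)\<^sup>2) \<le> ennreal (d powr (1 + 2 * s)) * kern s u z w"
proof (cases "z = w")
  case False
  have "(u z - u w)\<^sup>2 = \<bar>z - w\<bar> powr (1 + 2 * s) * ((u z - u w)\<^sup>2 / \<bar>z - w\<bar> powr (1 + 2 * s))"
    using False by simp
  also have "\<dots> \<le> d powr (1 + 2 * s) * ((u z - u w)\<^sup>2 / \<bar>z - w\<bar> powr (1 + 2 * s))"
    using assms by (intro mult_right_mono powr_mono2) auto
  finally show ?thesis unfolding kern_def by (subst ennreal_mult[symmetric]) (auto intro: ennreal_leI)
qed simp

lemma avg_point:
  assumes u [measurable]: "u \<in> borel_measurable borel" and lr: "l < r" and x: "x \<in> {l..r}" and s: "s > 0"
    and A [measurable]: "A \<in> sets borel" and sub: "{l<..<r} \<subseteq> A"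
  shows "ennreal ((avg l r u - u x)\<^sup>2) * ennreal (r - l) \<le> 
    ennreal ((r - l) powr (1 + 2 * s)) * (\<integral>\<^sup>+ w. kern s u x w * indicator A w \<partial>lborel)"
proof -
  have "ennreal ((avg l r u - u x)\<^sup>2) * ennreal (r - l) \<le> (\<integral>\<^sup>+ w. ennreal ((u w - u x)\<^sup>2) * indicator {l<..<r} w \<partial>lborel)"
    by (rule avg_variance[OF u lr])
  also have "\<dots> \<le> (\<integral>\<^sup>+ w. ennreal ((r - l) powr (1 + 2 * s)) * (kern s u x w * indicator A w) \<partial>lborel)"
  proof (rule nn_integral_mono)
    fix w
    show "ennreal ((u w - u x)\<^sup>2) * indicator {l<..<r} w \<le> ennreal ((r - l) powr (1 + 2 * s)) * (kern s u x w * indicator A w)"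
      using sq_le_kern[of x w "r - l" s u] sub x s by (auto simp: indicator_def power2_commute)
  qed
  also have "\<dots> = ennreal ((r - l) powr (1 + 2 * s)) * (\<integral>\<^sup>+ w. kern s u x w * indicator A w \<partial>lborel)"
    by (rule nn_integral_cmult) measurable
  finally show ?thesis .
qed

text \<open>\<open>avg_variance\<close> is used once in each variable; afterwards every pair has
  distance at most \<open>r - l\<close>, so the squared increment is dominated by the
  kernel.\<close>

lemma avg_avg:
  assumes u [measurable]: "u \<in> borel_measurable borel" and lr: "l \<le> l'" "l' < r'" "r' \<le> r" and s: "s > 0"
    and A [measurable]: "A \<in> sets borel" and sub: "{l<..<r} \<subseteq> A"
  shows "ennreal ((avg l r u - avg l' r' u)\<^sup>2) * ennreal (r - l) * ennreal (r' - l') \<le> 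
    ennreal ((r - l) powr (1 + 2 * s)) * gsq s A u"
proof -
  have "ennreal ((avg l r u - avg l' r' u)\<^sup>2) * ennreal (r - l) * ennreal (r' - l') 
    \<le> (\<integral>\<^sup>+ z. ennreal ((u z - avg l' r' u)\<^sup>2) * indicator {l<..<r} z \<partial>lborel) * ennreal (r' - l')"
    using lr by (intro mult_right_mono avg_variance[OF u]) auto
  also have "\<dots> = (\<integral>\<^sup>+ z. ennreal ((u z - avg l' r' u)\<^sup>2) * indicator {l<..<r} z * ennreal (r' - l') \<partial>lborel)"
    by (rule nn_integral_multc[symmetric]) measurable
  also have "\<dots> \<le> (\<integral>\<^sup>+ z. (\<integral>\<^sup>+ w. ennreal ((r - l) powr (1 + 2 * s)) * (kern s u z w * indicator A z * indicator A w) \<partial>lborel) \<partial>lborel)"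
  proof (rule nn_integral_mono)
    fix z
    show "ennreal ((u z - avg l' r' u)\<^sup>2) * indicator {l<..<r} z * ennreal (r' - l') \<le> 
      (\<integral>\<^sup>+ w. ennreal ((r - l) powr (1 + 2 * s)) * (kern s u z w * indicator A z * indicator A w) \<partial>lborel)"
    proof (cases "z \<in> {l<..<r}")
      case True
      have "ennreal ((avg l' r' u - u z)\<^sup>2) * ennreal (r' - l') \<le> (\<integral>\<^sup>+ w. ennreal ((u w - u z)\<^sup>2) * indicator {l'<..<r'} w \<partial>lborel)"
        by (rule avg_variance[OF u lr(2)])
      also have "\<dots> \<le> (\<integral>\<^sup>+ w. ennreal ((r - l) powr (1 + 2 * s)) * (kern s u z w * indicator A z * indicator A w) \<partial>lborel)"
      proof (rule nn_integral_mono)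
        fix w
        show "ennreal ((u w - u z)\<^sup>2) * indicator {l'<..<r'} w \<le> 
          ennreal ((r - l) powr (1 + 2 * s)) * (kern s u z w * indicator A z * indicator A w)"
        proof (cases "w \<in> {l'<..<r'}")
          case w: True
          then have "w \<in> A" "z \<in> A" "\<bar>z - w\<bar> \<le> r - l" using True lr sub by (auto simp: subset_iff)
          then show ?thesis using sq_le_kern[of z w "r - l" s u] s w by (auto simp: power2_commute)
        qed simp
      qed
      finally show ?thesis using True by (simp add: power2_commute)
    qed simp
  qed
  also have "\<dots> = (\<integral>\<^sup>+ z. ennreal ((r - l) powr (1 + 2 * s)) * (\<integral>\<^sup>+ w. (kern s u z w * indicator A z * indicator A w) \<partial>lborel) \<partial>lborel)"
    by (intro nn_integral_cong nn_integral_cmult) measurable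
  also have "\<dots> = ennreal ((r - l) powr (1 + 2 * s)) * gsq s A u"
    unfolding gsq_def by (rule nn_integral_cmult) measurable
  finally show ?thesis .
qed

lemma telescope_geometric:
  fixes a :: "nat \<Rightarrow> real"
  assumes step: "\<And>k. \<bar>a (Suc k) - a k\<bar> \<le> M * q ^ k" and q: "0 \<le> q" "q < 1" and lim: "a \<longlonglongrightarrow> L"
  shows "\<bar>L - a 0\<bar> \<le> M / (1 - q)"
proof -
  have M: "0 \<le> M" using step[of 0] by (simp add: order_trans[OF abs_ge_zero])
  have b: "\<bar>a n - a 0\<bar> \<le> M / (1 - q)" for n
  proof -
    have "a n - a 0 = (\<Sum>k<n. a (Suc k) - a k)" by (simp add: sum_lessThan_telescope)
    also have "\<bar>\<dots>\<bar> \<le> (\<Sum>k<n. M * q ^ k)" by (rule order_trans[OF sum_abs]) (intro sum_mono step)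
    also have "\<dots> = M * (\<Sum>k<n. q ^ k)" by (simp add: sum_distrib_left)
    also have "(\<Sum>k<n. q ^ k) \<le> (\<Sum>k. q ^ k)" using q by (intro sum_le_suminf) auto
    also have "\<dots> = 1 / (1 - q)" using q by (intro suminf_geometric) auto
    finally show ?thesis using M by (simp add: mult_left_mono)
  qed
  have "(\<lambda>n. \<bar>a n - a 0\<bar>) \<longlonglongrightarrow> \<bar>L - a 0\<bar>" using lim by (intro tendsto_intros)
  then show ?thesis by (rule LIMSEQ_le_const2) (use b in auto)
qed

text \<open>Campanato's chain of averages: halving the interval changes the average by at most a
  constant times \<open>(d / 2 ^ k) powr (s - 1/2)\<close>, a geometric sequence with ratio
  \<open>2 powr (1/2 - s)\<close>, which is below \<open>1\<close> exactly because
  \<open>s > 1/2\<close>. The hypothesis \<open>good\<close> makes the averages converge to the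
  value of \<open>u\<close> at the point \<open>x\<close> itself.\<close>

lemma dyadic_average_estimate:
  assumes u [measurable]: "u \<in> borel_measurable borel" and s: "1 / 2 < s" and K: "gsq s A u \<le> ennreal K" "0 \<le> K"
    and A [measurable]: "A \<in> sets borel" and sub: "{l 0<..<r 0} \<subseteq> A"
    and mono: "\<And>k. l k \<le> l (Suc k)" "\<And>k. r (Suc k) \<le> r k"
    and len: "\<And>k. r k - l k = d / 2 ^ k" and d: "0 < d" and x: "\<And>k. x \<in> {l k..r k}"
    and good: "(\<integral>\<^sup>+ w. kern s u x w * indicator A w \<partial>lborel) < \<infinity>"
  shows "\<bar>u x - avg (l 0) (r 0) u\<bar> \<le> sqrt (2 * K) * d powr (s - 1/2) / (1 - 2 powr (1/2 - s))"
proof (rule telescope_geometric[where a = "\<lambda>k. avg (l k) (r k) u"])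
  have lr: "l k < r k" for k using len[of k] d by (smt (verit) divide_pos_pos zero_less_power)
  have "l 0 \<le> l k" "r k \<le> r 0" for k
    using lift_Suc_mono_le[of l 0 k] lift_Suc_antimono_le[of r 0 k] mono by auto
  then have subk: "{l k<..<r k} \<subseteq> A" for k using sub by (meson greaterThanLessThan_subseteq_greaterThanLessThan order_trans)
  define q where "q = 2 powr (1/2 - s :: real)"
  have q: "0 < q" "q < 1" using s unfolding q_def by (auto simp: powr_less_one)
  then show "0 \<le> 2 powr (1/2 - s)" "2 powr (1/2 - s) < 1" by (auto simp: q_def)
  have qk: "(d / 2 ^ k) powr (s - 1/2) = d powr (s - 1/2) * q ^ k" for k
  proof -
    have "(d / 2 ^ k) powr (s - 1/2) = d powr (s - 1/2) * (1 / 2 ^ k) powr (s - 1/2)"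
      using d by (subst powr_mult[symmetric]) auto
    also have "(1 / 2 ^ k :: real) = 2 powr (- real k)" by (simp add: powr_minus_divide powr_realpow)
    also have "(2 powr (- real k)) powr (s - 1/2) = (2 powr (1/2 - s)) powr real k"
      unfolding powr_powr by (rule arg_cong[where f = "\<lambda>t. 2 powr t"]) (simp add: algebra_simps)
    also have "\<dots> = q ^ k" unfolding q_def by (rule powr_realpow) simp
    finally show ?thesis .
  qed
  show "\<bar>avg (l (Suc k)) (r (Suc k)) u - avg (l k) (r k) u\<bar> \<le> sqrt (2 * K) * d powr (s - 1 / 2) * (2 powr (1 / 2 - s)) ^ k" for k
  proof -
    define D where "D = d / 2 ^ k"
    define e where "e = avg (l k) (r k) u - avg (l (Suc k)) (r (Suc k)) u"
    have D: "0 < D" using d by (simp add: D_def)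
    have rl: "r k - l k = D" "r (Suc k) - l (Suc k) = D / 2" using len[of k] len[of "Suc k"] by (auto simp: D_def)
    \<comment> \<open>The lengths \<open>D\<close> and \<open>D / 2\<close> give
      \<open>D\<^sup>2 / 2\<close> on the left against \<open>D powr (1 + 2 * s)\<close> on the
      right, so \<open>e\<^sup>2\<close> is at most \<open>2 * K * D powr (2 * s - 1)\<close>; this
      is the origin of \<open>sqrt (2 * K)\<close>.\<close>
    have "ennreal (e\<^sup>2) * ennreal D * ennreal (D / 2) \<le> ennreal (D powr (1 + 2 * s)) * gsq s A u"
      using avg_avg[OF u mono(1)[of k] lr[of "Suc k"] mono(2)[of k] _ A subk[of k], of s] s unfolding e_def rl by simp
    also have "\<dots> \<le> ennreal (D powr (1 + 2 * s)) * ennreal K" by (intro mult_left_mono K) auto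
    finally have "e\<^sup>2 * D * (D / 2) \<le> D powr (1 + 2 * s) * K"
      using D K by (simp add: ennreal_mult[symmetric])
    also have "D powr (1 + 2 * s) = D powr (2 + 2 * (s - 1/2))" by simp
    also have "\<dots> = D powr 2 * D powr (2 * (s - 1/2))" by (rule powr_add)
    also have "D powr (2 * (s - 1/2)) = (D powr (s - 1/2)) powr 2" by (simp add: powr_powr mult.commute)
    finally have "e\<^sup>2 * D * (D / 2) \<le> D\<^sup>2 * (D powr (s - 1/2))\<^sup>2 * K" using D by simp
    then have "e\<^sup>2 * D\<^sup>2 \<le> (2 * K * (D powr (s - 1/2))\<^sup>2) * D\<^sup>2" by (simp add: power2_eq_square algebra_simps)
    then have "e\<^sup>2 \<le> 2 * K * (D powr (s - 1/2))\<^sup>2" using D by simp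
    then have "\<bar>e\<bar> \<le> sqrt (2 * K * (D powr (s - 1/2))\<^sup>2)" by (rule real_le_rsqrt[of "\<bar>e\<bar>", simplified])
    also have "\<dots> = sqrt (2 * K) * D powr (s - 1/2)" by (simp add: real_sqrt_mult)
    finally show ?thesis unfolding e_def D_def qk q_def[symmetric] by (simp add: abs_minus_commute mult.assoc)
  qed
  show "(\<lambda>k. avg (l k) (r k) u) \<longlonglongrightarrow> u x"
  proof -
    obtain g where g: "(\<integral>\<^sup>+ w. kern s u x w * indicator A w \<partial>lborel) = ennreal g" "0 \<le> g"
      using good by (cases "\<integral>\<^sup>+ w. kern s u x w * indicator A w \<partial>lborel" rule: ennreal_cases) auto
    have b: "(avg (l k) (r k) u - u x)\<^sup>2 \<le> (d / 2 ^ k) powr (2 * s) * g" for k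
    proof -
      define D where "D = d / 2 ^ k"
      define e where "e = avg (l k) (r k) u - u x"
      have D: "0 < D" using d by (simp add: D_def)
      have rl: "r k - l k = D" using len[of k] by (auto simp: D_def)
      have "ennreal (e\<^sup>2) * ennreal D \<le> ennreal (D powr (1 + 2 * s)) * ennreal g"
        unfolding e_def rl[symmetric] g(1)[symmetric] using s
        by (intro avg_point[OF u lr x _ A subk]) auto
      then have "e\<^sup>2 * D \<le> D powr (1 + 2 * s) * g"
        using D g by (simp add: ennreal_mult[symmetric])
      also have "D powr (1 + 2 * s) = D * D powr (2 * s)" using D by (simp add: powr_add)
      finally have "e\<^sup>2 * D \<le> (D powr (2 * s) * g) * D" by (simp add: algebra_simps)
      then have "e\<^sup>2 \<le> D powr (2 * s) * g" by (rule mult_right_le_imp_le) (rule D)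
      then show ?thesis by (simp only: D_def e_def)
    qed
    have "(\<lambda>k. d / 2 ^ k) \<longlonglongrightarrow> 0" by (rule LIMSEQ_divide_realpow_zero) simp
    then have "(\<lambda>k. (d / 2 ^ k) powr (2 * s) * g) \<longlonglongrightarrow> 0 powr (2 * s) * g"
      using s d by (intro tendsto_intros tendsto_powr') auto
    then have lim0: "(\<lambda>k. (d / 2 ^ k) powr (2 * s) * g) \<longlonglongrightarrow> 0" by simp
    have "(\<lambda>k. (avg (l k) (r k) u - u x)\<^sup>2) \<longlonglongrightarrow> 0"
      by (rule tendsto_sandwich[OF always_eventually always_eventually tendsto_const lim0])
        (use b in \<open>auto simp only: zero_le_power2\<close>)
    then have "(\<lambda>k. sqrt ((avg (l k) (r k) u - u x)\<^sup>2)) \<longlonglongrightarrow> sqrt 0" by (intro tendsto_real_sqrt)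
    then have "(\<lambda>k. avg (l k) (r k) u - u x) \<longlonglongrightarrow> 0" by (simp add: tendsto_rabs_zero_iff)
    then show ?thesis by (simp add: LIM_zero_iff)
  qed
qed

text \<open>Twice the constant of \<open>dyadic_average_estimate\<close>, one chain for each of two
  points. It blows up as \<open>s\<close> tends to \<open>1/2\<close>, which confines Hoelder
  estimates to limits \<open>s0 > 1/2\<close>.\<close>

definition holder_const :: "real \<Rightarrow> real" where
  "holder_const s = 2 * sqrt 2 / (1 - 2 powr (1/2 - s))"

lemma holder_const_pos: "1/2 < s \<Longrightarrow> 0 < holder_const s"
  unfolding holder_const_def by (auto simp: powr_less_one)

text \<open>Both dyadic chains start from the interval between the two points, one with fixed left
  end and one with fixed right end, so the common first average cancels. The two finiteness
  hypotheses hold at almost every point.\<close>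

lemma morrey_pointwise:
  assumes u [measurable]: "u \<in> borel_measurable borel" and s: "1 / 2 < s" and K: "gsq s {\<alpha><..<\<beta>} u \<le> ennreal K" "0 \<le> K"
    and xy: "x \<in> {\<alpha><..<\<beta>}" "y \<in> {\<alpha><..<\<beta>}"
    and gx: "(\<integral>\<^sup>+ w. kern s u x w * indicator {\<alpha><..<\<beta>} w \<partial>lborel) < \<infinity>"
    and gy: "(\<integral>\<^sup>+ w. kern s u y w * indicator {\<alpha><..<\<beta>} w \<partial>lborel) < \<infinity>"
  shows "\<bar>u x - u y\<bar> \<le> holder_const s * sqrt K * \<bar>x - y\<bar> powr (s - 1/2)"
proof -
  have *: "\<bar>u x - u y\<bar> \<le> holder_const s * sqrt K * \<bar>x - y\<bar> powr (s - 1/2)"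
    if xy: "x \<in> {\<alpha><..<\<beta>}" "y \<in> {\<alpha><..<\<beta>}" and less: "x < y"
    and gx: "(\<integral>\<^sup>+ w. kern s u x w * indicator {\<alpha><..<\<beta>} w \<partial>lborel) < \<infinity>"
    and gy: "(\<integral>\<^sup>+ w. kern s u y w * indicator {\<alpha><..<\<beta>} w \<partial>lborel) < \<infinity>" for x y
  proof -
    define d where "d = y - x"
    have d: "0 < d" using less by (simp add: d_def)
    have dd: "d / 2 ^ Suc k \<le> d / 2 ^ k" "0 \<le> d / 2 ^ k" for k using d by (auto simp: field_simps)
    have "\<bar>u x - avg x (x + d / 2 ^ 0) u\<bar> \<le> sqrt (2 * K) * d powr (s - 1/2) / (1 - 2 powr (1/2 - s))"
      by (rule dyadic_average_estimate[OF u s K, where l = "\<lambda>k. x" and r = "\<lambda>k. x + d / 2 ^ k"])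
         (use gx dd d xy in \<open>auto simp: d_def\<close>)
    moreover have "\<bar>u y - avg (y - d / 2 ^ 0) y u\<bar> \<le> sqrt (2 * K) * d powr (s - 1/2) / (1 - 2 powr (1/2 - s))"
      by (rule dyadic_average_estimate[OF u s K, where l = "\<lambda>k. y - d / 2 ^ k" and r = "\<lambda>k. y"])
         (use gy dd d xy in \<open>auto simp: d_def\<close>)
    ultimately have "\<bar>u x - u y\<bar> \<le> 2 * (sqrt (2 * K) * d powr (s - 1/2) / (1 - 2 powr (1/2 - s)))"
      by (simp add: d_def)
    then show ?thesis using less by (simp add: d_def holder_const_def real_sqrt_mult mult_ac)
  qed
  consider "x < y" | "x = y" | "y < x" by linarith
  then show ?thesis
  proof cases
    case 3
    then show ?thesis using *[of y x] xy gx gy by (simp add: abs_minus_commute)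
  qed (use * xy gx gy in auto)
qed

lemma kern_integrable_AE:
  assumes u [measurable]: "u \<in> borel_measurable borel" and A [measurable]: "A \<in> sets borel" and "gsq s A u < \<infinity>"
  shows "AE x in lborel. x \<in> A \<longrightarrow> (\<integral>\<^sup>+ w. kern s u x w * indicator A w \<partial>lborel) < \<infinity>"
proof -
  have "AE x in lborel. (\<integral>\<^sup>+ w. kern s u x w * indicator A x * indicator A w \<partial>lborel) \<noteq> \<infinity>"
  proof (rule nn_integral_PInf_AE)
    show "(\<integral>\<^sup>+ x. (\<integral>\<^sup>+ w. kern s u x w * indicator A x * indicator A w \<partial>lborel) \<partial>lborel) \<noteq> \<infinity>"
      using assms(3) unfolding gsq_def by simp
  qed measurable
  then show ?thesis by eventually_elim (auto simp: top.not_eq_extremum less_top)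
qed

lemma AE_dense:
  fixes A :: "real set"
  assumes "AE x in lborel. x \<in> A \<longrightarrow> x \<in> G" "open A"
  shows "A \<subseteq> closure (G \<inter> A)"
proof
  fix x assume x: "x \<in> A"
  show "x \<in> closure (G \<inter> A)"
  proof (rule ccontr)
    assume "x \<notin> closure (G \<inter> A)"
    then have "x \<in> A \<inter> - closure (G \<inter> A)" "open (A \<inter> - closure (G \<inter> A))" using x assms(2) by auto
    then obtain e where e: "e > 0" "ball x e \<subseteq> A \<inter> - closure (G \<inter> A)" using open_contains_ball by metis
    have "AE y in lborel. y \<notin> ball x e"
      using assms(1)
      by (rule eventually_mono) (use e(2) closure_subset[of "G \<inter> A"] in blast)
    then have "emeasure lborel (ball x e) = 0"
      by (subst (asm) AE_iff_measurable[of "ball x e"]) auto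
    then show False using e(1) by (simp add: ball_eq_greaterThanLessThan)
  qed
qed

lemma holder_closure:
  fixes v :: "real \<Rightarrow> real"
  assumes v: "continuous_on A v" and dense: "A \<subseteq> closure G" "G \<subseteq> A"
    and hol: "\<And>x y. x \<in> G \<Longrightarrow> y \<in> G \<Longrightarrow> \<bar>v x - v y\<bar> \<le> H * \<bar>x - y\<bar> powr \<gamma>" and \<gamma>: "\<gamma> > 0"
    and xy: "x \<in> A" "y \<in> A"
  shows "\<bar>v x - v y\<bar> \<le> H * \<bar>x - y\<bar> powr \<gamma>"
proof -
  obtain a where a: "\<And>n. a n \<in> G" "a \<longlonglongrightarrow> x" using subsetD[OF dense(1) xy(1)] unfolding closure_sequential by blast
  obtain b where b: "\<And>n. b n \<in> G" "b \<longlonglongrightarrow> y" using subsetD[OF dense(1) xy(2)] unfolding closure_sequential by blast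
  have "(\<lambda>n. v (a n)) \<longlonglongrightarrow> v x" "(\<lambda>n. v (b n)) \<longlonglongrightarrow> v y"
    using a b xy dense(2) by (auto intro!: continuous_on_tendsto_compose[OF v] always_eventually)
  then have "(\<lambda>n. \<bar>v (a n) - v (b n)\<bar>) \<longlonglongrightarrow> \<bar>v x - v y\<bar>" by (intro tendsto_intros)
  moreover have "(\<lambda>n. H * \<bar>a n - b n\<bar> powr \<gamma>) \<longlonglongrightarrow> H * \<bar>x - y\<bar> powr \<gamma>"
    using \<gamma> a b by (intro tendsto_intros tendsto_powr') auto
  ultimately show ?thesis by (rule LIMSEQ_le) (use hol a b in auto)
qed

text \<open>On the set \<open>G\<close> of full measure the Hoelder bound holds pointwise.
  \<open>G\<close> is dense, so \<open>u\<close> extends from it by uniform continuity and the bound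
  passes to the closure; the indicator makes the result Borel on the whole line.\<close>

lemma holder_representative:
  assumes u [measurable]: "u \<in> borel_measurable borel" and s: "1 / 2 < s" and K: "gsq s {\<alpha><..<\<beta>} u \<le> ennreal K" "0 \<le> K"
  obtains v where "v \<in> borel_measurable borel"
    "\<And>x y. x \<in> {\<alpha><..<\<beta>} \<Longrightarrow> y \<in> {\<alpha><..<\<beta>} \<Longrightarrow> \<bar>v x - v y\<bar> \<le> holder_const s * sqrt K * \<bar>x - y\<bar> powr (s - 1/2)"
    "AE x in lborel. x \<in> {\<alpha><..<\<beta>} \<longrightarrow> u x = v x"
proof -
  let ?A = "{\<alpha><..<\<beta>}"
  define G where "G = {x \<in> ?A. (\<integral>\<^sup>+ w. kern s u x w * indicator ?A w \<partial>lborel) < \<infinity>}"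
  have fin: "gsq s ?A u < \<infinity>" using K by (auto intro: le_less_trans)
  have AEG: "AE x in lborel. x \<in> ?A \<longrightarrow> x \<in> G"
    using kern_integrable_AE[OF u _ fin] by (auto simp: G_def)
  have GA: "G \<subseteq> ?A" by (auto simp: G_def)
  then have dense: "?A \<subseteq> closure G" using AE_dense[OF AEG] by (simp add: Int_absorb2)
  have hol: "\<bar>u x - u y\<bar> \<le> holder_const s * sqrt K * \<bar>x - y\<bar> powr (s - 1/2)" if "x \<in> G" "y \<in> G" for x y
    by (rule morrey_pointwise[OF u s K]) (use that in \<open>auto simp: G_def\<close>)
  have uc: "uniformly_continuous_on G u"
    unfolding uniformly_continuous_on_def dist_real_def
  proof (intro allI impI)
    fix e :: real assume e: "e > 0"
    \<comment> \<open>The summand \<open>1\<close> keeps \<open>C\<close> positive when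
      \<open>K = 0\<close>, since \<open>C\<close> is divided by.\<close>
    define C where "C = holder_const s * sqrt K + 1"
    have C: "C > 0" "holder_const s * sqrt K \<le> C" using K holder_const_pos[OF s] by (auto simp: C_def intro: add_nonneg_pos)
    define d where "d = (e / C) powr (1 / (s - 1/2))"
    have "d > 0" using e C by (simp add: d_def)
    moreover have "\<bar>u x' - u x\<bar> < e" if "x \<in> G" "x' \<in> G" "\<bar>x' - x\<bar> < d" for x x'
    proof -
      have "\<bar>u x' - u x\<bar> \<le> C * \<bar>x' - x\<bar> powr (s - 1/2)"
        using hol[of x' x] that C(2) by (meson mult_right_mono order_trans powr_ge_zero)
      also have "\<dots> < C * d powr (s - 1/2)" using that C s by (intro mult_strict_left_mono powr_less_mono2) auto
      also have "\<dots> = e" using e C s by (simp add: d_def powr_powr)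
      finally show ?thesis .
    qed
    ultimately show "\<exists>d>0. \<forall>x\<in>G. \<forall>x'\<in>G. \<bar>x' - x\<bar> < d \<longrightarrow> \<bar>u x' - u x\<bar> < e" by blast
  qed
  obtain g where g: "uniformly_continuous_on (closure G) g" "\<And>x. x \<in> G \<Longrightarrow> u x = g x"
    using uniformly_continuous_on_extension_on_closure[OF uc] by metis
  have cont: "continuous_on ?A g" 
    using uniformly_continuous_imp_continuous[OF g(1)] dense continuous_on_subset by blast
  show ?thesis
  proof (rule that[of "\<lambda>x. indicator ?A x *\<^sub>R g x"])
    show "(\<lambda>x. indicator ?A x *\<^sub>R g x) \<in> borel_measurable borel"
      by (rule borel_measurable_continuous_on_indicator[OF _ cont]) simp
    show "\<bar>indicator ?A x *\<^sub>R g x - indicator ?A y *\<^sub>R g y\<bar> \<le> holder_const s * sqrt K * \<bar>x - y\<bar> powr (s - 1/2)"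
      if "x \<in> ?A" "y \<in> ?A" for x y
      using holder_closure[OF cont dense GA _ _ that, of "holder_const s * sqrt K" "s - 1/2"] hol g(2) s that by simp
    show "AE x in lborel. x \<in> ?A \<longrightarrow> u x = indicator ?A x *\<^sub>R g x"
      using AEG by eventually_elim (auto simp: g(2))
  qed
qed

text \<open>The points with finite inner integral are dense, so continuity gives the bound
  everywhere. This serves competitors of \<open>m_const\<close>, which are not to be changed on a
  null set.\<close>

lemma holder_continuous:
  assumes v: "continuous_on UNIV v" and s: "1 / 2 < s" and K: "gsq s {\<alpha><..<\<beta>} v \<le> ennreal K" "0 \<le> K"
    and xy: "x \<in> {\<alpha><..<\<beta>}" "y \<in> {\<alpha><..<\<beta>}"
  shows "\<bar>v x - v y\<bar> \<le> holder_const s * sqrt K * \<bar>x - y\<bar> powr (s - 1/2)"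
proof -
  have [measurable]: "v \<in> borel_measurable borel" using v by (rule borel_measurable_continuous_onI)
  let ?A = "{\<alpha><..<\<beta>}"
  define G where "G = {x \<in> ?A. (\<integral>\<^sup>+ w. kern s v x w * indicator ?A w \<partial>lborel) < \<infinity>}"
  have fin: "gsq s ?A v < \<infinity>" using K by (auto intro: le_less_trans)
  have AEG: "AE x in lborel. x \<in> ?A \<longrightarrow> x \<in> G"
    using kern_integrable_AE[OF _ _ fin] by (auto simp: G_def)
  have GA: "G \<subseteq> ?A" by (auto simp: G_def)
  then have dense: "?A \<subseteq> closure G" using AE_dense[OF AEG] by (simp add: Int_absorb2)
  show ?thesis
  proof (rule holder_closure[OF continuous_on_subset[OF v subset_UNIV] dense GA _ _ xy])
    show "\<bar>v x - v y\<bar> \<le> holder_const s * sqrt K * \<bar>x - y\<bar> powr (s - 1/2)" if "x \<in> G" "y \<in> G" for x y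
      by (rule morrey_pointwise[OF _ s K]) (use that in \<open>auto simp: G_def\<close>)
  qed (use s in auto)
qed

subsection \<open>The scale factor\<close>

text \<open>With \<open>a = 2 * s - 1\<close> and \<open>E = \<epsilon> powr (- a)\<close> the
  factor is \<open>a * E / (E - 1)\<close>, and everything follows from
  \<open>exp t \<ge> 1 + t\<close> at \<open>t = \<plusminus> a * \<bar>ln \<epsilon>\<bar>\<close>.
  The bounds do not degenerate as \<open>s\<close> tends to \<open>1/2\<close>, so they give limits
  along arbitrary joint sequences.\<close>

lemma scale_factor_bounds:
  assumes e: "0 < \<epsilon>" "\<epsilon> < 1" and s: "1/2 \<le> s"
  shows "0 < scale_factor \<epsilon> s" "1 / \<bar>ln \<epsilon>\<bar> \<le> scale_factor \<epsilon> s" "scale_factor \<epsilon> s \<le> (2 * s - 1) + 1 / \<bar>ln \<epsilon>\<bar>"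
    "scale_factor \<epsilon> s * \<epsilon> powr (2 * s - 1) \<le> 1 / \<bar>ln \<epsilon>\<bar>"
proof -
  define x where "x = \<bar>ln \<epsilon>\<bar>"
  have x: "x > 0" "ln \<epsilon> = - x" using e by (auto simp: x_def)
  define a where "a = 2 * s - 1"
  have "0 < scale_factor \<epsilon> s \<and> 1 / x \<le> scale_factor \<epsilon> s \<and> scale_factor \<epsilon> s \<le> a + 1 / x \<and> scale_factor \<epsilon> s * \<epsilon> powr a \<le> 1 / x"
  proof (cases "s = 1/2")
    case True
    then have "a = 0" by (simp add: a_def)
    then show ?thesis using e x True by (simp add: scale_factor_def)
  next
    case False
    then have a: "a > 0" using s by (simp add: a_def)
    define E where "E = exp (a * x)"
    have E: "E > 1" "E \<ge> 1 + a * x" using a x by (auto simp: E_def)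
    have ea: "\<epsilon> powr a = 1 / E" using e x by (simp add: powr_def E_def exp_minus field_simps)
    have "scale_factor \<epsilon> s = (- a) / (\<epsilon> powr a - 1)" using False by (simp add: scale_factor_def a_def)
    then have l: "scale_factor \<epsilon> s = a * E / (E - 1)"
      unfolding ea using E by (simp add: divide_simps) (simp add: algebra_simps)?
    have "1 + - (a * x) \<le> exp (- (a * x))" by (rule exp_ge_add_one_self)
    then have E2: "(1 - a * x) * E \<le> 1" unfolding E_def exp_minus by (simp add: field_simps)
    have "0 < a * E / (E - 1)" using a E by auto
    moreover have "1 / x \<le> a * E / (E - 1)" using E E2 x a by (simp add: field_simps)
    moreover have "a * E / (E - 1) \<le> a + 1 / x"
    proof -
      have "a * E / (E - 1) = a + a / (E - 1)" using E by (simp add: field_simps)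
      also have "a / (E - 1) \<le> a / (a * x)" using E a x by (intro divide_left_mono) auto
      finally show ?thesis using a by simp
    qed
    moreover have "a * E / (E - 1) * (1 / E) \<le> 1 / x"
    proof -
      have "a * E / (E - 1) * (1 / E) = a / (E - 1)" using E by (simp add: field_simps)
      also have "a / (E - 1) \<le> a / (a * x)" using E a x by (intro divide_left_mono) auto
      finally show ?thesis using a by simp
    qed
    ultimately show ?thesis unfolding l ea by blast
  qed
  then show "0 < scale_factor \<epsilon> s" "1 / \<bar>ln \<epsilon>\<bar> \<le> scale_factor \<epsilon> s" "scale_factor \<epsilon> s \<le> (2 * s - 1) + 1 / \<bar>ln \<epsilon>\<bar>"
    "scale_factor \<epsilon> s * \<epsilon> powr (2 * s - 1) \<le> 1 / \<bar>ln \<epsilon>\<bar>" by (auto simp: x_def a_def)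
qed

lemma nn_integral_inverse_ivl:
  assumes "0 < a" "a \<le> b"
  shows "(\<integral>\<^sup>+ h. ennreal (1 / h) * indicator {a..b} h \<partial>lborel) = ennreal (ln (b / a))"
proof -
  have "(\<integral>\<^sup>+ h. ennreal (1 / h) * indicator {a..b} h \<partial>lborel) = ennreal (ln b - ln a)"
  proof (rule nn_integral_FTC_Icc)
    show "DERIV ln x :> 1 / x" if "x \<in> {a..b}" for x
      using that assms by (auto intro!: derivative_eq_intros simp: has_real_derivative_iff_has_vector_derivative[symmetric])
  qed (use assms in auto)
  then show ?thesis using assms by (simp add: ln_div)
qed

lemma nn_integral_inverse_sq_ivl:
  assumes "0 < a" "a \<le> b"
  shows "(\<integral>\<^sup>+ h. ennreal (a / h\<^sup>2) * indicator {a..b} h \<partial>lborel) \<le> 1"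
proof -
  have "(\<integral>\<^sup>+ h. ennreal (a / h\<^sup>2) * indicator {a..b} h \<partial>lborel) = ennreal ((- a / b) - (- a / a))"
  proof (rule nn_integral_FTC_Icc)
    show "DERIV (\<lambda>x. - a / x) x :> a / x\<^sup>2" if "x \<in> {a..b}" for x
      using that assms by (auto intro!: derivative_eq_intros simp: power2_eq_square)
  qed (use assms in auto)
  also have "\<dots> \<le> ennreal 1" using assms by (intro ennreal_leI) auto
  finally show ?thesis by simp
qed

lemma nn_integral_scale_factor:
  assumes e: "0 < \<epsilon>" "\<epsilon> < 1" and s: "1/2 \<le> s"
  shows "(\<integral>\<^sup>+ h. ennreal (\<epsilon> powr (2 * s - 1) * h powr (- (2 * s))) * indicator {\<epsilon>..1} h \<partial>lborel) = ennreal (1 / scale_factor \<epsilon> s)"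
proof (cases "s = 1/2")
  case True
  then have s2: "2 * s = 1" by simp
  have "(\<integral>\<^sup>+ h. ennreal (\<epsilon> powr (2 * s - 1) * h powr (- (2 * s))) * indicator {\<epsilon>..1} h \<partial>lborel) = 
     (\<integral>\<^sup>+ h. ennreal (1 / h) * indicator {\<epsilon>..1} h \<partial>lborel)"
    unfolding s2 using e by (intro nn_integral_cong) (auto simp: indicator_def powr_minus_divide)
  then show ?thesis using nn_integral_inverse_ivl[of \<epsilon> 1] e True by (simp only: scale_factor_def if_True) (simp add: ln_div)
next
  case False
  define a where "a = 2 * s - 1"
  have a: "a > 0" "- (2 * s) = - a - 1" using False s by (auto simp: a_def)
  have "(\<integral>\<^sup>+ h. ennreal (\<epsilon> powr a * h powr (- a - 1)) * indicator {\<epsilon>..1} h \<partial>lborel) = 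
    ennreal ((\<epsilon> powr a / (- a)) * 1 powr (- a) - (\<epsilon> powr a / (- a)) * \<epsilon> powr (- a))"
  proof (rule nn_integral_FTC_Icc)
    show "DERIV (\<lambda>h. \<epsilon> powr a / (- a) * h powr (- a)) x :> \<epsilon> powr a * x powr (- a - 1)" if "x \<in> {\<epsilon>..1}" for x
      using that e a by (auto intro!: derivative_eq_intros)
  qed (use e in auto)
  also have "(\<epsilon> powr a / (- a)) * 1 powr (- a) - (\<epsilon> powr a / (- a)) * \<epsilon> powr (- a) = (1 - \<epsilon> powr a) / a"
    using e a by (simp add: powr_minus field_simps)
  also have "\<dots> = 1 / scale_factor \<epsilon> s"
    using False by (simp add: scale_factor_def a_def divide_simps) (simp add: algebra_simps)?
  finally show ?thesis unfolding a_def[symmetric] a(2) .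
qed

section \<open>Counting along arithmetic progressions\<close>

text \<open>The cells of length \<open>h\<close> are translates of the first one, so summing along a
  progression of step \<open>h\<close> and integrating over one cell amounts to integrating over all
  cells.\<close>

lemma nn_integral_fold_le:
  fixes f :: "real \<Rightarrow> ennreal"
  assumes f [measurable]: "f \<in> borel_measurable borel" and h: "h > 0"
  shows "(\<integral>\<^sup>+ t. (\<Sum>k<m. f (t + real k * h)) * indicator {p<..<p + h} t \<partial>lborel) \<le> 
    (\<integral>\<^sup>+ x. f x * indicator {p<..<p + real m * h} x \<partial>lborel)"
proof (induction m)
  case (Suc m)
  have "(\<integral>\<^sup>+ t. (\<Sum>k<Suc m. f (t + real k * h)) * indicator {p<..<p + h} t \<partial>lborel) = 
    (\<integral>\<^sup>+ t. (\<Sum>k<m. f (t + real k * h)) * indicator {p<..<p + h} t \<partial>lborel) + 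
    (\<integral>\<^sup>+ t. f (t + real m * h) * indicator {p<..<p + h} t \<partial>lborel)"
    by (subst nn_integral_add[symmetric]) (auto intro!: nn_integral_cong simp: distrib_right)
  also have "(\<integral>\<^sup>+ t. f (t + real m * h) * indicator {p<..<p + h} t \<partial>lborel) = 
     (\<integral>\<^sup>+ x. f x * indicator {p + real m * h<..<p + real (Suc m) * h} x \<partial>lborel)"
  proof -
    have "(\<integral>\<^sup>+ x. f x * indicator {p + real m * h<..<p + real (Suc m) * h} x \<partial>lborel) = 
      ennreal \<bar>1\<bar> * (\<integral>\<^sup>+ t. f (real m * h + 1 * t) * indicator {p + real m * h<..<p + real (Suc m) * h} (real m * h + 1 * t) \<partial>lborel)"
      by (rule nn_integral_real_affine[where c = 1]) simp_all
    also have "\<dots> = (\<integral>\<^sup>+ t. f (t + real m * h) * indicator {p<..<p + h} t \<partial>lborel)"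
      unfolding abs_one ennreal_1 mult_1_left
      by (intro nn_integral_cong) (auto simp: indicator_def algebra_simps)
    finally show ?thesis ..
  qed
  also have "(\<integral>\<^sup>+ t. (\<Sum>k<m. f (t + real k * h)) * indicator {p<..<p + h} t \<partial>lborel) + 
      (\<integral>\<^sup>+ x. f x * indicator {p + real m * h<..<p + real (Suc m) * h} x \<partial>lborel) \<le> 
      (\<integral>\<^sup>+ x. f x * indicator {p<..<p + real m * h} x \<partial>lborel) + 
      (\<integral>\<^sup>+ x. f x * indicator {p + real m * h<..<p + real (Suc m) * h} x \<partial>lborel)"
    by (intro add_right_mono Suc.IH)
  also have "\<dots> = (\<integral>\<^sup>+ x. f x * indicator {p<..<p + real m * h} x + f x * indicator {p + real m * h<..<p + real (Suc m) * h} x \<partial>lborel)"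
    by (rule nn_integral_add[symmetric]) measurable
  also have "\<dots> \<le> (\<integral>\<^sup>+ x. f x * indicator {p<..<p + real (Suc m) * h} x \<partial>lborel)"
  proof (rule nn_integral_mono)
    fix x
    obtain w where w: "real m * h = w" "0 \<le> w" using h by simp
    have w2: "real (Suc m) * h = w + h" using w by (simp add: algebra_simps)
    show "f x * indicator {p<..<p + real m * h} x + f x * indicator {p + real m * h<..<p + real (Suc m) * h} x
       \<le> f x * indicator {p<..<p + real (Suc m) * h} x"
      unfolding w(1) w2
    proof (cases "p < x \<and> x < p + w")
      case True
      then have "x < p + (w + h)" "\<not> p + w < x" using h by linarith+
      with True show "f x * indicator {p<..<p + w} x + f x * indicator {p + w<..<p + (w + h)} x \<le> f x * indicator {p<..<p + (w + h)} x"
        by (simp add: indicator_def)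
    next
      case False
      then have "p + w < x \<Longrightarrow> p < x" using w(2) by linarith
      with False show "f x * indicator {p<..<p + w} x + f x * indicator {p + w<..<p + (w + h)} x \<le> f x * indicator {p<..<p + (w + h)} x"
        by (simp add: indicator_def)
    qed
  qed
  finally show ?case .
qed simp

text \<open>A start whose progression misses \<open>A\<close> puts a point of the exceptional set
  into each whole cell inside the interval. Hence the measure of such starts times the number of
  these cells is at most \<open>\<delta> * (d - c)\<close>.\<close>

lemma progression_miss_measure:
  assumes A [measurable]: "A \<in> sets borel" and h: "h > 0" and cd: "p \<le> c" "d \<le> p + real m * h" "4 * h \<le> d - c"
    and meas: "emeasure lborel ({c<..<d} - A) \<le> ennreal (\<delta> * (d - c))" and \<delta>: "\<delta> \<ge> 0"
  shows "emeasure lborel {t \<in> {p<..<p + h}. \<forall>k<m. t + real k * h \<notin> A} \<le> ennreal (2 * \<delta> * h)"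
proof -
  define Bad where "Bad = {t \<in> {p<..<p + h}. \<forall>k<m. t + real k * h \<notin> A}"
  have Bad [measurable]: "Bad \<in> sets borel" unfolding Bad_def by measurable
  define K where "K = {k. k < m \<and> c \<le> p + real k * h \<and> p + real (Suc k) * h \<le> d}"
  define i where "i = nat \<lceil>(c - p) / h\<rceil>"
  define j where "j = nat \<lfloor>(d - p) / h\<rfloor>"
  have c0: "0 \<le> (c - p) / h" "0 \<le> (d - p) / h" using cd h by auto
  have i: "(c - p) / h \<le> real i" "real i < (c - p) / h + 1" unfolding i_def using c0 by linarith+
  have j: "real j \<le> (d - p) / h" "(d - p) / h - 1 < real j" unfolding j_def using c0 by linarith+
  have sub: "{i..<j} \<subseteq> K"
  proof
    fix k assume k: "k \<in> {i..<j}"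
    then have "(c - p) / h \<le> real k" "real (Suc k) \<le> (d - p) / h" using i j by (auto intro: order_trans)
    then have *: "c \<le> p + real k * h" "p + real (Suc k) * h \<le> d" using h by (auto simp: field_simps)
    then have "real (Suc k) * h \<le> real m * h" using cd by linarith
    then have "k < m" using h by (simp add: mult_le_cancel_right)
    with * show "k \<in> K" by (simp add: K_def)
  qed
  have fK: "finite K" by (rule finite_subset[of _ "{..<m}"]) (auto simp: K_def)
  \<comment> \<open>Rounding at the two ends loses at most two cells; this inequality makes that at
    most half of all, which is where the factor \<open>2\<close> in the bound comes from.\<close>
  have dc: "4 \<le> (d - c) / h" using cd h by (simp add: field_simps)
  have "(d - c) / h = (d - p) / h - (c - p) / h" by (simp add: diff_divide_distrib)
  then have "(d - c) / h - 2 \<le> real j - real i" using i j by linarith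
  also have "\<dots> \<le> real (card {i..<j})" by simp
  also have "\<dots> \<le> real (card K)" using card_mono[OF fK sub] by simp
  finally have cK: "(d - c) / (2 * h) \<le> real (card K)" using dc by (simp add: field_simps)
  have cpos: "0 < (d - c) / (2 * h)" using cd h by auto
  have "ennreal ((d - c) / (2 * h)) * emeasure lborel Bad \<le> ennreal (real (card K)) * emeasure lborel Bad"
    by (intro mult_right_mono ennreal_leI cK) auto
  also have "\<dots> = (\<integral>\<^sup>+ t. ennreal (real (card K)) * indicator Bad t \<partial>lborel)"
    by (simp add: nn_integral_cmult_indicator)
  also have "\<dots> \<le> (\<integral>\<^sup>+ t. (\<Sum>k<m. indicator ({c<..<d} - A) (t + real k * h)) * indicator {p<..<p + h} t \<partial>lborel)"
  proof (rule nn_integral_mono)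
    fix t
    show "ennreal (real (card K)) * indicator Bad t \<le> 
      (\<Sum>k<m. indicator ({c<..<d} - A) (t + real k * h)) * indicator {p<..<p + h} t"
    proof (cases "t \<in> Bad")
      case True
      then have t: "t \<in> {p<..<p + h}" "\<And>k. k < m \<Longrightarrow> t + real k * h \<notin> A" by (auto simp: Bad_def)
      have "ennreal (real (card K)) = (\<Sum>k\<in>K. 1)" by (simp add: ennreal_of_nat_eq_real_of_nat)
      also have "\<dots> = (\<Sum>k\<in>K. indicator ({c<..<d} - A) (t + real k * h))"
      proof (rule sum.cong)
        fix k assume "k \<in> K"
        then have "c < t + real k * h" "t + real k * h < d" "t + real k * h \<notin> A"
          using t by (auto simp: K_def algebra_simps)
        then show "(1::ennreal) = indicator ({c<..<d} - A) (t + real k * h)" by simp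
      qed simp
      also have "\<dots> \<le> (\<Sum>k<m. indicator ({c<..<d} - A) (t + real k * h))"
        by (rule sum_mono2) (auto simp: K_def)
      finally show ?thesis using t True by simp
    qed simp
  qed
  also have "\<dots> \<le> (\<integral>\<^sup>+ x. indicator ({c<..<d} - A) x * indicator {p<..<p + real m * h} x \<partial>lborel)"
    by (rule nn_integral_fold_le) (use h in auto)
  also have "\<dots> \<le> (\<integral>\<^sup>+ x. indicator ({c<..<d} - A) x \<partial>lborel)"
    by (intro nn_integral_mono) (auto simp: indicator_def)
  also have "\<dots> \<le> ennreal (\<delta> * (d - c))" using meas by simp
  finally have *: "ennreal ((d - c) / (2 * h)) * emeasure lborel Bad \<le> ennreal (\<delta> * (d - c))" .
  have "emeasure lborel Bad \<le> emeasure lborel {p<..<p+h}" by (intro emeasure_mono) (auto simp: Bad_def)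
  also have "\<dots> < \<infinity>" by (simp add: emeasure_lborel_Ioo h less_imp_le)
  finally obtain b where b: "emeasure lborel Bad = ennreal b" "b \<ge> 0"
    by (cases "emeasure lborel Bad" rule: ennreal_cases) auto
  have "(d - c) / (2 * h) * b \<le> \<delta> * (d - c)"
    using * cpos b \<delta> cd h unfolding b(1) by (subst (asm) ennreal_mult[symmetric]) (auto simp: ennreal_le_iff)
  moreover have "d - c > 0" using cd h by linarith
  moreover have "(d - c) / (2 * h) * b * (2 * h) = (d - c) * b" using h by (simp only: times_divide_eq_left nonzero_eq_divide_eq) simp
  moreover have "(d - c) / (2 * h) * b * (2 * h) \<le> \<delta> * (d - c) * (2 * h)" using calculation(1) h by (intro mult_right_mono) auto
  ultimately have "(d - c) * b \<le> (d - c) * (2 * \<delta> * h)" by (simp only: mult_ac)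
  then have "b \<le> 2 * \<delta> * h" using \<open>d - c > 0\<close> by (rule mult_left_le_imp_le)
  then show ?thesis unfolding Bad_def[symmetric] b(1) by (rule ennreal_leI)
qed

text \<open>For most starts the progression stays in \<open>A \<union> B\<close> and meets both
  sets, so two consecutive terms lie in different sets and contribute at least \<open>g\<close>. The
  three exceptional sets of starts have measure at most \<open>2 * \<delta> * h\<close>,
  \<open>2 * \<delta> * h\<close> and \<rho>.\<close>

lemma progression_lower_bound:
  assumes v [measurable]: "v \<in> borel_measurable borel" and A [measurable]: "A \<in> sets borel" and B [measurable]: "B \<in> sets borel"
    and h: "h > 0"
    and sep: "\<And>x y. x \<in> A \<Longrightarrow> y \<in> B \<Longrightarrow> g \<le> (v x - v y)\<^sup>2" and g: "g \<ge> 0"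
    and bad: "emeasure lborel ({p<..<q} - (A \<union> B)) \<le> ennreal \<rho>" "\<rho> \<ge> 0"
    and J1: "p \<le> c1" "d1 \<le> q - h" "4 * h \<le> d1 - c1" "emeasure lborel ({c1<..<d1} - A) \<le> ennreal (\<delta> * (d1 - c1))"
    and J2: "p \<le> c2" "d2 \<le> q - h" "4 * h \<le> d2 - c2" "emeasure lborel ({c2<..<d2} - B) \<le> ennreal (\<delta> * (d2 - c2))"
    and \<delta>: "\<delta> \<ge> 0"
  shows "ennreal (g * ((1 - 4 * \<delta>) * h - \<rho>)) \<le> diff_sq {p<..<q} v h"
proof -
  define m where "m = nat \<lfloor>(q - p) / h\<rfloor>"
  have "q - p \<ge> 4 * h" using J1 h by linarith
  then have qph: "(q - p) / h \<ge> 4" using h by (simp add: field_simps)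
  have m: "real m \<le> (q - p) / h" "(q - p) / h - 1 < real m" using qph unfolding m_def by linarith+
  have mh: "p + real m * h \<le> q" "q - h \<le> p + real m * h" using m h by (auto simp: field_simps)
  have m1: "m \<ge> 1" using qph m by linarith
  define BA where "BA = {t \<in> {p<..<p + h}. \<forall>k<m. t + real k * h \<notin> A}"
  define BB where "BB = {t \<in> {p<..<p + h}. \<forall>k<m. t + real k * h \<notin> B}"
  define BN where "BN = {t \<in> {p<..<p + h}. \<exists>k<m. t + real k * h \<notin> A \<union> B}"
  define Good where "Good = {p<..<p + h} - (BA \<union> BB \<union> BN)"
  have [measurable]: "BA \<in> sets borel" "BB \<in> sets borel" "BN \<in> sets borel" "Good \<in> sets borel"
    unfolding BA_def BB_def BN_def Good_def by measurable
  have eBA: "emeasure lborel BA \<le> ennreal (2 * \<delta> * h)"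
    unfolding BA_def using mh J1 by (intro progression_miss_measure[of A h p c1 d1] h \<delta>) auto
  have eBB: "emeasure lborel BB \<le> ennreal (2 * \<delta> * h)"
    unfolding BB_def using mh J2 by (intro progression_miss_measure[of B h p c2 d2] h \<delta>) auto
  have "emeasure lborel BN = (\<integral>\<^sup>+ t. indicator BN t \<partial>lborel)" by simp
  also have "\<dots> \<le> (\<integral>\<^sup>+ t. (\<Sum>k<m. indicator (- (A \<union> B)) (t + real k * h)) * indicator {p<..<p + h} t \<partial>lborel)"
  proof (rule nn_integral_mono)
    fix t
    show "indicator BN t \<le> (\<Sum>k<m. indicator (- (A \<union> B)) (t + real k * h)) * (indicator {p<..<p + h} t :: ennreal)"
    proof (cases "t \<in> BN")
      case True
      then obtain k where "k < m" "t + real k * h \<in> - (A \<union> B)" "t \<in> {p<..<p + h}" by (auto simp: BN_def)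
      then have "(1::ennreal) \<le> (\<Sum>k<m. indicator (- (A \<union> B)) (t + real k * h))"
        using member_le_sum[of k "{..<m}" "\<lambda>k. indicator (- (A \<union> B)) (t + real k * h) :: ennreal"] by auto
      then show ?thesis using True \<open>t \<in> {p<..<p + h}\<close> by simp
    qed simp
  qed
  also have "\<dots> \<le> (\<integral>\<^sup>+ x. indicator (- (A \<union> B)) x * indicator {p<..<p + real m * h} x \<partial>lborel)"
    by (rule nn_integral_fold_le) (use h in auto)
  also have "\<dots> \<le> (\<integral>\<^sup>+ x. indicator ({p<..<q} - (A \<union> B)) x \<partial>lborel)"
    using mh by (intro nn_integral_mono) (auto simp: indicator_def)
  also have "\<dots> \<le> ennreal \<rho>" using bad by simp
  finally have eBN: "emeasure lborel BN \<le> ennreal \<rho>" .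
  have "ennreal h = emeasure lborel {p<..<p + h}" using h by simp
  also have "\<dots> \<le> emeasure lborel (((Good \<union> BA) \<union> BB) \<union> BN)" by (intro emeasure_mono) (auto simp: Good_def)
  also have "\<dots> \<le> ((emeasure lborel Good + emeasure lborel BA) + emeasure lborel BB) + emeasure lborel BN"
    by (intro order_trans[OF emeasure_subadditive] add_right_mono) auto
  also have "\<dots> \<le> ((emeasure lborel Good + ennreal (2 * \<delta> * h)) + ennreal (2 * \<delta> * h)) + ennreal \<rho>"
    by (intro add_mono eBA eBB eBN order_refl)
  also have "\<dots> = emeasure lborel Good + ennreal (4 * \<delta> * h + \<rho>)"
    using \<delta> h bad by (simp add: add.assoc ennreal_plus[symmetric] del: ennreal_plus)
  finally have hG: "ennreal h \<le> emeasure lborel Good + ennreal (4 * \<delta> * h + \<rho>)" .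
  \<comment> \<open>A negative value on the left is truncated to \<open>0\<close> by
    \<open>ennreal\<close>, in agreement with the truncated subtraction used in the proof.\<close>
  have G: "ennreal ((1 - 4 * \<delta>) * h - \<rho>) \<le> emeasure lborel Good"
  proof -
    have "ennreal ((1 - 4 * \<delta>) * h - \<rho>) = ennreal (h - (4 * \<delta> * h + \<rho>))" by (simp add: algebra_simps)
    also have "\<dots> = ennreal h - ennreal (4 * \<delta> * h + \<rho>)" using \<delta> h bad(2) by (intro ennreal_minus[symmetric] add_nonneg_nonneg mult_nonneg_nonneg) auto
    also have "\<dots> \<le> emeasure lborel Good" using hG by (simp add: ennreal_minus_le_iff add.commute)
    finally show ?thesis .
  qed
  define F where "F x = ennreal ((v (x + h) - v x)\<^sup>2)" for x
  have [measurable]: "F \<in> borel_measurable borel" unfolding F_def by measurable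
  have "ennreal (g * ((1 - 4 * \<delta>) * h - \<rho>)) = ennreal g * ennreal ((1 - 4 * \<delta>) * h - \<rho>)"
    using g by (simp add: ennreal_mult')
  also have "\<dots> \<le> ennreal g * emeasure lborel Good" by (intro mult_left_mono G) auto
  also have "\<dots> = (\<integral>\<^sup>+ t. ennreal g * indicator Good t \<partial>lborel)" by (simp add: nn_integral_cmult_indicator)
  also have "\<dots> \<le> (\<integral>\<^sup>+ t. (\<Sum>k<m - 1. F (t + real k * h)) * indicator {p<..<p + h} t \<partial>lborel)"
  proof (rule nn_integral_mono)
    fix t
    show "ennreal g * indicator Good t \<le> (\<Sum>k<m - 1. F (t + real k * h)) * indicator {p<..<p + h} t"
    proof (cases "t \<in> Good")
      case True
      define inA where "inA k \<longleftrightarrow> t + real k * h \<in> A" for k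
      have t: "t \<in> {p<..<p + h}" "\<exists>k<m. t + real k * h \<in> A" "\<exists>k<m. t + real k * h \<in> B" 
        and AB: "\<And>k. k < m \<Longrightarrow> t + real k * h \<in> A \<union> B"
        using True by (auto simp: Good_def BA_def BB_def BN_def)
      obtain k where k: "k < m - 1" "g \<le> (v (t + real (Suc k) * h) - v (t + real k * h))\<^sup>2"
      proof (rule ccontr)
        assume "\<not> thesis"
        then have no: "\<And>k. k < m - 1 \<Longrightarrow> \<not> g \<le> (v (t + real (Suc k) * h) - v (t + real k * h))\<^sup>2" using that by blast
        \<comment> \<open>Without a switch, membership in \<open>A\<close> propagates along the
          whole progression, so its term in \<open>B\<close> lies in \<open>A\<close> as well;
          separating this point from itself gives \<open>g \<le> 0\<close>.\<close>
        have same: "k < m \<Longrightarrow> t + real k * h \<in> A \<longleftrightarrow> t + real 0 * h \<in> A" for k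
        proof (induction k)
          case (Suc k)
          then have "k < m - 1" "t + real k * h \<in> A \<union> B" "t + real (Suc k) * h \<in> A \<union> B" 
            using AB[of k] AB[of "Suc k"] by auto
          moreover note no[OF \<open>k < m - 1\<close>] sep[of "t + real k * h" "t + real (Suc k) * h"] sep[of "t + real (Suc k) * h" "t + real k * h"]
          ultimately have "t + real (Suc k) * h \<in> A \<longleftrightarrow> t + real k * h \<in> A" by (auto simp: power2_commute)
          then show ?case using Suc by auto
        qed simp
        obtain k1 k2 where "k1 < m" "t + real k1 * h \<in> A" "k2 < m" "t + real k2 * h \<in> B" using t by blast
        then have allA: "\<And>k. k < m \<Longrightarrow> t + real k * h \<in> A" using same by blast
        \<comment> \<open>For \<open>g = 0\<close> every step of the progression would be a witness,
          so the assumption already fails at \<open>k = 0\<close>.\<close>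
        have g0: "g > 0"
        proof (rule ccontr)
          assume "\<not> g > 0"
          then have "g = 0" using g by simp
          then have "\<not> 0 < m - 1" using no[of 0] by auto
          then have "m \<le> 1" by simp
          then show False using qph m by linarith
        qed
        have "t + real k2 * h \<in> A" using allA \<open>k2 < m\<close> by blast
        then have "g \<le> (v (t + real k2 * h) - v (t + real k2 * h))\<^sup>2" using sep \<open>t + real k2 * h \<in> B\<close> by blast
        then show False using g0 by simp
      qed
      have "ennreal g \<le> F (t + real k * h)" unfolding F_def using k(2) by (intro ennreal_leI) (simp add: algebra_simps)
      also have "\<dots> \<le> (\<Sum>k<m - 1. F (t + real k * h))" using k by (intro member_le_sum) auto
      finally show ?thesis using True t by simp
    qed simp
  qed
  also have "\<dots> \<le> (\<integral>\<^sup>+ x. F x * indicator {p<..<p + real (m - 1) * h} x \<partial>lborel)"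
    by (rule nn_integral_fold_le) (use h in auto)
  also have "\<dots> \<le> diff_sq {p<..<q} v h" unfolding diff_sq_def F_def
  proof (rule nn_integral_mono)
    fix x
    \<comment> \<open>The last cell is left out so that \<open>x + h\<close> stays below
      \<open>q\<close>.\<close>
    have "p + real (m - 1) * h \<le> q - h" using mh m1 h by (simp add: of_nat_diff algebra_simps)
    then show "ennreal ((v (x + h) - v x)\<^sup>2) * indicator {p<..<p + real (m - 1) * h} x
      \<le> ennreal ((v (x + h) - v x)\<^sup>2) * indicator {p<..<q} x * indicator {p<..<q} (x + h)"
      using h by (auto simp: indicator_def)
  qed
  finally show ?thesis .
qed

subsection \<open>The critical exponent\<close>

lemma emeasure_lebesgue_borel: "S \<in> sets borel \<Longrightarrow> emeasure lebesgue S = emeasure lborel (S :: real set)"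
  by (simp add: emeasure_completion)

text \<open>Truncation at \<open>0\<close> makes \<open>ennreal\<close> subadditive without sign
  conditions; it is applied to an integrand that may be negative.\<close>

lemma ennreal_plus_le: "ennreal (a + b) \<le> ennreal a + ennreal b"
proof -
  have "ennreal (a + b) \<le> ennreal (max 0 a + max 0 b)" by (intro ennreal_leI) auto
  also have "\<dots> = ennreal (max 0 a) + ennreal (max 0 b)" by (rule ennreal_plus) auto
  also have "\<dots> = ennreal a + ennreal b" by (simp add: max_def ennreal_neg)
  finally show ?thesis .
qed

text \<open>A weak form of Lebesgue's density theorem. If every interval kept a proportion \<delta>
  outside \<open>S\<close>, then covering a compact part of \<open>S\<close> by small cells within
  an open set of almost the same measure would lose this proportion, more than the approximation
  error allows.\<close>

lemma density_interval:
  assumes S [measurable]: "S \<in> sets borel" and pos: "emeasure lborel (S \<inter> {p<..<q}) > 0" and \<delta>: "0 < \<delta>" "\<delta> < 1"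
  obtains c d where "p < c" "c < d" "d < q" "emeasure lborel ({c<..<d} - S) \<le> ennreal (\<delta> * (d - c))"
proof (rule ccontr)
  assume "\<not> thesis"
  then have no: "\<And>c d. p < c \<Longrightarrow> c < d \<Longrightarrow> d < q \<Longrightarrow> ennreal (\<delta> * (d - c)) < emeasure lborel ({c<..<d} - S)"
    using that by (meson not_le)
  define S0 where "S0 = S \<inter> {p<..<q}"
  have [measurable]: "S0 \<in> sets borel" by (simp add: S0_def)
  have pq: "p < q"
  proof (rule ccontr)
    assume "\<not> p < q"
    then have "S \<inter> {p<..<q} = {}" by auto
    then show False using pos by simp
  qed
  have "emeasure lborel S0 \<le> emeasure lborel {p<..<q}" by (intro emeasure_mono) (auto simp: S0_def)
  also have "\<dots> < \<infinity>" using pq by simp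
  finally obtain m where m: "emeasure lborel S0 = ennreal m" "m \<ge> 0"
    by (cases "emeasure lborel S0" rule: ennreal_cases) auto
  have m0: "m > 0" using pos m unfolding S0_def[symmetric] by (simp add: order.order_iff_strict) 
  \<comment> \<open>Inner and outer approximation cost at most \<theta> each, together exactly the
    deficit \<open>\<delta> * m\<close>; the contradiction comes from the extra
    \<open>\<delta> * \<theta>\<close>.\<close>
  define \<theta> where "\<theta> = \<delta> * m / 2"
  have \<theta>: "\<theta> > 0" using m0 \<delta> by (simp add: \<theta>_def)
  have Sl: "S0 \<in> sets lebesgue" by simp
  obtain T where T: "closed T" "T \<subseteq> S0" "emeasure lebesgue (S0 - T) < ennreal \<theta>"
    using sets_lebesgue_inner_closed[OF Sl \<theta>] by metis
  obtain U' where U': "open U'" "S0 \<subseteq> U'" "emeasure lebesgue (U' - S0) < ennreal \<theta>"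
    using sets_lebesgue_outer_open[OF Sl \<theta>] by metis
  have [measurable]: "T \<in> sets borel" "U' \<in> sets borel" using T U' by auto
  define U where "U = U' \<inter> {p<..<q}"
  have U: "open U" "S0 \<subseteq> U" "U \<subseteq> {p<..<q}" using U' by (auto simp: U_def S0_def)
  have [measurable]: "U \<in> sets borel" using U by auto
  have "T \<subseteq> {p..q}" using T(2) by (auto simp: S0_def)
  then have "compact T" using T(1) compact_Int_closed[OF compact_Icc[of p q] T(1)] by (simp add: Int_absorb1)
  moreover have "T \<inter> - U = {}" using T U by auto
  ultimately obtain r where r: "r > 0" "\<And>x y. x \<in> T \<Longrightarrow> y \<notin> U \<Longrightarrow> r \<le> dist x y"
    using separate_compact_closed[of T "- U"] U by (auto simp: closed_def)
  obtain n where n: "(q - p) / r < real n" using reals_Archimedean2 by blast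
  have n0: "n > 0" using n pq r by (metis diff_gt_0_iff_gt divide_pos_pos dual_order.strict_trans of_nat_0_less_iff)
  \<comment> \<open>Cells are shorter than the distance from \<open>T\<close> to the complement of
    \<open>U\<close>, so a cell that meets \<open>T\<close> lies in \<open>U\<close>.\<close>
  define w where "w = (q - p) / real n"
  have w: "0 < w" "w < r" using n n0 pq r by (auto simp: w_def field_simps)
  define C where "C k = {p + real k * w..p + real (Suc k) * w}" for k
  define I where "I = {k. k < n \<and> C k \<inter> T \<noteq> {}}"
  have fI: "finite I" by (simp add: I_def)
  have CU: "C k \<subseteq> U" if "k \<in> I" for k
  proof
    fix y assume y: "y \<in> C k"
    from that obtain x where x: "x \<in> T" "x \<in> C k" by (auto simp: I_def)
    have "dist x y \<le> w" using x y by (auto simp: C_def dist_real_def algebra_simps)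
    then show "y \<in> U" using r(2)[OF x(1)] w by force
  qed
  have cover: "T \<subseteq> (\<Union>k\<in>I. T \<inter> C k)"
  proof
    fix x assume x: "x \<in> T"
    then have xpq: "p < x" "x < q" using T(2) by (auto simp: S0_def)
    define k where "k = nat \<lfloor>(x - p) / w\<rfloor>"
    have "0 \<le> (x - p) / w" using xpq w by auto
    then have k: "real k \<le> (x - p) / w" "(x - p) / w < real k + 1" unfolding k_def by linarith+
    then have "x \<in> C k" using w by (auto simp: C_def field_simps)
    moreover have "k < n"
    proof -
      have "(x - p) / w < (q - p) / w" using xpq w by (simp add: divide_strict_right_mono)
      also have "\<dots> = real n" using n0 pq by (simp add: w_def)
      finally show ?thesis using k by linarith
    qed
    ultimately show "x \<in> (\<Union>k\<in>I. T \<inter> C k)" using x by (auto simp: I_def)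
  qed
  define D where "D k = {p + real k * w<..<p + real (Suc k) * w}" for k
  have eD: "emeasure lborel (D k) = ennreal w" for k using w by (simp add: D_def algebra_simps)
  have cell: "emeasure lborel (T \<inter> C k) \<le> ennreal (1 - \<delta>) * emeasure lborel (D k)" if k: "k \<in> I" for k
  proof -
    have e: "p + real k * w < p + real (Suc k) * w" using w by (simp add: algebra_simps)
    \<comment> \<open>The end points lie in \<open>U\<close>, hence strictly between
      \<open>p\<close> and \<open>q\<close>, as the negated claim \<open>no\<close>
      requires.\<close>
    have "p + real k * w \<in> U" "p + real (Suc k) * w \<in> U" using CU[OF k] e by (auto simp: C_def subset_iff)
    then have "p < p + real k * w" "p + real (Suc k) * w < q" using U by auto
    from no[OF this(1) e this(2)] have l: "ennreal (\<delta> * w) < emeasure lborel (D k - S)"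
      by (simp add: D_def algebra_simps)
    have "emeasure lborel (T \<inter> C k) \<le> emeasure lborel ((D k \<inter> S) \<union> ({p + real k * w} \<union> {p + real (Suc k) * w}))"
      using T(2) by (intro emeasure_mono) (auto simp: C_def D_def S0_def)
    also have "\<dots> \<le> emeasure lborel (D k \<inter> S) + (emeasure lborel {p + real k * w} + emeasure lborel {p + real (Suc k) * w})"
      by (intro order_trans[OF emeasure_subadditive] add_left_mono) (auto simp: D_def)
    finally have 1: "emeasure lborel (T \<inter> C k) \<le> emeasure lborel (D k \<inter> S)" by simp
    have "emeasure lborel (D k \<inter> S) + emeasure lborel (D k - S) = ennreal w"
      unfolding eD[symmetric, of k] by (subst plus_emeasure) (auto simp: D_def intro: arg_cong[where f = "emeasure lborel"])
    moreover obtain a where a: "emeasure lborel (D k \<inter> S) = ennreal a" "a \<ge> 0"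
      using calculation by (cases "emeasure lborel (D k \<inter> S)" rule: ennreal_cases) auto
    moreover obtain b where b: "emeasure lborel (D k - S) = ennreal b" "b \<ge> 0"
      using calculation by (cases "emeasure lborel (D k - S)" rule: ennreal_cases) auto
    ultimately have "a + b = w" using w by (simp add: ennreal_plus[symmetric] del: ennreal_plus)
    moreover have "\<delta> * w < b" using l \<delta> w unfolding b by (simp add: ennreal_less_iff)
    ultimately have "a \<le> (1 - \<delta>) * w" by (simp add: algebra_simps)
    then have "ennreal a \<le> ennreal ((1 - \<delta>) * w)" by (rule ennreal_leI)
    also have "\<dots> = ennreal (1 - \<delta>) * ennreal w" using \<delta> w by (simp add: ennreal_mult)
    finally show ?thesis using 1 a(1) eD by simp
  qed
  have "emeasure lborel T \<le> emeasure lborel (\<Union>k\<in>I. T \<inter> C k)" by (intro emeasure_mono cover) (auto simp: C_def fI)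
  also have "\<dots> \<le> (\<Sum>k\<in>I. emeasure lborel (T \<inter> C k))"
    by (rule emeasure_subadditive_finite[OF fI]) (auto simp: C_def)
  also have "\<dots> \<le> (\<Sum>k\<in>I. ennreal (1 - \<delta>) * emeasure lborel (D k))" by (intro sum_mono cell)
  also have "\<dots> = ennreal (1 - \<delta>) * (\<Sum>k\<in>I. emeasure lborel (D k))" by (simp add: sum_distrib_left)
  also have "(\<Sum>k\<in>I. emeasure lborel (D k)) = emeasure lborel (\<Union>k\<in>I. D k)"
  proof (rule sum_emeasure)
    have *: "D i \<inter> D j = {}" if "i < j" for i j :: nat
    proof -
      have "real (Suc i) * w \<le> real j * w" using that w by (intro mult_right_mono) auto
      then show ?thesis by (auto simp: D_def)
    qed
    show "disjoint_family_on D I"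
      unfolding disjoint_family_on_def
    proof (intro ballI impI)
      fix i j :: nat assume "i \<noteq> j"
      then show "D i \<inter> D j = {}" using *[of i j] *[of j i] by (cases i j rule: linorder_cases) auto
    qed
  qed (auto simp: D_def fI)
  also have "emeasure lborel (\<Union>k\<in>I. D k) \<le> emeasure lborel U"
    using CU by (intro emeasure_mono) (force simp: C_def D_def)+
  also have "emeasure lborel U \<le> emeasure lborel (S0 \<union> (U' - S0))" by (intro emeasure_mono) (auto simp: U_def)
  also have "\<dots> \<le> emeasure lborel S0 + emeasure lborel (U' - S0)" by (intro emeasure_subadditive) auto
  also have "\<dots> \<le> ennreal m + ennreal \<theta>"
    using U'(3) m by (intro add_mono) (auto simp: emeasure_lebesgue_borel)
  finally have 1: "emeasure lborel T \<le> ennreal (1 - \<delta>) * (ennreal m + ennreal \<theta>)" by (simp add: mult_left_mono)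
  have "emeasure lborel S0 \<le> emeasure lborel (T \<union> (S0 - T))" by (intro emeasure_mono) auto
  also have "\<dots> \<le> emeasure lborel T + emeasure lborel (S0 - T)" by (rule emeasure_subadditive) simp_all
  also have "\<dots> \<le> ennreal (1 - \<delta>) * (ennreal m + ennreal \<theta>) + ennreal \<theta>"
    using T(3) by (intro add_mono 1) (auto simp: emeasure_lebesgue_borel)
  also have "\<dots> = ennreal ((1 - \<delta>) * (m + \<theta>) + \<theta>)"
    using \<delta> m \<theta> by (simp add: ennreal_mult ennreal_plus)
  finally have "m \<le> (1 - \<delta>) * (m + \<theta>) + \<theta>" using \<delta> m \<theta> unfolding m(1) by (subst (asm) ennreal_le_iff) auto
  then have "\<delta> * m + \<delta> * \<theta> \<le> 2 * \<theta>" by (simp add: algebra_simps)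
  also have "2 * \<theta> = \<delta> * m" by (simp add: \<theta>_def)
  finally show False using \<delta> \<theta> mult_pos_pos[of \<delta> \<theta>] by linarith
qed

text \<open>Near infinity the two liminf conditions give a positive bound; on the remaining compact
  set, from which the zeros have been removed, continuity does.\<close>

lemma double_well_gap:
  assumes W: "double_well W" and \<eta>: "\<eta> > 0"
  obtains c where "c > 0" "\<And>z. \<eta> \<le> \<bar>z - 1\<bar> \<Longrightarrow> \<eta> \<le> \<bar>z + 1\<bar> \<Longrightarrow> c \<le> W z"
proof -
  have cont: "continuous_on UNIV W" and nn: "\<And>z. 0 \<le> W z" and zero: "\<And>z. W z = 0 \<longleftrightarrow> z = 1 \<or> z = -1"
    and lt: "Liminf at_top (\<lambda>z. ereal (W z)) > 0" and lb: "Liminf at_bot (\<lambda>z. ereal (W z)) > 0"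
    using W unfolding double_well_def by auto
  obtain a where a: "0 < ereal a" "ereal a < Liminf at_top (\<lambda>z. ereal (W z))" using lt by (meson ereal_dense2)
  obtain b where b: "0 < ereal b" "ereal b < Liminf at_bot (\<lambda>z. ereal (W z))" using lb by (meson ereal_dense2)
  obtain N where N: "\<And>z. N \<le> z \<Longrightarrow> a < W z" using less_LiminfD[OF a(2)] by (auto simp: eventually_at_top_linorder)
  obtain M where M: "\<And>z. z \<le> M \<Longrightarrow> b < W z" using less_LiminfD[OF b(2)] by (auto simp: eventually_at_bot_linorder)
  define K where "K = {M..N} \<inter> {z. \<eta> \<le> \<bar>z - 1\<bar> \<and> \<eta> \<le> \<bar>z + 1\<bar>}"
  have "closed {z::real. \<eta> \<le> \<bar>z - 1\<bar> \<and> \<eta> \<le> \<bar>z + 1\<bar>}" by (intro closed_Collect_conj closed_Collect_le continuous_intros)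
  then have K: "compact K" unfolding K_def by (intro compact_Int_closed) auto
  obtain d where d: "d > 0" "\<And>z. z \<in> K \<Longrightarrow> d \<le> W z"
  proof (cases "K = {}")
    case False
    then obtain z0 where z0: "z0 \<in> K" "\<And>z. z \<in> K \<Longrightarrow> W z0 \<le> W z"
      using continuous_attains_inf[OF K False continuous_on_subset[OF cont subset_UNIV]] by blast
    have "W z0 \<noteq> 0" using z0(1) \<eta> by (auto simp: K_def zero)
    then have "0 < W z0" using nn[of z0] by simp
    then show ?thesis using z0 that by blast
  qed (use that[of 1] in auto)
  show ?thesis
  proof (rule that[of "min (min a b) d"])
    show "0 < min (min a b) d" using a b d by simp
    fix z assume z: "\<eta> \<le> \<bar>z - 1\<bar>" "\<eta> \<le> \<bar>z + 1\<bar>"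
    show "min (min a b) d \<le> W z" using N[of z] M[of z] d(2)[of z] z by (cases "N \<le> z"; cases "z \<le> M") (auto simp: K_def)
  qed
qed

text \<open>A version of \<open>energy\<close> for Borel functions on arbitrary sets, superadditive
  over disjoint ones. On \<open>(0,1)\<close> the two are linked by
  \<open>energy_eq_loc_energy\<close>.\<close>

definition loc_energy :: "(real \<Rightarrow> real) \<Rightarrow> real \<Rightarrow> real \<Rightarrow> real set \<Rightarrow> (real \<Rightarrow> real) \<Rightarrow> ennreal" where
  "loc_energy W s \<epsilon> A u = ennreal (scale_factor \<epsilon> s) *
     (ennreal (1 / \<epsilon>) * (\<integral>\<^sup>+ t. ennreal (W (u t)) * indicator A t \<partial>lborel) + ennreal (\<epsilon> powr (2 * s - 1)) * gsq s A u)"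

definition conv_meas :: "(nat \<Rightarrow> real \<Rightarrow> real) \<Rightarrow> (real \<Rightarrow> real) \<Rightarrow> bool" where
  "conv_meas v u \<longleftrightarrow> (\<forall>\<delta>>0. (\<lambda>j. emeasure lborel {x \<in> {0<..<1}. \<bar>v j x - u x\<bar> > \<delta>}) \<longlonglongrightarrow> 0)"

text \<open>\<open>progression_lower_bound\<close> is integrated over
  \<open>h \<in> {\<rho>..h0}\<close> against the kernel. Compared with the exact normalisation over
  \<open>{\<epsilon>..1}\<close>, the two missing ranges cost at most
  \<open>ln (\<rho> / \<epsilon>)\<close> and \<open>ln (1 / h0)\<close>, and the term
  \<open>- \<rho>\<close> costs at most the integral of \<open>\<rho> / h\<^sup>2\<close>, that is
  \<open>1\<close>.\<close>

lemma integrated_lower_bound: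
  assumes v [measurable]: "v \<in> borel_measurable borel" and A [measurable]: "A \<in> sets borel" and B [measurable]: "B \<in> sets borel"
    and sep: "\<And>x y. x \<in> A \<Longrightarrow> y \<in> B \<Longrightarrow> g \<le> (v x - v y)\<^sup>2" and g: "g \<ge> 0"
    and bad: "emeasure lborel ({p<..<q} - (A \<union> B)) \<le> ennreal \<rho>" and \<rho>: "\<epsilon> \<le> \<rho>" "\<rho> \<le> h0" "h0 \<le> 1"
    and J1: "p \<le> ca" "da \<le> q - h0" "4 * h0 \<le> da - ca" "emeasure lborel ({ca<..<da} - A) \<le> ennreal (\<delta> * (da - ca))"
    and J2: "p \<le> cb" "db \<le> q - h0" "4 * h0 \<le> db - cb" "emeasure lborel ({cb<..<db} - B) \<le> ennreal (\<delta> * (db - cb))"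
    and \<delta>: "0 \<le> \<delta>" "\<delta> \<le> 1/4" and e: "0 < \<epsilon>" "\<epsilon> < 1" and s: "1/2 \<le> s"
  shows "ennreal (2 * g * ((1 - 4 * \<delta>) * (1 - scale_factor \<epsilon> s * (ln (\<rho> / \<epsilon>) + ln (1 / h0))) - scale_factor \<epsilon> s)) \<le> 
    ennreal (scale_factor \<epsilon> s) * (ennreal (\<epsilon> powr (2 * s - 1)) * gsq s {p<..<q} v)"
proof -
  define l where "l = scale_factor \<epsilon> s"
  have l: "l > 0" using scale_factor_bounds(1)[OF e s] by (simp add: l_def)
  define E where "E = \<epsilon> powr (2 * s - 1)"
  have E: "E > 0" using e by (simp add: E_def)
  have \<rho>0: "0 < \<rho>" using \<rho> e by simp
  have h0: "0 < h0" using \<rho> \<rho>0 by simp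
  \<comment> \<open>For \<open>h \<ge> \<epsilon>\<close> the weight lies below \<open>1 / h\<close>
    whatever \<open>s \<ge> 1/2\<close> is, so the lost ranges are logarithmic uniformly in
    \<open>s\<close>.\<close>
  have Eh: "E * h powr (- (2 * s)) \<le> 1 / h" if "\<epsilon> \<le> h" for h
  proof -
    have h: "h > 0" using that e by simp
    have "E * h powr (- (2 * s)) = (E / h powr (2 * s - 1)) * (1 / h)"
      using h by (simp add: powr_minus powr_diff divide_simps)
    also have "\<dots> \<le> 1 * (1 / h)"
      using that h e s by (intro mult_right_mono) (auto simp: E_def divide_le_eq powr_mono2)
    finally show ?thesis by simp
  qed
  define P where "P = (\<integral>\<^sup>+ h. ennreal (E * h powr (- (1 + 2 * s)) * ((1 - 4 * \<delta>) * h - \<rho>)) * indicator {\<rho>..h0} h \<partial>lborel)"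
  define Q where "Q = (\<integral>\<^sup>+ h. ennreal (E * h powr (- (2 * s))) * indicator {\<rho>..h0} h \<partial>lborel)"
  have "ennreal (1 / l) = (\<integral>\<^sup>+ h. ennreal (E * h powr (- (2 * s))) * indicator {\<epsilon>..1} h \<partial>lborel)"
    unfolding l_def E_def by (rule nn_integral_scale_factor[OF e s, symmetric])
  also have "\<dots> \<le> (\<integral>\<^sup>+ h. (ennreal (E * h powr (- (2 * s))) * indicator {\<rho>..h0} h + 
       ennreal (1 / h) * indicator {\<epsilon>..\<rho>} h) + ennreal (1 / h) * indicator {h0..1} h \<partial>lborel)"
  proof (rule nn_integral_mono)
    fix h
    show "ennreal (E * h powr (- (2 * s))) * indicator {\<epsilon>..1} h \<le> (ennreal (E * h powr (- (2 * s))) * indicator {\<rho>..h0} h + 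
       ennreal (1 / h) * indicator {\<epsilon>..\<rho>} h) + ennreal (1 / h) * indicator {h0..1} h"
    proof (cases "h \<in> {\<epsilon>..1}")
      case True
      then have "ennreal (E * h powr (- (2 * s))) \<le> ennreal (1 / h)" by (intro ennreal_leI Eh) auto
      moreover have "h \<in> {\<rho>..h0} \<or> h \<in> {\<epsilon>..\<rho>} \<or> h \<in> {h0..1}" using True by auto
      ultimately show ?thesis using True
        by (elim disjE) (auto simp: indicator_def intro: add_increasing add_increasing2)
    qed simp
  qed
  also have "\<dots> = (Q + ennreal (ln (\<rho> / \<epsilon>))) + ennreal (ln (1 / h0))"
    unfolding Q_def using \<rho> e h0
    by (subst nn_integral_add, measurable, subst nn_integral_add, measurable) (simp add: nn_integral_inverse_ivl)
  finally have "ennreal (1 / l) \<le> Q + ennreal (ln (\<rho> / \<epsilon>) + ln (1 / h0))"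
    using \<rho> e h0 by (simp add: add.assoc ennreal_plus[symmetric] del: ennreal_plus)
  then have "ennreal (1 / l) - ennreal (ln (\<rho> / \<epsilon>) + ln (1 / h0)) \<le> Q"
    by (simp add: ennreal_minus_le_iff add.commute)
  moreover have "0 \<le> ln (\<rho> / \<epsilon>) + ln (1 / h0)" using \<rho> e h0 by (intro add_nonneg_nonneg) (auto simp: ln_ge_zero)
  ultimately have Q: "ennreal (1 / l - (ln (\<rho> / \<epsilon>) + ln (1 / h0))) \<le> Q" by (simp add: ennreal_minus)
  have "ennreal (1 - 4 * \<delta>) * Q = (\<integral>\<^sup>+ h. ennreal (1 - 4 * \<delta>) * (ennreal (E * h powr (- (2 * s))) * indicator {\<rho>..h0} h) \<partial>lborel)"
    unfolding Q_def by (rule nn_integral_cmult[symmetric]) measurable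
  also have "\<dots> \<le> (\<integral>\<^sup>+ h. ennreal (E * h powr (- (1 + 2 * s)) * ((1 - 4 * \<delta>) * h - \<rho>)) * indicator {\<rho>..h0} h + ennreal (\<rho> / h\<^sup>2) * indicator {\<rho>..h0} h \<partial>lborel)"
  proof (rule nn_integral_mono)
    fix h
    show "ennreal (1 - 4 * \<delta>) * (ennreal (E * h powr (- (2 * s))) * indicator {\<rho>..h0} h) \<le> 
      ennreal (E * h powr (- (1 + 2 * s)) * ((1 - 4 * \<delta>) * h - \<rho>)) * indicator {\<rho>..h0} h + ennreal (\<rho> / h\<^sup>2) * indicator {\<rho>..h0} h"
    proof (cases "h \<in> {\<rho>..h0}")
      case True
      then have h: "h > 0" "\<epsilon> \<le> h" using \<rho>0 \<rho> by auto
      have p1: "h powr (- (1 + 2 * s)) = h powr (- (2 * s)) / h" proof -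
        have eq: "- (1 + 2 * s) = - (2 * s) - 1" by simp
        show ?thesis unfolding eq powr_diff using h by simp
      qed
      have "E * h powr (- (2 * s)) / h * \<rho> \<le> (1 / h) / h * \<rho>" using Eh[OF h(2)] h \<rho>0
        by (intro mult_right_mono divide_right_mono) auto
      then have "E * h powr (- (2 * s)) / h * \<rho> \<le> \<rho> / h\<^sup>2" by (simp add: power2_eq_square)
      moreover have "E * h powr (- (1 + 2 * s)) * ((1 - 4 * \<delta>) * h - \<rho>) = (1 - 4 * \<delta>) * (E * h powr (- (2 * s))) - E * h powr (- (2 * s)) / h * \<rho>"
        unfolding p1 using h by (simp add: field_simps)
      ultimately have "(1 - 4 * \<delta>) * (E * h powr (- (2 * s))) \<le> E * h powr (- (1 + 2 * s)) * ((1 - 4 * \<delta>) * h - \<rho>) + \<rho> / h\<^sup>2" by linarith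
      then have "ennreal ((1 - 4 * \<delta>) * (E * h powr (- (2 * s)))) \<le> ennreal (E * h powr (- (1 + 2 * s)) * ((1 - 4 * \<delta>) * h - \<rho>) + \<rho> / h\<^sup>2)"
        by (rule ennreal_leI)
      also have "\<dots> \<le> ennreal (E * h powr (- (1 + 2 * s)) * ((1 - 4 * \<delta>) * h - \<rho>)) + ennreal (\<rho> / h\<^sup>2)"
        by (rule ennreal_plus_le)
      finally show ?thesis using True \<delta> E by (simp add: ennreal_mult)
    qed simp
  qed
  also have "\<dots> = P + (\<integral>\<^sup>+ h. ennreal (\<rho> / h\<^sup>2) * indicator {\<rho>..h0} h \<partial>lborel)"
    unfolding P_def by (rule nn_integral_add) measurable
  also have "\<dots> \<le> P + 1" using \<rho>0 \<rho> by (intro add_left_mono nn_integral_inverse_sq_ivl) auto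
  finally have PQ: "ennreal (1 - 4 * \<delta>) * Q \<le> P + ennreal 1" by simp
  have "ennreal (1 - 4 * \<delta>) * ennreal (1 / l - (ln (\<rho> / \<epsilon>) + ln (1 / h0))) \<le> P + ennreal 1"
    by (rule order_trans[OF mult_left_mono[OF Q] PQ]) simp
  then have "ennreal ((1 - 4 * \<delta>) * (1 / l - (ln (\<rho> / \<epsilon>) + ln (1 / h0)))) - ennreal 1 \<le> P"
    using \<delta> by (simp add: ennreal_minus_le_iff add.commute ennreal_mult')
  then have P: "ennreal ((1 - 4 * \<delta>) * (1 / l - (ln (\<rho> / \<epsilon>) + ln (1 / h0))) - 1) \<le> P"
    by (simp add: ennreal_minus del: ennreal_1)
  have ennreal_split: "ennreal (l * 2 * g * X) = ennreal l * (2 * (ennreal g * ennreal X))" for X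
    using l g by (simp add: ennreal_mult' mult.assoc)
  have "ennreal (2 * g * ((1 - 4 * \<delta>) * (1 - l * (ln (\<rho> / \<epsilon>) + ln (1 / h0))) - l)) = 
     ennreal (l * 2 * g * ((1 - 4 * \<delta>) * (1 / l - (ln (\<rho> / \<epsilon>) + ln (1 / h0))) - 1))"
    using l by (intro arg_cong[where f = ennreal]) (simp add: field_simps)
  also have "\<dots> = ennreal l * (2 * (ennreal g * ennreal ((1 - 4 * \<delta>) * (1 / l - (ln (\<rho> / \<epsilon>) + ln (1 / h0))) - 1)))"
    using l g ennreal_split by blast
  also have "\<dots> \<le> ennreal l * (2 * (ennreal g * P))" by (intro mult_left_mono P) auto
  also have "\<dots> \<le> ennreal l * (2 * (ennreal E * (\<integral>\<^sup>+ h. ennreal (h powr (- (1 + 2 * s))) * diff_sq {p<..<q} v h * indicator {0<..} h \<partial>lborel)))"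
  proof (intro mult_left_mono)
  have "ennreal g * P = (\<integral>\<^sup>+ h. ennreal g * (ennreal (E * h powr (- (1 + 2 * s)) * ((1 - 4 * \<delta>) * h - \<rho>)) * indicator {\<rho>..h0} h) \<partial>lborel)"
    unfolding P_def by (rule nn_integral_cmult[symmetric]) measurable
  also have "\<dots> \<le> (\<integral>\<^sup>+ h. ennreal E * (ennreal (h powr (- (1 + 2 * s))) * diff_sq {p<..<q} v h * indicator {0<..} h) \<partial>lborel)"
  proof (rule nn_integral_mono)
    fix h
    show "ennreal g * (ennreal (E * h powr (- (1 + 2 * s)) * ((1 - 4 * \<delta>) * h - \<rho>)) * indicator {\<rho>..h0} h) \<le> 
      ennreal E * (ennreal (h powr (- (1 + 2 * s))) * diff_sq {p<..<q} v h * indicator {0<..} h)"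
    proof (cases "h \<in> {\<rho>..h0}")
      case True
      then have h: "h > 0" using \<rho>0 by auto
      have "ennreal (g * ((1 - 4 * \<delta>) * h - \<rho>)) \<le> diff_sq {p<..<q} v h"
        using True J1 J2 \<delta> h \<rho>0 sep g bad by (intro progression_lower_bound[OF v A B h]) auto
      then have "ennreal E * (ennreal (h powr (- (1 + 2 * s))) * ennreal (g * ((1 - 4 * \<delta>) * h - \<rho>))) \<le> ennreal E * (ennreal (h powr (- (1 + 2 * s))) * diff_sq {p<..<q} v h)"
        by (intro mult_left_mono) auto
      moreover have "ennreal E * (ennreal H * ennreal (g * Y)) = ennreal g * ennreal (E * H * Y)" if "H \<ge> 0" for H Y
      proof -
        have "ennreal (g * Y) = ennreal g * ennreal Y" by (rule ennreal_mult'[OF g])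
        moreover have "ennreal (E * H * Y) = ennreal E * ennreal H * ennreal Y" 
          using E that by (simp add: ennreal_mult')
        ultimately show ?thesis by (simp only: mult_ac)
      qed
      ultimately show ?thesis using True h by simp
    qed simp
  qed
  also have "\<dots> = ennreal E * (\<integral>\<^sup>+ h. ennreal (h powr (- (1 + 2 * s))) * diff_sq {p<..<q} v h * indicator {0<..} h \<partial>lborel)"
    by (rule nn_integral_cmult) measurable
  finally show "ennreal g * P \<le> ennreal E * (\<integral>\<^sup>+ h. ennreal (h powr (- (1 + 2 * s))) * diff_sq {p<..<q} v h * indicator {0<..} h \<partial>lborel)" .
  qed auto
  also have "\<dots> = 
    ennreal l * (ennreal E * gsq s {p<..<q} v)"
  proof -
    have *: "{p<..<q} \<in> sets borel" by simp
    have "ennreal l * (2 * (ennreal E * X)) = ennreal l * (ennreal E * (2 * X))" for X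
      by (simp only: mult_ac)
    then show ?thesis unfolding gsq_eq_diff_sq[OF v *] .
  qed
  finally show ?thesis unfolding l_def E_def .
qed

lemma scale_factor_ge:
  assumes e: "0 < \<epsilon>" "\<epsilon> < 1" and s: "1/2 \<le> s"
  shows "2 * s - 1 \<le> scale_factor \<epsilon> s"
proof (cases "s = 1/2")
  case True
  then show ?thesis using scale_factor_bounds(1)[OF e s] by simp
next
  case False
  define a where "a = 2 * s - 1"
  have a: "a > 0" using False s by (simp add: a_def)
  have p: "0 < \<epsilon> powr a" "\<epsilon> powr a < 1" using e a powr_less_mono2[of a \<epsilon> 1] by auto
  have "scale_factor \<epsilon> s = (- a) / (\<epsilon> powr a - 1)" using False by (simp add: scale_factor_def a_def)
  also have "\<dots> = a / (1 - \<epsilon> powr a)" using p by (simp add: divide_simps) (simp add: algebra_simps)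
  also have "\<dots> \<ge> a / 1" using p a by (intro divide_left_mono) auto
  finally show ?thesis by (simp add: a_def)
qed

section \<open>Joint sequences of exponents and scales\<close>

locale scales =
  fixes s :: "nat \<Rightarrow> real" and \<epsilon> :: "nat \<Rightarrow> real" and s0 :: real
  assumes s: "\<And>j. 1/2 \<le> s j" "\<And>j. s j < 1" and s_lim: "s \<longlonglongrightarrow> s0" and s0: "1/2 \<le> s0" "s0 < 1"
    and e: "\<And>j. 0 < \<epsilon> j" "\<And>j. \<epsilon> j < 1" and e_lim: "\<epsilon> \<longlonglongrightarrow> 0"
begin

lemma inv_ln_lim: "(\<lambda>j. 1 / \<bar>ln (\<epsilon> j)\<bar>) \<longlonglongrightarrow> 0"
proof -
  have "filterlim \<epsilon> (at_right 0) sequentially" using e e_lim by (intro tendsto_imp_filterlim_at_right always_eventually allI)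
  moreover have "((\<lambda>x::real. 1 / \<bar>ln x\<bar>) \<longlongrightarrow> 0) (at_right 0)" by real_asymp
  ultimately show ?thesis by (rule filterlim_compose[rotated])
qed

lemma scale_pos: "0 < scale_factor (\<epsilon> j) (s j)" using scale_factor_bounds(1)[OF e s(1)] .

lemma scale_lim: "(\<lambda>j. scale_factor (\<epsilon> j) (s j)) \<longlonglongrightarrow> 2 * s0 - 1"
proof (rule tendsto_sandwich)
  show "\<forall>\<^sub>F j in sequentially. 2 * s j - 1 \<le> scale_factor (\<epsilon> j) (s j)" using scale_factor_ge[OF e s(1)] by simp
  show "\<forall>\<^sub>F j in sequentially. scale_factor (\<epsilon> j) (s j) \<le> (2 * s j - 1) + 1 / \<bar>ln (\<epsilon> j)\<bar>" using scale_factor_bounds(3)[OF e s(1)] by simp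
  show "(\<lambda>j. 2 * s j - 1) \<longlonglongrightarrow> 2 * s0 - 1" by (intro tendsto_intros s_lim)
  have "(\<lambda>j. 2 * s j - 1 + 1 / \<bar>ln (\<epsilon> j)\<bar>) \<longlonglongrightarrow> 2 * s0 - 1 + 0" by (intro tendsto_intros s_lim inv_ln_lim)
  then show "(\<lambda>j. 2 * s j - 1 + 1 / \<bar>ln (\<epsilon> j)\<bar>) \<longlonglongrightarrow> 2 * s0 - 1" by simp
qed

text \<open>This product multiplies the seminorm in the original variable. Pairs of points at a
  fixed positive distance, in particular the interaction of different jumps, therefore disappear in
  the limit for every \<open>s0\<close>.\<close>

lemma scale_pre_lim: "(\<lambda>j. scale_factor (\<epsilon> j) (s j) * \<epsilon> j powr (2 * s j - 1)) \<longlonglongrightarrow> 0"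
proof (rule tendsto_sandwich[OF _ _ tendsto_const inv_ln_lim])
  show "\<forall>\<^sub>F j in sequentially. 0 \<le> scale_factor (\<epsilon> j) (s j) * \<epsilon> j powr (2 * s j - 1)"
    using scale_pos by (simp add: less_imp_le)
  show "\<forall>\<^sub>F j in sequentially. scale_factor (\<epsilon> j) (s j) * \<epsilon> j powr (2 * s j - 1) \<le> 1 / \<bar>ln (\<epsilon> j)\<bar>"
    using scale_factor_bounds(4)[OF e s(1)] by simp
qed

text \<open>Up to a constant this is the measure on which a function of bounded energy can stay away
  from the wells; the bound \<open>\<epsilon> * \<bar>ln \<epsilon>\<bar>\<close> covers all
  exponents at once.\<close>

lemma eps_over_scale_lim: "(\<lambda>j. \<epsilon> j / scale_factor (\<epsilon> j) (s j)) \<longlonglongrightarrow> 0"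
proof -
  have "filterlim \<epsilon> (at_right 0) sequentially" using e e_lim by (intro tendsto_imp_filterlim_at_right always_eventually allI)
  moreover have "((\<lambda>x::real. x * \<bar>ln x\<bar>) \<longlongrightarrow> 0) (at_right 0)" by real_asymp
  ultimately have *: "(\<lambda>j. \<epsilon> j * \<bar>ln (\<epsilon> j)\<bar>) \<longlonglongrightarrow> 0" by (rule filterlim_compose[rotated])
  show ?thesis
  proof (rule tendsto_sandwich[OF _ _ tendsto_const *])
    show "\<forall>\<^sub>F j in sequentially. 0 \<le> \<epsilon> j / scale_factor (\<epsilon> j) (s j)"
      using scale_pos e by (simp add: less_imp_le)
    show "\<forall>\<^sub>F j in sequentially. \<epsilon> j / scale_factor (\<epsilon> j) (s j) \<le> \<epsilon> j * \<bar>ln (\<epsilon> j)\<bar>"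
    proof (intro always_eventually allI)
      fix j
      have ln: "\<bar>ln (\<epsilon> j)\<bar> > 0" using e[of j] by simp
      have "\<epsilon> j / scale_factor (\<epsilon> j) (s j) \<le> \<epsilon> j / (1 / \<bar>ln (\<epsilon> j)\<bar>)"
        using scale_factor_bounds(2)[OF e s(1), of j j] e[of j] ln scale_pos[of j] by (intro divide_left_mono mult_pos_pos) auto
      then show "\<epsilon> j / scale_factor (\<epsilon> j) (s j) \<le> \<epsilon> j * \<bar>ln (\<epsilon> j)\<bar>" by simp
    qed
  qed
qed

end

text \<open>Chebyshev's inequality for the potential term.\<close>

lemma conv_meas_bad_set:
  fixes v W :: "real \<Rightarrow> real"
  assumes v [measurable]: "v \<in> borel_measurable borel" and W [measurable]: "W \<in> borel_measurable borel"
    and gap: "\<And>z. \<eta> \<le> \<bar>z - 1\<bar> \<Longrightarrow> \<eta> \<le> \<bar>z + 1\<bar> \<Longrightarrow> c \<le> W z" and c: "c > 0" and A [measurable]: "A \<in> sets borel"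
  shows "ennreal c * emeasure lborel (A - ({x. \<bar>v x - 1\<bar> < \<eta>} \<union> {x. \<bar>v x + 1\<bar> < \<eta>})) \<le> (\<integral>\<^sup>+ t. ennreal (W (v t)) * indicator A t \<partial>lborel)"
proof -
  have [measurable]: "{x. \<bar>v x - 1\<bar> < \<eta>} \<in> sets borel" "{x. \<bar>v x + 1\<bar> < \<eta>} \<in> sets borel" by measurable
  have "ennreal c * emeasure lborel (A - ({x. \<bar>v x - 1\<bar> < \<eta>} \<union> {x. \<bar>v x + 1\<bar> < \<eta>})) = 
    (\<integral>\<^sup>+ t. ennreal c * indicator (A - ({x. \<bar>v x - 1\<bar> < \<eta>} \<union> {x. \<bar>v x + 1\<bar> < \<eta>})) t \<partial>lborel)"
    by (rule nn_integral_cmult_indicator[symmetric]) simp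
  also have "\<dots> \<le> (\<integral>\<^sup>+ t. ennreal (W (v t)) * indicator A t \<partial>lborel)"
  proof (rule nn_integral_mono)
    fix t
    have "c \<le> W (v t)" if "\<not> \<bar>v t - 1\<bar> < \<eta>" "\<not> \<bar>v t + 1\<bar> < \<eta>" using that by (intro gap) (simp_all add: not_less)
    then show "ennreal c * indicator (A - ({x. \<bar>v x - 1\<bar> < \<eta>} \<union> {x. \<bar>v x + 1\<bar> < \<eta>})) t \<le> ennreal (W (v t)) * indicator A t"
      by (auto simp: indicator_def intro: ennreal_leI)
  qed
  finally show ?thesis .
qed

lemma double_well_measurable: "double_well W \<Longrightarrow> W \<in> borel_measurable borel"
  unfolding double_well_def by (auto intro: borel_measurable_continuous_onI)

text \<open>Density intervals for the values \<open>1\<close> and \<open>-1\<close> of the limit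
  survive convergence in measure with defect \<open>2 * t\<close>. A function of energy below
  \<open>8\<close> leaves the neighbourhoods \<open>A\<close> and \<open>B\<close> of the wells only
  on measure \<open>\<rho> j\<close>, of order \<open>\<epsilon> j / l j\<close>, and
  \<open>integrated_lower_bound\<close> applies with \<open>g = (2 - 2 * t)\<^sup>2\<close>.\<close>

lemma (in scales) half_local_liminf:
  assumes half: "s0 = 1/2" and W: "double_well W"
    and u [measurable]: "u \<in> borel_measurable borel" and v [measurable]: "\<And>j. v j \<in> borel_measurable borel" and conv: "conv_meas v u"
    and pq: "{p<..<q} \<subseteq> {0<..<1}"
    and pos: "emeasure lborel ({x. u x = 1} \<inter> {p<..<q}) > 0" and neg: "emeasure lborel ({x. u x = -1} \<inter> {p<..<q}) > 0"
  shows "8 \<le> liminf (\<lambda>j. loc_energy W (s j) (\<epsilon> j) {p<..<q} (v j))"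
proof (unfold le_Liminf_iff, intro allI impI)
  fix y :: ennreal assume "y < 8"
  then obtain y' where y': "y = ennreal y'" "0 \<le> y'" by (cases y rule: ennreal_cases) auto
  then have "y' < 8" using \<open>y < 8\<close> by (metis ennreal_less_iff ennreal_numeral)
  have [measurable]: "W \<in> borel_measurable borel" using W by (rule double_well_measurable)
  \<comment> \<open>This is the bound that will come out for large \<open>j\<close>;
    \<open>t\<close> measures both the closeness to the wells and the density defect, and at
    \<open>t = 0\<close> the value is \<open>8\<close>.\<close>
  have "((\<lambda>t::real. 2 * (2 - 2 * t)\<^sup>2 * (1 - 8 * t)) \<longlongrightarrow> 2 * (2 - 2 * 0)\<^sup>2 * (1 - 8 * 0)) (at_right 0)" by (intro tendsto_intros)
  then have "\<forall>\<^sub>F t in at_right (0::real). 2 * (2 - 2 * t)\<^sup>2 * (1 - 8 * t) > y'"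
    using \<open>y' < 8\<close> by (intro order_tendstoD) auto
  moreover have "\<forall>\<^sub>F t in at_right (0::real). t < 1/8" by (intro order_tendstoD tendsto_intros) auto
  moreover have "\<forall>\<^sub>F t in at_right (0::real). t > 0" by (simp add: eventually_at_right_less)
  ultimately have "\<forall>\<^sub>F t in at_right (0::real). 2 * (2 - 2 * t)\<^sup>2 * (1 - 8 * t) > y' \<and> t < 1/8 \<and> t > 0" by eventually_elim auto
  then obtain t where t: "2 * (2 - 2 * t)\<^sup>2 * (1 - 8 * t) > y'" "0 < t" "t < 1/8"
    using eventually_happens'[OF trivial_limit_at_right_real] by blast
  obtain c1 d1 where J1: "p < c1" "c1 < d1" "d1 < q" "emeasure lborel ({c1<..<d1} - {x. u x = 1}) \<le> ennreal (t * (d1 - c1))"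
    using density_interval[OF _ pos t(2)] t(3) by auto
  obtain c2 d2 where J2: "p < c2" "c2 < d2" "d2 < q" "emeasure lborel ({c2<..<d2} - {x. u x = -1}) \<le> ennreal (t * (d2 - c2))"
    using density_interval[OF _ neg t(2)] t(3) by auto
  obtain c where c: "c > 0" "\<And>z. t \<le> \<bar>z - 1\<bar> \<Longrightarrow> t \<le> \<bar>z + 1\<bar> \<Longrightarrow> c \<le> W z"
    using double_well_gap[OF W t(2)] by metis
  define h0 where "h0 = min 1 (min (min ((d1 - c1) / 4) ((d2 - c2) / 4)) (min (q - d1) (q - d2)))"
  have h0: "0 < h0" "h0 \<le> 1" "h0 \<le> (d1 - c1) / 4" "h0 \<le> (d2 - c2) / 4" "h0 \<le> q - d1" "h0 \<le> q - d2"
  proof -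
    show "0 < h0" unfolding h0_def using J1(2,3) J2(2,3) by simp
    show "h0 \<le> 1" "h0 \<le> (d1 - c1) / 4" "h0 \<le> (d2 - c2) / 4" "h0 \<le> q - d1" "h0 \<le> q - d2" unfolding h0_def by linarith+
  qed
  \<comment> \<open>Chebyshev with energy at most \<open>8\<close> gives \<open>8 / c\<close>; the
    maximum with \<open>1\<close>, together with \<open>l j < 1\<close>, ensures
    \<open>\<epsilon> j \<le> \<rho> j\<close>.\<close>
  define K where "K = max 1 (8 / c)"
  define l where "l j = scale_factor (\<epsilon> j) (s j)" for j
  have l: "l j > 0" for j using scale_pos by (simp add: l_def)
  have llim: "l \<longlonglongrightarrow> 0" using scale_lim half by (simp add: l_def[abs_def])
  define \<rho> where "\<rho> j = K * (\<epsilon> j / l j)" for j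
  have "\<rho> \<longlonglongrightarrow> K * 0" unfolding \<rho>_def l_def by (intro tendsto_intros eps_over_scale_lim)
  then have ev1: "\<forall>\<^sub>F j in sequentially. \<rho> j < h0" using h0 by (intro order_tendstoD) auto
  have ev2: "\<forall>\<^sub>F j in sequentially. l j < 1" using llim by (intro order_tendstoD) auto
  have evm: "\<forall>\<^sub>F j in sequentially. emeasure lborel {x \<in> {0<..<1}. \<bar>v j x - u x\<bar> > t / 2} < ennreal (t * (d - c))" if "c < d" for c d :: real
  proof (rule order_tendstoD(2))
    show "(\<lambda>j. emeasure lborel {x \<in> {0<..<1}. \<bar>v j x - u x\<bar> > t / 2}) \<longlonglongrightarrow> 0"
      using conv half_gt_zero[OF t(2)] unfolding conv_meas_def by blast
  qed (use t that in simp)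
  \<comment> \<open>Since \<open>\<rho> j / \<epsilon> j = K / l j\<close>, the lower bound depends
    on the scale factor alone, here called \<open>x\<close>; the logarithm is harmless because
    \<open>x * ln (1 / x)\<close> tends to \<open>0\<close>.\<close>
  define \<phi> where "\<phi> x = 2 * (2 - 2 * t)\<^sup>2 * ((1 - 4 * (2 * t)) * (1 - x * (ln (K / x) + ln (1 / h0))) - x)" for x
  have K: "K > 0" by (simp add: K_def)
  have "((\<lambda>x. x * (ln (K / x) + ln (1 / h0))) \<longlongrightarrow> 0) (at_right 0)" using K by real_asymp
  then have "(\<phi> \<longlongrightarrow> 2 * (2 - 2 * t)\<^sup>2 * ((1 - 4 * (2 * t)) * (1 - 0) - 0)) (at_right 0)"
    unfolding \<phi>_def by (intro tendsto_intros) 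
  moreover have "filterlim l (at_right 0) sequentially" using l llim by (intro tendsto_imp_filterlim_at_right always_eventually allI)
  ultimately have "(\<lambda>j. \<phi> (l j)) \<longlonglongrightarrow> 2 * (2 - 2 * t)\<^sup>2 * ((1 - 4 * (2 * t)) * (1 - 0) - 0)" by (rule filterlim_compose)
  then have ev3: "\<forall>\<^sub>F j in sequentially. y' < \<phi> (l j)" using t(1) by (intro order_tendstoD) auto
  have dens: "emeasure lborel ({c<..<d} - {x. \<bar>v j x - z\<bar> < t}) \<le> ennreal (2 * t * (d - c))"
    if cd: "p < c" "c < d" "d < q" and em: "emeasure lborel ({c<..<d} - {x. u x = z}) \<le> ennreal (t * (d - c))" 
      and vm: "emeasure lborel {x \<in> {0<..<1}. \<bar>v j x - u x\<bar> > t / 2} < ennreal (t * (d - c))" for c d j z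
  proof -
    have "emeasure lborel ({c<..<d} - {x. \<bar>v j x - z\<bar> < t}) \<le> 
      emeasure lborel (({c<..<d} - {x. u x = z}) \<union> {x \<in> {0<..<1}. \<bar>v j x - u x\<bar> > t / 2})"
      using cd pq t by (intro emeasure_mono) (auto simp: subset_iff)
    also have "\<dots> \<le> emeasure lborel ({c<..<d} - {x. u x = z}) + emeasure lborel {x \<in> {0<..<1}. \<bar>v j x - u x\<bar> > t / 2}"
      by (rule emeasure_subadditive) measurable
    also have "\<dots> \<le> ennreal (t * (d - c)) + ennreal (t * (d - c))" using em vm by (intro add_mono) auto
    also have "\<dots> = ennreal (2 * t * (d - c))" using t cd by (subst ennreal_plus[symmetric]) auto
    finally show ?thesis .
  qed
  show "\<forall>\<^sub>F j in sequentially. y < loc_energy W (s j) (\<epsilon> j) {p<..<q} (v j)"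
    using ev1 ev2 ev3 evm[OF J1(2)] evm[OF J2(2)]
  proof eventually_elim
    case (elim j)
    define E where "E = loc_energy W (s j) (\<epsilon> j) {p<..<q} (v j)"
    define A where "A = {x. \<bar>v j x - 1\<bar> < t}"
    define B where "B = {x. \<bar>v j x - (- 1)\<bar> < t}"
    have [measurable]: "A \<in> sets borel" "B \<in> sets borel" unfolding A_def B_def by measurable
    show "y < loc_energy W (s j) (\<epsilon> j) {p<..<q} (v j)"
    \<comment> \<open>Only energies below \<open>8\<close> need an argument, and for these the
      potential term is controlled.\<close>
    proof (cases "8 \<le> E")
      case True
      then show ?thesis using \<open>y < 8\<close> by (simp add: E_def)
    next
      case False
      define X where "X = (\<integral>\<^sup>+ t. ennreal (W (v j t)) * indicator {p<..<q} t \<partial>lborel)"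
      define b where "b = emeasure lborel ({p<..<q} - (A \<union> B))"
      have Eeq: "E = ennreal (l j) * (ennreal (1 / \<epsilon> j) * X) + ennreal (l j) * (ennreal (\<epsilon> j powr (2 * s j - 1)) * gsq (s j) {p<..<q} (v j))"
        unfolding E_def loc_energy_def l_def X_def by (rule distrib_left)
      have bX: "ennreal c * b \<le> X"
        unfolding b_def X_def A_def B_def using c by (simp add: conv_meas_bad_set)
      have "ennreal (l j) * (ennreal (1 / \<epsilon> j) * (ennreal c * b)) \<le> ennreal (l j) * (ennreal (1 / \<epsilon> j) * X)"
        by (intro mult_left_mono bX) auto
      also have "\<dots> \<le> E" unfolding Eeq by simp
      also have "\<dots> \<le> 8" using False by simp
      finally have 1: "ennreal (l j) * (ennreal (1 / \<epsilon> j) * (ennreal c * b)) \<le> 8" .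
      have "b \<le> emeasure lborel {p<..<q}" unfolding b_def by (intro emeasure_mono) auto
      also have "\<dots> < \<infinity>" using J1 by (simp add: emeasure_lborel_Ioo)
      finally obtain b' where b': "b = ennreal b'" "0 \<le> b'" by (cases b rule: ennreal_cases) auto
      have "l j * (1 / \<epsilon> j * (c * b')) \<le> 8"
        using 1 l[of j] e(1)[of j] c b' by (simp add: ennreal_mult[symmetric] del: ennreal_numeral flip: ennreal_numeral)
      then have "b' \<le> (8 / c) * (\<epsilon> j / l j)" using l[of j] e(1)[of j] c by (simp add: field_simps)
      also have "\<dots> \<le> \<rho> j" unfolding \<rho>_def using l[of j] e(1)[of j] by (intro mult_right_mono) (auto simp: K_def)
      finally have bad: "emeasure lborel ({p<..<q} - (A \<union> B)) \<le> ennreal (\<rho> j)" using b' by (simp add: b_def ennreal_leI)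
      have "\<epsilon> j * 1 \<le> \<epsilon> j * (K / l j)" using e(1)[of j] elim(2) l[of j] by (intro mult_left_mono) (auto simp: K_def le_divide_eq)
      then have e\<rho>: "\<epsilon> j \<le> \<rho> j" by (simp add: \<rho>_def mult.commute)
      have "ennreal (2 * (2 - 2 * t)\<^sup>2 * ((1 - 4 * (2 * t)) * (1 - scale_factor (\<epsilon> j) (s j) * (ln (\<rho> j / \<epsilon> j) + ln (1 / h0))) - scale_factor (\<epsilon> j) (s j)))
        \<le> ennreal (scale_factor (\<epsilon> j) (s j)) * (ennreal (\<epsilon> j powr (2 * s j - 1)) * gsq (s j) {p<..<q} (v j))"
      proof (rule integrated_lower_bound[where A = A and B = B and ca = c1 and da = d1 and cb = c2 and db = d2])
        fix x z assume "x \<in> A" "z \<in> B"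
        then have "2 - 2 * t \<le> \<bar>v j x - v j z\<bar>" by (auto simp: A_def B_def)
        then have "(2 - 2 * t)\<^sup>2 \<le> \<bar>v j x - v j z\<bar>\<^sup>2" using t by (intro power_mono) auto
        then show "(2 - 2 * t)\<^sup>2 \<le> (v j x - v j z)\<^sup>2" by simp
      next
        show "emeasure lborel ({c1<..<d1} - A) \<le> ennreal (2 * t * (d1 - c1))"
          unfolding A_def by (rule dens) (use J1 elim in auto)
        show "emeasure lborel ({c2<..<d2} - B) \<le> ennreal (2 * t * (d2 - c2))"
          unfolding B_def by (rule dens) (use J2 elim in auto)
      qed (use bad e\<rho> elim h0 J1 J2 t e s in auto)
      also have "\<rho> j / \<epsilon> j = K / l j" using e(1)[of j] by (simp add: \<rho>_def)
      finally have "ennreal (\<phi> (l j)) \<le> ennreal (l j) * (ennreal (\<epsilon> j powr (2 * s j - 1)) * gsq (s j) {p<..<q} (v j))"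
        unfolding \<phi>_def l_def .
      also have "\<dots> \<le> E" unfolding Eeq by simp
      finally have "ennreal (\<phi> (l j)) \<le> E" .
      moreover have "y < ennreal (\<phi> (l j))" unfolding y' using elim(3) y' by (simp add: ennreal_less_iff)
      ultimately show ?thesis unfolding E_def by (rule less_le_trans[rotated])
    qed
  qed
qed

text \<open>If \<open>u\<close> keeps away from the wells on a set of positive measure, then
  eventually \<open>v j\<close> does so on at least half that measure, and the potential term alone
  is at least a constant times the scale factor over \<open>\<epsilon> j\<close>, which is
  unbounded.\<close>

lemma (in scales) liminf_not_pm1:
  assumes W: "double_well W"
    and u [measurable]: "u \<in> borel_measurable borel" and v [measurable]: "\<And>j. v j \<in> borel_measurable borel" and conv: "conv_meas v u"
    and not: "\<not> (AE x in lborel. x \<in> {0<..<1} \<longrightarrow> u x = 1 \<or> u x = -1)"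
  shows "liminf (\<lambda>j. loc_energy W (s j) (\<epsilon> j) {0<..<1} (v j)) = \<infinity>"
proof -
  have [measurable]: "W \<in> borel_measurable borel" using W by (rule double_well_measurable)
  \<comment> \<open>The radius will be \<open>2 * \<eta>\<close>, so that a value of
    \<open>v j\<close> within \<open>\<eta> / 2\<close> of \<open>u\<close> still keeps distance
    \<eta> from the wells.\<close>
  define B where "B n = {x \<in> {0<..<1}. 2 / real (Suc n) \<le> \<bar>u x - 1\<bar> \<and> 2 / real (Suc n) \<le> \<bar>u x + 1\<bar>}" for n
  have [measurable]: "B n \<in> sets borel" for n unfolding B_def by measurable
  obtain n where n: "emeasure lborel (B n) > 0"
  proof (rule ccontr)
    assume "\<not> thesis"
    then have "emeasure lborel (B n) = 0" for n using that[of n] by (auto simp: zero_less_iff_neq_zero)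
    then have "AE x in lborel. \<forall>n. x \<notin> B n"
      by (auto simp: AE_all_countable intro!: AE_not_in null_setsI)
    then have "AE x in lborel. x \<in> {0<..<1} \<longrightarrow> u x = 1 \<or> u x = -1"
    proof eventually_elim
      case (elim x)
      show ?case
      proof (rule ccontr)
        assume a: "\<not> (x \<in> {0<..<1} \<longrightarrow> u x = 1 \<or> u x = -1)"
        define r where "r = min \<bar>u x - 1\<bar> \<bar>u x + 1\<bar> / 2"
        have "r > 0" using a by (auto simp: r_def)
        then obtain m where "inverse (real (Suc m)) < r" using reals_Archimedean by blast
        then have "2 / real (Suc m) \<le> min \<bar>u x - 1\<bar> \<bar>u x + 1\<bar>" by (simp add: r_def inverse_eq_divide)
        then show False using elim a by (auto simp: B_def)
      qed
    qed
    then show False using not by simp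
  qed
  define \<eta> where "\<eta> = 1 / real (Suc n)"
  have \<eta>: "\<eta> > 0" by (simp add: \<eta>_def)
  obtain c where c: "c > 0" "\<And>z. \<eta> \<le> \<bar>z - 1\<bar> \<Longrightarrow> \<eta> \<le> \<bar>z + 1\<bar> \<Longrightarrow> c \<le> W z"
    using double_well_gap[OF W \<eta>] by metis
  have "emeasure lborel (B n) \<le> emeasure lborel {0<..<1::real}" by (intro emeasure_mono) (auto simp: B_def)
  then have "emeasure lborel (B n) < \<infinity>" by (auto intro: le_less_trans)
  then obtain m where m: "emeasure lborel (B n) = ennreal m" "m \<ge> 0" by (cases "emeasure lborel (B n)" rule: ennreal_cases) auto
  have m0: "m > 0" using n m by simp
  have ev: "\<forall>\<^sub>F j in sequentially. emeasure lborel {x \<in> {0<..<1}. \<bar>v j x - u x\<bar> > \<eta> / 2} < ennreal (m / 2)"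
  proof (rule order_tendstoD(2))
    show "(\<lambda>j. emeasure lborel {x \<in> {0<..<1}. \<bar>v j x - u x\<bar> > \<eta> / 2}) \<longlonglongrightarrow> 0"
      using conv half_gt_zero[OF \<eta>] unfolding conv_meas_def by blast
  qed (use m0 in simp)
  have bound: "\<forall>\<^sub>F j in sequentially. ennreal (scale_factor (\<epsilon> j) (s j) / \<epsilon> j * (c * (m / 2))) \<le> loc_energy W (s j) (\<epsilon> j) {0<..<1} (v j)"
    using ev
  proof eventually_elim
    case (elim j)
    define D where "D = {0<..<1} - ({x. \<bar>v j x - 1\<bar> < \<eta>} \<union> {x. \<bar>v j x + 1\<bar> < \<eta>})"
    have [measurable]: "D \<in> sets borel" unfolding D_def by measurable
    have "B n \<subseteq> D \<union> {x \<in> {0<..<1}. \<bar>v j x - u x\<bar> > \<eta> / 2}"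
    proof
      fix x assume "x \<in> B n"
      then have x: "x \<in> {0<..<1}" "2 * \<eta> \<le> \<bar>u x - 1\<bar>" "2 * \<eta> \<le> \<bar>u x + 1\<bar>" by (auto simp: B_def \<eta>_def)
      have "\<not> \<bar>v j x - 1\<bar> < \<eta> \<and> \<not> \<bar>v j x + 1\<bar> < \<eta>" if "\<not> \<bar>v j x - u x\<bar> > \<eta> / 2"
        using x that \<eta> by linarith
      then show "x \<in> D \<union> {x \<in> {0<..<1}. \<bar>v j x - u x\<bar> > \<eta> / 2}" using x(1) by (auto simp: D_def)
    qed
    then have "ennreal m \<le> emeasure lborel (D \<union> {x \<in> {0<..<1}. \<bar>v j x - u x\<bar> > \<eta> / 2})" unfolding m(1)[symmetric] by (intro emeasure_mono) auto
    also have "\<dots> \<le> emeasure lborel D + emeasure lborel {x \<in> {0<..<1}. \<bar>v j x - u x\<bar> > \<eta> / 2}" by (rule emeasure_subadditive) measurable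
    also have "\<dots> \<le> emeasure lborel D + ennreal (m / 2)" using elim by (intro add_left_mono) auto
    finally have "ennreal m - ennreal (m / 2) \<le> emeasure lborel D" by (simp add: ennreal_minus_le_iff add.commute)
    then have D: "ennreal (m / 2) \<le> emeasure lborel D" using m0 by (simp add: ennreal_minus)
    have "ennreal (scale_factor (\<epsilon> j) (s j) / \<epsilon> j * (c * (m / 2))) = ennreal (scale_factor (\<epsilon> j) (s j)) * (ennreal (1 / \<epsilon> j) * (ennreal c * ennreal (m / 2)))"
      using scale_pos[of j] e(1)[of j] c m0 by (simp add: ennreal_mult[symmetric] less_imp_le)
    also have "\<dots> \<le> ennreal (scale_factor (\<epsilon> j) (s j)) * (ennreal (1 / \<epsilon> j) * (\<integral>\<^sup>+ t. ennreal (W (v j t)) * indicator {0<..<1} t \<partial>lborel))"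
    proof (intro mult_left_mono)
      have "ennreal c * ennreal (m / 2) \<le> ennreal c * emeasure lborel D" by (intro mult_left_mono D) auto
      also have "\<dots> \<le> (\<integral>\<^sup>+ t. ennreal (W (v j t)) * indicator {0<..<1} t \<partial>lborel)"
        unfolding D_def using c by (intro conv_meas_bad_set) auto
      finally show "ennreal c * ennreal (m / 2) \<le> (\<integral>\<^sup>+ t. ennreal (W (v j t)) * indicator {0<..<1} t \<partial>lborel)" .
    qed auto
    also have "\<dots> \<le> loc_energy W (s j) (\<epsilon> j) {0<..<1} (v j)" unfolding loc_energy_def by (intro mult_left_mono) auto
    finally show ?case .
  qed
  have "filterlim (\<lambda>j. scale_factor (\<epsilon> j) (s j) / \<epsilon> j) at_top sequentially"
  proof -
    have "filterlim (\<lambda>j. inverse (\<epsilon> j / scale_factor (\<epsilon> j) (s j))) at_top sequentially"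
      using eps_over_scale_lim scale_pos e by (intro filterlim_inverse_at_top) auto
    then show ?thesis by simp
  qed
  then have at_top: "filterlim (\<lambda>j. scale_factor (\<epsilon> j) (s j) / \<epsilon> j * (c * (m / 2))) at_top sequentially"
    using c m0 by (intro filterlim_at_top_mult_tendsto_pos[OF tendsto_const]) auto
  have "\<infinity> \<le> liminf (\<lambda>j. loc_energy W (s j) (\<epsilon> j) {0<..<1} (v j))"
  proof (unfold le_Liminf_iff, intro allI impI)
    fix y :: ennreal assume "y < \<infinity>"
    then obtain y' where y': "y = ennreal y'" "0 \<le> y'" by (cases y rule: ennreal_cases) auto
    have "\<forall>\<^sub>F j in sequentially. y' < scale_factor (\<epsilon> j) (s j) / \<epsilon> j * (c * (m / 2))"
      using at_top by (simp add: filterlim_at_top_dense)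
    then show "\<forall>\<^sub>F j in sequentially. y < loc_energy W (s j) (\<epsilon> j) {0<..<1} (v j)"
      using bound
    proof eventually_elim
      case (elim j)
      have "y < ennreal (scale_factor (\<epsilon> j) (s j) / \<epsilon> j * (c * (m / 2)))" unfolding y' using elim(1) y' by (simp add: ennreal_less_iff)
      then show ?case using elim(2) by (rule less_le_trans)
    qed
  qed
  then show ?thesis by (simp add: top.extremum_unique)
qed

subsection \<open>Compactness of profiles\<close>

text \<open>The energy in the blown-up variable \<open>x / \<epsilon>\<close>, where both inner
  weights become \<open>1\<close>; on the whole line it is the functional minimised in
  \<open>m_const\<close>.\<close>

definition profile_en :: "(real \<Rightarrow> real) \<Rightarrow> real \<Rightarrow> real set \<Rightarrow> (real \<Rightarrow> real) \<Rightarrow> ennreal" where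
  "profile_en W s A u = (\<integral>\<^sup>+ t. ennreal (W (u t)) * indicator A t \<partial>lborel) + gsq s A u"

text \<open>Restricting to distances at most \<open>1\<close> allows a larger exponent to be
  replaced by a smaller one, so functions belonging to different \<open>s j\<close> share one
  modulus.\<close>

definition holder_on :: "real \<Rightarrow> real \<Rightarrow> real set \<Rightarrow> (real \<Rightarrow> real) \<Rightarrow> bool" where
  "holder_on H \<gamma> J u \<longleftrightarrow> (\<forall>x\<in>J. \<forall>y\<in>J. \<bar>x - y\<bar> \<le> 1 \<longrightarrow> \<bar>u x - u y\<bar> \<le> H * \<bar>x - y\<bar> powr \<gamma>)"

lemma holder_onD: "holder_on H \<gamma> J u \<Longrightarrow> x \<in> J \<Longrightarrow> y \<in> J \<Longrightarrow> \<bar>x - y\<bar> \<le> 1 \<Longrightarrow> \<bar>u x - u y\<bar> \<le> H * \<bar>x - y\<bar> powr \<gamma>"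
  unfolding holder_on_def by blast

lemma holder_small_radius:
  fixes H \<gamma> e :: real
  assumes H: "0 \<le> H" and \<gamma>: "0 < \<gamma>" and e: "0 < e"
  obtains t where "0 < t" "t < 1" "H * t powr \<gamma> < e"
proof -
  define t where "t = min (1/2) ((e / (H + 1)) powr (1 / \<gamma>))"
  have t: "0 < t" "t < 1" using H e by (auto simp: t_def)
  have "t powr \<gamma> \<le> ((e / (H + 1)) powr (1 / \<gamma>)) powr \<gamma>" using t \<gamma> by (intro powr_mono2) (auto simp: t_def)
  also have "\<dots> = e / (H + 1)" using \<gamma> H e by (simp add: powr_powr)
  finally have "H * t powr \<gamma> \<le> H * (e / (H + 1))" using H by (intro mult_left_mono) auto
  also have "\<dots> < e" using H e by (simp add: field_simps)
  finally show ?thesis using that t by blast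
qed

lemma nn_integral_superadd:
  fixes f :: "real \<Rightarrow> ennreal"
  assumes [measurable]: "f \<in> borel_measurable borel" and fin: "finite I"
    and [measurable]: "\<And>i. i \<in> I \<Longrightarrow> A i \<in> sets borel" and disj: "disjoint_family_on A I"
    and sub: "\<And>i. i \<in> I \<Longrightarrow> A i \<subseteq> B"
  shows "(\<Sum>i\<in>I. \<integral>\<^sup>+ t. f t * indicator (A i) t \<partial>lborel) \<le> (\<integral>\<^sup>+ t. f t * indicator B t \<partial>lborel)"
proof -
  have "(\<Sum>i\<in>I. \<integral>\<^sup>+ t. f t * indicator (A i) t \<partial>lborel) = (\<integral>\<^sup>+ t. (\<Sum>i\<in>I. f t * indicator (A i) t) \<partial>lborel)"
    by (subst nn_integral_sum) auto
  also have "\<dots> \<le> (\<integral>\<^sup>+ t. f t * indicator B t \<partial>lborel)"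
  proof (rule nn_integral_mono)
    fix t
    have "(\<Sum>i\<in>I. f t * indicator (A i) t) = f t * (\<Sum>i\<in>I. indicator (A i) t)" by (simp add: sum_distrib_left)
    also have "(\<Sum>i\<in>I. indicator (A i) t) = (indicator (\<Union>i\<in>I. A i) t :: ennreal)"
      by (rule indicator_UN_disjoint[OF fin disj, symmetric])
    also have "f t * indicator (\<Union>i\<in>I. A i) t \<le> f t * indicator B t"
      using sub by (auto simp: indicator_def)
    finally show "(\<Sum>i\<in>I. f t * indicator (A i) t) \<le> f t * indicator B t" .
  qed
  finally show ?thesis .
qed

lemma profile_en_superadd2:
  assumes [measurable]: "W \<in> borel_measurable borel" "u \<in> borel_measurable borel" "A \<in> sets borel" "B \<in> sets borel"
    and "A \<inter> B = {}" "A \<subseteq> C" "B \<subseteq> C"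
  shows "profile_en W s A u + profile_en W s B u \<le> profile_en W s C u"
proof -
  define F where "F b = (if b then A else B)" for b
  have F: "disjoint_family_on F UNIV" "\<And>b. F b \<subseteq> C" "\<And>b. F b \<in> sets borel"
    using assms by (auto simp: F_def disjoint_family_on_def)
  have "(\<Sum>b\<in>UNIV. \<integral>\<^sup>+ t. ennreal (W (u t)) * indicator (F b) t \<partial>lborel) \<le> (\<integral>\<^sup>+ t. ennreal (W (u t)) * indicator C t \<partial>lborel)"
    by (rule nn_integral_superadd) (use F in auto)
  moreover have "(\<Sum>b\<in>UNIV. gsq s (F b) u) \<le> gsq s C u"
    by (rule gsq_superadd) (use F in auto)
  ultimately have "((\<integral>\<^sup>+ t. ennreal (W (u t)) * indicator A t \<partial>lborel) + (\<integral>\<^sup>+ t. ennreal (W (u t)) * indicator B t \<partial>lborel)) + (gsq s A u + gsq s B u)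
    \<le> (\<integral>\<^sup>+ t. ennreal (W (u t)) * indicator C t \<partial>lborel) + gsq s C u"
    by (intro add_mono) (simp_all add: UNIV_bool F_def add.commute)
  moreover have eq: "(a + c) + (b + d) = (a + b) + (c + d)" for a b c d :: ennreal by (simp add: ac_simps)
  ultimately show ?thesis unfolding profile_en_def by (subst eq)
qed

lemma profile_en_mono_set: "A \<subseteq> B \<Longrightarrow> profile_en W s A u \<le> profile_en W s B u"
  unfolding profile_en_def by (intro add_mono gsq_mono_set nn_integral_mono) (auto simp: indicator_def)

lemma profile_en_shift:
  assumes [measurable]: "W \<in> borel_measurable borel" and u [measurable]: "u \<in> borel_measurable borel"
  shows "profile_en W s {a - t<..<b - t} (\<lambda>x. u (t + x)) = profile_en W s {a<..<b} u"
proof -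
  have v: "(\<lambda>x. t + 1 * x) -` {a<..<b} = {a - t<..<b - t}" by auto
  have "gsq s {a - t<..<b - t} (\<lambda>x. u (t + x)) = gsq s {a<..<b} u"
    using gsq_affine[OF u, of "{a<..<b}" 1 s t] unfolding v by simp
  moreover have "(\<integral>\<^sup>+ x. ennreal (W (u x)) * indicator {a<..<b} x \<partial>lborel) = 
     ennreal \<bar>1\<bar> * (\<integral>\<^sup>+ x. ennreal (W (u (t + 1 * x))) * indicator {a<..<b} (t + 1 * x) \<partial>lborel)"
    by (rule nn_integral_real_affine) simp_all
  moreover have "(\<integral>\<^sup>+ x. ennreal (W (u (t + 1 * x))) * indicator {a<..<b} (t + 1 * x) \<partial>lborel) = 
    (\<integral>\<^sup>+ x. ennreal (W (u (t + x))) * indicator {a - t<..<b - t} x \<partial>lborel)"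
    by (intro nn_integral_cong) (auto simp: indicator_def)
  ultimately show ?thesis unfolding profile_en_def by simp
qed

text \<open>Packed as a predicate because the same \<open>r\<close> and \<delta> must serve all
  functions with a given modulus. The interval lies on one side of the zero, so that it can be
  fitted into a prescribed domain.\<close>

definition zero_costs :: "(real \<Rightarrow> real) \<Rightarrow> real \<Rightarrow> real \<Rightarrow> real \<Rightarrow> real \<Rightarrow> bool" where
  "zero_costs W H \<gamma> r \<delta> \<longleftrightarrow> (\<forall>u J z a. holder_on H \<gamma> J u \<longrightarrow> z \<in> J \<longrightarrow> u z = 0 \<longrightarrow> {a<..<a + r} \<subseteq> J \<longrightarrow> a = z \<or> a = z - r \<longrightarrow>
      ennreal \<delta> \<le> (\<integral>\<^sup>+ t. ennreal (W (u t)) * indicator {a<..<a + r} t \<partial>lborel))"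

lemma zero_costsD:
  "zero_costs W H \<gamma> r \<delta> \<Longrightarrow> holder_on H \<gamma> J u \<Longrightarrow> z \<in> J \<Longrightarrow> u z = 0 \<Longrightarrow> {a<..<a + r} \<subseteq> J \<Longrightarrow> a = z \<or> a = z - r \<Longrightarrow>
    ennreal \<delta> \<le> (\<integral>\<^sup>+ t. ennreal (W (u t)) * indicator {a<..<a + r} t \<partial>lborel)"
  unfolding zero_costs_def by blast

text \<open>Within distance \<open>r\<close> of a zero the modulus keeps the values in
  \<open>{-1/2..1/2}\<close>, where \<open>W\<close> is at least some \<open>c > 0\<close>; hence
  \<open>\<delta> = c * r\<close>.\<close>

lemma zero_cost:
  assumes W: "double_well W" and H: "0 \<le> H" and \<gamma>: "0 < \<gamma>"
  obtains r \<delta> :: real where "0 < r" "r \<le> 1" "0 < \<delta>"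
    "zero_costs W H \<gamma> r \<delta>"
proof -
  obtain c where c: "c > 0" "\<And>z. 1/2 \<le> \<bar>z - 1\<bar> \<Longrightarrow> 1/2 \<le> \<bar>z + 1\<bar> \<Longrightarrow> c \<le> W z"
    using double_well_gap[OF W, of "1/2"] by auto
  obtain r where r': "0 < r" "r < 1" "H * r powr \<gamma> < 1 / 2" using holder_small_radius[OF H \<gamma>, of "1/2"] by auto
  then have r: "0 < r" "r \<le> 1" and Hr: "H * r powr \<gamma> \<le> 1 / 2" by auto
  show ?thesis
  proof (rule that[of r "c * r"])
    show "zero_costs W H \<gamma> r (c * r)" unfolding zero_costs_def
    proof (intro allI impI)
    fix u J z a assume A: "holder_on H \<gamma> J u" "z \<in> J" "u z = 0" "{a<..<a + r} \<subseteq> J" "a = z \<or> a = z - r"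
    have "ennreal (c * r) = (\<integral>\<^sup>+ t. ennreal c * indicator {a<..<a + r} t \<partial>lborel)"
      using c r by (simp add: nn_integral_cmult_indicator ennreal_mult)
    also have "\<dots> \<le> (\<integral>\<^sup>+ t. ennreal (W (u t)) * indicator {a<..<a + r} t \<partial>lborel)"
    proof (rule nn_integral_mono)
      fix t
      show "ennreal c * indicator {a<..<a + r} t \<le> ennreal (W (u t)) * indicator {a<..<a + r} t"
      proof (cases "t \<in> {a<..<a + r}")
        case True
        then have tz: "\<bar>t - z\<bar> \<le> r" "t \<in> J" using A by auto
        then have "\<bar>t - z\<bar> \<le> 1" using r by linarith
        then have "\<bar>u t - u z\<bar> \<le> H * \<bar>t - z\<bar> powr \<gamma>" by (rule holder_onD[OF A(1) tz(2) A(2)])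
        also have "\<dots> \<le> H * r powr \<gamma>" using tz H \<gamma> by (intro mult_left_mono powr_mono2) auto
        finally have "\<bar>u t\<bar> \<le> 1/2" using Hr A by simp
        then have "c \<le> W (u t)" by (intro c(2)) linarith+
        then show ?thesis using True by (simp add: ennreal_leI)
      qed simp
    qed
    finally show "ennreal (c * r) \<le> (\<integral>\<^sup>+ t. ennreal (W (u t)) * indicator {a<..<a + r} t \<partial>lborel)" .
    qed
  qed (use r c in auto)
qed

lemma ennreal_liminf_add_le:
  fixes a b :: "nat \<Rightarrow> ennreal"
  shows "liminf a + liminf b \<le> liminf (\<lambda>n. a n + b n)"
proof -
  have "liminf a + liminf b = (SUP n. (INF m\<in>{n..}. a m) + (INF m\<in>{n..}. b m))"
    unfolding liminf_SUP_INF
    by (subst ennreal_SUP_add) (auto intro!: incseq_SucI INF_superset_mono)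
  also have "\<dots> \<le> liminf (\<lambda>n. a n + b n)"
    unfolding liminf_SUP_INF by (intro SUP_mono) (auto intro!: exI INF_greatest add_mono INF_lower)
  finally show ?thesis .
qed

text \<open>Fatou's lemma with varying exponents and domains: every point belongs to the domains
  eventually, so the integrands converge pointwise.\<close>

lemma profile_en_fatou:
  assumes W: "continuous_on UNIV W" and s: "s \<longlonglongrightarrow> s0" 
    and u [measurable]: "\<And>j. u j \<in> borel_measurable borel" and v [measurable]: "v \<in> borel_measurable borel"
    and A [measurable]: "\<And>j. A j \<in> sets borel"
    and lim: "\<And>x. (\<lambda>j. u j x) \<longlonglongrightarrow> v x" and inA: "\<And>x. \<forall>\<^sub>F j in sequentially. x \<in> A j"
    and bound: "\<And>j. profile_en W (s j) (A j) (u j) \<le> B"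
  shows "profile_en W s0 UNIV v \<le> B"
proof -
  have [measurable]: "W \<in> borel_measurable borel" using W by (rule borel_measurable_continuous_onI)
  have "(\<integral>\<^sup>+ t. ennreal (W (v t)) * indicator UNIV t \<partial>lborel) = (\<integral>\<^sup>+ t. liminf (\<lambda>j. ennreal (W (u j t)) * indicator (A j) t) \<partial>lborel)"
  proof (rule nn_integral_cong)
    fix t
    have "(\<lambda>j. W (u j t)) \<longlonglongrightarrow> W (v t)" by (rule continuous_on_tendsto_compose[OF W lim]) auto
    then have "(\<lambda>j. ennreal (W (u j t))) \<longlonglongrightarrow> ennreal (W (v t))" by (rule tendsto_ennrealI)
    moreover have "\<forall>\<^sub>F j in sequentially. ennreal (W (u j t)) = ennreal (W (u j t)) * indicator (A j) t"
      using inA[of t] by eventually_elim simp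
    ultimately have "(\<lambda>j. ennreal (W (u j t)) * indicator (A j) t) \<longlonglongrightarrow> ennreal (W (v t))"
      by (rule Lim_transform_eventually)
    from lim_imp_Liminf[OF _ this] show "ennreal (W (v t)) * indicator UNIV t = liminf (\<lambda>j. ennreal (W (u j t)) * indicator (A j) t)"
      by simp
  qed
  also have "\<dots> \<le> liminf (\<lambda>j. \<integral>\<^sup>+ t. ennreal (W (u j t)) * indicator (A j) t \<partial>lborel)"
    by (rule nn_integral_liminf) measurable
  finally have 1: "(\<integral>\<^sup>+ t. ennreal (W (v t)) * indicator UNIV t \<partial>lborel) \<le> liminf (\<lambda>j. \<integral>\<^sup>+ t. ennreal (W (u j t)) * indicator (A j) t \<partial>lborel)" .
  have "gsq s0 UNIV v = (\<integral>\<^sup>+ x. \<integral>\<^sup>+ y. liminf (\<lambda>j. kern (s j) (u j) x y * indicator (A j) x * indicator (A j) y) \<partial>lborel \<partial>lborel)"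
    unfolding gsq_def
  proof (intro nn_integral_cong)
    fix x y
    have "(\<lambda>j. kern (s j) (u j) x y) \<longlonglongrightarrow> kern s0 v x y"
    proof (cases "x = y")
      case False
      then show ?thesis unfolding kern_def by (intro tendsto_ennrealI tendsto_intros lim s) auto
    qed (simp add: kern_def)
    moreover have "\<forall>\<^sub>F j in sequentially. kern (s j) (u j) x y = kern (s j) (u j) x y * indicator (A j) x * indicator (A j) y"
      using inA[of x] inA[of y] by eventually_elim simp
    ultimately have "(\<lambda>j. kern (s j) (u j) x y * indicator (A j) x * indicator (A j) y) \<longlonglongrightarrow> kern s0 v x y"
      by (rule Lim_transform_eventually)
    from lim_imp_Liminf[OF _ this] show "kern s0 v x y * indicator UNIV x * indicator UNIV y = liminf (\<lambda>j. kern (s j) (u j) x y * indicator (A j) x * indicator (A j) y)"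
      by simp
  qed
  also have "\<dots> \<le> (\<integral>\<^sup>+ x. liminf (\<lambda>j. \<integral>\<^sup>+ y. kern (s j) (u j) x y * indicator (A j) x * indicator (A j) y \<partial>lborel) \<partial>lborel)"
    by (intro nn_integral_mono nn_integral_liminf) measurable
  also have "\<dots> \<le> liminf (\<lambda>j. gsq (s j) (A j) (u j))"
    unfolding gsq_def by (rule nn_integral_liminf) measurable
  finally have 2: "gsq s0 UNIV v \<le> liminf (\<lambda>j. gsq (s j) (A j) (u j))" .
  have "profile_en W s0 UNIV v \<le> liminf (\<lambda>j. \<integral>\<^sup>+ t. ennreal (W (u j t)) * indicator (A j) t \<partial>lborel) + liminf (\<lambda>j. gsq (s j) (A j) (u j))"
    unfolding profile_en_def by (intro add_mono 1 2)
  also have "\<dots> \<le> liminf (\<lambda>j. profile_en W (s j) (A j) (u j))" unfolding profile_en_def by (rule ennreal_liminf_add_le)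
  also have "\<dots> \<le> B" by (rule Liminf_le) (use bound in auto)
  finally show ?thesis .
qed

lemma holder_on_subset: "holder_on H \<gamma> J u \<Longrightarrow> J' \<subseteq> J \<Longrightarrow> holder_on H \<gamma> J' u"
  unfolding holder_on_def by blast

lemma holder_on_continuous:
  assumes "holder_on H \<gamma> J u" "\<gamma> > 0" shows "continuous_on J u"
  unfolding continuous_on_def
proof
  fix x assume x: "x \<in> J"
  have "((\<lambda>y. H * \<bar>y - x\<bar> powr \<gamma>) \<longlongrightarrow> H * \<bar>x - x\<bar> powr \<gamma>) (at x within J)"
    using assms(2) by (intro tendsto_intros tendsto_powr') auto
  then have 0: "((\<lambda>y. H * \<bar>y - x\<bar> powr \<gamma>) \<longlongrightarrow> 0) (at x within J)" using assms(2) by simp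
  have "\<forall>\<^sub>F y in at x within J. dist y x < 1" by (auto simp: eventually_at intro: exI[of _ 1])
  moreover have "\<forall>\<^sub>F y in at x within J. y \<in> J" by (simp add: eventually_at_topological) (metis open_UNIV UNIV_I)
  ultimately have "\<forall>\<^sub>F y in at x within J. norm (u y - u x) \<le> H * \<bar>y - x\<bar> powr \<gamma>"
    by eventually_elim (use assms(1) x in \<open>auto simp: holder_on_def dist_real_def\<close>)
  from Lim_null_comparison[OF this 0] show "(u \<longlongrightarrow> u x) (at x within J)" by (simp add: LIM_zero_iff)
qed

text \<open>Since \<open>holder_on\<close> compares only points at distance at most
  \<open>1\<close>, a chain of short steps from \<open>0\<close> to \<open>x\<close> is used; the
  result is linear growth.\<close>

lemma holder_on_growth:
  assumes hol: "holder_on H \<gamma> J u" and J: "{min 0 x..max 0 x} \<subseteq> J" and H: "0 \<le> H" and \<gamma>: "\<gamma> > 0"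
  shows "\<bar>u x - u 0\<bar> \<le> H * (\<bar>x\<bar> + 1)"
proof -
  define n where "n = nat \<lceil>\<bar>x\<bar>\<rceil>"
  have n: "\<bar>x\<bar> \<le> real n" "real n \<le> \<bar>x\<bar> + 1" unfolding n_def by linarith+
  show ?thesis
  proof (cases "n = 0")
    case True
    then show ?thesis using n H by simp
  next
    case False
    define p where "p k = x * (real k / real n)" for k
    have pJ: "p k \<in> J" if "k \<le> n" for k
    proof -
      define c where "c = real k / real n"
      have c: "0 \<le> c" "c \<le> 1" using that False by (auto simp: c_def)
      have "x * c \<in> {min 0 x..max 0 x}"
      proof (cases "0 \<le> x")
        case True
        then show ?thesis using c mult_left_mono[OF c(2), of x] by simp
      next
        case False
        then show ?thesis using c mult_left_mono_neg[OF c(2), of x] mult_nonpos_nonneg[of x c] by simp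
      qed
      then have "p k \<in> {min 0 x..max 0 x}" by (simp add: p_def c_def)
      then show ?thesis using J by auto
    qed
    have "\<bar>u (p k) - u (p 0)\<bar> \<le> H * real k" if "k \<le> n" for k
      using that
    proof (induction k)
      case (Suc k)
      have d: "\<bar>p (Suc k) - p k\<bar> \<le> 1" unfolding p_def using n False
        by (simp add: right_diff_distrib[symmetric] diff_divide_distrib[symmetric] abs_mult)
      then have "\<bar>u (p (Suc k)) - u (p k)\<bar> \<le> H * \<bar>p (Suc k) - p k\<bar> powr \<gamma>"
        using hol pJ[of "Suc k"] pJ[of k] Suc.prems unfolding holder_on_def by auto
      also have "\<dots> \<le> H * 1" using d H \<gamma> powr_mono2[of \<gamma> "\<bar>p (Suc k) - p k\<bar>" 1] by (intro mult_left_mono) auto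
      finally show ?case using Suc by (simp add: algebra_simps)
    qed simp
    from this[of n] have "\<bar>u x - u 0\<bar> \<le> H * real n" using False by (simp add: p_def)
    also have "\<dots> \<le> H * (\<bar>x\<bar> + 1)" using n H by (intro mult_left_mono) auto
    finally show ?thesis .
  qed
qed

text \<open>The Arzela-Ascoli theorem on growing intervals: a diagonal subsequence converges on the
  rationals, and the common modulus carries the convergence to all reals and passes to the
  limit.\<close>

lemma holder_compactness:
  assumes hol: "\<And>j. holder_on H \<gamma> {- L j<..<L j} (u j)" and L: "filterlim L at_top sequentially"
    and zero: "\<And>j. u j 0 = 0" and H: "0 \<le> H" and \<gamma>: "\<gamma> > 0"
  obtains k :: "nat \<Rightarrow> nat" and v where "strict_mono k" "\<And>x. (\<lambda>j. u (k j) x) \<longlonglongrightarrow> v x" "holder_on H \<gamma> UNIV v"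
proof -
  \<comment> \<open>Divided by the linear growth bound and set to \<open>0\<close> outside the
    domain, the functions are bounded by \<open>1\<close> everywhere, as the extraction of a
    subsequence requires.\<close>
  define f where "f j x = (if \<bar>x\<bar> < L j then u j x / (H * (\<bar>x\<bar> + 1) + 1) else 0)" for j x
  have D: "H * (\<bar>x\<bar> + 1) + 1 > 0" for x using H by (intro add_nonneg_pos mult_nonneg_nonneg) auto
  have "norm (f j x) \<le> 1" for j x
  proof (cases "\<bar>x\<bar> < L j")
    case True
    then have "{min 0 x..max 0 x} \<subseteq> {- L j<..<L j}" by (auto simp: min_def max_def split: if_splits)
    then have "\<bar>u j x - u j 0\<bar> \<le> H * (\<bar>x\<bar> + 1)" by (intro holder_on_growth[OF hol _ H \<gamma>])
    then have "\<bar>u j x\<bar> \<le> H * (\<bar>x\<bar> + 1) + 1" using zero by simp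
    then show ?thesis using True D[of x] by (simp add: f_def)
  qed (simp add: f_def)
  then obtain k :: "nat \<Rightarrow> nat" where k: "strict_mono k" "\<And>x. x \<in> \<rat> \<Longrightarrow> \<exists>l. (\<lambda>n. f (k n) x) \<longlonglongrightarrow> l"
    using function_convergent_subsequence[of "\<rat> :: real set" f 1] by (metis countable_rat)
  have Lk: "\<forall>\<^sub>F n in sequentially. \<bar>x\<bar> < L (k n)" for x
    using filterlim_compose[OF L filterlim_subseq[OF k(1)]] by (simp add: filterlim_at_top_dense)
  have rat: "convergent (\<lambda>n. u (k n) q)" if "q \<in> \<rat>" for q
  proof -
    obtain l where l: "(\<lambda>n. f (k n) q) \<longlonglongrightarrow> l" using k(2)[OF \<open>q \<in> \<rat>\<close>] by blast
    then have "(\<lambda>n. f (k n) q * (H * (\<bar>q\<bar> + 1) + 1)) \<longlonglongrightarrow> l * (H * (\<bar>q\<bar> + 1) + 1)" by (intro tendsto_intros)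
    moreover have "\<forall>\<^sub>F n in sequentially. f (k n) q * (H * (\<bar>q\<bar> + 1) + 1) = u (k n) q"
      using Lk[of q] by eventually_elim (use D[of q] in \<open>simp add: f_def\<close>)
    ultimately have "(\<lambda>n. u (k n) q) \<longlonglongrightarrow> l * (H * (\<bar>q\<bar> + 1) + 1)" by (rule Lim_transform_eventually)
    then show ?thesis by (auto simp: convergent_def)
  qed
  have conv: "convergent (\<lambda>n. u (k n) x)" for x
  proof (rule Cauchy_convergent, rule metric_CauchyI)
    fix e :: real assume e: "e > 0"
    obtain t where t: "H * t powr \<gamma> < e / 3" "t < 1" "t > 0" using holder_small_radius[OF H \<gamma>, of "e / 3"] e by auto
    obtain q where q: "q \<in> \<rat>" "x < q" "q < x + t" using Rats_dense_in_real[of x "x + t"] t by auto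
    have "Cauchy (\<lambda>n. u (k n) q)" using rat[OF q(1)] by (simp add: Cauchy_convergent_iff)
    then obtain M1 where M1: "\<And>m n. M1 \<le> m \<Longrightarrow> M1 \<le> n \<Longrightarrow> dist (u (k m) q) (u (k n) q) < e / 3"
      using metric_CauchyD[of _ "e/3"] e by (metis zero_less_divide_iff zero_less_numeral)
    have "\<forall>\<^sub>F n in sequentially. \<bar>x\<bar> < L (k n) \<and> \<bar>q\<bar> < L (k n)" using Lk[of x] Lk[of q] by eventually_elim auto
    then obtain M2 where M2: "\<And>n. M2 \<le> n \<Longrightarrow> \<bar>x\<bar> < L (k n) \<and> \<bar>q\<bar> < L (k n)" by (auto simp: eventually_sequentially)
    have near: "\<bar>u (k n) x - u (k n) q\<bar> < e / 3" if "M2 \<le> n" for n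
    proof -
      have "\<bar>u (k n) x - u (k n) q\<bar> \<le> H * \<bar>x - q\<bar> powr \<gamma>"
        using M2[OF that] q t by (intro holder_onD[OF hol[of "k n"]]) auto
      also have "\<dots> \<le> H * t powr \<gamma>" using q H \<gamma> by (intro mult_left_mono powr_mono2) auto
      finally show ?thesis using t by simp
    qed
    show "\<exists>M. \<forall>m\<ge>M. \<forall>n\<ge>M. dist (u (k m) x) (u (k n) x) < e"
    proof (intro exI[of _ "max M1 M2"] allI impI)
      fix m n assume "max M1 M2 \<le> m" "max M1 M2 \<le> n"
      then have mn: "M1 \<le> m" "M2 \<le> m" "M1 \<le> n" "M2 \<le> n" by auto
      show "dist (u (k m) x) (u (k n) x) < e"
        using M1[OF mn(1,3)] near[OF mn(2)] near[OF mn(4)] unfolding dist_real_def by linarith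
    qed
  qed
  define v where "v x = lim (\<lambda>n. u (k n) x)" for x
  have v: "(\<lambda>n. u (k n) x) \<longlonglongrightarrow> v x" for x using conv[of x] by (simp add: v_def convergent_LIMSEQ_iff)
  have "holder_on H \<gamma> UNIV v" unfolding holder_on_def
  proof (intro ballI impI)
    fix x y :: real assume xy: "\<bar>x - y\<bar> \<le> 1"
    have "(\<lambda>n. \<bar>u (k n) x - u (k n) y\<bar>) \<longlonglongrightarrow> \<bar>v x - v y\<bar>" by (intro tendsto_intros v)
    moreover have "\<forall>\<^sub>F n in sequentially. \<bar>u (k n) x - u (k n) y\<bar> \<le> H * \<bar>x - y\<bar> powr \<gamma>"
      using Lk[of x] Lk[of y] by eventually_elim (use hol xy in \<open>auto simp: holder_on_def abs_less_iff\<close>)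
    ultimately show "\<bar>v x - v y\<bar> \<le> H * \<bar>x - y\<bar> powr \<gamma>" by (intro tendsto_upperbound) auto
  qed
  then show ?thesis using that k(1) v by blast
qed

lemma nn_integral_reflect:
  fixes f :: "real \<Rightarrow> ennreal"
  assumes [measurable]: "f \<in> borel_measurable borel"
  shows "(\<integral>\<^sup>+ x. f (- x) \<partial>lborel) = (\<integral>\<^sup>+ x. f x \<partial>lborel)"
  using nn_integral_real_affine[of f "-1" 0] by simp

section \<open>Behaviour of finite-energy functions at infinity\<close>

text \<open>If \<open>v\<close> has distance \<eta> from both wells at some point, the modulus keeps
  it at distance \<open>\<eta> / 2\<close> over a length \<open>r\<close>, which costs
  \<open>c * r\<close>; the tail of a convergent integral cannot pay for this.\<close>

lemma tail_near_wells:
  assumes W: "double_well W" and hol: "holder_on H \<gamma> UNIV v" and H: "0 \<le> H" and \<gamma>: "0 < \<gamma>"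
    and fin: "(\<integral>\<^sup>+ t. ennreal (W (v t)) \<partial>lborel) < \<infinity>" and \<eta>: "0 < \<eta>"
  obtains N where "\<And>t. N \<le> t \<Longrightarrow> \<bar>v t - 1\<bar> < \<eta> \<or> \<bar>v t + 1\<bar> < \<eta>"
proof -
  have [measurable]: "W \<in> borel_measurable borel" using W by (rule double_well_measurable)
  have [measurable]: "v \<in> borel_measurable borel" using holder_on_continuous[OF hol \<gamma>] by (rule borel_measurable_continuous_onI)
  obtain c where c: "c > 0" "\<And>z. \<eta> / 2 \<le> \<bar>z - 1\<bar> \<Longrightarrow> \<eta> / 2 \<le> \<bar>z + 1\<bar> \<Longrightarrow> c \<le> W z"
    using double_well_gap[OF W half_gt_zero[OF \<eta>]] by metis
  obtain r where r: "0 < r" "r < 1" "H * r powr \<gamma> < \<eta> / 2" using holder_small_radius[OF H \<gamma> half_gt_zero[OF \<eta>]] by metis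
  have "(\<lambda>n. \<integral>\<^sup>+ t. ennreal (W (v t)) * indicator {real n..} t \<partial>lborel) \<longlonglongrightarrow> (\<integral>\<^sup>+ t. 0 \<partial>(lborel :: real measure))"
  proof (rule nn_integral_dominated_convergence[where w = "\<lambda>t. ennreal (W (v t))"])
    show "AE t in lborel. (\<lambda>n. ennreal (W (v t)) * indicator {real n..} t) \<longlonglongrightarrow> 0"
    proof (intro AE_I2 tendsto_eventually)
      fix t :: real
      obtain n where "t < real n" using reals_Archimedean2 by blast
      then show "\<forall>\<^sub>F n in sequentially. ennreal (W (v t)) * indicator {real n..} t = 0"
        by (intro eventually_sequentiallyI[of n]) (auto simp: indicator_def)
    qed
  qed (use fin in \<open>auto simp: indicator_def\<close>)
  then have "(\<lambda>n. \<integral>\<^sup>+ t. ennreal (W (v t)) * indicator {real n..} t \<partial>lborel) \<longlonglongrightarrow> 0" by simp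
  then have "\<forall>\<^sub>F n in sequentially. (\<integral>\<^sup>+ t. ennreal (W (v t)) * indicator {real n..} t \<partial>lborel) < ennreal (c * r)"
    using c r by (intro order_tendstoD(2)) auto
  then obtain n where n: "(\<integral>\<^sup>+ t. ennreal (W (v t)) * indicator {real n..} t \<partial>lborel) < ennreal (c * r)"
    by (auto simp: eventually_sequentially)
  show ?thesis
  proof (rule that[of "real n"], rule ccontr)
    fix t assume t: "real n \<le> t" "\<not> (\<bar>v t - 1\<bar> < \<eta> \<or> \<bar>v t + 1\<bar> < \<eta>)"
    have "ennreal (c * r) = (\<integral>\<^sup>+ x. ennreal c * indicator {t<..<t + r} x \<partial>lborel)"
      using c r by (simp add: nn_integral_cmult_indicator ennreal_mult)
    also have "\<dots> \<le> (\<integral>\<^sup>+ t. ennreal (W (v t)) * indicator {real n..} t \<partial>lborel)"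
    proof (rule nn_integral_mono)
      fix x
      show "ennreal c * indicator {t<..<t + r} x \<le> ennreal (W (v x)) * indicator {real n..} x"
      proof (cases "x \<in> {t<..<t + r}")
        case True
        then have "\<bar>x - t\<bar> \<le> 1" "\<bar>x - t\<bar> \<le> r" using r by auto
        then have "\<bar>v x - v t\<bar> \<le> H * \<bar>x - t\<bar> powr \<gamma>" by (intro holder_onD[OF hol]) auto
        also have "\<dots> \<le> H * r powr \<gamma>" using True H \<gamma> by (intro mult_left_mono powr_mono2) auto
        finally have "c \<le> W (v x)" using r(3) t(2) by (intro c(2)) linarith+
        then show ?thesis using True t(1) by (simp add: ennreal_leI)
      qed simp
    qed
    finally show False using n by simp
  qed
qed

text \<open>Far out the values stay within \<open>1/2\<close> of a well, so there is no zero and by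
  continuity no change of well.\<close>

lemma finite_energy_limit_at_top:
  assumes W: "double_well W" and hol: "holder_on H \<gamma> UNIV v" and H: "0 \<le> H" and \<gamma>: "0 < \<gamma>"
    and fin: "(\<integral>\<^sup>+ t. ennreal (W (v t)) \<partial>lborel) < \<infinity>"
  shows "(v \<longlongrightarrow> 1) at_top \<or> (v \<longlongrightarrow> -1) at_top"
proof -
  note near = tail_near_wells[OF W hol H \<gamma> fin]
  have cont: "continuous_on UNIV v" by (rule holder_on_continuous[OF hol \<gamma>])
  obtain N where N: "\<And>t. N \<le> t \<Longrightarrow> \<bar>v t - 1\<bar> < 1/2 \<or> \<bar>v t + 1\<bar> < 1/2" using near[of "1/2"] by auto
  have *: "(v \<longlongrightarrow> \<sigma>) at_top" if \<sigma>: "\<sigma> = 1 \<or> \<sigma> = -1" and vN: "\<bar>v N - \<sigma>\<bar> < 1/2" for \<sigma>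
  proof -
    have nz: "v p \<noteq> 0" if "N \<le> p" for p using N[OF that] by auto
    have sgn: "0 < \<sigma> * v t" if tN: "N \<le> t" for t
    proof (rule ccontr)
      assume "\<not> 0 < \<sigma> * v t"
      then have neg: "\<sigma> * v t \<le> 0" by simp
      have c2: "continuous_on {N..t} (\<lambda>x. \<sigma> * v x)" by (intro continuous_intros continuous_on_subset[OF cont]) auto
      have "0 \<le> \<sigma> * v N" using \<sigma> vN by (elim disjE; simp; linarith)
      then obtain p where "N \<le> p" "p \<le> t" "\<sigma> * v p = 0"
        using IVT2'[of "\<lambda>x. \<sigma> * v x" t 0 N] neg tN c2 \<sigma> by auto
      then show False using nz[of p] \<sigma> by auto
    qed
    show ?thesis
    proof (rule tendstoI)
      fix e :: real assume "e > 0"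
      then have e': "0 < min e 1" by simp
      obtain M where M: "\<And>t. M \<le> t \<Longrightarrow> \<bar>v t - 1\<bar> < min e 1 \<or> \<bar>v t + 1\<bar> < min e 1" using near[OF e'] by metis
      show "\<forall>\<^sub>F t in at_top. dist (v t) \<sigma> < e"
        unfolding eventually_at_top_linorder
      proof (intro exI[of _ "max M N"] allI impI)
        fix t assume "max M N \<le> t"
        then show "dist (v t) \<sigma> < e" using M[of t] sgn[of t] \<sigma> by (auto simp: dist_real_def)
      qed
    qed
  qed
  show ?thesis using N[of N] *[of 1] *[of "-1"] by auto
qed

lemma finite_energy_limit_at_bot:
  assumes W: "double_well W" and hol: "holder_on H \<gamma> UNIV v" and H: "0 \<le> H" and \<gamma>: "0 < \<gamma>"
    and fin: "(\<integral>\<^sup>+ t. ennreal (W (v t)) \<partial>lborel) < \<infinity>"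
  shows "(v \<longlongrightarrow> 1) at_bot \<or> (v \<longlongrightarrow> -1) at_bot"
proof -
  have [measurable]: "W \<in> borel_measurable borel" using W by (rule double_well_measurable)
  have [measurable]: "v \<in> borel_measurable borel" using holder_on_continuous[OF hol \<gamma>] by (rule borel_measurable_continuous_onI)
  have "holder_on H \<gamma> UNIV (\<lambda>x. v (- x))"
    unfolding holder_on_def using holder_onD[OF hol, of "- _" "- _"] by (auto simp: abs_minus_commute)
  moreover have "(\<integral>\<^sup>+ t. ennreal (W (v (- t))) \<partial>lborel) < \<infinity>"
    using fin nn_integral_reflect[of "\<lambda>t. ennreal (W (v t))"] by simp
  ultimately have "((\<lambda>x. v (- x)) \<longlongrightarrow> 1) at_top \<or> ((\<lambda>x. v (- x)) \<longlongrightarrow> -1) at_top"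
    by (rule finite_energy_limit_at_top[OF W _ H \<gamma>])
  then show ?thesis unfolding filterlim_at_bot_mirror .
qed

lemma borel_measurable_lebesgue_on:
  assumes "u \<in> borel_measurable borel" shows "u \<in> borel_measurable (lebesgue_on A)"
  using assms by (intro measurable_restrict_space1 measurable_completion) simp

section \<open>Competitors of the optimal profile problem\<close>

text \<open>Local square integrability comes from boundedness of a continuous function on compact
  intervals, and the local seminorms are dominated by the global one; if that is infinite, the
  inequality is trivial.\<close>

lemma m_const_le_profile_en:
  assumes W: "double_well W" and cont: "continuous_on UNIV v" and lim: "(v \<longlongrightarrow> 1) at_top" "(v \<longlongrightarrow> -1) at_bot"
  shows "m_const W s \<le> profile_en W s UNIV v"
proof (cases "gsq s UNIV v < \<infinity>")
  case True
  have [measurable]: "W \<in> borel_measurable borel" using W by (rule double_well_measurable)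
  have v [measurable]: "v \<in> borel_measurable borel" using cont by (rule borel_measurable_continuous_onI)
  have "v \<in> H_loc s" unfolding H_loc_def H_space_def
  proof (safe, goal_cases)
    case 1 show ?case by (rule borel_measurable_lebesgue_on[OF v])
  next
    case (2 a b)
    have "compact (v ` {a..b})" by (intro compact_continuous_image continuous_on_subset[OF cont]) auto
    then obtain M where M: "\<And>x. x \<in> {a..b} \<Longrightarrow> \<bar>v x\<bar> \<le> M" using compact_imp_bounded bounded_real by (metis image_eqI)
    have "(\<integral>\<^sup>+ x. ennreal (\<bar>v x\<bar>\<^sup>2) \<partial>lebesgue_on {a<..<b}) = (\<integral>\<^sup>+ x. ennreal (\<bar>v x\<bar>\<^sup>2) * indicator {a<..<b} x \<partial>lborel)"
      by (rule nn_integral_lebesgue_on) simp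
    also have "\<dots> \<le> (\<integral>\<^sup>+ x. ennreal (M\<^sup>2) * indicator {a<..<b} x \<partial>lborel)"
    proof (rule nn_integral_mono)
      fix x
      have "\<bar>v x\<bar>\<^sup>2 \<le> M\<^sup>2" if "x \<in> {a<..<b}" using M[of x] that by (intro power_mono) auto
      then show "ennreal (\<bar>v x\<bar>\<^sup>2) * indicator {a<..<b} x \<le> ennreal (M\<^sup>2) * indicator {a<..<b} x"
        by (simp add: indicator_def ennreal_leI)
    qed
    also have "\<dots> < \<infinity>" using 2 by (simp add: nn_integral_cmult_indicator ennreal_mult_less_top)
    finally show ?case .
  next
    case (3 a b)
    have "gagliardo_sq s {a<..<b} v = gsq s {a<..<b} v" by (rule gagliardo_sq_eq) auto
    also have "\<dots> \<le> gsq s UNIV v" by (rule gsq_mono_set) simp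
    finally show ?case using True by (rule le_less_trans)
  qed
  moreover have "limits_pm1 v" unfolding limits_pm1_def using cont lim by (intro exI[of _ v]) auto
  ultimately have "m_const W s \<le> (\<integral>\<^sup>+ t. ennreal (W (v t)) \<partial>lebesgue) + gagliardo_sq s UNIV v"
    unfolding m_const_def by (intro INF_lower) auto
  also have "gagliardo_sq s UNIV v = gsq s UNIV v" by (rule gagliardo_sq_eq) auto
  also have "(\<integral>\<^sup>+ t. ennreal (W (v t)) \<partial>lebesgue) = (\<integral>\<^sup>+ t. ennreal (W (v t)) * indicator UNIV t \<partial>lborel)"
    by (simp add: nn_integral_completion)
  finally show ?thesis unfolding profile_en_def .
next
  case False
  then show ?thesis unfolding profile_en_def by (simp add: not_less top_unique)
qed

lemma m_const_less_profile_en: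
  assumes W: "double_well W" and y: "m_const W s < y"
  obtains v where "continuous_on UNIV v" "(v \<longlongrightarrow> 1) at_top" "(v \<longlongrightarrow> -1) at_bot" "profile_en W s UNIV v < y"
proof -
  obtain u where u: "u \<in> H_loc s" "limits_pm1 u" "(\<integral>\<^sup>+ t. ennreal (W (u t)) \<partial>lebesgue) + gagliardo_sq s UNIV u < y"
    using y unfolding m_const_def INF_less_iff by auto
  then obtain v where v: "continuous_on UNIV v" "AE x in lebesgue. u x = v x" "(v \<longlongrightarrow> 1) at_top" "(v \<longlongrightarrow> -1) at_bot"
    unfolding limits_pm1_def by auto
  have [measurable]: "v \<in> borel_measurable borel" using v(1) by (rule borel_measurable_continuous_onI)
  have ae: "AE x in lborel. u x = v x" using v(2) by (rule AE_lborel_of_lebesgue)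
  have "gagliardo_sq s UNIV u = gsq s UNIV v" using ae by (intro gagliardo_sq_eq) auto
  moreover have "(\<integral>\<^sup>+ t. ennreal (W (u t)) \<partial>lebesgue) = (\<integral>\<^sup>+ t. ennreal (W (v t)) * indicator UNIV t \<partial>lborel)"
    unfolding nn_integral_completion using ae by (intro nn_integral_cong_AE) auto
  ultimately show ?thesis using that v u(3) unfolding profile_en_def by auto
qed

text \<open>A competitor of energy below \<open>1\<close> has seminorm at most \<open>1\<close>,
  which fixes its modulus and thereby \<delta> in advance; having limits \<open>-1\<close> and
  \<open>1\<close> it vanishes somewhere and pays at least \<delta>.\<close>

lemma m_const_pos:
  assumes W: "double_well W" and s: "1/2 < s"
  shows "0 < m_const W s"
proof -
  have [measurable]: "W \<in> borel_measurable borel" using W by (rule double_well_measurable)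
  define H where "H = holder_const s * sqrt 1"
  have H: "0 \<le> H" using holder_const_pos[OF s] by (simp add: H_def)
  have \<gamma>: "0 < s - 1/2" using s by simp
  obtain r \<delta> where r: "0 < r" "r \<le> 1" "0 < \<delta>"
    and cost: "zero_costs W H (s - 1/2) r \<delta>"
    using zero_cost[OF W H \<gamma>] by blast
  have "min 1 (ennreal \<delta>) \<le> m_const W s"
  proof (rule ccontr)
    assume "\<not> min 1 (ennreal \<delta>) \<le> m_const W s"
    then have "m_const W s < min 1 (ennreal \<delta>)" by (simp only: not_le)
    then obtain v where v: "continuous_on UNIV v" "(v \<longlongrightarrow> 1) at_top" "(v \<longlongrightarrow> -1) at_bot" "profile_en W s UNIV v < min 1 (ennreal \<delta>)"
      by (rule m_const_less_profile_en[OF W])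
    have gg1: "gsq s A v \<le> ennreal 1" for A
    proof -
      have "gsq s A v \<le> gsq s UNIV v" by (rule gsq_mono_set) simp
      also have "\<dots> \<le> profile_en W s UNIV v" unfolding profile_en_def by simp
      also have "\<dots> \<le> 1" using v(4) by (auto intro: less_imp_le)
      finally show ?thesis by simp
    qed
    have hol: "holder_on H (s - 1/2) UNIV v" unfolding holder_on_def
    proof (intro ballI impI)
      fix x y :: real
      show "\<bar>v x - v y\<bar> \<le> H * \<bar>x - y\<bar> powr (s - 1/2)" unfolding H_def
        by (rule holder_continuous[where \<alpha> = "min x y - 1" and \<beta> = "max x y + 1", OF v(1) s gg1]) auto
    qed
    have "\<forall>\<^sub>F x in at_top. 0 < v x" using v(2) by (intro order_tendstoD) auto
    then obtain b where b: "\<And>x. b \<le> x \<Longrightarrow> 0 < v x" by (auto simp: eventually_at_top_linorder)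
    have "\<forall>\<^sub>F x in at_bot. v x < 0" using v(3) by (intro order_tendstoD) auto
    then obtain a where a: "\<And>x. x \<le> a \<Longrightarrow> v x < 0" by (auto simp: eventually_at_bot_linorder)
    have "a \<le> b" using a[of "max a b"] b[of "max a b"] by (cases "a \<le> b") force+
    then obtain z where z: "v z = 0"
      using IVT'[of v a 0 b] a[of a] b[of b] continuous_on_subset[OF v(1)] by (auto simp: less_imp_le)
    have "ennreal \<delta> \<le> (\<integral>\<^sup>+ t. ennreal (W (v t)) * indicator {z<..<z + r} t \<partial>lborel)"
      by (rule zero_costsD[OF cost hol _ z]) auto
    also have "\<dots> \<le> profile_en W s UNIV v" unfolding profile_en_def by (intro add_increasing2 nn_integral_mono) (auto simp: indicator_def)
    finally show False using v(4) by (meson leD less_le_trans min.cobounded2)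
  qed
  moreover have "0 < min 1 (ennreal \<delta>)" using r by simp
  ultimately show ?thesis by (rule less_le_trans[rotated])
qed

text \<open>Pointwise convergence suffices thanks to the common modulus: at finitely many net points
  the values eventually exceed \<open>1/4\<close>, and near a net point they vary by less than
  \<open>1/8\<close>.\<close>

lemma pointwise_holder_positive:
  assumes hol: "\<And>j::nat. holder_on H \<gamma> {- L j<..<L j} (u j)" and holv: "holder_on H \<gamma> UNIV v" and L: "filterlim L at_top sequentially"
    and lim: "\<And>x. (\<lambda>j. u j x) \<longlonglongrightarrow> v x" and H: "0 \<le> H" and \<gamma>: "0 < \<gamma>" and pos: "\<And>x. x \<in> {c..d} \<Longrightarrow> 1/2 \<le> v x"
  shows "\<forall>\<^sub>F j in sequentially. \<forall>x\<in>{c..d}. 0 < u j x"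
proof -
  obtain t where t: "0 < t" "t < 1" "H * t powr \<gamma> < 1/8" using holder_small_radius[OF H \<gamma>, of "1/8"] by auto
  obtain K where K: "finite K" "K \<subseteq> {c..d}" "{c..d} \<subseteq> (\<Union>x\<in>K. ball x t)"
    using seq_compact_imp_totally_bounded[OF compact_imp_seq_compact[OF compact_Icc[of c d]]] t(1) by metis
  have "\<forall>\<^sub>F j in sequentially. \<forall>p\<in>K. 1/4 < u j p"
  proof (intro eventually_ball_finite[OF K(1)] ballI)
    fix p assume "p \<in> K"
    then have "1/4 < v p" using pos[of p] K(2) by auto
    then show "\<forall>\<^sub>F j in sequentially. 1/4 < u j p" using lim by (intro order_tendstoD)
  qed
  moreover have "\<forall>\<^sub>F j in sequentially. max \<bar>c\<bar> \<bar>d\<bar> < L j" using L by (simp add: filterlim_at_top_dense eventually_conj_iff)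
  ultimately show ?thesis
  proof eventually_elim
    case (elim j)
    show ?case
    proof
      fix x assume x: "x \<in> {c..d}"
      then obtain p where p: "p \<in> K" "x \<in> ball p t" using K(3) by auto
      then have px: "\<bar>p - x\<bar> < t" by (simp add: dist_real_def)
      have pcd: "p \<in> {c..d}" using p K(2) by auto
      have "\<bar>u j p - u j x\<bar> \<le> H * \<bar>p - x\<bar> powr \<gamma>"
        using px t x pcd elim(2) by (intro holder_onD[OF hol[of j]]) auto
      also have "\<dots> \<le> H * t powr \<gamma>" using px H \<gamma> by (intro mult_left_mono powr_mono2) auto
      finally have "\<bar>u j p - u j x\<bar> < 1/8" using t(3) by simp
      moreover have "1/4 < u j p" using elim(1) p(1) by blast
      ultimately show "0 < u j x" by linarith
    qed
  qed
qed

text \<open>The zeros form a nonempty compact set; a nonpositive value to the right of its maximum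
  would force a further zero.\<close>

lemma last_zero:
  fixes u :: "real \<Rightarrow> real"
  assumes cont: "continuous_on {p..q} u" and pq: "p < q" and neg: "u p < 0" and pos: "0 < u q"
  obtains z where "p < z" "z < q" "u z = 0" "\<And>x. z < x \<Longrightarrow> x \<le> q \<Longrightarrow> 0 < u x"
proof -
  define Z where "Z = {x \<in> {p..q}. u x = 0}"
  have "closed Z" unfolding Z_def using continuous_closed_preimage_constant[OF cont] by simp
  then have "compact ({p..q} \<inter> Z)" by (intro compact_Int_closed) auto
  moreover have "{p..q} \<inter> Z = Z" by (auto simp: Z_def)
  ultimately have "compact Z" by simp
  moreover obtain z0 where "z0 \<in> Z" using IVT'[of u p 0 q] cont pq neg pos by (auto simp: Z_def less_imp_le)
  ultimately obtain z where z: "z \<in> Z" "\<And>x. x \<in> Z \<Longrightarrow> x \<le> z" using compact_attains_sup[of Z] by blast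
  show ?thesis
  proof (rule that[of z])
    have "z \<noteq> p" "z \<noteq> q" using z(1) neg pos by (auto simp: Z_def)
    then show "p < z" "z < q" "u z = 0" using z(1) by (auto simp: Z_def)
    fix x assume x: "z < x" "x \<le> q"
    show "0 < u x"
    proof (rule ccontr)
      assume "\<not> 0 < u x"
      moreover have "continuous_on {x..q} u" using cont z(1) x by (intro continuous_on_subset[OF cont]) (auto simp: Z_def)
      ultimately obtain y where "x \<le> y" "y \<le> q" "u y = 0" using IVT'[of u x 0 q] pos x by (auto simp: less_imp_le)
      then show False using z(1) z(2)[of y] x by (auto simp: Z_def)
    qed
  qed
qed

subsection \<open>Energy of a transition\<close>

text \<open>Centre the functions at their last zero and pass to a limit. If the limit goes from \<open>1\<close> to \<open>1\<close>,
  a transition must still occur further left, and splitting it off costs the fixed amount \<open>\<delta>\<close>;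
  hence the induction on the number of such amounts that the energy bound allows.\<close>

lemma transition_energy:
  fixes s a b L :: "nat \<Rightarrow> real" and u :: "nat \<Rightarrow> real \<Rightarrow> real"
  assumes W: "double_well W" and H: "0 \<le> H" and \<gamma>: "0 < \<gamma>" and r: "0 < r" and \<delta>: "0 < \<delta>"
    and cost: "zero_costs W H \<gamma> r \<delta>"
    and s: "s \<longlonglongrightarrow> s0" and u: "\<And>j. u j \<in> borel_measurable borel" and hol: "\<And>j. holder_on H \<gamma> {a j<..<b j} (u j)"
    and L: "\<And>j. 0 < L j" "filterlim L at_top sequentially"
    and neg: "\<And>j x. a j < x \<Longrightarrow> x \<le> a j + L j \<Longrightarrow> u j x < 0"
    and pos: "\<And>j x. b j - L j \<le> x \<Longrightarrow> x < b j \<Longrightarrow> 0 < u j x"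
    and sep: "\<And>j. a j + L j < b j - L j"
    and bound: "\<And>j. profile_en W (s j) {a j<..<b j} (u j) \<le> ennreal B" and B: "B \<le> real n * \<delta>"
  shows "m_const W s0 \<le> ennreal B"
  using s u hol L neg pos sep bound B
proof (induction n arbitrary: B s a b L u)
  case (0 B s a b L u)
  have "\<forall>\<^sub>F j in sequentially. r < L j" using 0(5) by (simp add: filterlim_at_top_dense)
  then obtain j where j: "r < L j" by (auto simp: eventually_sequentially)
  \<comment> \<open>With no portion \<delta> left the bound is \<open>B \<le> 0\<close>, but the
    sign change forces a zero whose cost is \<delta>, so this case is contradictory.\<close>
  obtain z where z: "a j + L j < z" "z < b j - L j" "u j z = 0"
  proof (rule last_zero[of "a j + L j" "b j - L j" "u j"])
    show "continuous_on {a j + L j..b j - L j} (u j)"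
      using 0(4)[of j] by (intro continuous_on_subset[OF holder_on_continuous[OF 0(3)[of j] \<gamma>]]) auto
  qed (use 0(4,6,7,8)[of j] in auto)
  have "ennreal \<delta> \<le> (\<integral>\<^sup>+ t. ennreal (W (u j t)) * indicator {z<..<z + r} t \<partial>lborel)"
    by (rule zero_costsD[OF cost 0(3)[of j] _ z(3)]) (use z j 0(4)[of j] in auto)
  also have "\<dots> \<le> profile_en W (s j) {a j<..<b j} (u j)" unfolding profile_en_def
    using z j 0(4)[of j] r by (intro add_increasing2 nn_integral_mono) (auto simp: indicator_def)
  also have "\<dots> \<le> ennreal B" by (rule 0(9))
  also have "\<dots> = 0" using 0(10) by (simp add: ennreal_neg)
  finally show ?case using \<delta> by simp
next
  case (Suc n B s a b L u)
  note s = Suc(2) and u [measurable] = Suc(3) and hol = Suc(4) and L = Suc(5,6) and neg = Suc(7) and pos = Suc(8)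
    and sep = Suc(9) and bound = Suc(10) and B = Suc(11)
  have Wm [measurable]: "W \<in> borel_measurable borel" using W by (rule double_well_measurable)
  have Wc: "continuous_on UNIV W" using W by (simp add: double_well_def)
  have "\<exists>z. a j + L j < z \<and> z < b j - L j \<and> u j z = 0 \<and> (\<forall>x. z < x \<longrightarrow> x < b j \<longrightarrow> 0 < u j x)" for j
  proof -
    have "continuous_on {a j + L j..b j - L j} (u j)"
      using L(1)[of j] by (intro continuous_on_subset[OF holder_on_continuous[OF hol[of j] \<gamma>]]) auto
    then obtain z where z: "a j + L j < z" "z < b j - L j" "u j z = 0" "\<And>x. z < x \<Longrightarrow> x \<le> b j - L j \<Longrightarrow> 0 < u j x"
      by (rule last_zero) (use L(1)[of j] sep[of j] neg[of j] pos[of j] in auto)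
    have "0 < u j x" if "z < x" "x < b j" for x using z(4)[of x] pos[of j x] that by (cases "x \<le> b j - L j") auto
    then show ?thesis using z by blast
  qed
  then obtain z where z: "\<And>j. a j + L j < z j" "\<And>j. z j < b j - L j" "\<And>j. u j (z j) = 0" "\<And>j x. z j < x \<Longrightarrow> x < b j \<Longrightarrow> 0 < u j x"
    by metis
  \<comment> \<open>Centring at a zero prevents the transition from escaping to infinity, and
    choosing the last zero makes the limit nonnegative on the right.\<close>
  define v where "v j x = u j (z j + x)" for j x
  have v [measurable]: "v j \<in> borel_measurable borel" for j unfolding v_def by measurable
  have holv: "holder_on H \<gamma> {- L j<..<L j} (v j)" for j
    unfolding holder_on_def v_def
  proof (intro ballI impI)
    fix x y assume "x \<in> {- L j<..<L j}" "y \<in> {- L j<..<L j}" "\<bar>x - y\<bar> \<le> 1"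
    then show "\<bar>u j (z j + x) - u j (z j + y)\<bar> \<le> H * \<bar>x - y\<bar> powr \<gamma>"
      using holder_onD[OF hol[of j], of "z j + x" "z j + y"] z(1,2)[of j] by auto
  qed
  have v0: "v j 0 = 0" for j using z(3) by (simp add: v_def)
  obtain k V where k: "strict_mono k" and V: "\<And>x. (\<lambda>j. v (k j) x) \<longlonglongrightarrow> V x" and holV: "holder_on H \<gamma> UNIV V"
    using holder_compactness[OF holv L(2) v0 H \<gamma>] by metis
  have Vc: "continuous_on UNIV V" by (rule holder_on_continuous[OF holV \<gamma>])
  have Lk: "filterlim (\<lambda>j. L (k j)) at_top sequentially" by (rule filterlim_compose[OF L(2) filterlim_subseq[OF k]])
  have sk: "(\<lambda>j. s (k j)) \<longlonglongrightarrow> s0" using LIMSEQ_subseq_LIMSEQ[OF s k] by (simp add: o_def)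
  \<comment> \<open>The zero has distance more than \<open>L j\<close> from both ends, so the
    shifted intervals exhaust the line and the energy bound passes to the limit.\<close>
  have EEV: "profile_en W s0 UNIV V \<le> ennreal B"
  proof (rule profile_en_fatou[OF Wc sk, where u = "\<lambda>j. v (k j)" and A = "\<lambda>j. {a (k j) - z (k j)<..<b (k j) - z (k j)}"])
    show "V \<in> borel_measurable borel" using Vc by (rule borel_measurable_continuous_onI)
    fix x :: real
    have "\<forall>\<^sub>F j in sequentially. \<bar>x\<bar> < L (k j)" using Lk by (simp add: filterlim_at_top_dense)
    then show "\<forall>\<^sub>F j in sequentially. x \<in> {a (k j) - z (k j)<..<b (k j) - z (k j)}"
    proof eventually_elim
      case (elim j)
      then show ?case using z(1,2)[of "k j"] by auto
    qed
  next
    fix j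
    show "profile_en W (s (k j)) {a (k j) - z (k j)<..<b (k j) - z (k j)} (v (k j)) \<le> ennreal B"
      unfolding v_def profile_en_shift[OF Wm u] by (rule bound)
  qed (use V in auto)
  have fin: "(\<integral>\<^sup>+ t. ennreal (W (V t)) \<partial>lborel) < \<infinity>"
  proof -
    have "(\<integral>\<^sup>+ t. ennreal (W (V t)) \<partial>lborel) \<le> profile_en W s0 UNIV V" unfolding profile_en_def by simp
    also have "\<dots> < \<infinity>" using EEV by (auto intro: le_less_trans)
    finally show ?thesis .
  qed
  have Vnn: "0 \<le> V x" if "0 < x" for x
  proof (rule tendsto_lowerbound[OF V])
    have "\<forall>\<^sub>F j in sequentially. x < L (k j)" using Lk by (simp add: filterlim_at_top_dense)
    then show "\<forall>\<^sub>F j in sequentially. 0 \<le> v (k j) x"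
    proof eventually_elim
      case (elim j)
      then show ?case using z(2)[of "k j"] z(4)[of "k j" "z (k j) + x"] that by (auto simp: v_def less_imp_le)
    qed
  qed simp
  have top: "(V \<longlongrightarrow> 1) at_top"
  proof -
    have "\<not> (V \<longlongrightarrow> -1) at_top"
    proof
      assume "(V \<longlongrightarrow> -1) at_top"
      then have "\<forall>\<^sub>F x in at_top. V x < 0" by (intro order_tendstoD) auto
      moreover have "\<forall>\<^sub>F x in at_top. (0::real) < x" by (rule eventually_gt_at_top)
      ultimately have "\<forall>\<^sub>F x::real in at_top. False" by eventually_elim (use Vnn in force)
      then show False by simp
    qed
    then show ?thesis using finite_energy_limit_at_top[OF W holV H \<gamma> fin] by blast
  qed
  from finite_energy_limit_at_bot[OF W holV H \<gamma> fin] show ?case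
  proof
    assume bot: "(V \<longlongrightarrow> -1) at_bot"
    have "m_const W s0 \<le> profile_en W s0 UNIV V" by (rule m_const_le_profile_en[OF W Vc top bot])
    also have "\<dots> \<le> ennreal B" by (rule EEV)
    finally show ?thesis .
  next
    assume "(V \<longlongrightarrow> 1) at_bot"
    then have "\<forall>\<^sub>F x in at_bot. 1/2 < V x" by (intro order_tendstoD) auto
    then obtain M0 where M0: "\<And>x. x \<le> M0 \<Longrightarrow> 1/2 < V x" by (auto simp: eventually_at_bot_linorder)
    define M where "M = max (- M0) 0"
    have M: "0 \<le> M" "\<And>x. x \<le> - M \<Longrightarrow> 1/2 \<le> V x" using M0 by (auto simp: M_def intro!: less_imp_le)
    \<comment> \<open>For every length \<open>i + 1\<close> some function with a large index is
      positive on a window of that length ending at \<open>- M\<close>; these windows become the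
      positive plateaus for the induction hypothesis.\<close>
    have "\<exists>j\<ge>i. (\<forall>x\<in>{- M - real (Suc i)..- M}. 0 < v j x) \<and> M + real (Suc i) + r < L j" for i
    proof -
      have "\<forall>\<^sub>F j in sequentially. \<forall>x\<in>{- M - real (Suc i)..- M}. 0 < v (k j) x"
        by (rule pointwise_holder_positive[OF holv holV Lk V H \<gamma>]) (use M in auto)
      moreover have "\<forall>\<^sub>F j in sequentially. M + real (Suc i) + r < L (k j)" using Lk by (simp add: filterlim_at_top_dense)
      moreover have "\<forall>\<^sub>F j in sequentially. i \<le> k j" using filterlim_subseq[OF k] by (simp add: filterlim_at_top)
      ultimately have "\<forall>\<^sub>F j in sequentially. i \<le> k j \<and> (\<forall>x\<in>{- M - real (Suc i)..- M}. 0 < v (k j) x) \<and> M + real (Suc i) + r < L (k j)"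
        by eventually_elim auto
      then obtain j where "i \<le> k j \<and> (\<forall>x\<in>{- M - real (Suc i)..- M}. 0 < v (k j) x) \<and> M + real (Suc i) + r < L (k j)"
        by (auto simp: eventually_sequentially)
      then show ?thesis by blast
    qed
    then obtain \<kappa> where \<kappa>: "\<And>i. i \<le> \<kappa> i" "\<And>i x. x \<in> {- M - real (Suc i)..- M} \<Longrightarrow> 0 < v (\<kappa> i) x" "\<And>i. M + real (Suc i) + r < L (\<kappa> i)"
      by metis
    have \<kappa>lim: "filterlim \<kappa> at_top sequentially"
      unfolding filterlim_at_top by (metis \<kappa>(1) eventually_sequentiallyI order_trans)
    have s\<kappa>: "(\<lambda>i. s (\<kappa> i)) \<longlonglongrightarrow> s0" by (rule filterlim_compose[OF s \<kappa>lim])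
    \<comment> \<open>The part left of \<open>z - M\<close> and the interval of length
      \<open>r\<close> to the right of the zero are disjoint, so superadditivity leaves at most
      \<open>B - \<delta>\<close> for the former.\<close>
    have split: "profile_en W (s (\<kappa> i)) {a (\<kappa> i)<..<z (\<kappa> i) - M} (u (\<kappa> i)) \<le> ennreal (B - \<delta>) \<and> \<delta> \<le> B" for i
    proof -
      define j where "j = \<kappa> i"
      have Lj: "r < L j" using \<kappa>(3)[of i] M by (simp add: j_def)
      have zb: "a j < z j" "z j + r < b j" using z(1,2)[of j] L(1)[of j] Lj by auto
      have "ennreal \<delta> \<le> (\<integral>\<^sup>+ t. ennreal (W (u j t)) * indicator {z j<..<z j + r} t \<partial>lborel)"
        by (rule zero_costsD[OF cost hol[of j] _ z(3)]) (use zb r in auto)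
      also have "\<dots> \<le> profile_en W (s j) {z j<..<z j + r} (u j)" unfolding profile_en_def by simp
      finally have 1: "ennreal \<delta> \<le> profile_en W (s j) {z j<..<z j + r} (u j)" .
      have "profile_en W (s j) {a j<..<z j - M} (u j) + profile_en W (s j) {z j<..<z j + r} (u j) \<le> profile_en W (s j) {a j<..<b j} (u j)"
        using zb r M by (intro profile_en_superadd2) auto
      then have sum: "profile_en W (s j) {a j<..<z j - M} (u j) + ennreal \<delta> \<le> ennreal B"
        using 1 bound[of j] by (meson add_left_mono order_trans)
      have "profile_en W (s j) {a j<..<z j - M} (u j) \<le> ennreal B"
        by (rule order_trans[OF _ sum]) simp
      then obtain e where e: "profile_en W (s j) {a j<..<z j - M} (u j) = ennreal e" "0 \<le> e"
        by (cases "profile_en W (s j) {a j<..<z j - M} (u j)" rule: ennreal_cases) (auto simp: top_unique)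
      have "ennreal (e + \<delta>) \<le> ennreal B" using sum e \<delta> by (simp add: ennreal_plus)
      then have "e + \<delta> \<le> B" using e \<delta> by (subst (asm) ennreal_le_iff2) auto
      then show ?thesis using e by (auto simp: j_def[symmetric] intro: ennreal_leI)
    qed
    have "m_const W s0 \<le> ennreal (B - \<delta>)"
    proof (rule Suc.IH[where L = "\<lambda>i. real (Suc i)", OF s\<kappa>])
      show "u (\<kappa> i) \<in> borel_measurable borel" for i by (rule u)
      show "holder_on H \<gamma> {a (\<kappa> i)<..<z (\<kappa> i) - M} (u (\<kappa> i))" for i
        by (rule holder_on_subset[OF hol]) (use z(2)[of "\<kappa> i"] L(1)[of "\<kappa> i"] M in auto)
      show "filterlim (\<lambda>i. real (Suc i)) at_top sequentially"
        by (rule filterlim_compose[OF filterlim_real_sequentially filterlim_Suc])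
      show "u (\<kappa> i) x < 0" if "a (\<kappa> i) < x" "x \<le> a (\<kappa> i) + real (Suc i)" for i x
        using neg[of "\<kappa> i" x] \<kappa>(3)[of i] that M r by auto
      show "0 < u (\<kappa> i) x" if "z (\<kappa> i) - M - real (Suc i) \<le> x" "x < z (\<kappa> i) - M" for i x
        using \<kappa>(2)[of "x - z (\<kappa> i)" i] that by (auto simp: v_def)
      \<comment> \<open>If the plateaus were not separated, the left end of the positive window
        would lie in the region where \<open>u\<close> is negative.\<close>
      show "a (\<kappa> i) + real (Suc i) < z (\<kappa> i) - M - real (Suc i)" for i
      proof (rule ccontr)
        assume c: "\<not> a (\<kappa> i) + real (Suc i) < z (\<kappa> i) - M - real (Suc i)"
        define x where "x = max (z (\<kappa> i) - M - real (Suc i)) (a (\<kappa> i) + L (\<kappa> i) - r / 2 - real (Suc i))"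
        have "a (\<kappa> i) < z (\<kappa> i) - M - real (Suc i)" using z(1)[of "\<kappa> i"] \<kappa>(3)[of i] r by linarith
        moreover have "z (\<kappa> i) - M - real (Suc i) \<le> a (\<kappa> i) + L (\<kappa> i)" using c \<kappa>(3)[of i] M r by linarith
        ultimately have "u (\<kappa> i) (z (\<kappa> i) - M - real (Suc i)) < 0" by (rule neg)
        moreover have "0 < u (\<kappa> i) (z (\<kappa> i) - M - real (Suc i))"
          using \<kappa>(2)[of "- M - real (Suc i)" i] by (simp add: v_def add_diff_eq)
        ultimately show False by simp
      qed
      show "B - \<delta> \<le> real n * \<delta>" using B by (simp add: algebra_simps)
    qed (use split in auto)
    also have "\<dots> \<le> ennreal B" using \<delta> by (intro ennreal_leI) simp
    finally show ?thesis .
  qed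
qed

text \<open>Divide the interval into cells of length \<open>L\<close>. A cell with a zero costs at
  least \<delta>, so there are at most \<open>B / \<delta>\<close> of them; if no zero-free cell had
  the wanted sign, the set in \<open>big\<close> would be covered, up to finitely many points, by
  these cells and the incomplete last one.\<close>

lemma constant_sign_cell:
  assumes cost: "zero_costs W H \<gamma> r \<delta>"
    and Wm [measurable]: "W \<in> borel_measurable borel" and u [measurable]: "u \<in> borel_measurable borel"
    and hol: "holder_on H \<gamma> {0<..<l} u" and \<gamma>: "0 < \<gamma>" and r: "0 < r" and \<delta>: "0 < \<delta>" and L: "2 * r \<le> L" and l: "0 < l" and B: "0 \<le> B"
    and en: "(\<integral>\<^sup>+ t. ennreal (W (u t)) * indicator {0<..<l} t \<partial>lborel) \<le> ennreal B"
    and \<sigma>: "\<sigma> = 1 \<or> \<sigma> = (-1::real)" and big: "ennreal (L * (B / \<delta> + 1)) < emeasure lborel {x \<in> {0<..<l}. \<sigma> * u x < 0}"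
  obtains i :: nat where "real (Suc i) * L \<le> l" "\<And>x. real i * L < x \<Longrightarrow> x < real (Suc i) * L \<Longrightarrow> \<sigma> * u x < 0"
proof (rule ccontr)
  assume "\<not> thesis"
  then have no: "\<And>i. real (Suc i) * L \<le> l \<Longrightarrow> \<exists>x. real i * L < x \<and> x < real (Suc i) * L \<and> \<not> \<sigma> * u x < 0" using that by blast
  have L0: "0 < L" using L r by simp
  define n where "n = nat \<lfloor>l / L\<rfloor>"
  have "0 \<le> l / L" using l L0 by simp
  then have n: "real n \<le> l / L" "l / L < real n + 1" unfolding n_def by linarith+
  have nL: "real n * L \<le> l" "l < real n * L + L" using n L0 by (auto simp: field_simps)
  define C where "C i = {real i * L<..<real (Suc i) * L}" for i
  have Cl: "C i \<subseteq> {0<..<l}" "real (Suc i) * L \<le> l" if "i < n" for i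
  proof -
    have "real (Suc i) * L \<le> real n * L" using that L0 by (intro mult_right_mono) auto
    then show "real (Suc i) * L \<le> l" using nL by linarith
    moreover have "0 \<le> real i * L" using L0 by simp
    ultimately show "C i \<subseteq> {0<..<l}" by (auto simp: C_def)
  qed
  define Z where "Z = {i. i < n \<and> (\<exists>z\<in>C i. u z = 0)}"
  have fZ: "finite Z" by (simp add: Z_def)
  have disj: "disjoint_family_on C Z"
    unfolding disjoint_family_on_def
  proof (intro ballI impI)
    fix i j :: nat assume ij: "i \<noteq> j"
    have *: "C i \<inter> C j = {}" if "i < j" for i j :: nat
    proof -
      have "real (Suc i) * L \<le> real j * L" using that L0 by (intro mult_right_mono) auto
      then show ?thesis by (auto simp: C_def)
    qed
    show "C i \<inter> C j = {}" using *[of i j] *[of j i] ij by (cases i j rule: linorder_cases) auto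
  qed
  have cell: "ennreal \<delta> \<le> (\<integral>\<^sup>+ t. ennreal (W (u t)) * indicator (C i) t \<partial>lborel)" if i: "i \<in> Z" for i
  proof -
    obtain z where z: "z \<in> C i" "u z = 0" using i by (auto simp: Z_def)
    have "i < n" using i by (simp add: Z_def)
    \<comment> \<open>The interval of length \<open>r\<close> is put to the right of the zero if it
      fits there and to the left otherwise; \<open>2 * r \<le> L\<close> guarantees that one side
      works.\<close>
    define a where "a = (if z + r \<le> real (Suc i) * L then z else z - r)"
    have "real (Suc i) * L = real i * L + L" by (simp add: algebra_simps)
    then have sub: "{a<..<a + r} \<subseteq> C i" using z L r by (auto simp: a_def C_def split: if_splits)
    have "ennreal \<delta> \<le> (\<integral>\<^sup>+ t. ennreal (W (u t)) * indicator {a<..<a + r} t \<partial>lborel)"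
      by (rule zero_costsD[OF cost hol _ z(2)]) (use z Cl(1)[OF \<open>i < n\<close>] sub in \<open>auto simp: a_def\<close>)
    also have "\<dots> \<le> (\<integral>\<^sup>+ t. ennreal (W (u t)) * indicator (C i) t \<partial>lborel)"
      using sub by (intro nn_integral_mono) (auto simp: indicator_def)
    finally show ?thesis .
  qed
  have "ennreal (real (card Z) * \<delta>) = (\<Sum>i\<in>Z. ennreal \<delta>)" using \<delta> by (simp add: ennreal_mult ennreal_of_nat_eq_real_of_nat)
  also have "\<dots> \<le> (\<Sum>i\<in>Z. \<integral>\<^sup>+ t. ennreal (W (u t)) * indicator (C i) t \<partial>lborel)" by (intro sum_mono cell)
  also have "\<dots> \<le> (\<integral>\<^sup>+ t. ennreal (W (u t)) * indicator {0<..<l} t \<partial>lborel)"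
  proof (rule nn_integral_superadd[OF _ fZ _ disj])
    show "C i \<subseteq> {0<..<l}" if "i \<in> Z" for i using that by (intro Cl) (simp add: Z_def)
  qed (auto simp: C_def)
  also have "\<dots> \<le> ennreal B" by (rule en)
  finally have cZ: "real (card Z) \<le> B / \<delta>" using \<delta> B by (simp add: ennreal_le_iff pos_le_divide_eq)
  have cont: "continuous_on {0<..<l} u" by (rule holder_on_continuous[OF hol \<gamma>])
  have sub: "{x \<in> {0<..<l}. \<sigma> * u x < 0} \<subseteq> ((\<Union>i\<in>Z. C i) \<union> (\<lambda>i. real i * L) ` {..n}) \<union> {real n * L<..<real n * L + L}"
  proof
    fix x assume x: "x \<in> {x \<in> {0<..<l}. \<sigma> * u x < 0}"
    then have xl: "0 < x" "x < l" "\<sigma> * u x < 0" by auto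
    define i where "i = nat \<lfloor>x / L\<rfloor>"
    have "0 \<le> x / L" using xl L0 by simp
    then have i: "real i \<le> x / L" "x / L < real i + 1" unfolding i_def by linarith+
    then have iL: "real i * L \<le> x" "x < real (Suc i) * L" using L0 by (auto simp: field_simps)
    show "x \<in> ((\<Union>i\<in>Z. C i) \<union> (\<lambda>i. real i * L) ` {..n}) \<union> {real n * L<..<real n * L + L}"
    proof (cases "real i * L = x")
      case True
      have "real i * L < (real n + 1) * L" using True xl nL by (simp add: algebra_simps)
      then have "i \<le> n" using L0 by (simp add: mult_less_cancel_right)
      then show ?thesis using True by auto
    next
      case False
      then have xC: "x \<in> C i" using iL by (simp add: C_def)
      show ?thesis
      proof (cases "i < n")
        case True
        have ivl: "is_interval (C i)" by (simp add: C_def is_interval_1)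
        have "i \<in> Z"
        proof (rule ccontr)
          assume nZ: "i \<notin> Z"
          then have nz: "\<And>y. y \<in> C i \<Longrightarrow> u y \<noteq> 0" using True by (auto simp: Z_def)
          obtain y where y: "y \<in> C i" "\<not> \<sigma> * u y < 0" using no[OF Cl(2)[OF True]] by (auto simp: C_def)
          have subC: "{min x y..max x y} \<subseteq> C i" using xC y(1) by (auto simp: C_def min_def max_def split: if_splits)
          then have c: "continuous_on {min x y..max x y} (\<lambda>t. \<sigma> * u t)"
            using Cl(1)[OF True] by (intro continuous_intros continuous_on_subset[OF cont]) (rule order_trans)
          have "\<exists>t\<in>{min x y..max x y}. \<sigma> * u t = 0"
          proof (cases "x \<le> y")
            case True
            then show ?thesis using IVT'[of "\<lambda>t. \<sigma> * u t" x 0 y] c xl y by auto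
          next
            case False
            then show ?thesis using IVT2'[of "\<lambda>t. \<sigma> * u t" x 0 y] c xl y by auto
          qed
          then obtain t where "t \<in> C i" "u t = 0" using \<sigma> subC by auto
          then show False using nz by blast
        qed
        then show ?thesis using xC by blast
      next
        case False
        then have "real n * L \<le> real i * L" using L0 by (intro mult_right_mono) auto
        then have "real n * L < x" using iL \<open>real i * L \<noteq> x\<close> by linarith
        then show ?thesis using xl nL by auto
      qed
    qed
  qed
  have [measurable]: "(\<Union>i\<in>Z. C i) \<in> sets borel" "(\<lambda>i. real i * L) ` {..n} \<in> sets borel"
    by (auto simp: C_def intro!: borel_open borel_closed finite_imp_closed)
  have "emeasure lborel {x \<in> {0<..<l}. \<sigma> * u x < 0} \<le> emeasure lborel (((\<Union>i\<in>Z. C i) \<union> (\<lambda>i. real i * L) ` {..n}) \<union> {real n * L<..<real n * L + L})"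
    by (intro emeasure_mono sub) simp
  also have "\<dots> \<le> (emeasure lborel (\<Union>i\<in>Z. C i) + emeasure lborel ((\<lambda>i. real i * L) ` {..n})) + emeasure lborel {real n * L<..<real n * L + L}"
    by (intro order_trans[OF emeasure_subadditive] add_right_mono) simp_all
  also have "emeasure lborel ((\<lambda>i. real i * L) ` {..n}) = 0" by (intro finite_imp_null_set_lborel[THEN null_setsD1]) auto
  also have "emeasure lborel {real n * L<..<real n * L + L} = ennreal L" using L0 by simp
  also have "emeasure lborel (\<Union>i\<in>Z. C i) \<le> (\<Sum>i\<in>Z. emeasure lborel (C i))"
    by (rule emeasure_subadditive_finite[OF fZ]) (auto simp: C_def)
  also have "(\<Sum>i\<in>Z. emeasure lborel (C i)) = (\<Sum>i\<in>Z. ennreal L)"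
    using L0 by (intro sum.cong) (auto simp: C_def algebra_simps)
  also have "(\<Sum>i\<in>Z. ennreal L) + 0 + ennreal L = ennreal (real (card Z) * L + L)"
    using L0 by (simp add: ennreal_mult ennreal_plus ennreal_of_nat_eq_real_of_nat)
  also have "\<dots> \<le> ennreal (L * (B / \<delta> + 1))"
  proof (rule ennreal_leI)
    have "real (card Z) * L \<le> B / \<delta> * L" using cZ L0 by (intro mult_right_mono) auto
    then show "real (card Z) * L + L \<le> L * (B / \<delta> + 1)" by (simp add: algebra_simps)
  qed
  finally show False using big by (simp add: add_right_mono)
qed

section \<open>Blow-up and the cost of a jump above the critical exponent\<close>

lemma profile_en_cong_AE:
  assumes "AE x in lborel. x \<in> A \<longrightarrow> u x = v x"
  shows "profile_en W s A u = profile_en W s A v"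
proof -
  have "(\<integral>\<^sup>+ t. ennreal (W (u t)) * indicator A t \<partial>lborel) = (\<integral>\<^sup>+ t. ennreal (W (v t)) * indicator A t \<partial>lborel)"
    using assms by (intro nn_integral_cong_AE) (auto elim!: eventually_mono simp: indicator_def)
  then show ?thesis unfolding profile_en_def gsq_cong_AE[OF assms] by simp
qed

lemma profile_en_reflect:
  assumes [measurable]: "W \<in> borel_measurable borel" and u [measurable]: "u \<in> borel_measurable borel"
  shows "profile_en W s {- b<..<- a} (\<lambda>x. u (- x)) = profile_en W s {a<..<b} u"
proof -
  have v: "(\<lambda>x. 0 + (- 1) * x) -` {a<..<b} = {- b<..<- a}" by auto
  have "gsq s {- b<..<- a} (\<lambda>x. u (- x)) = gsq s {a<..<b} u"
    using gsq_affine[OF u, of "{a<..<b}" "-1" s 0] unfolding v by simp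
  moreover have "(\<integral>\<^sup>+ x. ennreal (W (u (- x))) * indicator {- b<..<- a} x \<partial>lborel) = (\<integral>\<^sup>+ x. ennreal (W (u x)) * indicator {a<..<b} x \<partial>lborel)"
    using nn_integral_reflect[of "\<lambda>x. ennreal (W (u x)) * indicator {a<..<b} x"]
    by (simp add: indicator_def minus_less_iff less_minus_iff conj_commute)
  ultimately show ?thesis unfolding profile_en_def by simp
qed

lemma nn_integral_rescale:
  fixes f :: "real \<Rightarrow> ennreal"
  assumes [measurable]: "f \<in> borel_measurable borel" and c: "c > 0"
  shows "(\<integral>\<^sup>+ x. f (t + c * x) \<partial>lborel) = ennreal (1 / c) * (\<integral>\<^sup>+ x. f x \<partial>lborel)"
proof -
  have "ennreal (1 / c) * (\<integral>\<^sup>+ x. f x \<partial>lborel) = (ennreal (1 / c) * ennreal \<bar>c\<bar>) * (\<integral>\<^sup>+ x. f (t + c * x) \<partial>lborel)"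
    using c by (subst nn_integral_real_affine[of f c t]) (auto simp: mult.assoc)
  also have "ennreal (1 / c) * ennreal \<bar>c\<bar> = 1" using c by (subst ennreal_mult[symmetric]) auto
  finally show ?thesis by simp
qed

lemma affine_mem_ivl:
  fixes e :: real
  assumes "0 < e" shows "p + e * x \<in> {p<..<q} \<longleftrightarrow> x \<in> {0<..<(q - p) / e}"
proof -
  have "p + e * x < q \<longleftrightarrow> x < (q - p) / e" using assms by (simp add: pos_less_divide_eq mult.commute less_diff_eq add.commute)
  moreover have "p < p + e * x \<longleftrightarrow> 0 < x" using assms by (simp add: zero_less_mult_iff)
  ultimately show ?thesis by simp
qed

text \<open>The weights \<open>1 / \<epsilon>\<close> and \<open>\<epsilon> powr (2 * s - 1)\<close>
  are exactly the Jacobian and the factor of \<open>gsq_affine\<close>, so only the scale factor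
  remains.\<close>

lemma loc_energy_rescale:
  assumes [measurable]: "W \<in> borel_measurable borel" and u [measurable]: "u \<in> borel_measurable borel" and e: "0 < \<epsilon>"
  shows "loc_energy W s \<epsilon> {p<..<q} u = ennreal (scale_factor \<epsilon> s) * profile_en W s {0<..<(q - p) / \<epsilon>} (\<lambda>x. u (p + \<epsilon> * x))"
proof -
  have v: "(\<lambda>x. p + \<epsilon> * x) -` {p<..<q} = {0<..<(q - p) / \<epsilon>}" using affine_mem_ivl[OF e] by blast
  have "gsq s {0<..<(q - p) / \<epsilon>} (\<lambda>x. u (p + \<epsilon> * x)) = ennreal (\<epsilon> powr (2 * s - 1)) * gsq s {p<..<q} u"
    using gsq_affine[OF u, of "{p<..<q}" \<epsilon> s p] e unfolding v by simp
  moreover have "(\<integral>\<^sup>+ x. ennreal (W (u (p + \<epsilon> * x))) * indicator {0<..<(q - p) / \<epsilon>} x \<partial>lborel) = 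
    ennreal (1 / \<epsilon>) * (\<integral>\<^sup>+ x. ennreal (W (u x)) * indicator {p<..<q} x \<partial>lborel)"
    unfolding v[symmetric] by (subst nn_integral_rescale[OF _ e, symmetric, where t = p]) (auto simp: indicator_vimage)
  ultimately show ?thesis unfolding loc_energy_def profile_en_def by simp
qed

lemma holder_const_mono:
  assumes "1/2 < s" "s \<le> s'" shows "holder_const s' \<le> holder_const s"
proof -
  have "2 powr (1/2 - s') \<le> 2 powr (1/2 - s)" using assms by (intro powr_mono) auto
  moreover have "1/2 < s'" using assms by simp
  then have "2 powr (1/2 - s') < (1::real)" by (simp add: powr_less_one)
  moreover have "2 powr (1/2 - s) < (1::real)" using assms by (simp add: powr_less_one)
  ultimately have A: "0 < 1 - 2 powr (1/2 - s')" "0 < 1 - 2 powr (1/2 - s :: real)" "1 - 2 powr (1/2 - s :: real) \<le> 1 - 2 powr (1/2 - s')" by simp_all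
  show ?thesis unfolding holder_const_def by (rule divide_left_mono[OF A(3) _ mult_pos_pos[OF A(1,2)]]) simp
qed

text \<open>The Hoelder constant decreases in the exponent and only distances up to \<open>1\<close>
  count, so \<open>s\<close> can be lowered to a common \<open>s1\<close> still above
  \<open>1/2\<close>.\<close>

lemma finite_energy_holder:
  assumes u [measurable]: "u \<in> borel_measurable borel" and s: "1/2 < s1" "s1 \<le> s" and B: "0 \<le> B" and en: "profile_en W s {\<alpha><..<\<beta>} u \<le> ennreal B"
  obtains v where "v \<in> borel_measurable borel" "holder_on (holder_const s1 * sqrt B) (s1 - 1/2) {\<alpha><..<\<beta>} v"
    "AE x in lborel. x \<in> {\<alpha><..<\<beta>} \<longrightarrow> u x = v x"
proof -
  have s': "1/2 < s" using s by simp
  have "gsq s {\<alpha><..<\<beta>} u \<le> profile_en W s {\<alpha><..<\<beta>} u" unfolding profile_en_def by simp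
  also note en
  finally have gsq: "gsq s {\<alpha><..<\<beta>} u \<le> ennreal B" .
  show ?thesis
  proof (rule holder_representative[OF u s' gsq B])
  fix v assume v: "v \<in> borel_measurable borel"
    "\<And>x y. x \<in> {\<alpha><..<\<beta>} \<Longrightarrow> y \<in> {\<alpha><..<\<beta>} \<Longrightarrow> \<bar>v x - v y\<bar> \<le> holder_const s * sqrt B * \<bar>x - y\<bar> powr (s - 1/2)"
    "AE x in lborel. x \<in> {\<alpha><..<\<beta>} \<longrightarrow> u x = v x"
  have "holder_on (holder_const s1 * sqrt B) (s1 - 1/2) {\<alpha><..<\<beta>} v"
    unfolding holder_on_def
  proof (intro ballI impI)
    fix x y assume xy: "x \<in> {\<alpha><..<\<beta>}" "y \<in> {\<alpha><..<\<beta>}" "\<bar>x - y\<bar> \<le> 1"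
    have "\<bar>v x - v y\<bar> \<le> holder_const s * sqrt B * \<bar>x - y\<bar> powr (s - 1/2)" using v(2) xy by blast
    also have "\<dots> \<le> holder_const s1 * sqrt B * \<bar>x - y\<bar> powr (s1 - 1/2)"
    proof (rule mult_mono)
      show "\<bar>x - y\<bar> powr (s - 1/2) \<le> \<bar>x - y\<bar> powr (s1 - 1/2)" using xy(3) s by (intro powr_mono') auto
      show "holder_const s * sqrt B \<le> holder_const s1 * sqrt B" using B by (intro mult_right_mono holder_const_mono s) simp
      show "0 \<le> holder_const s1 * sqrt B" using B holder_const_pos[OF s(1)] by (intro mult_nonneg_nonneg) simp_all
    qed simp
    finally show "\<bar>v x - v y\<bar> \<le> holder_const s1 * sqrt B * \<bar>x - y\<bar> powr (s1 - 1/2)" .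
  qed
  then show ?thesis using v(1,3) by (intro that[of v])
  qed
qed

text \<open>A long zero-free cell on which the function is negative and one on which it is positive bound a transition
  interval; when their order is wrong, the reflected function has a transition.\<close>

lemma transition_interval:
  assumes W: "double_well W" and cost: "zero_costs W H \<gamma> r \<delta>"
    and u [measurable]: "u \<in> borel_measurable borel" and hol: "holder_on H \<gamma> {0<..<l} u" 
    and \<gamma>: "0 < \<gamma>" and r: "0 < r" and \<delta>: "0 < \<delta>" and L: "2 * r \<le> L" and l: "0 < l" and B: "0 \<le> B"
    and en: "profile_en W s {0<..<l} u \<le> ennreal B"
    and neg: "ennreal (L * (B / \<delta> + 1)) < emeasure lborel {x \<in> {0<..<l}. u x < 0}"
    and pos: "ennreal (L * (B / \<delta> + 1)) < emeasure lborel {x \<in> {0<..<l}. 0 < u x}"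
  obtains a b w where "w \<in> borel_measurable borel" "holder_on H \<gamma> {a<..<b} w" "profile_en W s {a<..<b} w \<le> ennreal B"
    "\<And>x. a < x \<Longrightarrow> x \<le> a + L / 2 \<Longrightarrow> w x < 0" "\<And>x. b - L / 2 \<le> x \<Longrightarrow> x < b \<Longrightarrow> 0 < w x" "a + L / 2 < b - L / 2"
proof -
  have Wm [measurable]: "W \<in> borel_measurable borel" using W by (rule double_well_measurable)
  have L0: "0 < L" using L r by simp
  have "(\<integral>\<^sup>+ t. ennreal (W (u t)) * indicator {0<..<l} t \<partial>lborel) \<le> profile_en W s {0<..<l} u" unfolding profile_en_def by simp
  also note en
  finally have enW: "(\<integral>\<^sup>+ t. ennreal (W (u t)) * indicator {0<..<l} t \<partial>lborel) \<le> ennreal B" .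
  obtain i where i: "real (Suc i) * L \<le> l" "\<And>x. real i * L < x \<Longrightarrow> x < real (Suc i) * L \<Longrightarrow> u x < 0"
    using constant_sign_cell[where \<sigma> = 1, OF cost Wm u hol \<gamma> r \<delta> L l B enW] neg by auto
  obtain k where k: "real (Suc k) * L \<le> l" "\<And>x. real k * L < x \<Longrightarrow> x < real (Suc k) * L \<Longrightarrow> 0 < u x"
    using constant_sign_cell[where \<sigma> = "-1", OF cost Wm u hol \<gamma> r \<delta> L l B enW] pos by auto
  have Suc: "real (Suc j) * L = real j * L + L" for j by (simp add: algebra_simps)
  have iL: "0 \<le> real i * L" "0 \<le> real k * L" using L0 by auto
  have "i \<noteq> k" using i(2)[of "real i * L + L / 2"] k(2)[of "real i * L + L / 2"] L0 unfolding Suc by auto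
  then consider "i < k" | "k < i" by linarith
  then show ?thesis
  proof cases
    case 1
    then have "real (Suc i) * L \<le> real k * L" using L0 by (intro mult_right_mono) auto
    then have ik: "real i * L + L \<le> real k * L" unfolding Suc .
    show ?thesis
    proof (rule that[of u "real i * L" "real k * L + L"])
      have sub: "{real i * L<..<real k * L + L} \<subseteq> {0<..<l}" using iL k(1) unfolding Suc by auto
      show "holder_on H \<gamma> {real i * L<..<real k * L + L} u" by (rule holder_on_subset[OF hol sub])
      show "profile_en W s {real i * L<..<real k * L + L} u \<le> ennreal B" by (rule order_trans[OF profile_en_mono_set[OF sub] en])
      show "u x < 0" if "real i * L < x" "x \<le> real i * L + L / 2" for x using i(2)[of x] that L0 unfolding Suc by auto
      show "0 < u x" if "real k * L + L - L / 2 \<le> x" "x < real k * L + L" for x using k(2)[of x] that L0 unfolding Suc by auto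
      show "real i * L + L / 2 < real k * L + L - L / 2" using ik L0 by linarith
    qed (rule u)
  next
    case 2
    then have "real (Suc k) * L \<le> real i * L" using L0 by (intro mult_right_mono) auto
    then have ik: "real k * L + L \<le> real i * L" unfolding Suc .
    show ?thesis
    proof (rule that[of "\<lambda>x. u (- x)" "- (real i * L + L)" "- (real k * L)"])
      have sub: "{real k * L<..<real i * L + L} \<subseteq> {0<..<l}" using iL i(1) unfolding Suc by auto
      show "holder_on H \<gamma> {- (real i * L + L)<..<- (real k * L)} (\<lambda>x. u (- x))"
        unfolding holder_on_def
      proof (intro ballI impI)
        fix x y assume xy: "x \<in> {- (real i * L + L)<..<- (real k * L)}" "y \<in> {- (real i * L + L)<..<- (real k * L)}" "\<bar>x - y\<bar> \<le> 1"
        then have "- x \<in> {real k * L<..<real i * L + L}" "- y \<in> {real k * L<..<real i * L + L}" by auto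
        then have "- x \<in> {0<..<l}" "- y \<in> {0<..<l}" using sub by blast+
        moreover have eq: "\<bar>- x - - y\<bar> = \<bar>x - y\<bar>" by simp
        ultimately show "\<bar>u (- x) - u (- y)\<bar> \<le> H * \<bar>x - y\<bar> powr \<gamma>" using holder_onD[OF hol, of "- x" "- y"] xy(3) unfolding eq by blast
      qed
      show "profile_en W s {- (real i * L + L)<..<- (real k * L)} (\<lambda>x. u (- x)) \<le> ennreal B"
        unfolding profile_en_reflect[OF Wm u] by (rule order_trans[OF profile_en_mono_set[OF sub] en])
      show "u (- x) < 0" if "- (real i * L + L) < x" "x \<le> - (real i * L + L) + L / 2" for x using i(2)[of "- x"] that L0 unfolding Suc by auto
      show "0 < u (- x)" if "- (real k * L) - L / 2 \<le> x" "x < - (real k * L)" for x using k(2)[of "- x"] that L0 unfolding Suc by auto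
      show "- (real i * L + L) + L / 2 < - (real k * L) - L / 2" using ik L0 by linarith
    qed measurable
  qed
qed

lemma emeasure_rescale:
  assumes [measurable]: "S \<in> sets borel" and c: "c > 0"
  shows "emeasure lborel {x::real. p + c * x \<in> S} = ennreal (1 / c) * emeasure lborel S"
proof -
  have "(\<lambda>x. p + c * x) -` S \<in> sets borel" by (rule measurable_sets_borel[OF _ assms(1)]) simp
  then have "{x. p + c * x \<in> S} \<in> sets lborel" by (simp only: sets_lborel vimage_def)
  then have "emeasure lborel {x. p + c * x \<in> S} = (\<integral>\<^sup>+ x. indicator {x. p + c * x \<in> S} x \<partial>lborel)"
    by (rule nn_integral_indicator[symmetric])
  also have "\<dots> = (\<integral>\<^sup>+ x. indicator S (p + c * x) \<partial>lborel)"
    by (intro nn_integral_cong) (simp add: indicator_def)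
  also have "\<dots> = ennreal (1 / c) * (\<integral>\<^sup>+ x. indicator S x \<partial>lborel)"
    by (rule nn_integral_rescale[OF _ c]) measurable
  finally show ?thesis by simp
qed

text \<open>After blow-up the bound \<open>y\<close> becomes a bound \<open>B\<close> on the energy
  without scale factor, because that factor tends to \<open>2 * s0 - 1\<close>. Both signs occupy a
  fixed proportion of the long interval, which yields transition intervals with ever longer plateaus
  for \<open>transition_energy\<close>.\<close>

lemma (in scales) bounded_energy_m_const:
  assumes sup: "1/2 < s0" and W: "double_well W"
    and u [measurable]: "u \<in> borel_measurable borel" and v [measurable]: "\<And>j. v j \<in> borel_measurable borel" and conv: "conv_meas v u"
    and pq: "{p<..<q} \<subseteq> {0<..<1}"
    and pos: "emeasure lborel ({x. u x = 1} \<inter> {p<..<q}) > 0" and neg: "emeasure lborel ({x. u x = -1} \<inter> {p<..<q}) > 0"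
    and bound: "\<And>j. loc_energy W (s j) (\<epsilon> j) {p<..<q} (v j) \<le> ennreal y" and y: "0 \<le> y" and B: "y / (2 * s0 - 1) < B"
  shows "m_const W s0 \<le> ennreal B"
proof -
  have Wm [measurable]: "W \<in> borel_measurable borel" using W by (rule double_well_measurable)
  have "0 \<le> y / (2 * s0 - 1)" using y sup by (intro divide_nonneg_pos) auto
  then have B0: "0 < B" using B by linarith
  have pq': "p < q"
  proof (rule ccontr)
    assume "\<not> p < q"
    then have "{x. u x = 1} \<inter> {p<..<q} = {}" by auto
    then show False using pos by simp
  qed
  \<comment> \<open>Strictly between \<open>1/2\<close> and \<open>s0\<close>, so that eventually
    every \<open>s j\<close> exceeds it and one Hoelder modulus serves all functions.\<close>
  define s1 where "s1 = (1/2 + s0) / 2"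
  have s1: "1/2 < s1" "s1 < s0" using sup by (auto simp: s1_def)
  define H where "H = holder_const s1 * sqrt B"
  have H: "0 \<le> H" using holder_const_pos[OF s1(1)] B0 by (simp add: H_def)
  define \<gamma> where "\<gamma> = s1 - 1/2"
  have \<gamma>: "0 < \<gamma>" using s1 by (simp add: \<gamma>_def)
  obtain r \<delta> where r: "0 < r" "r \<le> 1" "0 < \<delta>"
    and cost: "zero_costs W H \<gamma> r \<delta>"
    using zero_cost[OF W H \<gamma>] by blast
  \<comment> \<open>An intermediate length: it tends to infinity, but is negligible against the
    measure of order \<open>1 / \<epsilon> j\<close> on which either sign occurs.\<close>
  define L where "L j = 1 / sqrt (\<epsilon> j)" for j
  define l where "l j = (q - p) / \<epsilon> j" for j
  have e0: "\<And>j. 0 < \<epsilon> j" by (rule e(1))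
  have l: "0 < l j" for j using e0[of j] pq' by (simp add: l_def)
  have sqrt_lim: "(\<lambda>j. sqrt (\<epsilon> j)) \<longlonglongrightarrow> 0" using tendsto_real_sqrt[OF e_lim] by simp
  have Linf: "filterlim L at_top sequentially"
  proof -
    have "filterlim (\<lambda>j. inverse (sqrt (\<epsilon> j))) at_top sequentially"
      using sqrt_lim e0 by (intro filterlim_inverse_at_top) auto
    then show ?thesis by (simp add: L_def[abs_def] inverse_eq_divide)
  qed
  define X where "X \<sigma> = {x. u x = \<sigma>} \<inter> {p<..<q}" for \<sigma>
  have Xm [measurable]: "X \<sigma> \<in> sets borel" for \<sigma> unfolding X_def by measurable
  have Xfin: "emeasure lborel (X \<sigma>) < \<infinity>" for \<sigma>
  proof -
    have "emeasure lborel (X \<sigma>) \<le> emeasure lborel {p<..<q}" unfolding X_def by (intro emeasure_mono) auto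
    also have "\<dots> < \<infinity>" using pq' by simp
    finally show ?thesis .
  qed
  have ev_meas: "\<forall>\<^sub>F j in sequentially. ennreal (L j * (B / \<delta> + 1)) < emeasure lborel {x \<in> {0<..<l j}. \<sigma> * v j (p + \<epsilon> j * x) < 0}"
    if \<sigma>: "\<sigma> = 1 \<or> \<sigma> = (-1::real)" for \<sigma>
  proof -
    have Xpos: "0 < emeasure lborel (X (- \<sigma>))" using \<sigma> pos neg by (auto simp: X_def)
    obtain m where m: "emeasure lborel (X (- \<sigma>)) = ennreal m" "0 \<le> m"
      using Xfin[of "- \<sigma>"] by (cases "emeasure lborel (X (- \<sigma>))" rule: ennreal_cases) auto
    have m0: "0 < m" using Xpos m by simp
    have "\<forall>\<^sub>F j in sequentially. emeasure lborel {x \<in> {0<..<1}. \<bar>v j x - u x\<bar> > 1 / 2} < ennreal (m / 2)"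
    proof (rule order_tendstoD(2))
      show "(\<lambda>j. emeasure lborel {x \<in> {0<..<1}. \<bar>v j x - u x\<bar> > 1 / 2}) \<longlonglongrightarrow> 0"
        using conv half_gt_zero[OF zero_less_one] unfolding conv_meas_def by blast
    qed (use m0 in simp)
    moreover have "\<forall>\<^sub>F j in sequentially. sqrt (\<epsilon> j) * (B / \<delta> + 1) < m / 2"
    proof (rule order_tendstoD(2))
      show "(\<lambda>j. sqrt (\<epsilon> j) * (B / \<delta> + 1)) \<longlonglongrightarrow> 0" using tendsto_mult_right[OF sqrt_lim, of "B / \<delta> + 1"] by simp
    qed (use m0 in simp)
    ultimately show ?thesis
    proof eventually_elim
      case (elim j)
      define S where "S = {x \<in> {p<..<q}. \<sigma> * v j x < 0}"
      have [measurable]: "S \<in> sets borel" unfolding S_def by measurable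
      have "X (- \<sigma>) \<subseteq> S \<union> {x \<in> {0<..<1}. \<bar>v j x - u x\<bar> > 1 / 2}"
      proof
        fix x assume x: "x \<in> X (- \<sigma>)"
        then have "u x = - \<sigma>" "x \<in> {p<..<q}" "x \<in> {0<..<1}" using pq by (auto simp: X_def)
        moreover have "\<sigma> * v j x < 0" if "\<not> \<bar>v j x - u x\<bar> > 1 / 2" using that \<open>u x = - \<sigma>\<close> \<sigma> by (elim disjE; simp; linarith)
        ultimately show "x \<in> S \<union> {x \<in> {0<..<1}. \<bar>v j x - u x\<bar> > 1 / 2}" by (auto simp: S_def)
      qed
      then have "ennreal m \<le> emeasure lborel (S \<union> {x \<in> {0<..<1}. \<bar>v j x - u x\<bar> > 1 / 2})"
        unfolding m(1)[symmetric] by (intro emeasure_mono) auto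
      also have "\<dots> \<le> emeasure lborel S + emeasure lborel {x \<in> {0<..<1}. \<bar>v j x - u x\<bar> > 1 / 2}"
        by (rule emeasure_subadditive) measurable
      also have "\<dots> \<le> emeasure lborel S + ennreal (m / 2)" using elim(1) by (intro add_left_mono) auto
      finally have "ennreal m - ennreal (m / 2) \<le> emeasure lborel S" by (simp add: ennreal_minus_le_iff add.commute)
      then have S: "ennreal (m / 2) \<le> emeasure lborel S" using m0 by (simp add: ennreal_minus)
      have "{x \<in> {0<..<l j}. \<sigma> * v j (p + \<epsilon> j * x) < 0} = {x. p + \<epsilon> j * x \<in> S}"
        using affine_mem_ivl[OF e0[of j], of p _ q] unfolding S_def l_def by blast
      then have eq: "emeasure lborel {x \<in> {0<..<l j}. \<sigma> * v j (p + \<epsilon> j * x) < 0} = ennreal (1 / \<epsilon> j) * emeasure lborel S"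
        by (simp only: emeasure_rescale[OF \<open>S \<in> sets borel\<close> e0])
      have "L j * (B / \<delta> + 1) = (1 / \<epsilon> j) * (sqrt (\<epsilon> j) * (B / \<delta> + 1))"
        using e0[of j] by (simp add: L_def divide_simps)
      also have "\<dots> < (1 / \<epsilon> j) * (m / 2)" using elim(2) e0[of j] by (intro mult_strict_left_mono) auto
      finally have "ennreal (L j * (B / \<delta> + 1)) < ennreal ((1 / \<epsilon> j) * (m / 2))"
        using B0 r e0[of j] by (intro ennreal_lessI) (auto simp: L_def m0)
      also have "\<dots> = ennreal (1 / \<epsilon> j) * ennreal (m / 2)" using e0[of j] m0 by (intro ennreal_mult) auto
      also have "\<dots> \<le> ennreal (1 / \<epsilon> j) * emeasure lborel S" by (intro mult_left_mono S) auto
      finally show ?case unfolding eq .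
    qed
  qed
  have ev_lam: "\<forall>\<^sub>F j in sequentially. y < B * scale_factor (\<epsilon> j) (s j)"
  proof (rule order_tendstoD(1))
    show "(\<lambda>j. B * scale_factor (\<epsilon> j) (s j)) \<longlonglongrightarrow> B * (2 * s0 - 1)" by (intro tendsto_intros scale_lim)
    show "y < B * (2 * s0 - 1)" using B sup by (simp add: field_simps)
  qed
  have ev_s: "\<forall>\<^sub>F j in sequentially. s1 < s j" using s_lim s1(2) by (rule order_tendstoD)
  have ev_L: "\<forall>\<^sub>F j in sequentially. 2 < L j" using Linf by (simp add: filterlim_at_top_dense)
  define Q where "Q j a b w \<longleftrightarrow> w \<in> borel_measurable borel \<and> holder_on H \<gamma> {a<..<b} w \<and> profile_en W (s j) {a<..<b} w \<le> ennreal B \<and>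
    (\<forall>x. a < x \<longrightarrow> x \<le> a + L j / 2 \<longrightarrow> w x < 0) \<and> (\<forall>x. b - L j / 2 \<le> x \<longrightarrow> x < b \<longrightarrow> 0 < w x) \<and> a + L j / 2 < b - L j / 2" for j a b w
  have "\<forall>\<^sub>F j in sequentially. \<exists>a b w. Q j a b w"
    using ev_meas[of 1, OF disjI1[OF refl]] ev_meas[of "-1", OF disjI2[OF refl]] ev_lam ev_s ev_L
  proof eventually_elim
    case (elim j)
    define U where "U x = v j (p + \<epsilon> j * x)" for x
    have U [measurable]: "U \<in> borel_measurable borel" unfolding U_def by measurable
    define lam where "lam = scale_factor (\<epsilon> j) (s j)"
    have lam: "0 < lam" using scale_pos by (simp add: lam_def)
    have "ennreal lam * profile_en W (s j) {0<..<l j} U \<le> ennreal y"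
      using bound[of j] unfolding loc_energy_rescale[OF Wm v e0] U_def l_def lam_def .
    then have "ennreal (1 / lam) * (ennreal lam * profile_en W (s j) {0<..<l j} U) \<le> ennreal (1 / lam) * ennreal y" by (intro mult_left_mono) auto
    also have "ennreal (1 / lam) * (ennreal lam * profile_en W (s j) {0<..<l j} U) = profile_en W (s j) {0<..<l j} U"
      using lam by (simp add: mult.assoc[symmetric] ennreal_mult[symmetric])
    also have "ennreal (1 / lam) * ennreal y = ennreal (y / lam)" using lam y by (simp add: ennreal_mult[symmetric])
    also have "\<dots> \<le> ennreal B" using elim(3) lam unfolding lam_def[symmetric] by (intro ennreal_leI) (simp add: pos_divide_le_eq)
    finally have enU: "profile_en W (s j) {0<..<l j} U \<le> ennreal B" .
    \<comment> \<open>Passing to the Hoelder representative changes neither the energy nor the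
      measure of the sets where the function has a given sign.\<close>
    obtain w where w [measurable]: "w \<in> borel_measurable borel" and hw: "holder_on H \<gamma> {0<..<l j} w" and ae: "AE x in lborel. x \<in> {0<..<l j} \<longrightarrow> U x = w x"
      using finite_energy_holder[OF U s1(1) less_imp_le[OF elim(4)] less_imp_le[OF B0] enU] unfolding H_def \<gamma>_def by blast
    have enw: "profile_en W (s j) {0<..<l j} w \<le> ennreal B" using enU unfolding profile_en_cong_AE[OF ae] .
    have "emeasure lborel {x \<in> {0<..<l j}. \<sigma> * U x < 0} = emeasure lborel {x \<in> {0<..<l j}. \<sigma> * w x < 0}" for \<sigma>
      using ae by (intro emeasure_eq_AE) (auto elim!: eventually_mono)
    note eqm = this[symmetric]
    have 1: "2 * r \<le> L j" using elim(5) r by simp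
    have 2: "ennreal (L j * (B / \<delta> + 1)) < emeasure lborel {x \<in> {0<..<l j}. w x < 0}"
      using elim(1) eqm[of 1] unfolding U_def by simp
    have 3: "ennreal (L j * (B / \<delta> + 1)) < emeasure lborel {x \<in> {0<..<l j}. 0 < w x}"
      using elim(2) eqm[of "-1"] unfolding U_def by simp
    show ?case by (rule transition_interval[OF W cost w hw \<gamma> r(1) r(3) 1 l less_imp_le[OF B0] enw 2 3]) (unfold Q_def, blast)
  qed
  then obtain N where N: "\<And>j. N \<le> j \<Longrightarrow> \<exists>a b w. Q j a b w"
    unfolding eventually_sequentially by blast
  have "\<forall>j. \<exists>t. Q (j + N) (fst t) (fst (snd t)) (snd (snd t))"
  proof
    fix j
    obtain a b w where "Q (j + N) a b w" using N[of "j + N"] by auto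
    then show "\<exists>t. Q (j + N) (fst t) (fst (snd t)) (snd (snd t))" by (intro exI[of _ "(a, b, w)"]) simp
  qed
  from choice[OF this] obtain t where t: "\<forall>j. Q (j + N) (fst (t j)) (fst (snd (t j))) (snd (snd (t j)))" by blast
  define a b w where "a j = fst (t j)" and "b j = fst (snd (t j))" and "w j = snd (snd (t j))" for j
  have Q: "Q (j + N) (a j) (b j) (w j)" for j using t by (simp add: a_def b_def w_def)
  have w: "w j \<in> borel_measurable borel" "holder_on H \<gamma> {a j<..<b j} (w j)" "profile_en W (s (j + N)) {a j<..<b j} (w j) \<le> ennreal B"
    "\<And>x. a j < x \<Longrightarrow> x \<le> a j + L (j + N) / 2 \<Longrightarrow> w j x < 0" "\<And>x. b j - L (j + N) / 2 \<le> x \<Longrightarrow> x < b j \<Longrightarrow> 0 < w j x"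
    "a j + L (j + N) / 2 < b j - L (j + N) / 2" for j
    using Q[of j] unfolding Q_def by blast+
  \<comment> \<open>The number of portions \<delta> that exhausts \<open>B\<close>, the induction
    parameter of \<open>transition_energy\<close>.\<close>
  obtain n where n: "B / \<delta> < real n" using reals_Archimedean2 by blast
  show ?thesis
  proof (rule transition_energy[where s = "\<lambda>j. s (j + N)" and u = w and a = a and b = b and L = "\<lambda>j. L (j + N) / 2" and n = n, OF W H \<gamma> r(1) r(3) cost])
    show "(\<lambda>j. s (j + N)) \<longlonglongrightarrow> s0" by (rule LIMSEQ_ignore_initial_segment[OF s_lim])
    show "filterlim (\<lambda>j. L (j + N) / 2) at_top sequentially"
    proof -
      have 1: "filterlim (\<lambda>j. L (j + N)) at_top sequentially"
        by (rule filterlim_compose[OF Linf filterlim_add_const_nat_at_top])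
      have "filterlim (\<lambda>j. L (j + N) * (1 / 2)) at_top sequentially"
        by (rule filterlim_at_top_mult_tendsto_pos[OF tendsto_const _ 1, of "1/2"]) simp
      then show ?thesis by simp
    qed
    show "0 < L (j + N) / 2" for j using e0[of "j + N"] by (simp add: L_def)
    show "B \<le> real n * \<delta>" using n r by (simp add: field_simps)
  qed (rule w; assumption?)+
qed

subsection \<open>The lower bound\<close>

text \<open>An extended number: no finiteness of \<open>m_const\<close> is proved, and the infinite
  case is split off in \<open>recovery_sequence\<close>.\<close>

definition limit_const :: "(real \<Rightarrow> real) \<Rightarrow> real \<Rightarrow> ennreal" where
  "limit_const W s = (if s = 1/2 then 8 else ennreal (2 * s - 1) * m_const W s)"

lemma limit_const_pos:
  assumes "double_well W" "1/2 \<le> s" shows "0 < limit_const W s"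
proof (cases "s = 1/2")
  case False
  then have "1/2 < s" using assms by simp
  then show ?thesis using m_const_pos[OF assms(1), of s] by (simp add: limit_const_def ennreal_zero_less_mult_iff)
qed (simp add: limit_const_def)

lemma subseq_below_of_liminf_less:
  fixes X :: "nat \<Rightarrow> ennreal"
  assumes "liminf X < y"
  obtains k :: "nat \<Rightarrow> nat" where "strict_mono k" "\<And>j. X (k j) < y"
proof -
  have "\<not> eventually (\<lambda>n. y \<le> X n) sequentially"
    using assms Liminf_bounded[of y X sequentially] by (meson leD)
  then have "infinite {n. \<not> y \<le> X n}"
    unfolding cofinite_eq_sequentially[symmetric] eventually_cofinite .
  then obtain k :: "nat \<Rightarrow> nat" where "strict_mono k" "\<forall>n. k n \<in> {n. \<not> y \<le> X n}" using infinite_enumerate by blast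
  then show ?thesis by (intro that[of k]) (simp_all add: not_le)
qed

lemma conv_meas_subseq:
  assumes "conv_meas v u" "strict_mono k" shows "conv_meas (\<lambda>j. v (k j)) u"
  unfolding conv_meas_def
proof (intro allI impI)
  fix \<delta> :: real assume "\<delta> > 0"
  then have "(\<lambda>j. emeasure lborel {x \<in> {0<..<1}. \<bar>v j x - u x\<bar> > \<delta>}) \<longlonglongrightarrow> 0" using assms(1) unfolding conv_meas_def by blast
  from LIMSEQ_subseq_LIMSEQ[OF this assms(2)] show "(\<lambda>j. emeasure lborel {x \<in> {0<..<1}. \<bar>v (k j) x - u x\<bar> > \<delta>}) \<longlonglongrightarrow> 0"
    by (simp add: o_def)
qed

text \<open>For \<open>s0 > 1/2\<close> a smaller liminf would give a subsequence with energies
  below some \<open>y'\<close> with \<open>y' / (2 * s0 - 1)\<close> below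
  \<open>m_const W s0\<close>; any \<open>B\<close> strictly between these two contradicts
  \<open>bounded_energy_m_const\<close>.\<close>

lemma (in scales) local_liminf:
  assumes W: "double_well W"
    and u [measurable]: "u \<in> borel_measurable borel" and v [measurable]: "\<And>j. v j \<in> borel_measurable borel" and conv: "conv_meas v u"
    and pq: "{p<..<q} \<subseteq> {0<..<1}"
    and pos: "emeasure lborel ({x. u x = 1} \<inter> {p<..<q}) > 0" and neg: "emeasure lborel ({x. u x = -1} \<inter> {p<..<q}) > 0"
  shows "limit_const W s0 \<le> liminf (\<lambda>j. loc_energy W (s j) (\<epsilon> j) {p<..<q} (v j))"
proof (cases "s0 = 1/2")
  case True
  then show ?thesis using half_local_liminf[OF True W u v conv pq pos neg] by (simp add: limit_const_def)
next
  case False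
  then have sup: "1/2 < s0" using s0 by simp
  define c where "c = 2 * s0 - 1"
  have c: "0 < c" using sup by (simp add: c_def)
  show ?thesis
  proof (rule ccontr)
    assume "\<not> ?thesis"
    then have "liminf (\<lambda>j. loc_energy W (s j) (\<epsilon> j) {p<..<q} (v j)) < ennreal c * m_const W s0"
      using False by (simp add: not_le limit_const_def c_def)
    then obtain y where y: "liminf (\<lambda>j. loc_energy W (s j) (\<epsilon> j) {p<..<q} (v j)) < y" "y < ennreal c * m_const W s0"
      using dense by blast
    then obtain y' where y': "y = ennreal y'" "0 \<le> y'" by (cases y rule: ennreal_cases) auto
    obtain k :: "nat \<Rightarrow> nat" where k: "strict_mono k" "\<And>j. loc_energy W (s (k j)) (\<epsilon> (k j)) {p<..<q} (v (k j)) < y"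
      using subseq_below_of_liminf_less[OF y(1)] by blast
    interpret S: scales "\<lambda>j. s (k j)" "\<lambda>j. \<epsilon> (k j)" s0
    proof
      show "(\<lambda>j. s (k j)) \<longlonglongrightarrow> s0" using LIMSEQ_subseq_LIMSEQ[OF s_lim k(1)] by (simp add: o_def)
      show "(\<lambda>j. \<epsilon> (k j)) \<longlonglongrightarrow> 0" using LIMSEQ_subseq_LIMSEQ[OF e_lim k(1)] by (simp add: o_def)
    qed (use s e s0 in auto)
    have "ennreal (y' / c) < m_const W s0"
    proof (rule ccontr)
      assume "\<not> ennreal (y' / c) < m_const W s0"
      then have "ennreal c * m_const W s0 \<le> ennreal c * ennreal (y' / c)" by (intro mult_left_mono) (simp_all add: not_less)
      also have "\<dots> = y" using c y' by (simp add: ennreal_mult[symmetric])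
      finally show False using y(2) by simp
    qed
    then obtain z where z: "ennreal (y' / c) < z" "z < m_const W s0" using dense by blast
    then obtain B where B: "z = ennreal B" "0 \<le> B" by (cases z rule: ennreal_cases) auto
    have "y' / c < B" using z(1) B c y' by (simp add: ennreal_less_iff)
    then have "m_const W s0 \<le> ennreal B"
      unfolding c_def
      by (intro S.bounded_energy_m_const[OF sup W u v conv_meas_subseq[OF conv k(1)] pq pos neg _ y'(2)])
        (use k(2) y' in \<open>auto intro: less_imp_le\<close>)
    then show False using z(2) B by simp
  qed
qed

text \<open>Unlike one-sided limits, these points make sense for every \<open>\<plusminus>1\<close>-valued function; when there are finitely many,
  they are exactly the jump points.\<close>

definition ess_jumps :: "(real \<Rightarrow> real) \<Rightarrow> real set" where
  "ess_jumps u = {x \<in> {0<..<1}. \<forall>r>0. emeasure lborel ({y. u y = 1} \<inter> {x - r<..<x + r}) > 0 \<and> 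
     emeasure lborel ({y. u y = -1} \<inter> {x - r<..<x + r}) > 0}"

lemma separation_radius:
  fixes T :: "real set"
  assumes "finite T" "T \<subseteq> {0<..<1}"
  obtains r where "0 < r" "\<And>x. x \<in> T \<Longrightarrow> 0 < x - r \<and> x + r < 1" "\<And>x y. x \<in> T \<Longrightarrow> y \<in> T \<Longrightarrow> x \<noteq> y \<Longrightarrow> 2 * r \<le> \<bar>x - y\<bar>"
proof -
  define D where "D = insert 1 ((\<lambda>x. x) ` T \<union> (\<lambda>x. 1 - x) ` T \<union> (\<lambda>(x, y). \<bar>x - y\<bar>) ` (T \<times> T - Id))"
  have D: "finite D" "D \<noteq> {}" "\<And>d. d \<in> D \<Longrightarrow> 0 < d" using assms by (auto simp: D_def)
  define m where "m = Min D"
  have m: "0 < m" "\<And>d. d \<in> D \<Longrightarrow> m \<le> d" using D by (auto simp: m_def)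
  show ?thesis
  proof (rule that[of "m / 2"])
    show "0 < x - m / 2 \<and> x + m / 2 < 1" if "x \<in> T" for x
    proof -
      have "m \<le> x" "m \<le> 1 - x" using that by (auto simp: D_def intro!: m(2))
      then show ?thesis using m(1) by simp
    qed
    show "2 * (m / 2) \<le> \<bar>x - y\<bar>" if "x \<in> T" "y \<in> T" "x \<noteq> y" for x y
    proof -
      have "\<bar>x - y\<bar> \<in> D" using that unfolding D_def by (intro insertI2 UnI2 image_eqI[of _ _ "(x, y)"]) auto
      then show ?thesis using m(2) by simp
    qed
  qed (use m in auto)
qed

lemma loc_energy_superadd:
  assumes [measurable]: "W \<in> borel_measurable borel" "u \<in> borel_measurable borel" and fin: "finite I"
    and [measurable]: "\<And>i. i \<in> I \<Longrightarrow> A i \<in> sets borel" and disj: "disjoint_family_on A I" and sub: "\<And>i. i \<in> I \<Longrightarrow> A i \<subseteq> B"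
  shows "(\<Sum>i\<in>I. loc_energy W s \<epsilon> (A i) u) \<le> loc_energy W s \<epsilon> B u"
proof -
  have "(\<Sum>i\<in>I. loc_energy W s \<epsilon> (A i) u) = ennreal (scale_factor \<epsilon> s) *
     (ennreal (1 / \<epsilon>) * (\<Sum>i\<in>I. \<integral>\<^sup>+ t. ennreal (W (u t)) * indicator (A i) t \<partial>lborel) + ennreal (\<epsilon> powr (2 * s - 1)) * (\<Sum>i\<in>I. gsq s (A i) u))"
    unfolding loc_energy_def sum_distrib_left[symmetric] sum.distrib ..
  also have "\<dots> \<le> loc_energy W s \<epsilon> B u"
    unfolding loc_energy_def
    by (intro mult_left_mono add_mono gsq_superadd nn_integral_superadd fin disj sub) auto
  finally show ?thesis .
qed

lemma sum_liminf_le: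
  fixes X :: "'a \<Rightarrow> nat \<Rightarrow> ennreal"
  assumes "finite I"
  shows "(\<Sum>i\<in>I. liminf (X i)) \<le> liminf (\<lambda>n. \<Sum>i\<in>I. X i n)"
  using assms
proof (induction I rule: finite_induct)
  case (insert i I)
  have "(\<Sum>i\<in>insert i I. liminf (X i)) \<le> liminf (X i) + liminf (\<lambda>n. \<Sum>i\<in>I. X i n)"
    using insert by (simp add: add_left_mono)
  also have "\<dots> \<le> liminf (\<lambda>n. X i n + (\<Sum>i\<in>I. X i n))" by (rule ennreal_liminf_add_le)
  finally show ?case using insert by simp
qed simp

text \<open>Disjoint intervals around finitely many jump points contribute at least
  \<open>limit_const\<close> each, and superadditivity adds them up. Infinitely many jump points
  force an infinite liminf because the constant is positive.\<close>

lemma (in scales) liminf_inequality: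
  assumes W: "double_well W"
    and u [measurable]: "u \<in> borel_measurable borel" and v [measurable]: "\<And>j. v j \<in> borel_measurable borel" and conv: "conv_meas v u"
  shows "limit_const W s0 * emeasure (count_space UNIV) (ess_jumps u) \<le> liminf (\<lambda>j. loc_energy W (s j) (\<epsilon> j) {0<..<1} (v j))"
proof -
  have Wm [measurable]: "W \<in> borel_measurable borel" using W by (rule double_well_measurable)
  have *: "limit_const W s0 * of_nat (card T) \<le> liminf (\<lambda>j. loc_energy W (s j) (\<epsilon> j) {0<..<1} (v j))"
    if T: "finite T" "T \<subseteq> ess_jumps u" for T
  proof -
    have T01: "T \<subseteq> {0<..<1}" using T(2) by (auto simp: ess_jumps_def)
    obtain r where r: "0 < r" "\<And>x. x \<in> T \<Longrightarrow> 0 < x - r \<and> x + r < 1" "\<And>x y. x \<in> T \<Longrightarrow> y \<in> T \<Longrightarrow> x \<noteq> y \<Longrightarrow> 2 * r \<le> \<bar>x - y\<bar>"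
      using separation_radius[OF T(1) T01] by blast
    define A where "A x = {x - r<..<x + r}" for x
    have A01: "A x \<subseteq> {0<..<1}" if "x \<in> T" for x using r(2)[OF that] by (auto simp: A_def)
    have disj: "disjoint_family_on A T"
      unfolding disjoint_family_on_def
    proof (intro ballI impI)
      fix x y assume "x \<in> T" "y \<in> T" "x \<noteq> y"
      then have "2 * r \<le> \<bar>x - y\<bar>" by (rule r(3))
      then show "A x \<inter> A y = {}" by (auto simp: A_def abs_if split: if_splits)
    qed
    have "limit_const W s0 * of_nat (card T) = (\<Sum>x\<in>T. limit_const W s0)" by (simp add: mult.commute)
    also have "\<dots> \<le> (\<Sum>x\<in>T. liminf (\<lambda>j. loc_energy W (s j) (\<epsilon> j) (A x) (v j)))"
    proof (rule sum_mono)
      fix x assume x: "x \<in> T"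
      then have J: "emeasure lborel ({y. u y = 1} \<inter> {x - r<..<x + r}) > 0" "emeasure lborel ({y. u y = -1} \<inter> {x - r<..<x + r}) > 0"
        using T(2) r(1) by (auto simp: ess_jumps_def)
      show "limit_const W s0 \<le> liminf (\<lambda>j. loc_energy W (s j) (\<epsilon> j) (A x) (v j))"
        unfolding A_def by (rule local_liminf[OF W u v conv A01[OF x, unfolded A_def] J])
    qed
    also have "\<dots> \<le> liminf (\<lambda>j. \<Sum>x\<in>T. loc_energy W (s j) (\<epsilon> j) (A x) (v j))" by (rule sum_liminf_le[OF T(1)])
    also have "\<dots> \<le> liminf (\<lambda>j. loc_energy W (s j) (\<epsilon> j) {0<..<1} (v j))"
    proof (intro Liminf_mono always_eventually allI)
      fix j
      show "(\<Sum>x\<in>T. loc_energy W (s j) (\<epsilon> j) (A x) (v j)) \<le> loc_energy W (s j) (\<epsilon> j) {0<..<1} (v j)"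
        by (rule loc_energy_superadd[OF Wm v T(1) _ disj A01]) (simp add: A_def)
    qed
    finally show ?thesis .
  qed
  show ?thesis
  proof (cases "finite (ess_jumps u)")
    case True
    then show ?thesis using *[OF True order_refl] by (simp add: emeasure_count_space_finite)
  next
    case False
    have "\<infinity> \<le> liminf (\<lambda>j. loc_energy W (s j) (\<epsilon> j) {0<..<1} (v j))"
    proof (rule ccontr)
      define l where "l = liminf (\<lambda>j. loc_energy W (s j) (\<epsilon> j) {0<..<1} (v j))"
      assume "\<not> \<infinity> \<le> liminf (\<lambda>j. loc_energy W (s j) (\<epsilon> j) {0<..<1} (v j))"
      then have "l < \<infinity>" by (simp add: l_def not_le)
      then obtain b where b: "l = ennreal b" "0 \<le> b" by (cases l rule: ennreal_cases) auto
      \<comment> \<open>The minimum with \<open>1\<close> replaces a possibly infinite constant by a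
        positive real one.\<close>
      have cp: "0 < min 1 (limit_const W s0)" using limit_const_pos[OF W s0(1)] by simp
      obtain c where c: "min 1 (limit_const W s0) = ennreal c" "0 \<le> c"
        by (cases "min 1 (limit_const W s0)" rule: ennreal_cases) (auto simp: min_def split: if_splits)
      have c0: "0 < c" using cp c by simp
      have cle: "ennreal c \<le> limit_const W s0" unfolding c(1)[symmetric] by simp
      obtain n where n: "b / c < real n" using reals_Archimedean2 by blast
      obtain T where T: "finite T" "card T = n" "T \<subseteq> ess_jumps u" using infinite_arbitrarily_large[OF False] by blast
      have "ennreal (c * real n) = ennreal c * of_nat (card T)" using c0 T(2) by (simp add: ennreal_mult ennreal_of_nat_eq_real_of_nat)
      also have "\<dots> \<le> limit_const W s0 * of_nat (card T)" by (intro mult_right_mono cle) auto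
      also have "\<dots> \<le> ennreal b" using *[OF T(1,3)] b by (simp add: l_def)
      finally have "c * real n \<le> b" using b by (simp add: ennreal_le_iff)
      then show False using n c0 by (simp add: field_simps)
    qed
    then show ?thesis by (simp add: top_unique)
  qed
qed

subsection \<open>Jump points and total variation\<close>

text \<open>A second difference of positive parts: a triangle over \<open>{c..c + 2 * h}\<close> of
  height \<open>1 / h\<close> and integral \<open>1\<close>. Its antiderivative
  \<open>tent_primitive\<close>, the same difference of squares, is a continuously differentiable
  step from \<open>0\<close> to \<open>1\<close>, from which test functions can be built.\<close>

definition tent :: "real \<Rightarrow> real \<Rightarrow> real \<Rightarrow> real" where
  "tent c h t = (max 0 (t - c) - 2 * max 0 (t - (c + h)) + max 0 (t - (c + 2 * h))) / h\<^sup>2"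

definition tent_primitive :: "real \<Rightarrow> real \<Rightarrow> real \<Rightarrow> real" where
  "tent_primitive c h t = ((max 0 (t - c))\<^sup>2 - 2 * (max 0 (t - (c + h)))\<^sup>2 + (max 0 (t - (c + 2 * h)))\<^sup>2) / (2 * h\<^sup>2)"

lemma max0_sq_deriv: "((\<lambda>t::real. (max 0 (t - a))\<^sup>2) has_real_derivative 2 * max 0 (t - a)) (at t)"
proof -
  consider "t < a" | "t = a" | "a < t" by linarith
  then show ?thesis
  proof cases
    case 1
    have "((\<lambda>t. (max 0 (t - a))\<^sup>2) has_real_derivative 0) (at t)"
      by (rule has_field_derivative_transform_within_open[of "\<lambda>_. 0" _ _ "{..<a}"]) (use 1 in auto)
    then show ?thesis using 1 by simp
  next
    case 3
    have "((\<lambda>t. (t - a)\<^sup>2) has_real_derivative 2 * (t - a)) (at t)" by (auto intro!: derivative_eq_intros)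
    then have "((\<lambda>t. (max 0 (t - a))\<^sup>2) has_real_derivative 2 * (t - a)) (at t)"
      by (rule has_field_derivative_transform_within_open[where S = "{a<..}"]) (use 3 in auto)
    then show ?thesis using 3 by simp
  next
    case 2
    have "((\<lambda>h::real. \<bar>h\<bar>) \<longlongrightarrow> 0) (at 0)" using tendsto_rabs[OF tendsto_ident_at[of "0::real" UNIV]] by simp
    moreover have "norm ((max 0 h)\<^sup>2 / h) \<le> \<bar>h\<bar>" for h :: real by (cases "h > 0") (auto simp: power2_eq_square)
    ultimately have "((\<lambda>h::real. (max 0 h)\<^sup>2 / h) \<longlongrightarrow> 0) (at 0)" by (intro Lim_null_comparison[of "\<lambda>h. (max 0 h)\<^sup>2 / h" "\<lambda>h. \<bar>h\<bar>"] always_eventually allI)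
    then show ?thesis using 2 by (simp add: DERIV_def)
  qed
qed

lemma tent_primitive_deriv: "(tent_primitive c h has_real_derivative tent c h t) (at t)"
proof -
  have "(tent_primitive c h has_real_derivative
     (2 * max 0 (t - c) - 2 * (2 * max 0 (t - (c + h))) + 2 * max 0 (t - (c + 2 * h))) / (2 * h\<^sup>2)) (at t)"
    unfolding tent_primitive_def[abs_def]
    by (intro DERIV_cdivide DERIV_add DERIV_diff DERIV_cmult max0_sq_deriv)
  moreover have "(2 * x - 2 * (2 * y) + 2 * z) / (2 * h\<^sup>2) = (x - 2 * y + z) / h\<^sup>2" for x y z :: real
  proof -
    have "2 * x - 2 * (2 * y) + 2 * z = 2 * (x - 2 * y + z)" by simp
    then show ?thesis by (simp only: mult_divide_mult_cancel_left[OF zero_neq_numeral[symmetric]])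
  qed
  ultimately show ?thesis by (simp only: tent_def)
qed

lemma tent_props:
  assumes h: "0 < h"
  shows "0 \<le> tent c h t" "tent c h t \<le> 1 / h" "t \<notin> {c<..<c + 2 * h} \<Longrightarrow> tent c h t = 0"
    "t \<le> c \<Longrightarrow> tent_primitive c h t = 0" "c + 2 * h \<le> t \<Longrightarrow> tent_primitive c h t = 1"
proof -
  have num: "0 \<le> max 0 (t - c) - 2 * max 0 (t - (c + h)) + max 0 (t - (c + 2 * h))"
    "max 0 (t - c) - 2 * max 0 (t - (c + h)) + max 0 (t - (c + 2 * h)) \<le> h"
    using h by (auto simp: max_def)
  show "0 \<le> tent c h t" unfolding tent_def using num h by simp
  have "tent c h t \<le> h / h\<^sup>2" unfolding tent_def using num h by (intro divide_right_mono) auto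
  also have "\<dots> = 1 / h" using h by (simp add: power2_eq_square)
  finally show "tent c h t \<le> 1 / h" .
  show "tent c h t = 0" if "t \<notin> {c<..<c + 2 * h}" using that h unfolding tent_def by (auto simp: max_def)
  show "tent_primitive c h t = 0" if "t \<le> c" using that h unfolding tent_primitive_def by (auto simp: max_def)
  show "tent_primitive c h t = 1" if t: "c + 2 * h \<le> t"
  proof -
    have "(t - c)\<^sup>2 - 2 * (t - (c + h))\<^sup>2 + (t - (c + 2 * h))\<^sup>2 = 2 * h\<^sup>2" by (simp add: power2_eq_square algebra_simps)
    moreover have "max 0 (t - c) = t - c" "max 0 (t - (c + h)) = t - (c + h)" "max 0 (t - (c + 2 * h)) = t - (c + 2 * h)" 
      using t h by auto
    ultimately show ?thesis unfolding tent_primitive_def using h by simp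
  qed
qed

lemma tent_continuous: "continuous_on A (tent c h)"
  unfolding tent_def[abs_def] divide_inverse by (intro continuous_intros)

lemma tent_measurable [measurable]: "tent c h \<in> borel_measurable borel"
  by (rule borel_measurable_continuous_onI[OF tent_continuous])

lemma tent_primitive_bounds:
  assumes h: "0 < h" shows "0 \<le> tent_primitive c h t" "tent_primitive c h t \<le> 1"
proof -
  have mono: "tent_primitive c h x \<le> tent_primitive c h y" if "x \<le> y" for x y
    using DERIV_nonneg_imp_nondecreasing[OF that, of "tent_primitive c h"] tent_primitive_deriv tent_props(1)[OF h] by blast
  show "0 \<le> tent_primitive c h t" using mono[of "min c t" t] tent_props(4)[OF h, of "min c t"] by simp
  show "tent_primitive c h t \<le> 1" using mono[of t "max (c + 2 * h) t"] tent_props(5)[OF h, of c "max (c + 2 * h) t"] by simp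
qed

lemma tent_integral:
  assumes h: "0 < h" shows "integrable lborel (tent c h)" "(\<integral>x. tent c h x \<partial>lborel) = 1"
proof -
  have "has_bochner_integral lborel (\<lambda>x. tent c h x * indicator {c..c + 2 * h} x) (tent_primitive c h (c + 2 * h) - tent_primitive c h c)"
    by (rule has_bochner_integral_FTC_Icc_nonneg) (use h tent_props tent_primitive_deriv in auto)
  moreover have "tent c h x * indicator {c..c + 2 * h} x = tent c h x" for x
    using tent_props(3)[OF h, of x c] by (cases "x \<in> {c..c + 2 * h}") auto
  ultimately have "has_bochner_integral lborel (tent c h) 1" using tent_props(4,5)[OF h] by simp
  then show "integrable lborel (tent c h)" "(\<integral>x. tent c h x \<partial>lborel) = 1" by (auto simp: has_bochner_integral_iff)
qed

text \<open>Where \<open>w\<close> differs from \<sigma> the integrand loses at most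
  \<open>2 / h\<close>, and this happens on measure at most \<open>h / 4\<close>; so half of the
  unit integral keeps the sign.\<close>

lemma tent_average:
  assumes w [measurable]: "w \<in> borel_measurable borel" and pm: "\<And>x. w x = 1 \<or> w x = -1" and h: "0 < h" and \<sigma>: "\<sigma> = 1 \<or> \<sigma> = (-1::real)"
    and dens: "emeasure lborel ({c<..<c + 2 * h} - {x. w x = \<sigma>}) \<le> ennreal (1/8 * (2 * h))"
  shows "integrable lborel (\<lambda>x. w x * tent c h x)" "1/2 \<le> \<sigma> * (\<integral>x. w x * tent c h x \<partial>lborel)"
proof -
  have int: "integrable lborel (\<lambda>x. w x * tent c h x)"
  proof (rule Bochner_Integration.integrable_bound[OF tent_integral(1)[OF h]])
    show "AE x in lborel. norm (w x * tent c h x) \<le> norm (tent c h x)" 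
    proof (intro AE_I2)
      fix x show "norm (w x * tent c h x) \<le> norm (tent c h x)" using pm[of x] by (elim disjE) simp_all
    qed
  qed measurable
  then show "integrable lborel (\<lambda>x. w x * tent c h x)" .
  define S where "S = {c<..<c + 2 * h} - {x. w x = \<sigma>}"
  have S [measurable]: "S \<in> sets borel" unfolding S_def by measurable
  have fS: "emeasure lborel S < \<infinity>" using dens by (auto simp: S_def intro: le_less_trans)
  have mS: "measure lborel S \<le> 1/8 * (2 * h)"
    using dens h unfolding S_def[symmetric] measure_def by (intro enn2real_leI) auto
  have intS: "integrable lborel (\<lambda>x. 2 * (1 / h) * indicator S x)" using fS by (intro integrable_mult_right integrable_real_indicator) auto
  have "1 - \<sigma> * (\<integral>x. w x * tent c h x \<partial>lborel) = (\<integral>x. tent c h x - \<sigma> * (w x * tent c h x) \<partial>lborel)"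
    using int tent_integral[OF h] by simp
  also have "\<dots> \<le> (\<integral>x. 2 * (1 / h) * indicator S x \<partial>lborel)"
  proof (rule integral_mono)
    fix x
    show "tent c h x - \<sigma> * (w x * tent c h x) \<le> 2 * (1 / h) * indicator S x"
    proof (cases "x \<in> {c<..<c + 2 * h}")
      case True
      then show ?thesis using tent_props(1,2)[OF h, of c x] pm[of x] \<sigma> by (auto simp: S_def)
    next
      case False
      then show ?thesis using tent_props(3)[OF h False] h by (simp add: S_def)
    qed
  qed (use int intS tent_integral[OF h] in auto)
  also have "\<dots> = 2 * (1 / h) * measure lborel S" by simp
  also have "\<dots> \<le> 2 * (1 / h) * (1/8 * (2 * h))" using h mS by (intro mult_left_mono) auto
  also have "\<dots> = 1/2" using h by simp
  finally show "1/2 \<le> \<sigma> * (\<integral>x. w x * tent c h x \<partial>lborel)" by simp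
qed

lemma variation_integral_eq:
  fixes u w g :: "real \<Rightarrow> real"
  assumes u: "u \<in> borel_measurable (lebesgue_on {0<..<1})" and ae: "AE x in lborel. x \<in> {0<..<1} \<longrightarrow> u x = w x"
    and w [measurable]: "w \<in> borel_measurable borel" and g [measurable]: "g \<in> borel_measurable borel"
  shows "(\<integral>x. u x * g x \<partial>lebesgue_on {0<..<1}) = (\<integral>x. indicator {0<..<1} x * (w x * g x) \<partial>lborel)"
proof -
  have ae': "AE x in lebesgue_on {0<..<1}. u x = w x" using ae by (subst AE_lebesgue_on_iff) auto
  have "(\<integral>x. u x * g x \<partial>lebesgue_on {0<..<1}) = (\<integral>x. w x * g x \<partial>lebesgue_on {0<..<1})"
    using ae' by (intro integral_cong_AE borel_measurable_times u borel_measurable_lebesgue_on[OF w] borel_measurable_lebesgue_on[OF g]) (auto elim!: eventually_mono)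
  also have "\<dots> = (\<integral>x. indicator {0<..<1} x *\<^sub>R (w x * g x) \<partial>lebesgue)"
    by (rule integral_restrict_space) simp
  also have "\<dots> = (\<integral>x. indicator {0<..<1} x *\<^sub>R (w x * g x) \<partial>lborel)"
    by (rule integral_completion) measurable
  finally show ?thesis by simp
qed

text \<open>At each jump point the test function is a difference of two steps, one rising where
  \<open>w\<close> is mostly \<open>1\<close>, the other where it is mostly \<open>-1\<close>.
  Pairing with the derivative gives at least \<open>1/2 + 1/2\<close>, and the supports belonging to
  different points are disjoint, which keeps the bound \<open>1\<close>.\<close>

lemma total_variation_ge_card:
  assumes u: "u \<in> borel_measurable (lebesgue_on {0<..<1})" and ae: "AE x in lborel. x \<in> {0<..<1} \<longrightarrow> u x = w x"
    and w [measurable]: "w \<in> borel_measurable borel" and pm: "\<And>x. w x = 1 \<or> w x = -1" and T: "finite T" "T \<subseteq> ess_jumps w"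
  shows "ereal (real (card T)) \<le> total_variation {0<..<1} u"
proof -
  have T01: "T \<subseteq> {0<..<1}" using T(2) by (auto simp: ess_jumps_def)
  obtain r where r: "0 < r" "\<And>x. x \<in> T \<Longrightarrow> 0 < x - r \<and> x + r < 1" "\<And>x y. x \<in> T \<Longrightarrow> y \<in> T \<Longrightarrow> x \<noteq> y \<Longrightarrow> 2 * r \<le> \<bar>x - y\<bar>"
    using separation_radius[OF T(1) T01] by blast
  \<comment> \<open>The density defect \<open>1/8\<close> is the one with which
    \<open>tent_average\<close> yields \<open>1/2\<close>.\<close>
  define G where "G \<sigma> x c h \<longleftrightarrow> x - r < c \<and> 0 < h \<and> c + 2 * h < x + r \<and> emeasure lborel ({c<..<c + 2 * h} - {x. w x = \<sigma>}) \<le> ennreal (1/8 * (2 * h))" for \<sigma> x c h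
  have exG: "\<exists>t. G \<sigma> x (fst t) (snd t)" if x: "x \<in> T" and \<sigma>: "\<sigma> = 1 \<or> \<sigma> = -1" for x \<sigma>
  proof -
    have "emeasure lborel ({y. w y = \<sigma>} \<inter> {x - r<..<x + r}) > 0" using x T(2) r(1) \<sigma> by (auto simp: ess_jumps_def)
    then obtain c d where cd: "x - r < c" "c < d" "d < x + r" "emeasure lborel ({c<..<d} - {x. w x = \<sigma>}) \<le> ennreal (1/8 * (d - c))"
      by (rule density_interval[where \<delta> = "1/8", rotated]) auto
    define l where "l = (d - c) / 2"
    have d: "d = c + 2 * l" by (simp add: l_def field_simps)
    have "G \<sigma> x c l" using cd unfolding G_def d by simp
    then show ?thesis by (intro exI[of _ "(c, l)"]) simp
  qed
  have "\<exists>t. G 1 x (fst t) (snd t)" "\<exists>t. G (-1) x (fst t) (snd t)" if "x \<in> T" for x using exG[OF that] by auto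
  then have "\<exists>f. \<forall>x\<in>T. G 1 x (fst (f x)) (snd (f x))" "\<exists>f. \<forall>x\<in>T. G (-1) x (fst (f x)) (snd (f x))" by (auto intro!: bchoice)
  then obtain f g where fg: "\<And>x. x \<in> T \<Longrightarrow> G 1 x (fst (f x)) (snd (f x))" "\<And>x. x \<in> T \<Longrightarrow> G (-1) x (fst (g x)) (snd (g x))" by blast
  define a where "a x = fst (f x)" for x
  define h where "h x = snd (f x)" for x
  define b where "b x = fst (g x)" for x
  define k where "k x = snd (g x)" for x
  have P: "x - r < a x" "0 < h x" "a x + 2 * h x < x + r" "emeasure lborel ({a x<..<a x + 2 * h x} - {y. w y = 1}) \<le> ennreal (1/8 * (2 * h x))" if "x \<in> T" for x
    using fg(1)[OF that] unfolding G_def a_def h_def by auto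
  have N: "x - r < b x" "0 < k x" "b x + 2 * k x < x + r" "emeasure lborel ({b x<..<b x + 2 * k x} - {y. w y = -1}) \<le> ennreal (1/8 * (2 * k x))" if "x \<in> T" for x
    using fg(2)[OF that] unfolding G_def b_def k_def by auto
  define \<phi>1 where "\<phi>1 x t = tent_primitive (a x) (h x) t - tent_primitive (b x) (k x) t" for x t
  define \<psi>1 where "\<psi>1 x t = tent (a x) (h x) t - tent (b x) (k x) t" for x t
  define \<phi> where "\<phi> t = (\<Sum>x\<in>T. \<phi>1 x t)" for t
  define \<psi> where "\<psi> t = (\<Sum>x\<in>T. \<psi>1 x t)" for t
  have der: "(\<phi> has_real_derivative \<psi> t) (at t)" for t
    unfolding \<phi>_def[abs_def] \<psi>_def \<phi>1_def \<psi>1_def by (intro DERIV_sum DERIV_diff tent_primitive_deriv)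
  have cont\<psi>: "continuous_on UNIV \<psi>" unfolding \<psi>_def[abs_def] \<psi>1_def by (intro continuous_intros tent_continuous)
  then have [measurable]: "\<psi> \<in> borel_measurable borel" by (rule borel_measurable_continuous_onI)
  have deriv: "deriv \<phi> = \<psi>" using DERIV_imp_deriv[OF der] by auto
  have supp1: "\<phi>1 x t = 0" if "x \<in> T" "t \<notin> {x - r<..<x + r}" for x t
    using that P[OF that(1)] N[OF that(1)] tent_props(4)[of "h x" t "a x"] tent_props(4)[of "k x" t "b x"]
      tent_props(5)[of "h x" "a x" t] tent_props(5)[of "k x" "b x" t]
    unfolding \<phi>1_def by (cases "t \<le> x - r") auto
  have bound1: "\<bar>\<phi>1 x t\<bar> \<le> 1" if "x \<in> T" for x t
    using tent_primitive_bounds[OF P(2)[OF that], of "a x" t] tent_primitive_bounds[OF N(2)[OF that], of "b x" t] unfolding \<phi>1_def by linarith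
  have bound: "\<bar>\<phi> t\<bar> \<le> 1" for t
  proof (cases "\<exists>x\<in>T. t \<in> {x - r<..<x + r}")
    case True
    then obtain x where x: "x \<in> T" "t \<in> {x - r<..<x + r}" by blast
    have "\<phi>1 y t = 0" if "y \<in> T" "y \<noteq> x" for y
      by (rule supp1[OF that(1)]) (use r(3)[OF x(1) that(1)] that x(2) in \<open>auto simp: abs_if split: if_splits\<close>)
    then have "\<phi> t = (\<Sum>y\<in>{x}. \<phi>1 y t)" unfolding \<phi>_def using x(1) T(1) by (intro sum.mono_neutral_right) auto
    then show ?thesis using bound1[OF x(1)] by simp
  next
    case False
    then have "\<phi> t = 0" unfolding \<phi>_def using supp1 by (intro sum.neutral) blast
    then show ?thesis by simp
  qed
  have suppsub: "{t. \<phi> t \<noteq> 0} \<subseteq> (\<Union>x\<in>T. {x - r..x + r})"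
  proof
    fix t assume "t \<in> {t. \<phi> t \<noteq> 0}"
    then obtain x where "x \<in> T" "\<phi>1 x t \<noteq> 0" unfolding \<phi>_def by (auto elim: sum.not_neutral_contains_not_neutral)
    then show "t \<in> (\<Union>x\<in>T. {x - r..x + r})" using supp1[of x t] by force
  qed
  have cpt: "compact (\<Union>x\<in>T. {x - r..x + r})" using T(1) by (intro compact_UN) auto
  have clsub: "closure {t. \<phi> t \<noteq> 0} \<subseteq> (\<Union>x\<in>T. {x - r..x + r})" by (rule closure_minimal[OF suppsub compact_imp_closed[OF cpt]])
  have "\<phi> \<in> test_functions {0<..<1}" unfolding test_functions_def mem_Collect_eq
  proof (intro conjI)
    show "\<phi> C1_differentiable_on UNIV" unfolding C1_differentiable_on_def
      using der cont\<psi> by (intro exI[of _ \<psi>]) (auto simp: has_real_derivative_iff_has_vector_derivative)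
    have "compact ((\<Union>x\<in>T. {x - r..x + r}) \<inter> closure {t. \<phi> t \<noteq> 0})" by (rule compact_Int_closed[OF cpt]) simp
    then show "compact (closure {t. \<phi> t \<noteq> 0})" using clsub by (simp add: Int_absorb1)
    show "closure {t. \<phi> t \<noteq> 0} \<subseteq> {0<..<1}" using clsub r(2) by fastforce
  qed
  then have mem: "\<phi> \<in> {\<phi> \<in> test_functions {0<..<1}. \<forall>x. \<bar>\<phi> x\<bar> \<le> 1}" using bound by simp
  have zero: "\<psi>1 x t = 0" if "x \<in> T" "t \<notin> {0<..<1}" for x t
    using that P[OF that(1)] N[OF that(1)] r(2)[OF that(1)] tent_props(3)[of "h x" t "a x"] tent_props(3)[of "k x" t "b x"] unfolding \<psi>1_def by auto
  have A: "integrable lborel (\<lambda>t. w t * tent (a x) (h x) t)" "1/2 \<le> (\<integral>t. w t * tent (a x) (h x) t \<partial>lborel)" if "x \<in> T" for x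
    using tent_average[OF w pm P(2)[OF that] disjI1[OF refl] P(4)[OF that]] by auto
  have B: "integrable lborel (\<lambda>t. w t * tent (b x) (k x) t)" "1/2 \<le> - (\<integral>t. w t * tent (b x) (k x) t \<partial>lborel)" if "x \<in> T" for x
    using tent_average[OF w pm N(2)[OF that] disjI2[OF refl] N(4)[OF that]] by auto
  have "real (card T) = (\<Sum>x\<in>T. 1)" by simp
  also have "\<dots> \<le> (\<Sum>x\<in>T. (\<integral>t. w t * tent (a x) (h x) t \<partial>lborel) - (\<integral>t. w t * tent (b x) (k x) t \<partial>lborel))"
  proof (rule sum_mono)
    fix x assume "x \<in> T"
    then show "1 \<le> (\<integral>t. w t * tent (a x) (h x) t \<partial>lborel) - (\<integral>t. w t * tent (b x) (k x) t \<partial>lborel)" using A(2)[of x] B(2)[of x] by linarith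
  qed
  also have "\<dots> = (\<Sum>x\<in>T. (\<integral>t. w t * \<psi>1 x t \<partial>lborel))"
    using A(1) B(1) by (intro sum.cong refl) (simp add: \<psi>1_def right_diff_distrib)
  also have "\<dots> = (\<integral>t. (\<Sum>x\<in>T. w t * \<psi>1 x t) \<partial>lborel)"
    using A(1) B(1) by (intro Bochner_Integration.integral_sum[symmetric]) (simp add: \<psi>1_def right_diff_distrib)
  also have "\<dots> = (\<integral>t. indicator {0<..<1} t * (w t * \<psi> t) \<partial>lborel)"
  proof (intro Bochner_Integration.integral_cong refl)
    fix t :: real
    show "(\<Sum>x\<in>T. w t * \<psi>1 x t) = indicator {0<..<1} t * (w t * \<psi> t)"
      unfolding \<psi>_def sum_distrib_left[symmetric] using zero by (cases "t \<in> {0<..<1}") (auto intro!: sum.neutral)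
  qed
  also have "\<dots> = (\<integral>x. u x * deriv \<phi> x \<partial>lebesgue_on {0<..<1})" unfolding deriv by (rule variation_integral_eq[OF u ae w, symmetric]) measurable
  finally have "ereal (real (card T)) \<le> ereal (\<integral>x. u x * deriv \<phi> x \<partial>lebesgue_on {0<..<1})" by simp
  also have "\<dots> \<le> total_variation {0<..<1} u" unfolding total_variation_def by (rule SUP_upper[OF mem])
  finally show ?thesis .
qed

section \<open>Structure of functions with finitely many jump points\<close>

text \<open>The points near which the value \<open>1\<close>, respectively \<open>-1\<close>, is
  null form two disjoint open sets covering the interval, so connectedness leaves only one of them.
  A locally negligible set is negligible, which removes the other value.\<close>

lemma jump_free_constant:
  assumes w [measurable]: "w \<in> borel_measurable borel" and pm: "\<And>x. w x = 1 \<or> w x = -1"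
    and cd: "{c<..<d} \<subseteq> {0<..<1}" and free: "{c<..<d} \<inter> ess_jumps w = {}"
  obtains \<sigma> where "\<sigma> = 1 \<or> \<sigma> = -1" "AE x in lborel. x \<in> {c<..<d} \<longrightarrow> w x = \<sigma>"
proof -
  define P where "P \<sigma> = {x \<in> {c<..<d}. \<exists>r>0. emeasure lborel ({y. w y = \<sigma>} \<inter> {x - r<..<x + r}) = 0}" for \<sigma>
  have opn: "open (P \<sigma>)" for \<sigma>
    unfolding open_dist
  proof
    fix x assume x: "x \<in> P \<sigma>"
    then obtain r where r: "r > 0" "emeasure lborel ({y. w y = \<sigma>} \<inter> {x - r<..<x + r}) = 0" "x \<in> {c<..<d}" by (auto simp: P_def)
    define e where "e = min (r / 2) (min (x - c) (d - x))"
    have e: "e > 0" using r by (auto simp: e_def)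
    have "y \<in> P \<sigma>" if "dist y x < e" for y
    proof -
      have y: "\<bar>y - x\<bar> < r / 2" "y \<in> {c<..<d}" using that r(3) by (auto simp: dist_real_def e_def)
      have "emeasure lborel ({z. w z = \<sigma>} \<inter> {y - r / 2<..<y + r / 2}) \<le> emeasure lborel ({y. w y = \<sigma>} \<inter> {x - r<..<x + r})"
      proof (intro emeasure_mono Int_mono order_refl subsetI)
        fix t assume "t \<in> {y - r / 2<..<y + r / 2}"
        moreover have "y - x < r / 2" "x - y < r / 2" using y(1) by linarith+
        ultimately show "t \<in> {x - r<..<x + r}" unfolding greaterThanLessThan_iff by linarith
      qed measurable
      then show ?thesis using y r by (auto simp: P_def intro!: exI[of _ "r / 2"])
    qed
    then show "\<exists>e>0. \<forall>y. dist y x < e \<longrightarrow> y \<in> P \<sigma>" using e by blast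
  qed
  have cover: "{c<..<d} \<subseteq> P 1 \<union> P (-1)"
  proof
    fix x assume x: "x \<in> {c<..<d}"
    then have "x \<notin> ess_jumps w" "x \<in> {0<..<1}" using free cd by auto
    then obtain r where "r > 0" "\<not> (emeasure lborel ({y. w y = 1} \<inter> {x - r<..<x + r}) > 0 \<and> emeasure lborel ({y. w y = -1} \<inter> {x - r<..<x + r}) > 0)"
      by (auto simp: ess_jumps_def)
    then show "x \<in> P 1 \<union> P (-1)" using x by (auto simp: P_def zero_less_iff_neq_zero)
  qed
  have disj: "P 1 \<inter> P (-1) = {}"
  proof (rule ccontr)
    assume "P 1 \<inter> P (-1) \<noteq> {}"
    then obtain x r1 r2 where r: "r1 > 0" "r2 > 0" "emeasure lborel ({y. w y = 1} \<inter> {x - r1<..<x + r1}) = 0" "emeasure lborel ({y. w y = -1} \<inter> {x - r2<..<x + r2}) = 0"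
      by (auto simp: P_def)
    define r where "r = min r1 r2"
    have "emeasure lborel {x - r<..<x + r} \<le> emeasure lborel (({y. w y = 1} \<inter> {x - r1<..<x + r1}) \<union> ({y. w y = -1} \<inter> {x - r2<..<x + r2}))"
      using pm by (intro emeasure_mono) (auto simp: r_def)
    also have "\<dots> \<le> emeasure lborel ({y. w y = 1} \<inter> {x - r1<..<x + r1}) + emeasure lborel ({y. w y = -1} \<inter> {x - r2<..<x + r2})"
      by (rule emeasure_subadditive) measurable
    also have "\<dots> = 0" using r by simp
    finally have "emeasure lborel {x - r<..<x + r} = 0" by simp
    moreover have "0 < r" using r(1,2) by (simp add: r_def)
    ultimately show False by simp
  qed
  have "P 1 \<inter> {c<..<d} = {} \<or> P (-1) \<inter> {c<..<d} = {}"
    using connectedD[OF connected_Ioo opn opn _ cover] disj by blast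
  then have "{c<..<d} \<subseteq> P (-1) \<or> {c<..<d} \<subseteq> P 1" using cover by blast
  then have "\<exists>\<sigma>. (\<sigma> = 1 \<or> \<sigma> = -1) \<and> {c<..<d} \<subseteq> P (- \<sigma>)"
  proof
    assume "{c<..<d} \<subseteq> P (-1)" then show ?thesis by (intro exI[of _ 1]) simp
  next
    assume "{c<..<d} \<subseteq> P 1" then show ?thesis by (intro exI[of _ "-1"]) simp
  qed
  then obtain \<sigma> where \<sigma>: "\<sigma> = 1 \<or> \<sigma> = -1" "{c<..<d} \<subseteq> P (- \<sigma>)" by blast
  define S where "S = {y. w y = - \<sigma>} \<inter> {c<..<d}"
  have [measurable]: "S \<in> sets borel" unfolding S_def by measurable
  have "negligible S"
  proof (rule locally_negligible_alt[THEN iffD2], rule ballI)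
    fix x assume x: "x \<in> S"
    then have "x \<in> P (- \<sigma>)" using \<sigma>(2) by (auto simp: S_def)
    then obtain r where r: "r > 0" "emeasure lborel ({y. w y = - \<sigma>} \<inter> {x - r<..<x + r}) = 0" by (auto simp: P_def)
    have "{y. w y = - \<sigma>} \<inter> {x - r<..<x + r} \<in> null_sets lborel" using r(2) by (intro null_setsI) measurable
    then have "negligible ({y. w y = - \<sigma>} \<inter> {x - r<..<x + r})" unfolding negligible_iff_null_sets by (rule null_sets_completionI)
    then have "negligible (S \<inter> {x - r<..<x + r})" by (rule negligible_subset) (auto simp: S_def)
    moreover have "openin (top_of_set S) (S \<inter> {x - r<..<x + r})" by (rule openin_open_Int) simp
    ultimately show "\<exists>U. openin (top_of_set S) U \<and> x \<in> U \<and> negligible U" using x r(1) by (intro exI[of _ "S \<inter> {x - r<..<x + r}"]) auto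
  qed
  then have "S \<in> null_sets lebesgue" by (simp only: negligible_iff_null_sets)
  then have "AE x in lebesgue. x \<notin> S" by (rule AE_not_in)
  then have "AE x in lborel. x \<notin> S" by (rule AE_lborel_of_lebesgue)
  then have "AE x in lborel. x \<in> {c<..<d} \<longrightarrow> w x = \<sigma>"
  proof (rule eventually_mono)
    fix x assume "x \<notin> S"
    then show "x \<in> {c<..<d} \<longrightarrow> w x = \<sigma>" using pm[of x] \<sigma>(1) by (auto simp: S_def)
  qed
  then show ?thesis using that \<sigma>(1) by blast
qed

lemma not_in_ess_jumps_if_constant:
  assumes w [measurable]: "w \<in> borel_measurable borel" and r: "0 < r" and ae: "AE y in lborel. y \<in> {x - r<..<x + r} \<longrightarrow> w y = \<sigma>"
  shows "x \<notin> ess_jumps w"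
proof
  assume "x \<in> ess_jumps w"
  then have pos: "emeasure lborel ({y. w y = \<tau>} \<inter> {x - r<..<x + r}) > 0" if "\<tau> = 1 \<or> \<tau> = -1" for \<tau> using r that by (auto simp: ess_jumps_def)
  define \<tau> :: real where "\<tau> = (if \<sigma> = 1 then -1 else 1)"
  have "AE y in lborel. y \<notin> {y. w y = \<tau>} \<inter> {x - r<..<x + r}" using ae by (rule eventually_mono) (auto simp: \<tau>_def)
  then have "emeasure lborel ({y. w y = \<tau>} \<inter> {x - r<..<x + r}) = 0"
    by (subst (asm) AE_iff_measurable[of "{y. w y = \<tau>} \<inter> {x - r<..<x + r}"]) auto
  moreover have "\<tau> = 1 \<or> \<tau> = -1" by (simp add: \<tau>_def)
  ultimately show False using pos[of \<tau>] by simp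
qed

text \<open>Counting only points strictly to the left makes the value at a jump the one on its left;
  \<open>glue\<close> uses this value as the direction of the jump.\<close>

definition step_fun :: "real \<Rightarrow> real set \<Rightarrow> real \<Rightarrow> real" where
  "step_fun \<sigma> J x = \<sigma> * (-1) ^ card (J \<inter> {..<x})"

lemma finite_ess_jumps_isolated:
  assumes "finite J" "x \<in> {0<..<(1::real)}"
  obtains r where "0 < r" "{x - r<..<x + r} \<subseteq> {0<..<1}" "J \<inter> {x - r<..<x + r} \<subseteq> {x}"
proof -
  have "open ({0<..<1} - (J - {x}))" using assms(1) by (intro open_Diff finite_imp_closed) auto
  moreover have "x \<in> {0<..<1} - (J - {x})" using assms(2) by auto
  ultimately obtain r where r: "0 < r" "ball x r \<subseteq> {0<..<1} - (J - {x})" using open_contains_ball by metis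
  then show ?thesis using that[of r] unfolding ball_eq_greaterThanLessThan by blast
qed

lemma card_left:
  fixes x :: real
  assumes J: "finite J" "J \<inter> {x - r<..<x + r} \<subseteq> {x}"
  shows "y \<in> {x - r<..x} \<Longrightarrow> J \<inter> {..<y} = J \<inter> {..<x}"
    "y \<in> {x<..<x + r} \<Longrightarrow> J \<inter> {..<y} = (if x \<in> J then insert x (J \<inter> {..<x}) else J \<inter> {..<x})"
proof -
  have *: "z = x" if "z \<in> J" "x - r < z" "z < x + r" for z using J(2) that by auto
  show "J \<inter> {..<y} = J \<inter> {..<x}" if y: "y \<in> {x - r<..x}"
  proof -
    have "z < y \<longleftrightarrow> z < x" if "z \<in> J" for z using *[OF that] y by (cases "z < x") force+
    then show ?thesis by auto
  qed
  show "J \<inter> {..<y} = (if x \<in> J then insert x (J \<inter> {..<x}) else J \<inter> {..<x})" if y: "y \<in> {x<..<x + r}"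
  proof -
    have "z < y \<longleftrightarrow> z \<le> x" if "z \<in> J" for z using *[OF that] y by (cases "z \<le> x") force+
    then show ?thesis by (auto simp: less_le)
  qed
qed

lemma step_fun_sides:
  assumes J: "finite J" "J \<inter> {x - r<..<x + r} \<subseteq> {x}"
  shows "y \<in> {x - r<..x} \<Longrightarrow> step_fun \<sigma> J y = step_fun \<sigma> J x"
    "y \<in> {x<..<x + r} \<Longrightarrow> step_fun \<sigma> J y = (if x \<in> J then - step_fun \<sigma> J x else step_fun \<sigma> J x)"
  using card_left[OF J, of y] J(1) unfolding step_fun_def by auto

text \<open>Multiplying \<open>w\<close> by the alternating step function \<open>k\<close> cancels
  every jump, so the product has no jump point and is constant by
  \<open>jump_free_constant\<close>.\<close>

lemma finite_ess_jumps_step: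
  assumes w [measurable]: "w \<in> borel_measurable borel" and pm: "\<And>x. w x = 1 \<or> w x = -1" and J: "finite (ess_jumps w)"
  obtains \<sigma> where "\<sigma> = 1 \<or> \<sigma> = -1" "AE x in lborel. x \<in> {0<..<1} \<longrightarrow> w x = step_fun \<sigma> (ess_jumps w) x"
proof -
  define k where "k x = step_fun 1 (ess_jumps w) x" for x
  have k1: "k x = 1 \<or> k x = -1" for x unfolding k_def step_fun_def using minus_one_power_iff[of "card (ess_jumps w \<inter> {..<x})", where 'a = real] by (auto split: if_splits)
  have kk: "k x * k x = 1" for x using k1[of x] by auto
  have km [measurable]: "k \<in> borel_measurable borel"
  proof -
    have "mono (\<lambda>x. real (card (ess_jumps w \<inter> {..<x})))"
      by (intro monoI of_nat_mono card_mono) (use J in auto)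
    then have [measurable]: "(\<lambda>x. real (card (ess_jumps w \<inter> {..<x}))) \<in> borel_measurable borel" by (rule borel_measurable_mono)
    \<comment> \<open>The count takes only finitely many values, so its parity is a Borel condition
      in this form.\<close>
    have "k x = (if \<exists>n\<in>{..card (ess_jumps w)}. even n \<and> real (card (ess_jumps w \<inter> {..<x})) = real n then 1 else -1)" for x
    proof -
      have "card (ess_jumps w \<inter> {..<x}) \<le> card (ess_jumps w)" by (intro card_mono J) auto
      then show ?thesis by (auto simp: k_def step_fun_def minus_one_power_iff)
    qed
    moreover have "(\<lambda>x. if \<exists>n\<in>{..card (ess_jumps w)}. even n \<and> real (card (ess_jumps w \<inter> {..<x})) = real n then 1 else -1 :: real) \<in> borel_measurable borel"
      by measurable
    ultimately show ?thesis by (simp add: fun_eq_iff[symmetric] cong: measurable_cong)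
  qed
  define g where "g x = w x * k x" for x
  have g [measurable]: "g \<in> borel_measurable borel" unfolding g_def by measurable
  have gpm: "g x = 1 \<or> g x = -1" for x using pm[of x] k1[of x] by (auto simp: g_def)
  have free: "x \<notin> ess_jumps g" if x: "x \<in> {0<..<1}" for x
  proof -
    obtain r where r: "0 < r" "{x - r<..<x + r} \<subseteq> {0<..<1}" "ess_jumps w \<inter> {x - r<..<x + r} \<subseteq> {x}"
      using finite_ess_jumps_isolated[OF J x] by blast
    obtain \<sigma>1 where \<sigma>a: "\<sigma>1 = 1 \<or> \<sigma>1 = -1" "AE y in lborel. y \<in> {x - r<..<x} \<longrightarrow> w y = \<sigma>1"
      by (rule jump_free_constant[OF w pm, of "x - r" x]) (use r in auto)
    obtain \<sigma>2 where \<sigma>b: "\<sigma>2 = 1 \<or> \<sigma>2 = -1" "AE y in lborel. y \<in> {x<..<x + r} \<longrightarrow> w y = \<sigma>2"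
      by (rule jump_free_constant[OF w pm, of x "x + r"]) (use r in auto)
    have \<sigma>: "\<sigma>1 = 1 \<or> \<sigma>1 = -1" "AE y in lborel. y \<in> {x - r<..<x} \<longrightarrow> w y = \<sigma>1"
       "\<sigma>2 = 1 \<or> \<sigma>2 = -1" "AE y in lborel. y \<in> {x<..<x + r} \<longrightarrow> w y = \<sigma>2"
      using \<sigma>a \<sigma>b by blast+
    have nx: "AE y in lborel. y \<noteq> x" by (rule AE_lborel_singleton)
    \<comment> \<open>The two sides of \<open>x\<close> carry different constants exactly at a jump
      point, which is exactly where \<open>k\<close> changes sign.\<close>
    have eq: "\<sigma>2 = (if x \<in> ess_jumps w then - \<sigma>1 else \<sigma>1)"
    proof (cases "x \<in> ess_jumps w")
      case True
      have "\<sigma>2 \<noteq> \<sigma>1"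
      proof
        assume e: "\<sigma>2 = \<sigma>1"
        have "AE y in lborel. y \<in> {x - r<..<x + r} \<longrightarrow> w y = \<sigma>1"
          using \<sigma>(2,4) nx by eventually_elim (use e in force)
        then show False using not_in_ess_jumps_if_constant[OF w r(1)] True by blast
      qed
      then show ?thesis using True \<sigma>(1,3) by auto
    next
      case False
      then have "{x - r<..<x + r} \<inter> ess_jumps w = {}" using r(3) by auto
      then obtain \<sigma>3 where \<sigma>3: "AE y in lborel. y \<in> {x - r<..<x + r} \<longrightarrow> w y = \<sigma>3" using jump_free_constant[OF w pm r(2)] by blast
      have ex: "\<exists>y\<in>{c<..<d}. Q y" if "AE y in lborel. Q y" "c < d" for Q and c d :: real
      proof (rule ccontr)
        assume "\<not> (\<exists>y\<in>{c<..<d}. Q y)"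
        then have "AE y in lborel. y \<notin> {c<..<d}" using that(1) by (auto elim!: eventually_mono)
        then have "emeasure lborel {c<..<d} = 0" by (subst (asm) AE_iff_measurable[of "{c<..<d}"]) auto
        then show False using that(2) by simp
      qed
      have "AE y in lborel. (y \<in> {x - r<..<x} \<longrightarrow> w y = \<sigma>1) \<and> (y \<in> {x - r<..<x + r} \<longrightarrow> w y = \<sigma>3)" using \<sigma>(2) \<sigma>3 by eventually_elim auto
      from ex[OF this, of "x - r" x] have "\<sigma>1 = \<sigma>3" using r(1) by auto
      moreover have "AE y in lborel. (y \<in> {x<..<x + r} \<longrightarrow> w y = \<sigma>2) \<and> (y \<in> {x - r<..<x + r} \<longrightarrow> w y = \<sigma>3)" using \<sigma>(4) \<sigma>3 by eventually_elim auto
      from ex[OF this, of x "x + r"] have "\<sigma>2 = \<sigma>3" using r(1) by auto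
      ultimately show ?thesis using False by simp
    qed
    have "AE y in lborel. y \<in> {x - r<..<x + r} \<longrightarrow> g y = \<sigma>1 * k x"
      using \<sigma>(2,4) nx
    proof eventually_elim
      case (elim y)
      show ?case
      proof
        assume y: "y \<in> {x - r<..<x + r}"
        show "g y = \<sigma>1 * k x"
        proof (cases "y < x")
          case True
          then show ?thesis using elim(1) y step_fun_sides(1)[OF J r(3), of y 1] by (simp add: g_def k_def)
        next
          case False
          then have "x < y" using elim(3) by simp
          then show ?thesis using elim(2) y step_fun_sides(2)[OF J r(3), of y 1] eq by (simp add: g_def k_def split: if_splits)
        qed
      qed
    qed
    then show ?thesis by (rule not_in_ess_jumps_if_constant[OF g r(1)])
  qed
  then have "{0<..<1} \<inter> ess_jumps g = {}" by auto
  then obtain \<sigma> where \<sigma>: "\<sigma> = 1 \<or> \<sigma> = -1" "AE x in lborel. x \<in> {0<..<1} \<longrightarrow> g x = \<sigma>"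
    using jump_free_constant[OF g gpm order_refl] by blast
  show ?thesis
  proof (rule that[OF \<sigma>(1)])
    show "AE x in lborel. x \<in> {0<..<1} \<longrightarrow> w x = step_fun \<sigma> (ess_jumps w) x"
      using \<sigma>(2)
    proof (rule eventually_mono)
      fix x assume x: "x \<in> {0<..<1} \<longrightarrow> g x = \<sigma>"
      have "w x = g x * k x" unfolding g_def using kk[of x] by (simp add: mult.assoc)
      moreover have "step_fun \<sigma> (ess_jumps w) x = \<sigma> * k x" by (simp add: step_fun_def k_def)
      ultimately show "x \<in> {0<..<1} \<longrightarrow> w x = step_fun \<sigma> (ess_jumps w) x" using x by simp
    qed
  qed
qed

text \<open>Crossing \<open>z\<close> replaces the value at \<open>z\<close> by its negative, an
  increment of minus twice that value. The sum form is visibly Borel, can be integrated term by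
  term, and is the pattern for \<open>glue\<close>.\<close>

lemma step_fun_telescope:
  assumes J: "finite J" shows "step_fun \<sigma> J x = \<sigma> - 2 * (\<Sum>z\<in>J \<inter> {..<x}. step_fun \<sigma> J z)"
proof (induction "card (J \<inter> {..<x})" arbitrary: x)
  case 0
  then have "J \<inter> {..<x} = {}" using J by simp
  then show ?case by (simp add: step_fun_def)
next
  case (Suc n)
  have fin: "finite (J \<inter> {..<x})" "J \<inter> {..<x} \<noteq> {}" using J Suc(2) by auto
  define z where "z = Max (J \<inter> {..<x})"
  have z: "z \<in> J \<inter> {..<x}" "\<And>y. y \<in> J \<inter> {..<x} \<Longrightarrow> y \<le> z"
    unfolding z_def by (rule Max_in[OF fin], rule Max_ge[OF fin(1)])
  have eq: "J \<inter> {..<x} = insert z (J \<inter> {..<z})" using z by force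
  have c: "card (J \<inter> {..<x}) = Suc (card (J \<inter> {..<z}))" unfolding eq using J by simp
  then have IH: "step_fun \<sigma> J z = \<sigma> - 2 * (\<Sum>y\<in>J \<inter> {..<z}. step_fun \<sigma> J y)" using Suc by (intro Suc(1)) simp
  have "step_fun \<sigma> J x = - step_fun \<sigma> J z" unfolding step_fun_def c by simp
  also have "\<dots> = step_fun \<sigma> J z - 2 * step_fun \<sigma> J z" by simp
  also have "\<dots> = \<sigma> - 2 * (\<Sum>y\<in>J \<inter> {..<x}. step_fun \<sigma> J y)" unfolding eq using J by (subst IH) (simp add: algebra_simps)
  finally show ?case .
qed

lemma step_fun_pm1: "\<sigma> = 1 \<or> \<sigma> = -1 \<Longrightarrow> step_fun \<sigma> J x = 1 \<or> step_fun \<sigma> J x = -1"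
  unfolding step_fun_def by (cases "even (card (J \<inter> {..<x}))") auto

text \<open>By the fundamental theorem of calculus each term of the telescoped form contributes a
  difference of two values of the test function, at most \<open>2\<close> in modulus; the terms at
  jumps carry the factor \<open>2\<close>.\<close>

lemma total_variation_step_bound:
  assumes u: "u \<in> borel_measurable (lebesgue_on {0<..<1})" and ae: "AE x in lborel. x \<in> {0<..<1} \<longrightarrow> u x = step_fun \<sigma> J x"
    and \<sigma>: "\<sigma> = 1 \<or> \<sigma> = -1" and J: "finite J" "J \<subseteq> {0<..<1}"
  shows "total_variation {0<..<1} u \<le> ereal (2 + 4 * real (card J))"
  unfolding total_variation_def
proof (rule SUP_least)
  fix \<phi> assume "\<phi> \<in> {\<phi> \<in> test_functions {0<..<1}. \<forall>x. \<bar>\<phi> x\<bar> \<le> 1}"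
  then have \<phi>: "\<phi> C1_differentiable_on UNIV" "\<And>x. \<bar>\<phi> x\<bar> \<le> 1" by (auto simp: test_functions_def)
  then obtain D where D: "\<And>x. (\<phi> has_vector_derivative D x) (at x)" "continuous_on UNIV D" unfolding C1_differentiable_on_def by auto
  have der: "(\<phi> has_real_derivative D x) (at x)" for x using D(1) by (simp add: has_real_derivative_iff_has_vector_derivative)
  have deriv: "deriv \<phi> = D" using DERIV_imp_deriv[OF der] by auto
  have Dm [measurable]: "D \<in> borel_measurable borel" using D(2) by (rule borel_measurable_continuous_onI)
  have FTC: "has_bochner_integral lborel (\<lambda>x. D x * indicator {a..1} x) (\<phi> 1 - \<phi> a)" if "a \<le> 1" for a
    by (rule has_bochner_integral_FTC_Icc_real[OF that der]) (use D(2) in \<open>simp add: continuous_on_eq_continuous_at\<close>)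
  define w where "w x = \<sigma> - 2 * (\<Sum>z\<in>J. step_fun \<sigma> J z * indicator {z<..} x)" for x
  have w [measurable]: "w \<in> borel_measurable borel" unfolding w_def by measurable
  have "step_fun \<sigma> J x = w x" for x
  proof -
    have "(\<Sum>z\<in>J \<inter> {..<x}. step_fun \<sigma> J z) = (\<Sum>z\<in>J. step_fun \<sigma> J z * indicator {z<..} x)"
      by (rule sum.mono_neutral_cong_left) (use J in \<open>auto simp: indicator_def\<close>)
    then show ?thesis using step_fun_telescope[OF J(1), of \<sigma> x] by (simp add: w_def)
  qed
  then have ae': "AE x in lborel. x \<in> {0<..<1} \<longrightarrow> u x = w x" using ae by simp
  have "(\<integral>x. u x * deriv \<phi> x \<partial>lebesgue_on {0<..<1}) = (\<integral>x. indicator {0<..<1} x * (w x * D x) \<partial>lborel)"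
    unfolding deriv by (rule variation_integral_eq[OF u ae' w Dm])
  also have "\<dots> = (\<integral>x. \<sigma> * (D x * indicator {0..1} x) - 2 * (\<Sum>z\<in>J. step_fun \<sigma> J z * (D x * indicator {z..1} x)) \<partial>lborel)"
  proof (rule integral_cong_AE)
    have "AE x in lborel. x \<notin> J \<union> {0, 1}" using J(1) by (intro AE_not_in finite_imp_null_set_lborel) auto
    then show "AE x in lborel. indicator {0<..<1} x * (w x * D x) = \<sigma> * (D x * indicator {0..1} x) - 2 * (\<Sum>z\<in>J. step_fun \<sigma> J z * (D x * indicator {z..1} x))"
    proof (rule eventually_mono)
      fix x assume x: "x \<notin> J \<union> {0, 1}"
      show "indicator {0<..<1} x * (w x * D x) = \<sigma> * (D x * indicator {0..1} x) - 2 * (\<Sum>z\<in>J. step_fun \<sigma> J z * (D x * indicator {z..1} x))"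
      proof (cases "x \<in> {0<..<1}")
        case True
        have "(\<Sum>z\<in>J. step_fun \<sigma> J z * (D x * indicator {z..1} x)) = (\<Sum>z\<in>J. step_fun \<sigma> J z * indicator {z<..} x) * D x"
          unfolding sum_distrib_right using True x by (intro sum.cong refl) (auto simp: indicator_def less_le)
        then show ?thesis using True by (simp add: w_def left_diff_distrib)
      next
        case False
        then have "(\<Sum>z\<in>J. step_fun \<sigma> J z * (D x * indicator {z..1} x)) = 0"
          using x J(2) by (intro sum.neutral) (auto simp: indicator_def)
        then show ?thesis using False x by (auto simp: indicator_def)
      qed
    qed
  next
    show "(\<lambda>x. indicator {0<..<1} x * (w x * D x)) \<in> borel_measurable lborel"
      by (intro borel_measurable_times borel_measurable_indicator) (use w Dm in auto)
    have "(\<lambda>x. step_fun \<sigma> J z * (D x * indicator {z..1} x)) \<in> borel_measurable lborel" for z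
      by (intro borel_measurable_times borel_measurable_indicator borel_measurable_const) (use Dm in auto)
    moreover have "(\<lambda>x. \<sigma> * (D x * indicator {0..1} x)) \<in> borel_measurable lborel"
      by (intro borel_measurable_times borel_measurable_indicator borel_measurable_const) (use Dm in auto)
    ultimately show "(\<lambda>x. \<sigma> * (D x * indicator {0..1} x) - 2 * (\<Sum>z\<in>J. step_fun \<sigma> J z * (D x * indicator {z..1} x))) \<in> borel_measurable lborel"
      by (intro borel_measurable_diff borel_measurable_times[OF borel_measurable_const borel_measurable_sum]) auto
  qed
  also have "\<dots> = \<sigma> * (\<phi> 1 - \<phi> 0) - 2 * (\<Sum>z\<in>J. step_fun \<sigma> J z * (\<phi> 1 - \<phi> z))"
  proof (rule has_bochner_integral_integral_eq)
    show "has_bochner_integral lborel (\<lambda>x. \<sigma> * (D x * indicator {0..1} x) - 2 * (\<Sum>z\<in>J. step_fun \<sigma> J z * (D x * indicator {z..1} x)))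
      (\<sigma> * (\<phi> 1 - \<phi> 0) - 2 * (\<Sum>z\<in>J. step_fun \<sigma> J z * (\<phi> 1 - \<phi> z)))"
      by (intro has_bochner_integral_diff has_bochner_integral_mult_right has_bochner_integral_sum FTC) (use J(2) in auto)
  qed
  also have "\<dots> \<le> 2 + 2 * (\<Sum>z\<in>J. 2)"
  proof -
    have "\<bar>\<tau> * (\<phi> 1 - \<phi> z)\<bar> \<le> 2" if "\<tau> = 1 \<or> \<tau> = -1" for \<tau> z using \<phi>(2)[of 1] \<phi>(2)[of z] that by (elim disjE; simp)
    then have b: "\<bar>\<sigma> * (\<phi> 1 - \<phi> 0)\<bar> \<le> 2" "\<And>z. \<bar>step_fun \<sigma> J z * (\<phi> 1 - \<phi> z)\<bar> \<le> 2" using \<sigma> step_fun_pm1[OF \<sigma>] by blast+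
    have "\<bar>\<Sum>z\<in>J. step_fun \<sigma> J z * (\<phi> 1 - \<phi> z)\<bar> \<le> (\<Sum>z\<in>J. 2)" by (rule order_trans[OF sum_abs]) (intro sum_mono b)
    then show ?thesis using b(1) by linarith
  qed
  finally show "ereal (\<integral>x. u x * deriv \<phi> x \<partial>lebesgue_on {0<..<1}) \<le> ereal (2 + 4 * real (card J))" by simp
qed

lemma one_sided_mean_constant:
  assumes c: "c < d" and sub: "{c<..<d} \<subseteq> {a<..<b}" and ae: "AE y in lborel. y \<in> {a<..<b} \<longrightarrow> u y = \<sigma>"
  shows "(\<integral>\<^sup>+ y. ennreal \<bar>u y - t\<bar> \<partial>lebesgue_on {c<..<d}) / ennreal (d - c) = ennreal \<bar>\<sigma> - t\<bar>"
proof -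
  have "(\<integral>\<^sup>+ y. ennreal \<bar>u y - t\<bar> \<partial>lebesgue_on {c<..<d}) = (\<integral>\<^sup>+ y. ennreal \<bar>u y - t\<bar> * indicator {c<..<d} y \<partial>lborel)"
    by (rule nn_integral_lebesgue_on) simp
  also have "\<dots> = (\<integral>\<^sup>+ y. ennreal \<bar>\<sigma> - t\<bar> * indicator {c<..<d} y \<partial>lborel)"
    by (rule nn_integral_cong_AE) (use ae sub in \<open>auto elim!: eventually_mono simp: indicator_def\<close>)
  also have "\<dots> = ennreal (\<bar>\<sigma> - t\<bar> * (d - c))" using c by (simp add: nn_integral_cmult_indicator ennreal_mult)
  finally show ?thesis using c by (simp add: divide_ennreal)
qed

text \<open>Around any point the function is constant on either side, so the one-sided mean
  deviations tend to \<open>0\<close> exactly for these two constants, and they differ exactly at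
  the points of \<open>ess_jumps\<close>.\<close>

lemma jump_set_eq:
  assumes w [measurable]: "w \<in> borel_measurable borel" and pm: "\<And>x. w x = 1 \<or> w x = -1" and J: "finite (ess_jumps w)"
    and ae: "AE x in lborel. x \<in> {0<..<1} \<longrightarrow> u x = w x"
  shows "jump_set u = ess_jumps w"
proof -
  have sides: "\<exists>r \<sigma>1 \<sigma>2. 0 < r \<and> (AE y in lborel. y \<in> {x - r<..<x} \<longrightarrow> u y = \<sigma>1) \<and> (AE y in lborel. y \<in> {x<..<x + r} \<longrightarrow> u y = \<sigma>2) \<and> (x \<in> ess_jumps w \<longleftrightarrow> \<sigma>1 \<noteq> \<sigma>2)"
    if x: "x \<in> {0<..<1}" for x
  proof -
    obtain \<sigma> where \<sigma>: "\<sigma> = 1 \<or> \<sigma> = -1" "AE x in lborel. x \<in> {0<..<1} \<longrightarrow> w x = step_fun \<sigma> (ess_jumps w) x" by (rule finite_ess_jumps_step[OF w pm J])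
    obtain r where r: "0 < r" "{x - r<..<x + r} \<subseteq> {0<..<1}" "ess_jumps w \<inter> {x - r<..<x + r} \<subseteq> {x}"
      using finite_ess_jumps_isolated[OF J x] by blast
    define S where "S = step_fun \<sigma> (ess_jumps w)"
    have S: "S x \<noteq> 0" unfolding S_def using step_fun_pm1[OF \<sigma>(1), of "ess_jumps w" x] by auto
    have "AE y in lborel. y \<in> {x - r<..<x} \<longrightarrow> u y = S x" using ae \<sigma>(2)
    proof eventually_elim
      case (elim y)
      show ?case
      proof
        assume y: "y \<in> {x - r<..<x}"
        then have y': "y \<in> {x - r<..<x + r}" "y \<in> {x - r<..x}" using r(1) by auto
        then have "y \<in> {0<..<1}" using r(2) by blast
        then have "u y = step_fun \<sigma> (ess_jumps w) y" using elim by simp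
        then show "u y = S x" unfolding S_def using step_fun_sides(1)[OF J r(3) y'(2), of \<sigma>] by simp
      qed
    qed
    moreover have "AE y in lborel. y \<in> {x<..<x + r} \<longrightarrow> u y = (if x \<in> ess_jumps w then - S x else S x)" using ae \<sigma>(2)
    proof eventually_elim
      case (elim y)
      show ?case
      proof
        assume y: "y \<in> {x<..<x + r}"
        then have "y \<in> {x - r<..<x + r}" using r(1) by simp
        then have "y \<in> {0<..<1}" using r(2) by blast
        then have "u y = S y" using elim by (simp add: S_def)
        then show "u y = (if x \<in> ess_jumps w then - S x else S x)" using step_fun_sides(2)[OF J r(3) y, of \<sigma>] by (simp add: S_def)
      qed
    qed
    ultimately show ?thesis using r(1) S by (intro exI[of _ r] exI[of _ "S x"] exI[of _ "if x \<in> ess_jumps w then - S x else S x"]) simp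
  qed
  have lim: "((\<lambda>\<rho>. (\<integral>\<^sup>+ y. ennreal \<bar>u y - t\<bar> \<partial>lebesgue_on {x - \<rho><..<x}) / ennreal \<rho>) \<longlongrightarrow> 0) (at_right 0) \<longleftrightarrow> t = \<sigma>"
      "((\<lambda>\<rho>. (\<integral>\<^sup>+ y. ennreal \<bar>u y - t\<bar> \<partial>lebesgue_on {x<..<x + \<rho>}) / ennreal \<rho>) \<longlongrightarrow> 0) (at_right 0) \<longleftrightarrow> t = \<tau>"
    if r: "0 < r" and l: "AE y in lborel. y \<in> {x - r<..<x} \<longrightarrow> u y = \<sigma>" and rr: "AE y in lborel. y \<in> {x<..<x + r} \<longrightarrow> u y = \<tau>" for x r \<sigma> \<tau> t
  proof -
    have const: "((\<lambda>\<rho>::real. ennreal \<bar>a - t\<bar>) \<longlongrightarrow> 0) (at_right 0) \<longleftrightarrow> t = a" for a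
      by (auto simp: tendsto_const_iff)
    have ev: "\<forall>\<^sub>F \<rho> in at_right 0. 0 < \<rho> \<and> \<rho> < r" using r by (auto simp: eventually_at_right)
    have "((\<lambda>\<rho>. (\<integral>\<^sup>+ y. ennreal \<bar>u y - t\<bar> \<partial>lebesgue_on {x - \<rho><..<x}) / ennreal \<rho>) \<longlongrightarrow> 0) (at_right 0) \<longleftrightarrow> ((\<lambda>\<rho>::real. ennreal \<bar>\<sigma> - t\<bar>) \<longlongrightarrow> 0) (at_right 0)"
    proof (rule tendsto_cong, use ev in eventually_elim)
      case (elim \<rho>)
      then have "x - \<rho> < x" "{x - \<rho><..<x} \<subseteq> {x - r<..<x}" by auto
      then show ?case using one_sided_mean_constant[OF _ _ l, of "x - \<rho>" x t] by simp
    qed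
    then show "((\<lambda>\<rho>. (\<integral>\<^sup>+ y. ennreal \<bar>u y - t\<bar> \<partial>lebesgue_on {x - \<rho><..<x}) / ennreal \<rho>) \<longlongrightarrow> 0) (at_right 0) \<longleftrightarrow> t = \<sigma>" unfolding const .
    have "((\<lambda>\<rho>. (\<integral>\<^sup>+ y. ennreal \<bar>u y - t\<bar> \<partial>lebesgue_on {x<..<x + \<rho>}) / ennreal \<rho>) \<longlongrightarrow> 0) (at_right 0) \<longleftrightarrow> ((\<lambda>\<rho>::real. ennreal \<bar>\<tau> - t\<bar>) \<longlongrightarrow> 0) (at_right 0)"
    proof (rule tendsto_cong, use ev in eventually_elim)
      case (elim \<rho>)
      then have "x < x + \<rho>" "{x<..<x + \<rho>} \<subseteq> {x<..<x + r}" by auto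
      then show ?case using one_sided_mean_constant[OF _ _ rr, of x "x + \<rho>" t] by simp
    qed
    then show "((\<lambda>\<rho>. (\<integral>\<^sup>+ y. ennreal \<bar>u y - t\<bar> \<partial>lebesgue_on {x<..<x + \<rho>}) / ennreal \<rho>) \<longlongrightarrow> 0) (at_right 0) \<longleftrightarrow> t = \<tau>" unfolding const .
  qed
  show ?thesis
  proof (rule set_eqI)
    fix x
    show "x \<in> jump_set u \<longleftrightarrow> x \<in> ess_jumps w"
    proof (cases "x \<in> {0<..<1}")
      case True
      then obtain r \<sigma>1 \<sigma>2 where *: "0 < r" "AE y in lborel. y \<in> {x - r<..<x} \<longrightarrow> u y = \<sigma>1" "AE y in lborel. y \<in> {x<..<x + r} \<longrightarrow> u y = \<sigma>2" "x \<in> ess_jumps w \<longleftrightarrow> \<sigma>1 \<noteq> \<sigma>2"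
        using sides by blast
      have "x \<in> jump_set u \<longleftrightarrow> (\<exists>a b. a \<noteq> b \<and> a = \<sigma>1 \<and> b = \<sigma>2)"
        unfolding jump_set_def mem_Collect_eq lim[OF *(1-3)] using True by blast
      then show ?thesis using *(4) by blast
    qed (auto simp: jump_set_def ess_jumps_def)
  qed
qed

text \<open>With finitely many jump points \<open>u\<close> is a step function almost everywhere,
  hence of bounded variation with the same jump set. With infinitely many,
  \<open>total_variation_ge_card\<close> makes the variation infinite, and both sides are
  infinite.\<close>

lemma F0_eq_count:
  assumes u: "u \<in> borel_measurable (lebesgue_on {0<..<1})" and w [measurable]: "w \<in> borel_measurable borel" and pm: "\<And>x. w x = 1 \<or> w x = -1"
    and ae: "AE x in lborel. x \<in> {0<..<1} \<longrightarrow> u x = w x"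
  shows "F0 u = emeasure (count_space UNIV) (ess_jumps w)"
proof (cases "finite (ess_jumps w)")
  case True
  obtain \<sigma> where \<sigma>: "\<sigma> = 1 \<or> \<sigma> = -1" "AE x in lborel. x \<in> {0<..<1} \<longrightarrow> w x = step_fun \<sigma> (ess_jumps w) x" by (rule finite_ess_jumps_step[OF w pm True])
  have ae2: "AE x in lborel. x \<in> {0<..<1} \<longrightarrow> u x = step_fun \<sigma> (ess_jumps w) x" using ae \<sigma>(2) by eventually_elim auto
  have "total_variation {0<..<1} u \<le> ereal (2 + 4 * real (card (ess_jumps w)))"
    by (rule total_variation_step_bound[OF u ae2 \<sigma>(1) True]) (auto simp: ess_jumps_def)
  also have "\<dots> < \<infinity>" by simp
  finally have tv: "total_variation {0<..<1} u < \<infinity>" .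
  have pmu: "AE x in lebesgue_on {0<..<1}. u x \<in> {-1, 1}"
  proof (subst AE_lebesgue_on_iff)
    show "AE x in lborel. x \<in> {0<..<1} \<longrightarrow> u x \<in> {-1, 1}" using ae
    proof eventually_elim
      case (elim x)
      then show ?case using pm[of x] by auto
    qed
  qed simp
  have "integrable (lebesgue_on {0<..<1}) u"
  proof (rule integrableI_bounded[OF u])
    have "(\<integral>\<^sup>+ x. ennreal (norm (u x)) \<partial>lebesgue_on {0<..<1}) = (\<integral>\<^sup>+ x. 1 \<partial>lebesgue_on {0<..<1::real})"
      by (rule nn_integral_cong_AE) (use pmu in \<open>auto elim!: eventually_mono\<close>)
    also have "\<dots> < \<infinity>" by (simp add: emeasure_restrict_space)
    finally show "(\<integral>\<^sup>+ x. ennreal (norm (u x)) \<partial>lebesgue_on {0<..<1}) < \<infinity>" .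
  qed
  then have "u \<in> BV_pm1" using tv pmu by (simp add: BV_pm1_def BV_def)
  then show ?thesis unfolding F0_def jump_set_eq[OF w pm True ae] by simp
next
  case False
  have "u \<notin> BV_pm1"
  proof
    assume "u \<in> BV_pm1"
    then have "total_variation {0<..<1} u < \<infinity>" by (simp add: BV_pm1_def BV_def)
    moreover have "ereal (real n) \<le> total_variation {0<..<1} u" for n
    proof -
      obtain T where T: "finite T" "card T = n" "T \<subseteq> ess_jumps w" using infinite_arbitrarily_large[OF False] by blast
      then show ?thesis using total_variation_ge_card[OF u ae w pm T(1,3)] by simp
    qed
    ultimately show False
    proof (cases "total_variation {0<..<1} u")
      case (real r)
      obtain n :: nat where "r < real n" using reals_Archimedean2 by blast
      then show ?thesis using \<open>\<And>n. ereal (real n) \<le> total_variation {0<..<1} u\<close>[of n] real by simp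
    next
      case MInf
      then show ?thesis using \<open>\<And>n. ereal (real n) \<le> total_variation {0<..<1} u\<close>[of 0] by simp
    qed simp
  qed
  then show ?thesis using False by (simp add: F0_def emeasure_count_space_infinite)
qed

lemma F0_not_pm1: "\<not> (AE x in lborel. x \<in> {0<..<1} \<longrightarrow> u x = 1 \<or> u x = -1) \<Longrightarrow> F0 u = \<infinity>"
  unfolding F0_def BV_pm1_def by (auto simp: AE_lebesgue_on_iff disj_commute)

subsection \<open>Gluing profiles\<close>

lemma sum_power2_single:
  fixes a :: "'a \<Rightarrow> real"
  assumes "finite J" "\<And>z z'. z \<in> J \<Longrightarrow> z' \<in> J \<Longrightarrow> a z \<noteq> 0 \<Longrightarrow> a z' \<noteq> 0 \<Longrightarrow> z = z'"
  shows "(\<Sum>z\<in>J. a z)\<^sup>2 = (\<Sum>z\<in>J. (a z)\<^sup>2)"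
proof (cases "\<exists>z0\<in>J. a z0 \<noteq> 0")
  case True
  then obtain z0 where z0: "z0 \<in> J" "a z0 \<noteq> 0" by blast
  have z: "a z = 0" if "z \<in> J - {z0}" for z using assms(2)[of z z0] z0 that by blast
  have "(\<Sum>z\<in>J. a z) = a z0" using sum.remove[OF assms(1) z0(1), of a] z by simp
  moreover have "(\<Sum>z\<in>J. (a z)\<^sup>2) = (a z0)\<^sup>2" using sum.remove[OF assms(1) z0(1), of "\<lambda>z. (a z)\<^sup>2"] z by simp
  ultimately show ?thesis by simp
qed simp

text \<open>The form of \<open>step_fun_telescope\<close> with each increment
  \<open>- 2 * step_fun \<sigma> J z\<close> smeared out by a rescaled profile. The factor
  \<open>- step_fun \<sigma> J z\<close> in the argument orients the profile from the value left of
  \<open>z\<close> to its negative.\<close>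

definition glue :: "(real \<Rightarrow> real) \<Rightarrow> real \<Rightarrow> real set \<Rightarrow> real \<Rightarrow> real \<Rightarrow> real" where
  "glue \<phi> \<sigma> J \<epsilon> x = \<sigma> + (\<Sum>z\<in>J. \<phi> (- step_fun \<sigma> J z * (x - z) / \<epsilon>) - step_fun \<sigma> J z)"

locale glue_profile =
  fixes \<phi> :: "real \<Rightarrow> real" and R M \<sigma> :: real and J :: "real set" and \<rho> \<epsilon> :: real
  assumes \<phi> [measurable]: "\<phi> \<in> borel_measurable borel" and low: "\<And>x. x \<le> - R \<Longrightarrow> \<phi> x = -1" and high: "\<And>x. R \<le> x \<Longrightarrow> \<phi> x = 1"
    and M: "\<And>x. \<bar>\<phi> x\<bar> \<le> M" and R: "0 < R" and \<sigma>: "\<sigma> = 1 \<or> \<sigma> = -1" and J: "finite J" "J \<subseteq> {0<..<1}" and \<epsilon>: "0 < \<epsilon>"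
begin

abbreviation "T \<equiv> step_fun \<sigma> J"
definition "g z x = \<phi> (- T z * (x - z) / \<epsilon>)"
abbreviation "v \<equiv> glue \<phi> \<sigma> J \<epsilon>"

lemma v_eq: "v x = \<sigma> + (\<Sum>z\<in>J. g z x - T z)" unfolding glue_def g_def ..

lemma T_cases: "T z = 1 \<or> T z = -1" by (rule step_fun_pm1[OF \<sigma>])

lemma g_measurable [measurable]: "g z \<in> borel_measurable borel" unfolding g_def[abs_def] by measurable

lemma v_measurable [measurable]: "v \<in> borel_measurable borel" unfolding v_eq[abs_def] by measurable

lemma g_left: "x \<le> z - R * \<epsilon> \<Longrightarrow> g z x = T z"
proof -
  assume x: "x \<le> z - R * \<epsilon>"
  then have "(x - z) / \<epsilon> \<le> - R" "R \<le> (z - x) / \<epsilon>" using \<epsilon> by (simp_all add: divide_le_eq le_divide_eq)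
  note * = low[OF this(1)] high[OF this(2)]
  have "- T z * (x - z) / \<epsilon> = (if T z = 1 then (z - x) / \<epsilon> else (x - z) / \<epsilon>)" using T_cases[of z] by (auto simp: diff_divide_distrib)
  then show ?thesis unfolding g_def using T_cases[of z] * by auto
qed

lemma g_right: "z + R * \<epsilon> \<le> x \<Longrightarrow> g z x = - T z"
proof -
  assume x: "z + R * \<epsilon> \<le> x"
  then have "R \<le> (x - z) / \<epsilon>" "(z - x) / \<epsilon> \<le> - R" using \<epsilon> by (simp_all add: divide_le_eq le_divide_eq)
  note * = high[OF this(1)] low[OF this(2)]
  have "- T z * (x - z) / \<epsilon> = (if T z = 1 then (z - x) / \<epsilon> else (x - z) / \<epsilon>)" using T_cases[of z] by (auto simp: diff_divide_distrib)
  then show ?thesis unfolding g_def using T_cases[of z] * by auto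
qed

lemma v_far:
  assumes far: "\<And>z. z \<in> J \<Longrightarrow> R * \<epsilon> \<le> \<bar>x - z\<bar>"
  shows "v x = T x"
proof -
  have R\<epsilon>: "0 < R * \<epsilon>" using R \<epsilon> by simp
  have "(\<Sum>z\<in>J. g z x - T z) = (\<Sum>z\<in>J. if z \<in> {..<x} then - 2 * T z else 0)"
  proof (rule sum.cong[OF refl])
    fix z assume "z \<in> J"
    from far[OF this] have "x \<le> z - R * \<epsilon> \<or> z + R * \<epsilon> \<le> x" by linarith
    then show "g z x - T z = (if z \<in> {..<x} then - 2 * T z else 0)" using g_left[of x z] g_right[of z x] R\<epsilon> by auto
  qed
  also have "\<dots> = (\<Sum>z\<in>J \<inter> {..<x}. - 2 * T z)" by (rule sum.inter_restrict[symmetric]) (use J(1) in simp)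
  finally show ?thesis unfolding v_eq using step_fun_telescope[OF J(1), of \<sigma> x] by (simp add: sum_distrib_left sum_negf)
qed

context
  assumes sep: "\<And>z z'. z \<in> J \<Longrightarrow> z' \<in> J \<Longrightarrow> z \<noteq> z' \<Longrightarrow> 4 * \<rho> \<le> \<bar>z - z'\<bar>" and small: "R * \<epsilon> \<le> \<rho>" and \<rho>: "0 < \<rho>" "\<rho> \<le> 1"
begin

lemma v_near:
  assumes z0: "z0 \<in> J" and near: "\<bar>x - z0\<bar> < R * \<epsilon>"
  shows "v x = g z0 x"
proof -
  have R\<epsilon>: "0 < R * \<epsilon>" using R \<epsilon> by simp
  have "(\<Sum>z\<in>J - {z0}. g z x - T z) = (\<Sum>z\<in>J - {z0}. if z \<in> {..<z0} then - 2 * T z else 0)"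
  proof (rule sum.cong[OF refl])
    fix z assume z: "z \<in> J - {z0}"
    have "4 * \<rho> \<le> \<bar>z - z0\<bar>" by (rule sep) (use z z0 in auto)
    then have "x \<le> z - R * \<epsilon> \<and> z0 < z \<or> z + R * \<epsilon> \<le> x \<and> z < z0" using near small \<rho> by linarith
    then show "g z x - T z = (if z \<in> {..<z0} then - 2 * T z else 0)" using g_left[of x z] g_right[of z x] by auto
  qed
  also have "\<dots> = (\<Sum>z\<in>(J - {z0}) \<inter> {..<z0}. - 2 * T z)" by (rule sum.inter_restrict[symmetric]) (use J(1) in simp)
  also have "(J - {z0}) \<inter> {..<z0} = J \<inter> {..<z0}" by auto
  finally have "(\<Sum>z\<in>J. g z x - T z) = (g z0 x - T z0) + (\<Sum>z\<in>J \<inter> {..<z0}. - 2 * T z)" using sum.remove[OF J(1) z0, of "\<lambda>z. g z x - T z"] by simp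
  then show ?thesis unfolding v_eq using step_fun_telescope[OF J(1), of \<sigma> z0] by (simp add: sum_distrib_left sum_negf)
qed

text \<open>Inside a transition layer the glued function is a single profile, and outside all layers
  it sits in a well.\<close>

lemma W_glue:
  assumes W: "W 1 = 0" "W (-1) = (0::real)"
  shows "ennreal (W (v x)) \<le> (\<Sum>z\<in>J. ennreal (W (g z x)))"
proof (cases "\<exists>z0\<in>J. \<bar>x - z0\<bar> < R * \<epsilon>")
  case True
  then obtain z0 where z0: "z0 \<in> J" "\<bar>x - z0\<bar> < R * \<epsilon>" by blast
  show ?thesis unfolding v_near[OF z0] using member_le_sum[OF z0(1), of "\<lambda>z. ennreal (W (g z x))"] J(1) by simp
next
  case False
  then have "v x = T x" by (intro v_far) force
  then show ?thesis using T_cases[of x] W by auto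
qed

text \<open>At distance below \<rho> at most one of the separated profiles varies between the two
  points, so the square of the sum is the sum of the squares. At larger distance a crude bound
  suffices, with \<open>\<rho> ^ 3\<close> because \<open>1 + 2 * s < 3\<close> and
  \<open>\<rho> \<le> 1\<close>.\<close>

lemma kern_glue:
  assumes s: "s < 1" "0 \<le> s"
  shows "kern s v x y \<le> (\<Sum>z\<in>J. kern s (g z) x y) + ennreal ((2 * M * real (card J))\<^sup>2 / \<rho> ^ 3)"
proof -
  have d: "v x - v y = (\<Sum>z\<in>J. g z x - g z y)" unfolding v_eq by (simp add: sum_subtractf)
  show ?thesis
  proof (cases "\<bar>x - y\<bar> < \<rho>")
    case True
    \<comment> \<open>A layer has half-width at most \<rho>, so a profile that varies between
      \<open>x\<close> and \<open>y\<close> has its centre within \<open>2 * \<rho>\<close> of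
      \<open>x\<close>; two such centres would violate the separation
      \<open>4 * \<rho>\<close>.\<close>
    have near: "\<bar>x - z\<bar> < 2 * \<rho>" if "g z x - g z y \<noteq> 0" for z
    proof (rule ccontr)
      assume "\<not> \<bar>x - z\<bar> < 2 * \<rho>"
      then have "x \<le> z - R * \<epsilon> \<and> y \<le> z - R * \<epsilon> \<or> z + R * \<epsilon> \<le> x \<and> z + R * \<epsilon> \<le> y" using True small by linarith
      then show False using that g_left[of x z] g_left[of y z] g_right[of z x] g_right[of z y] by auto
    qed
    have "(v x - v y)\<^sup>2 = (\<Sum>z\<in>J. (g z x - g z y)\<^sup>2)" unfolding d
    proof (rule sum_power2_single[OF J(1)])
      fix z z' assume z: "z \<in> J" "z' \<in> J" "g z x - g z y \<noteq> 0" "g z' x - g z' y \<noteq> 0"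
      have "\<bar>z - z'\<bar> < 4 * \<rho>" using near[OF z(3)] near[OF z(4)] by linarith
      then show "z = z'" using sep[OF z(1,2)] by linarith
    qed
    then have "kern s v x y = (\<Sum>z\<in>J. kern s (g z) x y)" unfolding kern_def by (simp add: sum_divide_distrib sum_ennreal)
    then show ?thesis by simp
  next
    case False
    have "\<bar>v x - v y\<bar> \<le> (\<Sum>z\<in>J. 2 * M)" unfolding d
    proof (rule order_trans[OF sum_abs], rule sum_mono)
      fix z show "\<bar>g z x - g z y\<bar> \<le> 2 * M" using M[of "- T z * (x - z) / \<epsilon>"] M[of "- T z * (y - z) / \<epsilon>"] unfolding g_def by linarith
    qed
    then have "\<bar>v x - v y\<bar> \<le> 2 * M * real (card J)" by (simp add: mult_ac)
    then have "(v x - v y)\<^sup>2 \<le> (2 * M * real (card J))\<^sup>2" by (metis abs_ge_zero power2_abs power_mono)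
    moreover have "\<rho> ^ 3 \<le> \<bar>x - y\<bar> powr (1 + 2 * s)"
    proof -
      have "\<rho> ^ 3 = \<rho> powr 3" using \<rho> by (simp add: powr_numeral)
      also have "\<dots> \<le> \<rho> powr (1 + 2 * s)" using \<rho> s by (intro powr_mono') auto
      also have "\<dots> \<le> \<bar>x - y\<bar> powr (1 + 2 * s)" using \<rho> s False by (intro powr_mono2) auto
      finally show ?thesis .
    qed
    ultimately have "kern s v x y \<le> ennreal ((2 * M * real (card J))\<^sup>2 / \<rho> ^ 3)" unfolding kern_def using \<rho> by (intro ennreal_leI frac_le) auto
    then show ?thesis by (simp add: add_increasing)
  qed
qed

text \<open>Points of \<open>(0,1)\<close> have distance less than \<open>1\<close> from the jump,
  hence the window of radius \<open>1 / \<epsilon>\<close> in the blown-up variable. The window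
  matters at \<open>s = 1/2\<close>, where a transition between two plateaus has infinite seminorm
  on the line.\<close>

lemma gsq_g_le:
  assumes z: "z \<in> J"
  shows "ennreal (\<epsilon> powr (2 * s - 1)) * gsq s {0<..<1} (g z) \<le> gsq s {- (1 / \<epsilon>)<..<1 / \<epsilon>} \<phi>"
proof -
  define c where "c = - T z / \<epsilon>"
  define t where "t = T z * z / \<epsilon>"
  have c: "c \<noteq> 0" "\<bar>c\<bar> = 1 / \<epsilon>" unfolding c_def using T_cases[of z] \<epsilon> by auto
  have tc: "t + c * x = - T z * (x - z) / \<epsilon>" for x unfolding t_def c_def using \<epsilon> by (simp add: field_simps)
  have g: "g z = (\<lambda>x. \<phi> (t + c * x))" unfolding g_def[abs_def] tc ..
  have sub: "{0<..<1} \<subseteq> (\<lambda>x. t + c * x) -` {- (1 / \<epsilon>)<..<1 / \<epsilon>}"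
  proof
    fix x :: real assume x: "x \<in> {0<..<1}"
    then have "0 < x" "x < 1" "0 < z" "z < 1" using J(2) z by auto
    then have "\<bar>x - z\<bar> < 1" by linarith
    then have "\<bar>T z * (x - z)\<bar> < 1" using T_cases[of z] by auto
    then have "\<bar>- T z * (x - z) / \<epsilon>\<bar> < 1 / \<epsilon>" using \<epsilon> by (simp add: abs_mult divide_strict_right_mono)
    then show "x \<in> (\<lambda>x. t + c * x) -` {- (1 / \<epsilon>)<..<1 / \<epsilon>}" unfolding tc[symmetric] by auto
  qed
  have "gsq s {0<..<1} (g z) \<le> gsq s ((\<lambda>x. t + c * x) -` {- (1 / \<epsilon>)<..<1 / \<epsilon>}) (\<lambda>x. \<phi> (t + c * x))" unfolding g by (rule gsq_mono_set[OF sub])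
  also have "\<dots> = ennreal (\<bar>c\<bar> powr (2 * s - 1)) * gsq s {- (1 / \<epsilon>)<..<1 / \<epsilon>} \<phi>" by (rule gsq_affine) (use c in auto)
  finally have "ennreal (\<epsilon> powr (2 * s - 1)) * gsq s {0<..<1} (g z) \<le> ennreal (\<epsilon> powr (2 * s - 1)) * (ennreal (\<bar>c\<bar> powr (2 * s - 1)) * gsq s {- (1 / \<epsilon>)<..<1 / \<epsilon>} \<phi>)"
    by (rule mult_left_mono) simp
  also have "\<dots> = ennreal (\<epsilon> powr (2 * s - 1) * \<bar>c\<bar> powr (2 * s - 1)) * gsq s {- (1 / \<epsilon>)<..<1 / \<epsilon>} \<phi>" by (simp add: ennreal_mult mult.assoc)
  also have "\<epsilon> powr (2 * s - 1) * \<bar>c\<bar> powr (2 * s - 1) = 1" unfolding c using \<epsilon> by (simp flip: powr_mult)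
  finally show ?thesis by simp
qed

lemma W_g_eq:
  assumes [measurable]: "W \<in> borel_measurable borel" 
  shows "ennreal (1 / \<epsilon>) * (\<integral>\<^sup>+ x. ennreal (W (g z x)) \<partial>lborel) = (\<integral>\<^sup>+ x. ennreal (W (\<phi> x)) \<partial>lborel)"
proof -
  define c where "c = - T z / \<epsilon>"
  define t where "t = T z * z / \<epsilon>"
  have c: "c \<noteq> 0" "\<bar>c\<bar> = 1 / \<epsilon>" unfolding c_def using T_cases[of z] \<epsilon> by auto
  have tc: "t + c * x = - T z * (x - z) / \<epsilon>" for x unfolding t_def c_def using \<epsilon> by (simp add: field_simps)
  show ?thesis using nn_integral_real_affine[of "\<lambda>x. ennreal (W (\<phi> x))" c t] c(1) unfolding c(2) tc g_def by simp
qed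

text \<open>Each jump is charged with the full profile energy on the window; the remainder is the
  bounded interaction at distance at least \<rho>, whose prefactor vanishes by
  \<open>scale_pre_lim\<close>.\<close>

lemma glue_energy:
  assumes s: "s < 1" "0 \<le> s" and W: "W 1 = 0" "W (-1) = (0::real)" and [measurable]: "W \<in> borel_measurable borel" 
  shows "loc_energy W s \<epsilon> {0<..<1} v \<le> of_nat (card J) * (ennreal (scale_factor \<epsilon> s) * ((\<integral>\<^sup>+ x. ennreal (W (\<phi> x)) \<partial>lborel) + gsq s {- (1 / \<epsilon>)<..<1 / \<epsilon>} \<phi>))
    + ennreal (scale_factor \<epsilon> s) * ennreal (\<epsilon> powr (2 * s - 1)) * ennreal ((2 * M * real (card J))\<^sup>2 / \<rho> ^ 3)"
proof -
  define C where "C = ennreal ((2 * M * real (card J))\<^sup>2 / \<rho> ^ 3)"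
  define p where "p = ennreal (\<epsilon> powr (2 * s - 1))"
  define A :: "real set" where "A = {0<..<1}"
  have [measurable]: "A \<in> sets borel" unfolding A_def by simp
  have "ennreal (1 / \<epsilon>) * (\<integral>\<^sup>+ t. ennreal (W (v t)) * indicator A t \<partial>lborel) \<le> ennreal (1 / \<epsilon>) * (\<integral>\<^sup>+ t. (\<Sum>z\<in>J. ennreal (W (g z t))) \<partial>lborel)"
    by (intro mult_left_mono nn_integral_mono order_trans[OF _ W_glue[OF W]]) (auto simp: indicator_def)
  also have "\<dots> = (\<Sum>z\<in>J. ennreal (1 / \<epsilon>) * (\<integral>\<^sup>+ t. ennreal (W (g z t)) \<partial>lborel))"
    by (subst nn_integral_sum) (auto simp: sum_distrib_left)
  also have "\<dots> = of_nat (card J) * (\<integral>\<^sup>+ x. ennreal (W (\<phi> x)) \<partial>lborel)" unfolding W_g_eq[OF \<open>W \<in> borel_measurable borel\<close>] by simp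
  finally have 1: "ennreal (1 / \<epsilon>) * (\<integral>\<^sup>+ t. ennreal (W (v t)) * indicator A t \<partial>lborel) \<le> of_nat (card J) * (\<integral>\<^sup>+ x. ennreal (W (\<phi> x)) \<partial>lborel)" .
  have "gsq s A v \<le> (\<integral>\<^sup>+ x. (\<integral>\<^sup>+ y. (\<Sum>z\<in>J. kern s (g z) x y * indicator A x * indicator A y) + C * indicator A x * indicator A y \<partial>lborel) \<partial>lborel)"
    unfolding gsq_def
  proof (intro nn_integral_mono)
    fix x y
    show "kern s v x y * indicator A x * indicator A y \<le> (\<Sum>z\<in>J. kern s (g z) x y * indicator A x * indicator A y) + C * indicator A x * indicator A y"
      using kern_glue[OF s, of x y] unfolding C_def by (simp add: indicator_def)
  qed
  also have "\<dots> = (\<integral>\<^sup>+ x. (\<Sum>z\<in>J. \<integral>\<^sup>+ y. kern s (g z) x y * indicator A x * indicator A y \<partial>lborel) + (\<integral>\<^sup>+ y. C * indicator A x * indicator A y \<partial>lborel) \<partial>lborel)"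
    by (subst nn_integral_add, measurable)+ (subst nn_integral_sum, measurable)
  also have "\<dots> = (\<Sum>z\<in>J. gsq s A (g z)) + (\<integral>\<^sup>+ x. (\<integral>\<^sup>+ y. C * indicator A x * indicator A y \<partial>lborel) \<partial>lborel)"
    unfolding gsq_def by (subst nn_integral_add, measurable)+ (subst nn_integral_sum, measurable)
  also have "(\<integral>\<^sup>+ x. (\<integral>\<^sup>+ y. C * indicator A x * indicator A y \<partial>lborel) \<partial>lborel) = C"
    by (simp add: nn_integral_cmult A_def mult.assoc nn_integral_cmult_indicator)
  finally have "p * gsq s A v \<le> p * ((\<Sum>z\<in>J. gsq s A (g z)) + C)" by (rule mult_left_mono) simp
  also have "\<dots> = (\<Sum>z\<in>J. p * gsq s A (g z)) + p * C" by (simp add: distrib_left sum_distrib_left)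
  also have "\<dots> \<le> (\<Sum>z\<in>J. gsq s {- (1 / \<epsilon>)<..<1 / \<epsilon>} \<phi>) + p * C"
    unfolding p_def A_def by (intro add_right_mono sum_mono gsq_g_le)
  finally have 2: "p * gsq s A v \<le> of_nat (card J) * gsq s {- (1 / \<epsilon>)<..<1 / \<epsilon>} \<phi> + p * C" by simp
  have "loc_energy W s \<epsilon> A v \<le> ennreal (scale_factor \<epsilon> s) * (of_nat (card J) * (\<integral>\<^sup>+ x. ennreal (W (\<phi> x)) \<partial>lborel) + (of_nat (card J) * gsq s {- (1 / \<epsilon>)<..<1 / \<epsilon>} \<phi> + p * C))"
    unfolding loc_energy_def by (intro mult_left_mono add_mono 1 2[unfolded p_def, folded p_def]) (use 2 in \<open>auto simp: p_def\<close>)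
  also have "\<dots> = of_nat (card J) * (ennreal (scale_factor \<epsilon> s) * ((\<integral>\<^sup>+ x. ennreal (W (\<phi> x)) \<partial>lborel) + gsq s {- (1 / \<epsilon>)<..<1 / \<epsilon>} \<phi>)) + ennreal (scale_factor \<epsilon> s) * p * C"
    by (simp add: distrib_left mult.left_commute mult.assoc add.assoc)
  finally show ?thesis unfolding A_def p_def C_def .
qed

end

end

lemma finite_separation:
  fixes J :: "real set"
  assumes "finite J"
  obtains \<rho> where "0 < \<rho>" "\<rho> \<le> 1" "\<And>z z'. z \<in> J \<Longrightarrow> z' \<in> J \<Longrightarrow> z \<noteq> z' \<Longrightarrow> 4 * \<rho> \<le> \<bar>z - z'\<bar>"
proof -
  define D where "D = insert 4 ((\<lambda>(z, z'). \<bar>z - z'\<bar>) ` ((J \<times> J) \<inter> {(z, z'). z \<noteq> z'}))"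
  have D: "finite D" "D \<noteq> {}" unfolding D_def using assms by auto
  have "0 < Min D" using D by (subst Min_gr_iff) (auto simp: D_def)
  moreover have "Min D \<le> 4" using D by (intro Min_le) (auto simp: D_def)
  moreover have "Min D \<le> \<bar>z - z'\<bar>" if "z \<in> J" "z' \<in> J" "z \<noteq> z'" for z z' using D that by (intro Min_le) (force simp: D_def)+
  ultimately show ?thesis using that[of "Min D / 4"] by simp
qed

text \<open>The glued functions differ from the step function only in layers of width
  \<open>2 * R * \<epsilon> j\<close>, one per jump, which gives convergence in measure; \<eta>
  absorbs the far interaction in \<open>glue_energy\<close>.\<close>

lemma (in scales) profile_recovery:
  assumes W: "double_well W" and \<phi> [measurable]: "\<phi> \<in> borel_measurable borel" and low: "\<And>x. x \<le> - R \<Longrightarrow> \<phi> x = -1" and high: "\<And>x. R \<le> x \<Longrightarrow> \<phi> x = 1"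
    and M: "\<And>x. \<bar>\<phi> x\<bar> \<le> M" and R: "0 < R" and \<sigma>: "\<sigma> = 1 \<or> \<sigma> = -1" and J: "finite J" "J \<subseteq> {0<..<1}"
    and P: "0 \<le> P"
    and Pev: "\<forall>\<^sub>F j in sequentially. ennreal (scale_factor (\<epsilon> j) (s j)) * ((\<integral>\<^sup>+ x. ennreal (W (\<phi> x)) \<partial>lborel) + gsq (s j) {- (1 / \<epsilon> j)<..<1 / \<epsilon> j} \<phi>) \<le> ennreal P"
  shows "\<exists>v. (\<forall>j.  v j \<in> borel_measurable borel) \<and> conv_meas v (step_fun \<sigma> J) \<and> (\<forall>\<eta>>0. \<forall>\<^sub>F j in sequentially. loc_energy W (s j) (\<epsilon> j) {0<..<1} (v j) \<le> ennreal (real (card J) * P + \<eta>))"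
proof -
  have gp: "glue_profile \<phi> R M \<sigma> J (\<epsilon> j)" for j by unfold_locales (use assms e in auto)
  have [measurable]: "W \<in> borel_measurable borel" by (rule double_well_measurable[OF W])
  have W01: "W 1 = 0" "W (-1) = 0" using W by (auto simp: double_well_def)
  obtain \<rho> where \<rho>: "0 < \<rho>" "\<rho> \<le> 1" "\<And>z z'. z \<in> J \<Longrightarrow> z' \<in> J \<Longrightarrow> z \<noteq> z' \<Longrightarrow> 4 * \<rho> \<le> \<bar>z - z'\<bar>" using finite_separation[OF J(1)] by blast
  define v where "v j = glue \<phi> \<sigma> J (\<epsilon> j)" for j
  define Q where "Q j = ennreal (scale_factor (\<epsilon> j) (s j)) * ((\<integral>\<^sup>+ x. ennreal (W (\<phi> x)) \<partial>lborel) + gsq (s j) {- (1 / \<epsilon> j)<..<1 / \<epsilon> j} \<phi>)" for j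
  define C where "C = ennreal ((2 * M * real (card J))\<^sup>2 / \<rho> ^ 3)"
  define q where "q j = ennreal (scale_factor (\<epsilon> j) (s j)) * ennreal (\<epsilon> j powr (2 * s j - 1)) * C" for j
  have [measurable]: "v j \<in> borel_measurable borel" for j unfolding v_def by (rule glue_profile.v_measurable[OF gp])
  define C' where "C' = (2 * M * real (card J))\<^sup>2 / \<rho> ^ 3"
  have "(\<lambda>j. scale_factor (\<epsilon> j) (s j) * \<epsilon> j powr (2 * s j - 1) * C') \<longlonglongrightarrow> 0 * C'" by (intro tendsto_intros scale_pre_lim)
  then have "(\<lambda>j. ennreal (scale_factor (\<epsilon> j) (s j) * \<epsilon> j powr (2 * s j - 1) * C')) \<longlonglongrightarrow> ennreal 0" using tendsto_ennrealI[of "\<lambda>j. scale_factor (\<epsilon> j) (s j) * \<epsilon> j powr (2 * s j - 1) * C'" 0 sequentially] by simp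
  moreover have "ennreal (scale_factor (\<epsilon> j) (s j) * \<epsilon> j powr (2 * s j - 1) * C') = q j" for j
    unfolding q_def C_def C'_def[symmetric] using scale_pos[of j] by (simp add: ennreal_mult' ennreal_mult'' less_imp_le)
  ultimately have q: "q \<longlonglongrightarrow> ennreal 0" by simp
  have conv: "conv_meas v (step_fun \<sigma> J)" unfolding conv_meas_def
  proof (intro allI impI)
    fix \<delta> :: real assume \<delta>: "0 < \<delta>"
    have sub: "{x \<in> {0<..<1}. \<delta> < \<bar>v j x - step_fun \<sigma> J x\<bar>} \<subseteq> (\<Union>z\<in>J. {z - R * \<epsilon> j<..<z + R * \<epsilon> j})" for j
    proof
      fix x assume x: "x \<in> {x \<in> {0<..<1}. \<delta> < \<bar>v j x - step_fun \<sigma> J x\<bar>}"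
      show "x \<in> (\<Union>z\<in>J. {z - R * \<epsilon> j<..<z + R * \<epsilon> j})"
      proof (rule ccontr)
        assume n: "x \<notin> (\<Union>z\<in>J. {z - R * \<epsilon> j<..<z + R * \<epsilon> j})"
        have "R * \<epsilon> j \<le> \<bar>x - z\<bar>" if z: "z \<in> J" for z
        proof (rule ccontr)
          assume "\<not> R * \<epsilon> j \<le> \<bar>x - z\<bar>"
          then have "x \<in> {z - R * \<epsilon> j<..<z + R * \<epsilon> j}" unfolding greaterThanLessThan_iff by linarith
          then show False using n z by blast
        qed
        then have "v j x = step_fun \<sigma> J x" unfolding v_def by (rule glue_profile.v_far[OF gp])
        then show False using x \<delta> by simp
      qed
    qed
    have R\<epsilon>: "0 < R * \<epsilon> j" for j using R e(1)[of j] by simp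
    have le: "emeasure lborel {x \<in> {0<..<1}. \<delta> < \<bar>v j x - step_fun \<sigma> J x\<bar>} \<le> ennreal (real (card J) * (2 * R * \<epsilon> j))" for j
    proof -
      have "emeasure lborel {x \<in> {0<..<1}. \<delta> < \<bar>v j x - step_fun \<sigma> J x\<bar>} \<le> emeasure lborel (\<Union>z\<in>J. {z - R * \<epsilon> j<..<z + R * \<epsilon> j})"
        by (rule emeasure_mono[OF sub]) (use J(1) in \<open>simp add: sets.finite_UN\<close>)
      also have "\<dots> \<le> (\<Sum>z\<in>J. emeasure lborel {z - R * \<epsilon> j<..<z + R * \<epsilon> j})" by (rule emeasure_subadditive_finite[OF J(1)]) auto
      also have "\<dots> = (\<Sum>z\<in>J. ennreal (2 * R * \<epsilon> j))" using R\<epsilon>[of j] by (intro sum.cong refl) (simp add: emeasure_lborel_Ioo mult.assoc)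
      also have "\<dots> = ennreal (real (card J) * (2 * R * \<epsilon> j))" using R e(1)[of j] by (simp add: sum_ennreal ennreal_mult ennreal_of_nat_eq_real_of_nat)
      finally show ?thesis .
    qed
    have "(\<lambda>j. ennreal (real (card J) * (2 * R * \<epsilon> j))) \<longlonglongrightarrow> ennreal (real (card J) * (2 * R * 0))" by (intro tendsto_ennrealI tendsto_intros e_lim)
    then have lim: "(\<lambda>j. ennreal (real (card J) * (2 * R * \<epsilon> j))) \<longlonglongrightarrow> 0" by simp
    show "(\<lambda>j. emeasure lborel {x \<in> {0<..<1}. \<delta> < \<bar>v j x - step_fun \<sigma> J x\<bar>}) \<longlonglongrightarrow> 0"
      by (rule tendsto_sandwich[OF _ _ tendsto_const lim]) (rule always_eventually, intro allI, (rule le | rule zero_le))+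
  qed
  have ev: "\<forall>\<^sub>F j in sequentially. R * \<epsilon> j < \<rho>"
  proof -
    have "(\<lambda>j. R * \<epsilon> j) \<longlonglongrightarrow> R * 0" by (intro tendsto_intros e_lim)
    then show ?thesis using \<rho>(1) by (intro order_tendstoD(2)[of _ "R * 0"]) auto
  qed
  have "\<forall>\<^sub>F j in sequentially. loc_energy W (s j) (\<epsilon> j) {0<..<1} (v j) \<le> ennreal (real (card J) * P + \<eta>)" if \<eta>: "0 < \<eta>" for \<eta>
  proof -
    have "\<forall>\<^sub>F j in sequentially. q j < ennreal \<eta>" using q \<eta> by (intro order_tendstoD(2)[OF q]) auto
    then show ?thesis using ev Pev
    proof eventually_elim
      case (elim j)
      have "0 \<le> s j" using s(1)[of j] by simp
      then have "loc_energy W (s j) (\<epsilon> j) {0<..<1} (v j) \<le> of_nat (card J) * Q j + q j" unfolding v_def Q_def q_def C_def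
        using glue_profile.glue_energy[OF gp \<rho>(3) _ \<rho>(1,2) s(2)[of j] _ W01] elim by simp
      also have "\<dots> \<le> of_nat (card J) * ennreal P + ennreal \<eta>" using elim by (intro add_mono mult_left_mono) (auto simp: Q_def)
      also have "\<dots> = ennreal (real (card J) * P + \<eta>)" using P \<eta> by (simp add: ennreal_mult ennreal_of_nat_eq_real_of_nat)
      finally show ?case .
    qed
  qed
  then show ?thesis using conv by (intro exI[of _ v]) auto
qed

subsection \<open>Profiles for the upper bound\<close>

lemma nn_integral_powr_near_0:
  assumes "a > (-1::real)"
  shows "(\<integral>\<^sup>+ h. ennreal (h powr a) * indicator {0<..1} h \<partial>lborel) = ennreal (1 / (a + 1))"
proof -
  have "(\<integral>\<^sup>+ h. ennreal (h powr a) * indicator {0<..1} h \<partial>lborel) = (\<integral>\<^sup>+ h. ennreal (h powr a) * indicator {0..1} h \<partial>lborel)"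
    by (intro nn_integral_cong) (auto simp: indicator_def)
  also have "\<dots> = ennreal (1 / (a + 1))"
    using nn_integral_has_integral_lebesgue'[OF _ has_integral_powr_from_0[OF assms, of 1]] by simp
  finally show ?thesis .
qed

lemma nn_integral_powr_at_top:
  assumes "a < (-1::real)"
  shows "(\<integral>\<^sup>+ h. ennreal (h powr a) * indicator {1..} h \<partial>lborel) = ennreal (- 1 / (a + 1))"
  using nn_integral_has_integral_lebesgue'[OF _ has_integral_powr_to_inf[OF assms, of 1]] by simp

text \<open>This is \<open>nn_integral_scale_factor\<close> in the variable
  \<open>h / \<epsilon>\<close>, the form suited to profiles in the blown-up variable.\<close>

lemma nn_integral_powr_to_inverse:
  assumes e: "0 < \<epsilon>" "\<epsilon> < 1" and s: "1/2 \<le> s"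
  shows "(\<integral>\<^sup>+ h. ennreal (h powr (- (2 * s))) * indicator {1..1 / \<epsilon>} h \<partial>lborel) = ennreal (1 / scale_factor \<epsilon> s)"
proof -
  define f where "f h = ennreal (\<epsilon> powr (2 * s - 1) * h powr (- (2 * s))) * indicator {\<epsilon>..1} h" for h
  have [measurable]: "f \<in> borel_measurable borel" unfolding f_def by measurable
  have "f (0 + \<epsilon> * h) = ennreal (1 / \<epsilon>) * (ennreal (h powr (- (2 * s))) * indicator {1..1 / \<epsilon>} h)" for h
  proof (cases "h \<in> {1..1 / \<epsilon>}")
    case True
    then have h: "0 < h" "\<epsilon> \<le> \<epsilon> * h" "\<epsilon> * h \<le> 1" using e by (auto simp: field_simps)
    have "\<epsilon> powr (2 * s - 1) * (\<epsilon> * h) powr (- (2 * s)) = (\<epsilon> powr (2 * s - 1) * \<epsilon> powr (- (2 * s))) * h powr (- (2 * s))"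
      using e h by (simp add: powr_mult)
    also have "\<epsilon> powr (2 * s - 1) * \<epsilon> powr (- (2 * s)) = 1 / \<epsilon>" using e by (simp only: powr_add[symmetric]) (simp add: powr_minus_divide)
    finally show ?thesis using True h e unfolding f_def by (simp flip: ennreal_mult)
  next
    case False
    then have "\<not> (\<epsilon> \<le> \<epsilon> * h \<and> \<epsilon> * h \<le> 1)" using e by (auto simp: field_simps)
    then show ?thesis using False unfolding f_def by auto
  qed
  then have "(\<integral>\<^sup>+ h. ennreal (1 / \<epsilon>) * (ennreal (h powr (- (2 * s))) * indicator {1..1 / \<epsilon>} h) \<partial>lborel) = ennreal (1 / \<epsilon>) * (\<integral>\<^sup>+ h. f h \<partial>lborel)"
    using nn_integral_rescale[of f \<epsilon> 0] e by simp
  then have "ennreal (1 / \<epsilon>) * (\<integral>\<^sup>+ h. ennreal (h powr (- (2 * s))) * indicator {1..1 / \<epsilon>} h \<partial>lborel) = ennreal (1 / \<epsilon>) * ennreal (1 / scale_factor \<epsilon> s)"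
    unfolding f_def nn_integral_scale_factor[OF e s] by (subst (asm) nn_integral_cmult) auto
  then show ?thesis using e by (simp add: ennreal_mult_cancel_left)
qed

section \<open>Lipschitz transitions between two plateaus\<close>

definition transition :: "real \<Rightarrow> real \<Rightarrow> real \<Rightarrow> (real \<Rightarrow> real) \<Rightarrow> bool" where
  "transition K B R f \<longleftrightarrow> (\<forall>x y. \<bar>f x - f y\<bar> \<le> K * \<bar>x - y\<bar>) \<and> (\<forall>x y. \<bar>f x - f y\<bar> \<le> B) \<and>
     (\<forall>x\<le>-R. f x = f (-R)) \<and> (\<forall>x\<ge>R. f x = f R) \<and> 0 \<le> K \<and> 0 \<le> B \<and> 0 \<le> R"

lemma transition_measurable: "transition K B R f \<Longrightarrow> f \<in> borel_measurable borel"
proof -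
  assume t: "transition K B R f"
  have "K-lipschitz_on UNIV f" using t unfolding transition_def lipschitz_on_def dist_real_def by auto
  then show ?thesis by (intro borel_measurable_continuous_onI lipschitz_on_continuous_on)
qed

text \<open>An increment vanishes unless it starts in \<open>{- R - h..R}\<close>; the part
  \<open>h\<close> of the length of this interval is the interaction of the two plateaus.\<close>

lemma diff_sq_transition:
  assumes t: "transition K B R f" and h: "0 < h"
  shows "diff_sq A f h \<le> ennreal ((min (K * h) B)\<^sup>2 * (2 * R + h))"
proof -
  have K: "0 \<le> K" "0 \<le> B" "0 \<le> R" using t by (auto simp: transition_def)
  have "diff_sq A f h \<le> (\<integral>\<^sup>+ x. ennreal ((min (K * h) B)\<^sup>2) * indicator {- R - h..R} x \<partial>lborel)"
    unfolding diff_sq_def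
  proof (rule nn_integral_mono)
    fix x
    have "(f (x + h) - f x)\<^sup>2 \<le> (min (K * h) B)\<^sup>2 * indicator {- R - h..R} x"
    proof (cases "x \<in> {- R - h..R}")
      case True
      have 1: "\<bar>f (x + h) - f x\<bar> \<le> K * \<bar>x + h - x\<bar>" "\<bar>f (x + h) - f x\<bar> \<le> B" using t unfolding transition_def by blast+
      then have "\<bar>f (x + h) - f x\<bar> \<le> min (K * h) B" using h by simp
      then have "\<bar>f (x + h) - f x\<bar>\<^sup>2 \<le> (min (K * h) B)\<^sup>2" by (intro power_mono) auto
      then show ?thesis using True by simp
    next
      case False
      then have "x + h \<le> - R \<and> x \<le> - R \<or> R \<le> x + h \<and> R \<le> x" using h by auto
      then have "f (x + h) = f x" using t unfolding transition_def by metis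
      then show ?thesis using False by simp
    qed
    then have "ennreal ((f (x + h) - f x)\<^sup>2) \<le> ennreal ((min (K * h) B)\<^sup>2) * indicator {- R - h..R} x"
      by (auto simp: indicator_def intro: ennreal_leI split: if_splits)
    then show "ennreal ((f (x + h) - f x)\<^sup>2) * indicator A x * indicator A (x + h) \<le> ennreal ((min (K * h) B)\<^sup>2) * indicator {- R - h..R} x"
      by (rule order_trans[rotated]) (auto simp: indicator_def)
  qed
  also have "\<dots> = ennreal ((min (K * h) B)\<^sup>2) * ennreal (2 * R + h)" using K h by (subst nn_integral_cmult_indicator) auto
  also have "\<dots> = ennreal ((min (K * h) B)\<^sup>2 * (2 * R + h))" using K h by (simp add: ennreal_mult)
  finally show ?thesis .
qed

text \<open>For small \<open>h\<close> the Lipschitz bound leaves \<open>h powr (1 - 2 * s)\<close>,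
  integrable since \<open>s < 1\<close>; for large \<open>h\<close> the oscillation bound leaves
  \<open>h powr (- (2 * s))\<close>, integrable since \<open>s > 1/2\<close>.\<close>

lemma transition_gsq_finite:
  assumes t: "transition K B R f" and s: "1/2 < s" "s < 1"
  shows "gsq s UNIV f < \<infinity>"
proof -
  have [measurable]: "f \<in> borel_measurable borel" using t by (rule transition_measurable)
  have K: "0 \<le> K" "0 \<le> B" "0 \<le> R" using t by (auto simp: transition_def)
  define C1 where "C1 = K\<^sup>2 * (2 * R + 1)"
  define C2 where "C2 = B\<^sup>2 * (2 * R + 1)"
  have C: "0 \<le> C1" "0 \<le> C2" unfolding C1_def C2_def using K by auto
  have "ennreal (h powr (- (1 + 2 * s))) * diff_sq UNIV f h * indicator {0<..} h
     \<le> ennreal C1 * (ennreal (h powr (1 - 2 * s)) * indicator {0<..1} h) + ennreal C2 * (ennreal (h powr (- (2 * s))) * indicator {1..} h)" (is "?L h \<le> _") for h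
  proof (cases "0 < h")
    case True
    have L: "?L h \<le> ennreal (h powr (- (1 + 2 * s)) * ((min (K * h) B)\<^sup>2 * (2 * R + h)))"
      using diff_sq_transition[OF t True, of UNIV] True K by (simp add: ennreal_mult mult_left_mono)
    show ?thesis
    proof (cases "h \<le> 1")
      case h: True
      have "(min (K * h) B)\<^sup>2 * (2 * R + h) \<le> (K * h)\<^sup>2 * (2 * R + 1)" using K True h by (intro mult_mono power_mono) auto
      then have "h powr (- (1 + 2 * s)) * ((min (K * h) B)\<^sup>2 * (2 * R + h)) \<le> h powr (- (1 + 2 * s)) * ((K * h)\<^sup>2 * (2 * R + 1))" by (intro mult_left_mono) auto
      also have "\<dots> = C1 * (h powr (- (1 + 2 * s)) * h powr 2)" unfolding C1_def using True by (simp add: powr_numeral power_mult_distrib)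
      also have "h powr (- (1 + 2 * s)) * h powr 2 = h powr (1 - 2 * s)" by (simp flip: powr_add)
      finally have "?L h \<le> ennreal C1 * (ennreal (h powr (1 - 2 * s)) * indicator {0<..1} h)"
        using L True h C by (intro order_trans[OF L]) (simp add: ennreal_leI flip: ennreal_mult)
      then show ?thesis by (rule order_trans) simp
    next
      case h: False
      have "(min (K * h) B)\<^sup>2 * (2 * R + h) \<le> B\<^sup>2 * ((2 * R + 1) * h)"
      proof (intro mult_mono power_mono)
        have "2 * R * 1 \<le> 2 * R * h" using K h by (intro mult_left_mono) auto
        then show "2 * R + h \<le> (2 * R + 1) * h" by (simp add: algebra_simps)
      qed (use K h True in auto)
      then have "h powr (- (1 + 2 * s)) * ((min (K * h) B)\<^sup>2 * (2 * R + h)) \<le> h powr (- (1 + 2 * s)) * (B\<^sup>2 * ((2 * R + 1) * h))" by (intro mult_left_mono) auto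
      also have "\<dots> = C2 * (h powr (- (1 + 2 * s)) * h powr 1)" unfolding C2_def using True by simp
      also have "h powr (- (1 + 2 * s)) * h powr 1 = h powr (- (2 * s))" by (simp only: powr_add[symmetric]) simp
      finally have "?L h \<le> ennreal C2 * (ennreal (h powr (- (2 * s))) * indicator {1..} h)"
        using L True h C by (intro order_trans[OF L]) (simp add: ennreal_leI flip: ennreal_mult)
      then show ?thesis by (rule order_trans) simp
    qed
  qed simp
  then have "(\<integral>\<^sup>+ h. ?L h \<partial>lborel) \<le> (\<integral>\<^sup>+ h. ennreal C1 * (ennreal (h powr (1 - 2 * s)) * indicator {0<..1} h) + ennreal C2 * (ennreal (h powr (- (2 * s))) * indicator {1..} h) \<partial>lborel)"
    by (rule nn_integral_mono)
  also have "\<dots> = ennreal C1 * (\<integral>\<^sup>+ h. ennreal (h powr (1 - 2 * s)) * indicator {0<..1} h \<partial>lborel) + ennreal C2 * (\<integral>\<^sup>+ h. ennreal (h powr (- (2 * s))) * indicator {1..} h \<partial>lborel)"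
    by (subst nn_integral_add, measurable)+ (subst nn_integral_cmult, measurable)+
  also have "\<dots> < \<infinity>"
    using s by (subst nn_integral_powr_near_0, simp, subst nn_integral_powr_at_top, simp) (simp add: ennreal_mult_less_top)
  finally have fin: "(\<integral>\<^sup>+ h. ?L h \<partial>lborel) < \<infinity>" .
  have "gsq s UNIV f = 2 * (\<integral>\<^sup>+ h. ?L h \<partial>lborel)" by (rule gsq_eq_diff_sq) auto
  moreover have "2 * I < \<infinity>" if "I < \<infinity>" for I :: ennreal using that by (simp add: ennreal_mult_less_top)
  ultimately show ?thesis using fin by simp
qed

text \<open>Dominated convergence in \<open>h\<close>: for \<open>h \<le> 1\<close> the integrand of
  the larger exponent \<open>b\<close> dominates, for \<open>h \<ge> 1\<close> that of the smaller
  exponent \<open>a\<close>, and both are integrable.\<close>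

lemma transition_gsq_tendsto:
  assumes t: "transition K B R f" and s0: "1/2 < s0" "s0 < 1" and s: "s \<longlonglongrightarrow> s0"
  shows "(\<lambda>j. gsq (s j) UNIV f) \<longlonglongrightarrow> gsq s0 UNIV f"
proof -
  have f [measurable]: "f \<in> borel_measurable borel" using t by (rule transition_measurable)
  define a where "a = (1/2 + s0) / 2"
  define b where "b = (1 + s0) / 2"
  have ab: "1/2 < a" "a < s0" "s0 < b" "b < 1" unfolding a_def b_def using s0 by auto
  have "\<forall>\<^sub>F j in sequentially. a < s j \<and> s j < b" using order_tendstoD(1)[OF s ab(2)] order_tendstoD(2)[OF s ab(3)] by eventually_elim simp
  then obtain N where N: "\<And>j. N \<le> j \<Longrightarrow> a < s j \<and> s j < b" unfolding eventually_sequentially by blast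
  define F where "F r h = ennreal (h powr (- (1 + 2 * r))) * diff_sq UNIV f h * indicator {0<..} h" for r h
  have [measurable]: "F r \<in> borel_measurable borel" for r unfolding F_def by measurable
  have gF: "gsq r UNIV f = 2 * (\<integral>\<^sup>+ h. F r h \<partial>lborel)" for r unfolding F_def by (rule gsq_eq_diff_sq) auto
  have fin: "(\<integral>\<^sup>+ h. F r h \<partial>lborel) < \<infinity>" if "1/2 < r" "r < 1" for r
    using transition_gsq_finite[OF t that] unfolding gF by (auto simp: ennreal_mult_less_top)
  have "(\<lambda>j. \<integral>\<^sup>+ h. F (s (j + N)) h \<partial>lborel) \<longlonglongrightarrow> (\<integral>\<^sup>+ h. F s0 h \<partial>lborel)"
  proof (rule nn_integral_dominated_convergence[where w = "\<lambda>h. F a h + F b h"])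
    show "(\<integral>\<^sup>+ h. F a h + F b h \<partial>lborel) < \<infinity>" using fin[of a] fin[of b] ab s0 by (subst nn_integral_add) auto
    show "AE h in lborel. F (s (j + N)) h \<le> F a h + F b h" for j
    proof (rule AE_I2)
      fix h :: real
      have r: "a < s (j + N)" "s (j + N) < b" using N[of "j + N"] by auto
      show "F (s (j + N)) h \<le> F a h + F b h"
      proof (cases "h \<le> 1")
        case True
        have "F (s (j + N)) h \<le> F b h"
        proof (cases "0 < h")
          case h: True
          then show ?thesis unfolding F_def
            by (intro mult_right_mono) (use True r ab in \<open>auto simp: indicator_def intro!: ennreal_leI powr_mono'\<close>)
        qed (simp add: F_def)
        then show ?thesis by (rule order_trans) simp
      next
        case False
        have "F (s (j + N)) h \<le> F a h" unfolding F_def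
          by (intro mult_right_mono) (use False r ab in \<open>auto simp: indicator_def intro!: ennreal_leI powr_mono\<close>)
        then show ?thesis by (rule order_trans) simp
      qed
    qed
    show "AE h in lborel. (\<lambda>j. F (s (j + N)) h) \<longlonglongrightarrow> F s0 h"
    proof (rule AE_I2)
      fix h :: real
      have sN: "(\<lambda>j. s (j + N)) \<longlonglongrightarrow> s0" using s by (rule LIMSEQ_ignore_initial_segment)
      show "(\<lambda>j. F (s (j + N)) h) \<longlonglongrightarrow> F s0 h"
      proof (cases "0 < h")
        case True
        have fd: "diff_sq UNIV f h < top" using diff_sq_transition[OF t True, of UNIV] by (rule le_less_trans) simp
        have "(\<lambda>j. h powr (- (1 + 2 * s (j + N)))) \<longlonglongrightarrow> h powr (- (1 + 2 * s0))" using True by (intro tendsto_intros sN) auto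
        then have "(\<lambda>j. ennreal (h powr (- (1 + 2 * s (j + N)))) * diff_sq UNIV f h) \<longlonglongrightarrow> ennreal (h powr (- (1 + 2 * s0))) * diff_sq UNIV f h"
          using fd by (intro tendsto_mult_ennreal tendsto_ennrealI tendsto_const) auto
        then show ?thesis unfolding F_def using True by simp
      qed (simp add: F_def)
    qed
  qed auto
  then have "(\<lambda>j. \<integral>\<^sup>+ h. F (s j) h \<partial>lborel) \<longlonglongrightarrow> (\<integral>\<^sup>+ h. F s0 h \<partial>lborel)" by (rule LIMSEQ_offset)
  then show ?thesis unfolding gF using fin[OF s0] by (intro tendsto_mult_ennreal tendsto_const) auto
qed

lemma potential_profile_finite:
  fixes \<phi> :: "real \<Rightarrow> real"
  assumes W: "double_well W" and [measurable]: "\<phi> \<in> borel_measurable borel" and low: "\<And>x. x \<le> - R \<Longrightarrow> \<phi> x = -1" and high: "\<And>x. R \<le> x \<Longrightarrow> \<phi> x = 1"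
    and M: "\<And>x. \<bar>\<phi> x\<bar> \<le> M" 
  shows "(\<integral>\<^sup>+ x. ennreal (W (\<phi> x)) \<partial>lborel) < \<infinity>"
proof -
  have "compact (W ` {-M..M})" using W unfolding double_well_def by (intro compact_continuous_image) (auto intro: continuous_on_subset)
  then have "bounded (W ` {-M..M})" by (rule compact_imp_bounded)
  then obtain K where K: "\<And>z. z \<in> {-M..M} \<Longrightarrow> norm (W z) \<le> K" unfolding bounded_iff by blast
  have "(\<integral>\<^sup>+ x. ennreal (W (\<phi> x)) \<partial>lborel) \<le> (\<integral>\<^sup>+ x. ennreal K * indicator {-R..R} x \<partial>lborel)"
  proof (rule nn_integral_mono)
    fix x
    show "ennreal (W (\<phi> x)) \<le> ennreal K * indicator {-R..R} x"
    proof (cases "x \<in> {-R..R}")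
      case True
      then show ?thesis using K[of "\<phi> x"] M[of x] by (auto simp: abs_le_iff intro!: ennreal_leI)
    next
      case False
      then have "\<phi> x = 1 \<or> \<phi> x = -1" using low[of x] high[of x] by auto
      moreover have "W 1 = 0" "W (-1) = 0" using W unfolding double_well_def by blast+
      ultimately show ?thesis by auto
    qed
  qed
  also have "\<dots> < \<infinity>" by (subst nn_integral_cmult_indicator) (auto simp: ennreal_mult_less_top emeasure_lborel_Icc_eq)
  finally show ?thesis .
qed

abbreviation ramp :: "real \<Rightarrow> real" where "ramp x \<equiv> max (-1) (min 1 x)"

lemma transition_ramp: "transition 1 2 1 ramp"
  unfolding transition_def by (auto simp: max_def min_def abs_if)

text \<open>The plateaus at distances between \<open>1\<close> and \<open>1 / \<epsilon>\<close>
  give \<open>4 * h powr (- (2 * s))\<close>, with integral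
  \<open>4 / scale_factor \<epsilon> s\<close>, and the two directions double this. The rest is
  \<open>36 = 2 * (3 * 2 + 8 + 4)\<close>: small \<open>h\<close>, the layer itself, and distances
  from \<open>1 / \<epsilon>\<close> to \<open>2 / \<epsilon>\<close>; \<open>s \<le> 3/4\<close>
  keeps the first of these uniform.\<close>

lemma gsq_ramp_le:
  assumes e: "0 < \<epsilon>" "\<epsilon> < 1" and s: "1/2 \<le> s" "s \<le> 3/4"
  shows "gsq s {- (1 / \<epsilon>)<..<1 / \<epsilon>} ramp \<le> ennreal (8 / scale_factor \<epsilon> s + 36)"
proof -
  define L where "L = 1 / \<epsilon>"
  have L: "1 \<le> L" unfolding L_def using e by simp
  have lam: "0 < scale_factor \<epsilon> s" using scale_factor_bounds(1)[OF e s(1)] .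
  define F1 where "F1 h = ennreal (h powr (-1/2)) * indicator {0<..1} h" for h :: real
  define F2 where "F2 h = ennreal (h powr (-2)) * indicator {1..} h" for h :: real
  define F3 where "F3 h = ennreal (h powr (- (2 * s))) * indicator {1..L} h" for h :: real
  define F4 where "F4 h = ennreal (1 / h) * indicator {L..2 * L} h" for h :: real
  have [measurable]: "F1 \<in> borel_measurable borel" "F2 \<in> borel_measurable borel" "F3 \<in> borel_measurable borel" "F4 \<in> borel_measurable borel"
    unfolding F1_def F2_def F3_def F4_def by measurable
  have i1: "(\<integral>\<^sup>+ h. F1 h \<partial>lborel) = ennreal 2" unfolding F1_def using nn_integral_powr_near_0[of "-1/2"] by simp
  have i2: "(\<integral>\<^sup>+ h. F2 h \<partial>lborel) = ennreal 1" unfolding F2_def using nn_integral_powr_at_top[of "-2"] by simp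
  have i3: "(\<integral>\<^sup>+ h. F3 h \<partial>lborel) = ennreal (1 / scale_factor \<epsilon> s)" unfolding F3_def L_def by (rule nn_integral_powr_to_inverse[OF e s(1)])
  have "(\<integral>\<^sup>+ h. F4 h \<partial>lborel) = ennreal (ln (2 * L / L))" unfolding F4_def using L by (intro nn_integral_inverse_ivl) auto
  also have "\<dots> \<le> ennreal 1" using L ln_add_one_self_le_self[of 1] by (intro ennreal_leI) simp
  finally have i4: "(\<integral>\<^sup>+ h. F4 h \<partial>lborel) \<le> ennreal 1" .
  have "ennreal (h powr (- (1 + 2 * s))) * diff_sq {- L<..<L} ramp h * indicator {0<..} h \<le> ennreal 3 * F1 h + (ennreal 8 * F2 h + (ennreal 4 * F3 h + ennreal 4 * F4 h))" (is "?L h \<le> _") for h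
  proof (cases "0 < h")
    case h: True
    have DDle: "?L h \<le> ennreal (h powr (- (1 + 2 * s)) * ((min (1 * h) 2)\<^sup>2 * (2 * 1 + h)))"
      using diff_sq_transition[OF transition_ramp h, of "{- L<..<L}"] h by (simp add: ennreal_mult mult_left_mono)
    consider "h \<le> 1" | "1 < h" "h < 2 * L" | "2 * L \<le> h" by linarith
    then show ?thesis
    proof cases
      case 1
      have "(min (1 * h) 2)\<^sup>2 * (2 * 1 + h) \<le> h\<^sup>2 * 3" using h 1 by (intro mult_mono power_mono) auto
      then have "h powr (- (1 + 2 * s)) * ((min (1 * h) 2)\<^sup>2 * (2 * 1 + h)) \<le> h powr (- (1 + 2 * s)) * (h\<^sup>2 * 3)" by (intro mult_left_mono) auto
      also have "\<dots> = 3 * (h powr (- (1 + 2 * s)) * h powr 2)" using h by (simp add: powr_numeral)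
      also have "h powr (- (1 + 2 * s)) * h powr 2 = h powr (1 - 2 * s)" by (simp flip: powr_add)
      also have "h powr (1 - 2 * s) \<le> h powr (-1/2)" using h 1 s by (intro powr_mono') auto
      finally have "h powr (- (1 + 2 * s)) * ((min (1 * h) 2)\<^sup>2 * (2 * 1 + h)) \<le> 3 * h powr (-1/2)" by simp
      from ennreal_leI[OF this] have "ennreal (h powr (- (1 + 2 * s)) * ((min (1 * h) 2)\<^sup>2 * (2 * 1 + h))) \<le> ennreal 3 * ennreal (h powr (-1/2))"
        by (subst (asm) (2) ennreal_mult) auto
      then have "?L h \<le> ennreal 3 * F1 h" unfolding F1_def using h 1 by (intro order_trans[OF DDle]) simp
      then show ?thesis by (rule order_trans) simp
    next
      case 2
      have "(min (1 * h) 2)\<^sup>2 * (2 * 1 + h) \<le> 2\<^sup>2 * (2 + h)" using 2 by (intro mult_mono power_mono) auto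
      then have "h powr (- (1 + 2 * s)) * ((min (1 * h) 2)\<^sup>2 * (2 * 1 + h)) \<le> h powr (- (1 + 2 * s)) * (2\<^sup>2 * (2 + h))" by (intro mult_left_mono) auto
      also have "\<dots> = 8 * h powr (- (1 + 2 * s)) + 4 * (h powr (- (1 + 2 * s)) * h powr 1)" using h by (simp add: algebra_simps)
      also have "h powr (- (1 + 2 * s)) * h powr 1 = h powr (- (2 * s))" by (simp only: powr_add[symmetric]) simp
      finally have le: "h powr (- (1 + 2 * s)) * ((min (1 * h) 2)\<^sup>2 * (2 * 1 + h)) \<le> 8 * h powr (- (1 + 2 * s)) + 4 * h powr (- (2 * s))" .
      have p2: "h powr (- (1 + 2 * s)) \<le> h powr (-2)" using 2 s by (intro powr_mono) auto
      have p1: "h powr (- (2 * s)) \<le> h powr (-1)" using 2 s by (intro powr_mono) auto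
      have "ennreal (h powr (- (2 * s))) \<le> F3 h + F4 h"
      proof (cases "h \<le> L")
        case True
        then show ?thesis unfolding F3_def using 2 by simp
      next
        case False
        have "ennreal (h powr (- (2 * s))) \<le> F4 h" unfolding F4_def using False 2 p1 by (auto simp: powr_minus_divide intro: ennreal_leI)
        then show ?thesis by (rule order_trans) simp
      qed
      then have "ennreal 4 * ennreal (h powr (- (2 * s))) \<le> ennreal 4 * (F3 h + F4 h)" by (rule mult_left_mono) simp
      moreover have "ennreal (8 * h powr (- (1 + 2 * s))) \<le> ennreal 8 * F2 h" unfolding F2_def using 2 p2 by (auto simp: ennreal_mult intro!: mult_left_mono ennreal_leI)
      ultimately have "ennreal (8 * h powr (- (1 + 2 * s)) + 4 * h powr (- (2 * s))) \<le> ennreal 8 * F2 h + (ennreal 4 * F3 h + ennreal 4 * F4 h)"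
        by (simp add: ennreal_plus ennreal_mult distrib_left add_mono)
      then have "?L h \<le> ennreal 8 * F2 h + (ennreal 4 * F3 h + ennreal 4 * F4 h)" using DDle ennreal_leI[OF le] by (meson order_trans)
      then show ?thesis by (rule order_trans) simp
    next
      case 3
      have "diff_sq {- L<..<L} ramp h = 0" unfolding diff_sq_def using 3 by (intro nn_integral_0_iff_AE[THEN iffD2] AE_I2) (auto simp: indicator_def)
      then show ?thesis by simp
    qed
  qed simp
  then have "(\<integral>\<^sup>+ h. ?L h \<partial>lborel) \<le> (\<integral>\<^sup>+ h. ennreal 3 * F1 h + (ennreal 8 * F2 h + (ennreal 4 * F3 h + ennreal 4 * F4 h)) \<partial>lborel)"
    by (rule nn_integral_mono)
  also have "\<dots> = ennreal 3 * (\<integral>\<^sup>+ h. F1 h \<partial>lborel) + (ennreal 8 * (\<integral>\<^sup>+ h. F2 h \<partial>lborel) + (ennreal 4 * (\<integral>\<^sup>+ h. F3 h \<partial>lborel) + ennreal 4 * (\<integral>\<^sup>+ h. F4 h \<partial>lborel)))"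
    by (simp add: nn_integral_add nn_integral_cmult)
  also have "\<dots> \<le> ennreal 3 * ennreal 2 + (ennreal 8 * ennreal 1 + (ennreal 4 * ennreal (1 / scale_factor \<epsilon> s) + ennreal 4 * ennreal 1))"
    unfolding i1 i2 i3 by (intro add_mono mult_left_mono i4) auto
  also have "\<dots> = ennreal (3 * 2 + (8 * 1 + (4 * (1 / scale_factor \<epsilon> s) + 4 * 1)))"
    using lam by (simp only: ennreal_mult[symmetric] ennreal_plus[symmetric] zero_le_numeral zero_le_one zero_le_divide_1_iff less_imp_le add_nonneg_nonneg mult_nonneg_nonneg)
  finally have "2 * (\<integral>\<^sup>+ h. ?L h \<partial>lborel) \<le> ennreal 2 * ennreal (3 * 2 + (8 * 1 + (4 * (1 / scale_factor \<epsilon> s) + 4 * 1)))"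
    by (auto intro: mult_left_mono)
  also have "\<dots> = ennreal (8 / scale_factor \<epsilon> s + 36)" using lam by (subst ennreal_mult[symmetric]) (auto simp: algebra_simps)
  finally show ?thesis unfolding L_def by (subst gsq_eq_diff_sq) auto
qed

text \<open>Multiplying \<open>K + 8 / \<lambda> + 36\<close> by the scale factor \<lambda> leaves
  \<open>8\<close> and a remainder that tends to \<open>0\<close>, even if no \<open>s j\<close>
  equals \<open>1/2\<close>.\<close>

lemma (in scales) half_profile:
  assumes half: "s0 = 1/2" and W: "double_well W" and \<eta>: "0 < \<eta>"
  shows "\<forall>\<^sub>F j in sequentially. ennreal (scale_factor (\<epsilon> j) (s j)) * ((\<integral>\<^sup>+ x. ennreal (W (ramp x)) \<partial>lborel) + gsq (s j) {- (1 / \<epsilon> j)<..<1 / \<epsilon> j} ramp) \<le> ennreal (8 + \<eta>)"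
proof -
  have "(\<integral>\<^sup>+ x. ennreal (W (ramp x)) \<partial>lborel) < \<infinity>" by (rule potential_profile_finite[OF W, where R = 1 and M = 1]) auto
  then obtain K where K: "0 \<le> K" "(\<integral>\<^sup>+ x. ennreal (W (ramp x)) \<partial>lborel) = ennreal K" by (cases "\<integral>\<^sup>+ x. ennreal (W (ramp x)) \<partial>lborel") auto
  have "(\<lambda>j. scale_factor (\<epsilon> j) (s j) * (K + 36)) \<longlonglongrightarrow> (2 * s0 - 1) * (K + 36)" by (intro tendsto_intros scale_lim)
  then have "(\<lambda>j. scale_factor (\<epsilon> j) (s j) * (K + 36)) \<longlonglongrightarrow> 0" using half by simp
  then have "\<forall>\<^sub>F j in sequentially. scale_factor (\<epsilon> j) (s j) * (K + 36) < \<eta>" using \<eta> by (rule order_tendstoD)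
  moreover have "\<forall>\<^sub>F j in sequentially. s j < 3/4" using order_tendstoD(2)[OF s_lim, of "3/4"] half by simp
  ultimately show ?thesis
  proof eventually_elim
    case (elim j)
    have lam: "0 < scale_factor (\<epsilon> j) (s j)" by (rule scale_pos)
    have "ennreal (scale_factor (\<epsilon> j) (s j)) * ((\<integral>\<^sup>+ x. ennreal (W (ramp x)) \<partial>lborel) + gsq (s j) {- (1 / \<epsilon> j)<..<1 / \<epsilon> j} ramp)
      \<le> ennreal (scale_factor (\<epsilon> j) (s j)) * (ennreal K + ennreal (8 / scale_factor (\<epsilon> j) (s j) + 36))"
      unfolding K(2) by (intro mult_left_mono add_left_mono gsq_ramp_le e s) (use elim in auto)
    also have "\<dots> = ennreal (scale_factor (\<epsilon> j) (s j) * (K + (8 / scale_factor (\<epsilon> j) (s j) + 36)))" using lam K(1) by (simp add: ennreal_mult)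
    also have "\<dots> \<le> ennreal (8 + \<eta>)" using elim lam by (intro ennreal_leI) (simp add: distrib_left)
    finally show ?case .
  qed
qed

lemma mean_value_near:
  fixes f :: "real \<Rightarrow> real"
  assumes f: "continuous_on UNIV f" and \<delta>: "0 < \<delta>" and b: "\<And>t. t \<in> {0..\<delta>} \<Longrightarrow> \<bar>f t - c\<bar> \<le> e"
  shows "\<bar>integral {0..\<delta>} f / \<delta> - c\<bar> \<le> e"
proof -
  have i: "f integrable_on {0..\<delta>}" by (intro integrable_continuous_interval continuous_on_subset[OF f]) auto
  have "norm (integral {0..\<delta>} (\<lambda>t. f t - c)) \<le> e * (\<delta> - 0)"
    by (rule integral_bound) (use \<delta> b in \<open>auto intro!: continuous_intros continuous_on_subset[OF f]\<close>)
  moreover have "integral {0..\<delta>} (\<lambda>t. f t - c) = integral {0..\<delta>} f - \<delta> * c"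
    using \<delta> i by (subst integral_diff) auto
  moreover have "integral {0..\<delta>} f / \<delta> - c = (integral {0..\<delta>} f - \<delta> * c) / \<delta>" using \<delta> by (simp add: diff_divide_distrib)
  ultimately show ?thesis using \<delta> by (simp add: abs_divide divide_le_eq)
qed

lemma mean_value_power2:
  fixes f :: "real \<Rightarrow> real"
  assumes f: "continuous_on UNIV f" and \<delta>: "0 < \<delta>"
  shows "(integral {0..\<delta>} f / \<delta>)\<^sup>2 \<le> integral {0..\<delta>} (\<lambda>t. (f t)\<^sup>2) / \<delta>"
proof -
  define m where "m = integral {0..\<delta>} f / \<delta>"
  have c: "continuous_on {0..\<delta>} f" by (rule continuous_on_subset[OF f]) simp
  have i: "f integrable_on {0..\<delta>}" "(\<lambda>t. (f t)\<^sup>2) integrable_on {0..\<delta>}" "(\<lambda>t. 2 * m * f t) integrable_on {0..\<delta>}"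
    by (intro integrable_continuous_interval continuous_intros c)+
  have "0 \<le> integral {0..\<delta>} (\<lambda>t. (f t - m)\<^sup>2)" by (intro integral_nonneg integrable_continuous_interval continuous_intros c) auto
  also have "(\<lambda>t. (f t - m)\<^sup>2) = (\<lambda>t. ((f t)\<^sup>2 - 2 * m * f t) + m\<^sup>2)" by (auto simp: power2_eq_square algebra_simps)
  also have "integral {0..\<delta>} \<dots> = integral {0..\<delta>} (\<lambda>t. (f t)\<^sup>2) - 2 * m * integral {0..\<delta>} f + \<delta> * m\<^sup>2"
    using integral_unique[OF has_integral_add[OF has_integral_diff[OF integrable_integral[OF i(2)] has_integral_mult_right[OF integrable_integral[OF i(1)], of "2 * m"]] has_integral_const_real[of "m\<^sup>2" 0 \<delta>]]] \<delta>
    by simp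
  also have "integral {0..\<delta>} f = m * \<delta>" unfolding m_def using \<delta> by simp
  finally have "m\<^sup>2 * \<delta> \<le> integral {0..\<delta>} (\<lambda>t. (f t)\<^sup>2)" by (simp add: power2_eq_square algebra_simps)
  then show ?thesis unfolding m_def[symmetric] using \<delta> by (simp add: le_divide_eq)
qed

lemma integral_translate:
  fixes f :: "real \<Rightarrow> real"
  assumes "continuous_on UNIV f"
  shows "integral {a..b} (\<lambda>t. f (x + t)) = integral {a + x..b + x} f"
  using integral_shift[of a x b f] continuous_on_subset[OF assms, of "{a + x..b + x}"] by (simp add: o_def add.commute)

text \<open>The average over a window is Lipschitz, and by Jensen's inequality averaging does not increase the seminorm.\<close>

lemma steklov_profile:
  assumes W: "double_well W" and U: "continuous_on UNIV U" and low: "\<And>x. x \<le> - R \<Longrightarrow> U x = -1" and high: "\<And>x. R \<le> x \<Longrightarrow> U x = (1::real)"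
    and M: "\<And>x. \<bar>U x\<bar> \<le> M" and R: "0 < R" and \<omega>: "0 < \<omega>"
  obtains \<phi> K where "0 \<le> K" "\<And>x y. \<bar>\<phi> x - \<phi> y\<bar> \<le> K * \<bar>x - y\<bar>" "\<And>x. x \<le> - (R + 1) \<Longrightarrow> \<phi> x = -1" "\<And>x. R + 1 \<le> x \<Longrightarrow> \<phi> x = 1"
    "\<And>x. \<bar>\<phi> x\<bar> \<le> M" "(\<integral>\<^sup>+ x. ennreal (W (\<phi> x)) \<partial>lborel) \<le> (\<integral>\<^sup>+ x. ennreal (W (U x)) \<partial>lborel) + ennreal \<omega>" "gsq s UNIV \<phi> \<le> gsq s UNIV U"
proof -
  have [measurable]: "U \<in> borel_measurable borel" using U by (rule borel_measurable_continuous_onI)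
  have [measurable]: "W \<in> borel_measurable borel" by (rule double_well_measurable[OF W])
  have W01: "W 1 = 0" "W (-1) = 0" "\<And>z. 0 \<le> W z" using W unfolding double_well_def by blast+
  have "uniformly_continuous_on {-M..M} W" using W unfolding double_well_def by (intro compact_uniformly_continuous) (auto intro: continuous_on_subset)
  moreover have \<omega>': "0 < \<omega> / (2 * R + 2)" using \<omega> R by simp
  \<comment> \<open>The tolerance for \<open>W\<close> is \<omega> divided by
    \<open>2 * R + 2\<close>, the length of the interval on which the averaged function can leave
    the wells.\<close>
  ultimately obtain e where e: "0 < e" "\<And>z z'. z \<in> {-M..M} \<Longrightarrow> z' \<in> {-M..M} \<Longrightarrow> dist z' z < e \<Longrightarrow> dist (W z') (W z) < \<omega> / (2 * R + 2)"
    unfolding uniformly_continuous_on_def by blast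
  have "uniformly_continuous_on {-(R+2)..R+2} U" using U by (intro compact_uniformly_continuous) (auto intro: continuous_on_subset)
  moreover have "0 < e / 2" using e by simp
  ultimately obtain d where d: "0 < d" "\<And>z z'. z \<in> {-(R+2)..R+2} \<Longrightarrow> z' \<in> {-(R+2)..R+2} \<Longrightarrow> dist z' z < d \<Longrightarrow> dist (U z') (U z) < e / 2"
    unfolding uniformly_continuous_on_def by blast
  \<comment> \<open>Windows of length at most \<open>1\<close> enlarge the transition zone to
    \<open>R + 1\<close> at most and stay within the interval on which uniform continuity was
    taken.\<close>
  define \<delta> where "\<delta> = min (d / 2) 1"
  have \<delta>: "0 < \<delta>" "\<delta> < d" "\<delta> \<le> 1" unfolding \<delta>_def using d by auto
  define \<phi> where "\<phi> x = integral {0..\<delta>} (\<lambda>t. U (x + t)) / \<delta>" for x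
  have Uc: "continuous_on UNIV (\<lambda>t. U (x + t))" for x by (intro continuous_on_compose2[OF U] continuous_intros) auto
  have near: "\<bar>\<phi> x - c\<bar> \<le> r" if "\<And>t. t \<in> {0..\<delta>} \<Longrightarrow> \<bar>U (x + t) - c\<bar> \<le> r" for x c r
    unfolding \<phi>_def by (rule mean_value_near[OF Uc \<delta>(1) that])
  have Uint: "U integrable_on {a..b}" for a b by (intro integrable_continuous_interval continuous_on_subset[OF U]) auto
  have Ubd: "\<bar>integral {a..b} U\<bar> \<le> M * (b - a)" if "a \<le> b" for a b
    using integral_bound[OF that continuous_on_subset[OF U], of M] M by auto
  \<comment> \<open>Shifting the window changes the integral only by two end pieces of length
    \<open>y - x\<close>, hence the factor \<open>2 * M / \<delta>\<close>.\<close>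
  have lip1: "\<bar>\<phi> y - \<phi> x\<bar> \<le> 2 * M / \<delta> * (y - x)" if "x \<le> y" for x y
  proof -
    have a: "integral {x..x + \<delta>} U + integral {x + \<delta>..y + \<delta>} U = integral {x..y + \<delta>} U"
      by (intro Henstock_Kurzweil_Integration.integral_combine Uint) (use that \<delta> in auto)
    have b: "integral {x..y} U + integral {y..y + \<delta>} U = integral {x..y + \<delta>} U"
      by (intro Henstock_Kurzweil_Integration.integral_combine Uint) (use that \<delta> in auto)
    have "\<phi> y - \<phi> x = (integral {y..y + \<delta>} U - integral {x..x + \<delta>} U) / \<delta>"
      unfolding \<phi>_def integral_translate[OF U] by (simp add: diff_divide_distrib add.commute)
    also have "integral {y..y + \<delta>} U - integral {x..x + \<delta>} U = integral {x + \<delta>..y + \<delta>} U - integral {x..y} U" using a b by linarith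
    finally have "\<bar>\<phi> y - \<phi> x\<bar> = \<bar>integral {x + \<delta>..y + \<delta>} U - integral {x..y} U\<bar> / \<delta>" using \<delta> by (simp add: abs_divide)
    also have "\<dots> \<le> (2 * M * (y - x)) / \<delta>"
      using Ubd[of "x + \<delta>" "y + \<delta>"] Ubd[OF that] that \<delta> by (intro divide_right_mono) (auto simp: abs_le_iff)
    finally show ?thesis by simp
  qed
  have lip: "\<bar>\<phi> x - \<phi> y\<bar> \<le> 2 * M / \<delta> * \<bar>x - y\<bar>" for x y
    using lip1[of x y] lip1[of y x] by (cases "x \<le> y") (auto simp: abs_minus_commute)
  have M0: "0 \<le> M" using M[of 0] by linarith
  have K: "0 \<le> 2 * M / \<delta>" using M0 \<delta> by simp
  have "(2 * M / \<delta>)-lipschitz_on UNIV \<phi>" using lip K unfolding lipschitz_on_def dist_real_def by auto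
  then have [measurable]: "\<phi> \<in> borel_measurable borel" by (intro borel_measurable_continuous_onI lipschitz_on_continuous_on)
  have lowp: "\<phi> x = -1" if "x \<le> - (R + 1)" for x
  proof -
    have "\<bar>\<phi> x - (-1)\<bar> \<le> 0" by (rule near) (use that \<delta> low in auto)
    then show ?thesis by simp
  qed
  have highp: "\<phi> x = 1" if "R + 1 \<le> x" for x
  proof -
    have "\<bar>\<phi> x - 1\<bar> \<le> 0" by (rule near) (use that \<delta> high in auto)
    then show ?thesis by simp
  qed
  have Mp: "\<bar>\<phi> x\<bar> \<le> M" for x using near[of x 0 M] M by simp
  have "(\<integral>\<^sup>+ x. ennreal (W (\<phi> x)) \<partial>lborel) \<le> (\<integral>\<^sup>+ x. ennreal (W (U x)) + ennreal (\<omega> / (2 * R + 2)) * indicator {-(R+1)..R+1} x \<partial>lborel)"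
  proof (rule nn_integral_mono)
    fix x
    show "ennreal (W (\<phi> x)) \<le> ennreal (W (U x)) + ennreal (\<omega> / (2 * R + 2)) * indicator {-(R+1)..R+1} x"
    proof (cases "x \<in> {-(R+1)..R+1}")
      case True
      have "\<bar>\<phi> x - U x\<bar> \<le> e / 2"
      proof (rule near)
        fix t assume t: "t \<in> {0..\<delta>}"
        have "dist (U (x + t)) (U x) < e / 2" by (rule d(2)) (use t True \<delta> in \<open>auto simp: dist_real_def\<close>)
        then show "\<bar>U (x + t) - U x\<bar> \<le> e / 2" by (simp add: dist_real_def)
      qed
      then have "dist (W (\<phi> x)) (W (U x)) < \<omega> / (2 * R + 2)" using e(1) Mp[of x] M[of x] by (intro e(2)) (simp_all add: dist_real_def abs_le_iff)
      then have "W (\<phi> x) \<le> W (U x) + \<omega> / (2 * R + 2)" by (simp add: dist_real_def abs_less_iff)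
      then have "ennreal (W (\<phi> x)) \<le> ennreal (W (U x) + \<omega> / (2 * R + 2))" by (rule ennreal_leI)
      also have "\<dots> = ennreal (W (U x)) + ennreal (\<omega> / (2 * R + 2))" using W01(3) \<omega>' by (intro ennreal_plus) auto
      finally show ?thesis using True by simp
    next
      case False
      then have "x \<le> - (R + 1) \<or> R + 1 \<le> x" by auto
      then have "W (\<phi> x) = 0" using lowp[of x] highp[of x] W01 by metis
      then show ?thesis by simp
    qed
  qed
  also have "\<dots> = (\<integral>\<^sup>+ x. ennreal (W (U x)) \<partial>lborel) + ennreal (\<omega> / (2 * R + 2)) * ennreal (2 * R + 2)"
    using R by (subst nn_integral_add) (auto simp: nn_integral_cmult_indicator)
  also have "ennreal (\<omega> / (2 * R + 2)) * ennreal (2 * R + 2) = ennreal \<omega>" using R \<omega>' by (subst ennreal_mult[symmetric]) auto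
  finally have Wle: "(\<integral>\<^sup>+ x. ennreal (W (\<phi> x)) \<partial>lborel) \<le> (\<integral>\<^sup>+ x. ennreal (W (U x)) \<partial>lborel) + ennreal \<omega>" .
  have DDle: "diff_sq UNIV \<phi> h \<le> diff_sq UNIV U h" for h
  proof -
    \<comment> \<open>The increment of the mean is the mean of the increments, so Jensen applies.
      After exchanging the integrals, translation invariance makes the inner one equal to
      \<open>diff_sq UNIV U h\<close> for every \<open>t\<close> of the window.\<close>
    have sq: "ennreal ((\<phi> (x + h) - \<phi> x)\<^sup>2) \<le> (\<integral>\<^sup>+ t. ennreal (1 / \<delta>) * (ennreal ((U (x + t + h) - U (x + t))\<^sup>2) * indicator {0..\<delta>} t) \<partial>lborel)" for x
    proof -
      define f where "f t = U (x + h + t) - U (x + t)" for t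
      have fc: "continuous_on UNIV f" unfolding f_def by (intro continuous_intros Uc)
      have fi: "(\<lambda>t. (f t)\<^sup>2) integrable_on {0..\<delta>}" by (intro integrable_continuous_interval continuous_intros continuous_on_subset[OF fc]) auto
      have "\<phi> (x + h) - \<phi> x = integral {0..\<delta>} f / \<delta>"
        unfolding \<phi>_def f_def by (subst integral_diff) (auto intro!: integrable_continuous_interval continuous_on_subset[OF Uc] simp: diff_divide_distrib)
      then have "(\<phi> (x + h) - \<phi> x)\<^sup>2 \<le> (1 / \<delta>) * integral {0..\<delta>} (\<lambda>t. (f t)\<^sup>2)" using mean_value_power2[OF fc \<delta>(1)] by simp
      then have "ennreal ((\<phi> (x + h) - \<phi> x)\<^sup>2) \<le> ennreal ((1 / \<delta>) * integral {0..\<delta>} (\<lambda>t. (f t)\<^sup>2))" by (rule ennreal_leI)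
      also have "\<dots> = ennreal (1 / \<delta>) * ennreal (integral {0..\<delta>} (\<lambda>t. (f t)\<^sup>2))" using \<delta> by (intro ennreal_mult integral_nonneg fi) auto
      also have "ennreal (integral {0..\<delta>} (\<lambda>t. (f t)\<^sup>2)) = (\<integral>\<^sup>+ t. ennreal ((f t)\<^sup>2) * indicator {0..\<delta>} t \<partial>lborel)"
        by (rule nn_integral_has_integral_lebesgue'[symmetric]) (use fi in \<open>auto intro: integrable_integral\<close>)
      finally show ?thesis unfolding f_def by (subst nn_integral_cmult) (auto simp: add.assoc add.commute add.left_commute)
    qed
    have "diff_sq UNIV \<phi> h \<le> (\<integral>\<^sup>+ x. (\<integral>\<^sup>+ t. ennreal (1 / \<delta>) * (ennreal ((U (x + t + h) - U (x + t))\<^sup>2) * indicator {0..\<delta>} t) \<partial>lborel) \<partial>lborel)"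
      unfolding diff_sq_def by (rule nn_integral_mono) (simp add: sq)
    also have "\<dots> = (\<integral>\<^sup>+ t. (\<integral>\<^sup>+ x. ennreal (1 / \<delta>) * (ennreal ((U (x + t + h) - U (x + t))\<^sup>2) * indicator {0..\<delta>} t) \<partial>lborel) \<partial>lborel)"
      by (rule lborel_pair.Fubini') measurable
    also have "\<dots> = (\<integral>\<^sup>+ t. ennreal (1 / \<delta>) * diff_sq UNIV U h * indicator {0..\<delta>} t \<partial>lborel)"
    proof (rule nn_integral_cong)
      fix t
      have "(\<integral>\<^sup>+ x. ennreal ((U (x + t + h) - U (x + t))\<^sup>2) \<partial>lborel) = diff_sq UNIV U h"
        using nn_integral_rescale[of "\<lambda>x. ennreal ((U (x + h) - U x)\<^sup>2)" 1 t] unfolding diff_sq_def by (simp add: add.commute)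
      then show "(\<integral>\<^sup>+ x. ennreal (1 / \<delta>) * (ennreal ((U (x + t + h) - U (x + t))\<^sup>2) * indicator {0..\<delta>} t) \<partial>lborel) = ennreal (1 / \<delta>) * diff_sq UNIV U h * indicator {0..\<delta>} t"
        by (cases "t \<in> {0..\<delta>}") (auto simp: nn_integral_cmult)
    qed
    also have "\<dots> = ennreal (1 / \<delta>) * diff_sq UNIV U h * ennreal \<delta>" using \<delta> by (subst nn_integral_cmult_indicator) auto
    also have "\<dots> = (ennreal (1 / \<delta>) * ennreal \<delta>) * diff_sq UNIV U h" by (simp only: mult_ac)
    also have "ennreal (1 / \<delta>) * ennreal \<delta> = 1" using \<delta> by (subst ennreal_mult[symmetric]) auto
    finally show ?thesis by simp
  qed
  have "gsq s UNIV \<phi> = 2 * (\<integral>\<^sup>+ h. ennreal (h powr (- (1 + 2 * s))) * diff_sq UNIV \<phi> h * indicator {0<..} h \<partial>lborel)" by (rule gsq_eq_diff_sq) auto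
  also have "\<dots> \<le> 2 * (\<integral>\<^sup>+ h. ennreal (h powr (- (1 + 2 * s))) * diff_sq UNIV U h * indicator {0<..} h \<partial>lborel)"
    by (intro mult_left_mono nn_integral_mono mult_right_mono DDle) auto
  also have "\<dots> = gsq s UNIV U" by (rule gsq_eq_diff_sq[symmetric]) auto
  finally have ggle: "gsq s UNIV \<phi> \<le> gsq s UNIV U" .
  show ?thesis by (rule that[OF K lip lowp highp Mp Wle ggle])
qed

abbreviation unit_ramp :: "real \<Rightarrow> real" where "unit_ramp x \<equiv> max 0 (min 1 x)"

text \<open>The difference of the two sides is \<open>\<eta> * (a - (b + c))\<^sup>2 +
  (\<eta>\<^sup>2 + \<eta>) * (b - c)\<^sup>2\<close>. The weights keep the coefficient of the main
  term near \<open>1\<close> and the corrections of order \<eta>.\<close>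

lemma square_sum_weighted:
  fixes a b c \<eta> :: real
  assumes "0 < \<eta>"
  shows "(a + \<eta> * b + \<eta> * c)\<^sup>2 \<le> (1 + \<eta>) * a\<^sup>2 + 2 * (\<eta>\<^sup>2 + \<eta>) * (b\<^sup>2 + c\<^sup>2)"
proof -
  have "(1 + \<eta>) * a\<^sup>2 + 2 * (\<eta>\<^sup>2 + \<eta>) * (b\<^sup>2 + c\<^sup>2) - (a + \<eta> * b + \<eta> * c)\<^sup>2 = \<eta> * (a - (b + c))\<^sup>2 + (\<eta>\<^sup>2 + \<eta>) * (b - c)\<^sup>2"
    by (simp add: power2_eq_square algebra_simps)
  moreover have "0 \<le> \<eta> * (a - (b + c))\<^sup>2 + (\<eta>\<^sup>2 + \<eta>) * (b - c)\<^sup>2" using assms by simp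
  ultimately show ?thesis by linarith
qed

text \<open>Far out \<open>U\<close> is within \<eta> of its limits, so blending it into
  \<open>\<plusminus>1\<close> over an interval of length \<open>1\<close> enlarges increments by at
  most \<eta> times those of a ramp. The seminorm \<open>G\<close> of the ramp does not depend on
  the position \<open>R\<close>, so the loss is of order \<eta>.\<close>

lemma cut_profile:
  assumes W: "double_well W" and s: "1/2 < s" "s < 1" and U: "continuous_on UNIV U" and lims: "(U \<longlongrightarrow> 1) at_top" "(U \<longlongrightarrow> -1) at_bot"
    and E: "profile_en W s UNIV U \<le> ennreal E" and \<omega>: "0 < \<omega>"
  obtains V R M where "continuous_on UNIV V" "0 < R" "\<And>x. x \<le> - R \<Longrightarrow> V x = -1" "\<And>x. R \<le> x \<Longrightarrow> V x = (1::real)" "\<And>x. \<bar>V x\<bar> \<le> M"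
    "profile_en W s UNIV V \<le> profile_en W s UNIV U + ennreal \<omega>"
proof -
  have [measurable]: "U \<in> borel_measurable borel" using U by (rule borel_measurable_continuous_onI)
  have [measurable]: "W \<in> borel_measurable borel" by (rule double_well_measurable[OF W])
  have W01: "W 1 = 0" "W (-1) = 0" "\<And>z. 0 \<le> W z" using W unfolding double_well_def by blast+
  have tr: "transition 1 1 1 unit_ramp" unfolding transition_def by (auto simp: max_def min_def abs_if)
  obtain G where G: "0 \<le> G" "gsq s UNIV unit_ramp = ennreal G" using transition_gsq_finite[OF tr s] by (cases "gsq s UNIV unit_ramp") auto
  define E0 where "E0 = max E 0"
  have E0: "0 \<le> E0" "gsq s UNIV U \<le> ennreal E0" using E unfolding E0_def profile_en_def by (auto simp: max_def ennreal_neg intro: order_trans[rotated])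
  have Wc: "isCont W z" for z using W unfolding double_well_def by (simp add: continuous_on_eq_continuous_at)
  have "\<exists>r>0. \<forall>z. \<bar>z - z0\<bar> \<le> r \<longrightarrow> W z \<le> \<omega> / 4" if z0: "W z0 = 0" for z0
  proof -
    have "0 < \<omega> / 4" using \<omega> by simp
    with Wc[of z0] obtain r where r: "0 < r" "\<And>z. dist z z0 < r \<Longrightarrow> dist (W z) (W z0) < \<omega> / 4" unfolding continuous_at_eps_delta by (metis dist_commute)
    show ?thesis
    proof (intro exI[of _ "r / 2"] conjI allI impI)
      fix z assume "\<bar>z - z0\<bar> \<le> r / 2"
      then have "dist (W z) (W z0) < \<omega> / 4" using r(1) by (intro r(2)) (simp add: dist_real_def)
      then show "W z \<le> \<omega> / 4" using z0 by (simp add: dist_real_def abs_less_iff)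
    qed (use r in simp)
  qed
  from this[OF W01(1)] this[OF W01(2)] obtain r1 r2 where r1: "0 < r1" "\<And>z. \<bar>z - 1\<bar> \<le> r1 \<Longrightarrow> W z \<le> \<omega> / 4" and r2: "0 < r2" "\<And>z. \<bar>z - (-1)\<bar> \<le> r2 \<Longrightarrow> W z \<le> \<omega> / 4" by blast
  \<comment> \<open>The seminorm grows by at most \<open>\<eta> * E0 + 2 * c * G\<close> with
    \<open>c \<le> 4 * \<eta>\<close>, that is by \<open>\<eta> * (E0 + 8 * G)\<close>; the term
    with \<omega> makes this at most \<open>\<omega> / 2\<close>, and \<open>r1\<close>,
    \<open>r2\<close> keep the potential below \<open>\<omega> / 4\<close> on each cutting
    interval.\<close>
  define \<eta> where "\<eta> = min 1 (min (\<omega> / (2 * (E0 + 8 * G + 1))) (min r1 r2))"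
  have pos: "0 < 2 * (E0 + 8 * G + 1)" using E0 G by simp
  have \<eta>: "0 < \<eta>" "\<eta> \<le> 1" "\<eta> \<le> r1" "\<eta> \<le> r2" unfolding \<eta>_def using pos \<omega> r1 r2 by auto
  have "\<eta> \<le> \<omega> / (2 * (E0 + 8 * G + 1))" unfolding \<eta>_def by simp
  then have "\<eta> * (2 * (E0 + 8 * G + 1)) \<le> \<omega>" using pos by (simp add: le_divide_eq)
  then have \<eta>\<omega>: "\<eta> * (E0 + 8 * G) \<le> \<omega> / 2" using \<eta>(1) by (simp add: algebra_simps)
  have "\<forall>\<^sub>F x in at_top. \<bar>U x - 1\<bar> < \<eta>" using tendstoD[OF lims(1) \<eta>(1)] by (simp add: dist_real_def)
  then obtain Ra where Ra: "\<And>x. Ra \<le> x \<Longrightarrow> \<bar>U x - 1\<bar> < \<eta>" unfolding eventually_at_top_linorder by blast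
  have "\<forall>\<^sub>F x in at_bot. \<bar>U x + 1\<bar> < \<eta>" using tendstoD[OF lims(2) \<eta>(1)] by (simp add: dist_real_def)
  then obtain Rb where Rb: "\<And>x. x \<le> Rb \<Longrightarrow> \<bar>U x + 1\<bar> < \<eta>" unfolding eventually_at_bot_linorder by blast
  define R where "R = max 1 (max Ra (- Rb))"
  have R: "1 \<le> R" "\<And>x. R \<le> x \<Longrightarrow> \<bar>U x - 1\<bar> \<le> \<eta>" "\<And>x. x \<le> - R \<Longrightarrow> \<bar>U x + 1\<bar> \<le> \<eta>"
    unfolding R_def using Ra Rb by (auto intro!: less_imp_le)
  define k where "k x = unit_ramp (- R + 1 * x)" for x
  define l where "l x = unit_ramp (- R + (-1) * x)" for x
  define V where "V x = U x - k x * (U x - 1) - l x * (U x + 1)" for x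
  have [measurable]: "k \<in> borel_measurable borel" "l \<in> borel_measurable borel" unfolding k_def l_def by measurable
  have kl: "gsq s UNIV k = ennreal G" "gsq s UNIV l = ennreal G"
    using gsq_affine[of unit_ramp UNIV 1 s "- R"] gsq_affine[of unit_ramp UNIV "-1" s "- R"] G unfolding k_def[abs_def] l_def[abs_def] by simp_all
  have k01: "0 \<le> k x" "k x \<le> 1" "0 \<le> l x" "l x \<le> 1" for x unfolding k_def l_def by auto
  have k0: "k x = 0" if "x \<le> R" for x using that unfolding k_def by auto
  have l0: "l x = 0" if "- R \<le> x" for x using that unfolding l_def by auto
  have k1: "k x = 1" if "R + 1 \<le> x" for x using that unfolding k_def by auto
  have l1: "l x = 1" if "x \<le> - (R + 1)" for x using that unfolding l_def by auto
  have Vc: "continuous_on UNIV V" unfolding V_def k_def l_def by (intro continuous_intros U)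
  then have [measurable]: "V \<in> borel_measurable borel" by (rule borel_measurable_continuous_onI)
  have high: "V x = 1" if "R + 1 \<le> x" for x using k1[OF that] l0[of x] that R(1) by (simp add: V_def)
  have low: "V x = -1" if "x \<le> - (R + 1)" for x using l1[OF that] k0[of x] that R(1) by (simp add: V_def)
  have "compact (V ` {-(R+1)..R+1})" by (intro compact_continuous_image continuous_on_subset[OF Vc]) auto
  then have "bounded (V ` {-(R+1)..R+1})" by (rule compact_imp_bounded)
  then obtain M0 where M0: "\<And>x. x \<in> {-(R+1)..R+1} \<Longrightarrow> norm (V x) \<le> M0" unfolding bounded_iff by blast
  have M: "\<bar>V x\<bar> \<le> max 1 M0" for x
  proof (cases "x \<in> {-(R+1)..R+1}")
    case True
    then show ?thesis using M0[OF True] by simp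
  next
    case False
    then have "x \<le> -(R+1) \<or> R + 1 \<le> x" by auto
    then show ?thesis using high[of x] low[of x] by auto
  qed
  have key: "\<bar>V x - V y\<bar> \<le> \<bar>U x - U y\<bar> + \<eta> * \<bar>k x - k y\<bar> + \<eta> * \<bar>l x - l y\<bar>" if xy: "y \<le> x" for x y
  proof -
    \<comment> \<open>The splitting lets the increment of \<open>k\<close> multiply \<open>U\<close>
      at the right point \<open>x\<close> and that of \<open>l\<close> multiply \<open>U\<close> at
      the left point \<open>y\<close>: if \<open>k\<close> changes, then \<open>x\<close> lies
      beyond \<open>R\<close>, where \<open>U\<close> is near \<open>1\<close>, and likewise on the
      left.\<close>
    have id: "V x - V y = (1 - k y - l x) * (U x - U y) - (k x - k y) * (U x - 1) - (l x - l y) * (U y + 1)"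
      unfolding V_def by (simp add: algebra_simps)
    have "\<bar>1 - k y - l x\<bar> \<le> 1" using k01[of x] k01[of y] by linarith
    then have 1: "\<bar>(1 - k y - l x) * (U x - U y)\<bar> \<le> \<bar>U x - U y\<bar>" unfolding abs_mult by (rule mult_left_le_one_le[OF abs_ge_zero abs_ge_zero])
    have 2: "\<bar>(k x - k y) * (U x - 1)\<bar> \<le> \<eta> * \<bar>k x - k y\<bar>"
    proof (cases "x \<le> R")
      case True
      then show ?thesis using k0[of x] k0[of y] xy by simp
    next
      case False
      then have "\<bar>U x - 1\<bar> \<le> \<eta>" by (intro R(2)) simp
      then have "\<bar>k x - k y\<bar> * \<bar>U x - 1\<bar> \<le> \<bar>k x - k y\<bar> * \<eta>" by (intro mult_left_mono) auto
      then show ?thesis by (simp add: abs_mult mult.commute)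
    qed
    have 3: "\<bar>(l x - l y) * (U y + 1)\<bar> \<le> \<eta> * \<bar>l x - l y\<bar>"
    proof (cases "- R \<le> y")
      case True
      then show ?thesis using l0[of x] l0[of y] xy by simp
    next
      case False
      then have "\<bar>U y + 1\<bar> \<le> \<eta>" by (intro R(3)) simp
      then have "\<bar>l x - l y\<bar> * \<bar>U y + 1\<bar> \<le> \<bar>l x - l y\<bar> * \<eta>" by (intro mult_left_mono) auto
      then show ?thesis by (simp add: abs_mult mult.commute)
    qed
    show ?thesis unfolding id using 1 2 3 by linarith
  qed
  have key': "(V x - V y)\<^sup>2 \<le> (1 + \<eta>) * (U x - U y)\<^sup>2 + 2 * (\<eta>\<^sup>2 + \<eta>) * ((k x - k y)\<^sup>2 + (l x - l y)\<^sup>2)" for x y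
  proof -
    have "\<bar>V x - V y\<bar> \<le> \<bar>U x - U y\<bar> + \<eta> * \<bar>k x - k y\<bar> + \<eta> * \<bar>l x - l y\<bar>"
      using key[of y x] key[of x y] by (cases "y \<le> x") (simp_all add: abs_minus_commute)
    then have "\<bar>V x - V y\<bar>\<^sup>2 \<le> (\<bar>U x - U y\<bar> + \<eta> * \<bar>k x - k y\<bar> + \<eta> * \<bar>l x - l y\<bar>)\<^sup>2" by (intro power_mono) auto
    also have "\<dots> \<le> (1 + \<eta>) * \<bar>U x - U y\<bar>\<^sup>2 + 2 * (\<eta>\<^sup>2 + \<eta>) * (\<bar>k x - k y\<bar>\<^sup>2 + \<bar>l x - l y\<bar>\<^sup>2)" by (rule square_sum_weighted[OF \<eta>(1)])
    finally show ?thesis by simp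
  qed
  define c where "c = 2 * (\<eta>\<^sup>2 + \<eta>)"
  have c0: "0 \<le> c" unfolding c_def using \<eta> by simp
  have kern: "kern s V x y \<le> ennreal (1 + \<eta>) * kern s U x y + (ennreal c * kern s k x y + ennreal c * kern s l x y)" for x y
  proof -
    define p where "p = \<bar>x - y\<bar> powr (1 + 2 * s)"
    have p: "0 \<le> p" unfolding p_def by simp
    have "(V x - V y)\<^sup>2 / p \<le> ((1 + \<eta>) * (U x - U y)\<^sup>2 + c * ((k x - k y)\<^sup>2 + (l x - l y)\<^sup>2)) / p" using key'[of x y] p unfolding c_def by (intro divide_right_mono) auto
    also have "\<dots> = (1 + \<eta>) * ((U x - U y)\<^sup>2 / p) + (c * ((k x - k y)\<^sup>2 / p) + c * ((l x - l y)\<^sup>2 / p))" by (simp add: add_divide_distrib distrib_left)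
    finally have "ennreal ((V x - V y)\<^sup>2 / p) \<le> ennreal \<dots>" by (rule ennreal_leI)
    also have "\<dots> = ennreal (1 + \<eta>) * ennreal ((U x - U y)\<^sup>2 / p) + (ennreal c * ennreal ((k x - k y)\<^sup>2 / p) + ennreal c * ennreal ((l x - l y)\<^sup>2 / p))"
      using \<eta> c0 p by (simp only: ennreal_mult ennreal_plus add_nonneg_nonneg mult_nonneg_nonneg zero_le_one less_imp_le divide_nonneg_nonneg zero_le_power2)
    finally show ?thesis unfolding kern_def p_def .
  qed
  have "gsq s UNIV V \<le> (\<integral>\<^sup>+ x. (\<integral>\<^sup>+ y. ennreal (1 + \<eta>) * kern s U x y + (ennreal c * kern s k x y + ennreal c * kern s l x y) \<partial>lborel) \<partial>lborel)"
    unfolding gsq_def by (intro nn_integral_mono) (simp add: kern)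
  also have "\<dots> = ennreal (1 + \<eta>) * gsq s UNIV U + (ennreal c * gsq s UNIV k + ennreal c * gsq s UNIV l)"
    unfolding gsq_def by (simp add: nn_integral_add nn_integral_cmult)
  also have "\<dots> = gsq s UNIV U + (ennreal \<eta> * gsq s UNIV U + (ennreal c * ennreal G + ennreal c * ennreal G))"
    unfolding kl using \<eta> by (simp add: ennreal_plus distrib_right add.assoc)
  also have "\<dots> \<le> gsq s UNIV U + (ennreal \<eta> * ennreal E0 + (ennreal c * ennreal G + ennreal c * ennreal G))"
    by (intro add_left_mono add_right_mono mult_left_mono E0) auto
  also have "ennreal \<eta> * ennreal E0 + (ennreal c * ennreal G + ennreal c * ennreal G) = ennreal (\<eta> * E0 + (c * G + c * G))"
    using \<eta> E0 G c0 by (simp only: ennreal_mult ennreal_plus add_nonneg_nonneg mult_nonneg_nonneg less_imp_le)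
  also have "\<dots> \<le> ennreal (\<omega> / 2)"
  proof (rule ennreal_leI)
    have "\<eta>\<^sup>2 \<le> \<eta>" using \<eta> by (simp add: power2_eq_square mult_left_le)
    then have "c \<le> 4 * \<eta>" unfolding c_def by simp
    then have "c * G \<le> 4 * \<eta> * G" by (intro mult_right_mono G)
    then show "\<eta> * E0 + (c * G + c * G) \<le> \<omega> / 2" using \<eta>\<omega> by (simp add: algebra_simps)
  qed
  finally have 1: "gsq s UNIV V \<le> gsq s UNIV U + ennreal (\<omega> / 2)" by (simp add: add_left_mono)
  have "(\<integral>\<^sup>+ x. ennreal (W (V x)) \<partial>lborel) \<le> (\<integral>\<^sup>+ x. ennreal (W (U x)) + (ennreal (\<omega> / 4) * indicator {R..R+1} x + ennreal (\<omega> / 4) * indicator {-(R+1)..-R} x) \<partial>lborel)"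
  proof (rule nn_integral_mono)
    fix x
    consider "x \<le> -(R+1)" | "x \<in> {-(R+1)..-R}" "x < - R" | "x \<in> {-R..R}" | "x \<in> {R..R+1}" "R < x" | "R + 1 \<le> x" by fastforce
    then show "ennreal (W (V x)) \<le> ennreal (W (U x)) + (ennreal (\<omega> / 4) * indicator {R..R+1} x + ennreal (\<omega> / 4) * indicator {-(R+1)..-R} x)"
    proof cases
      case 1
      then show ?thesis using low[OF 1] W01 by simp
    next
      case 2
      have "V x - (-1) = (1 - l x) * (U x + 1)" unfolding V_def using k0[of x] 2 R(1) by (simp add: algebra_simps)
      moreover have "\<bar>(1 - l x) * (U x + 1)\<bar> \<le> \<bar>U x + 1\<bar>" unfolding abs_mult using k01[of x] by (intro mult_left_le_one_le) auto
      ultimately have "\<bar>V x - (-1)\<bar> \<le> r2" using R(3)[of x] 2 \<eta>(4) by auto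
      then have "ennreal (W (V x)) \<le> ennreal (\<omega> / 4)" by (intro ennreal_leI r2)
      then show ?thesis using 2 by (simp add: add_increasing)
    next
      case 3
      then show ?thesis using k0[of x] l0[of x] by (simp add: V_def)
    next
      case 4
      have "V x - 1 = (1 - k x) * (U x - 1)" unfolding V_def using l0[of x] 4 R(1) by (simp add: algebra_simps)
      moreover have "\<bar>(1 - k x) * (U x - 1)\<bar> \<le> \<bar>U x - 1\<bar>" unfolding abs_mult using k01[of x] by (intro mult_left_le_one_le) auto
      ultimately have "\<bar>V x - 1\<bar> \<le> r1" using R(2)[of x] 4 \<eta>(3) by auto
      then have "ennreal (W (V x)) \<le> ennreal (\<omega> / 4)" by (intro ennreal_leI r1)
      then show ?thesis using 4 by (simp add: add_increasing add_increasing2)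
    next
      case 5
      then show ?thesis using high[OF 5] W01 by simp
    qed
  qed
  also have "\<dots> = (\<integral>\<^sup>+ x. ennreal (W (U x)) \<partial>lborel) + (ennreal (\<omega> / 4) + ennreal (\<omega> / 4))"
    by (simp add: nn_integral_add nn_integral_cmult)
  also have "ennreal (\<omega> / 4) + ennreal (\<omega> / 4) = ennreal (\<omega> / 2)" using \<omega> by (subst ennreal_plus[symmetric]) auto
  finally have 2: "(\<integral>\<^sup>+ x. ennreal (W (V x)) \<partial>lborel) \<le> (\<integral>\<^sup>+ x. ennreal (W (U x)) \<partial>lborel) + ennreal (\<omega> / 2)" .
  have "profile_en W s UNIV V \<le> ((\<integral>\<^sup>+ x. ennreal (W (U x)) \<partial>lborel) + ennreal (\<omega> / 2)) + (gsq s UNIV U + ennreal (\<omega> / 2))"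
    unfolding profile_en_def using add_mono[OF 2 1] by simp
  also have "\<dots> = profile_en W s UNIV U + (ennreal (\<omega> / 2) + ennreal (\<omega> / 2))" unfolding profile_en_def by (simp add: add_ac)
  also have "ennreal (\<omega> / 2) + ennreal (\<omega> / 2) = ennreal \<omega>" using \<omega> by (subst ennreal_plus[symmetric]) auto
  finally have 3: "profile_en W s UNIV V \<le> profile_en W s UNIV U + ennreal \<omega>" .
  show ?thesis by (rule that[of V "R + 1" "max 1 M0", OF Vc _ low high M 3]) (use R in auto)
qed

text \<open>Three portions \<tau> are spent: on a near-minimiser, on cutting its tails and on
  averaging. The seminorm of a Lipschitz transition is continuous in the exponent, so the bound at
  \<open>s0\<close> passes to \<open>s j\<close>.\<close>

lemma (in scales) sobolev_profile:
  assumes s0': "1/2 < s0" and W: "double_well W" and m: "m_const W s0 = ennreal m" "0 \<le> m" and P: "(2 * s0 - 1) * m < P"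
  obtains \<phi> R M where "\<phi> \<in> borel_measurable borel" "0 < R" "\<And>x. x \<le> - R \<Longrightarrow> \<phi> x = -1" "\<And>x. R \<le> x \<Longrightarrow> \<phi> x = (1::real)" "\<And>x. \<bar>\<phi> x\<bar> \<le> M"
    "\<forall>\<^sub>F j in sequentially. ennreal (scale_factor (\<epsilon> j) (s j)) * ((\<integral>\<^sup>+ x. ennreal (W (\<phi> x)) \<partial>lborel) + gsq (s j) {- (1 / \<epsilon> j)<..<1 / \<epsilon> j} \<phi>) \<le> ennreal P"
proof -
  define a where "a = 2 * s0 - 1"
  have a: "0 < a" "a * m < P" unfolding a_def using s0' P by auto
  \<comment> \<open>After multiplication by \<open>a\<close> the three portions amount to three
    quarters of \<open>P - a * m\<close>, which leaves a strict inequality for the limit.\<close>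
  define \<tau> where "\<tau> = (P - a * m) / (4 * a)"
  have \<tau>: "0 < \<tau>" unfolding \<tau>_def using a by simp
  have "a * (m + 3 * \<tau>) = a * m + 3 * ((P - a * m) / 4)" unfolding \<tau>_def using a by (simp add: field_simps)
  also have "\<dots> < P" using a(2) by (simp add: field_simps)
  finally have aP: "a * (m + 3 * \<tau>) < P" .
  have "m_const W s0 < ennreal (m + \<tau>)" unfolding m(1) using m(2) \<tau> by (intro ennreal_lessI) auto
  then obtain U where U: "continuous_on UNIV U" "(U \<longlongrightarrow> 1) at_top" "(U \<longlongrightarrow> -1) at_bot" "profile_en W s0 UNIV U < ennreal (m + \<tau>)"
    by (rule m_const_less_profile_en[OF W])
  obtain V R M where V: "continuous_on UNIV V" "0 < R" "\<And>x. x \<le> - R \<Longrightarrow> V x = -1" "\<And>x. R \<le> x \<Longrightarrow> V x = (1::real)" "\<And>x. \<bar>V x\<bar> \<le> M"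
    "profile_en W s0 UNIV V \<le> profile_en W s0 UNIV U + ennreal \<tau>" by (rule cut_profile[OF W s0' s0(2) U(1-3) less_imp_le[OF U(4)] \<tau>]) blast
  obtain \<phi> K where \<phi>: "0 \<le> K" "\<And>x y. \<bar>\<phi> x - \<phi> y\<bar> \<le> K * \<bar>x - y\<bar>" "\<And>x. x \<le> - (R + 1) \<Longrightarrow> \<phi> x = -1" "\<And>x. R + 1 \<le> x \<Longrightarrow> \<phi> x = 1"
    "\<And>x. \<bar>\<phi> x\<bar> \<le> M" "(\<integral>\<^sup>+ x. ennreal (W (\<phi> x)) \<partial>lborel) \<le> (\<integral>\<^sup>+ x. ennreal (W (V x)) \<partial>lborel) + ennreal \<tau>" "gsq s0 UNIV \<phi> \<le> gsq s0 UNIV V"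
    by (rule steklov_profile[OF W V(1,3,4,5,2) \<tau>, of s0]) blast+
  have M0: "0 \<le> M" using V(5)[of 0] by linarith
  have osc: "\<bar>\<phi> x - \<phi> y\<bar> \<le> 2 * M" for x y using \<phi>(5)[of x] \<phi>(5)[of y] by linarith
  have t: "transition K (2 * M) (R + 1) \<phi>" unfolding transition_def using \<phi>(1-4) osc M0 V(2) by auto
  define w where "w = (\<integral>\<^sup>+ x. ennreal (W (\<phi> x)) \<partial>lborel)"
  have "w + gsq s0 UNIV \<phi> \<le> ((\<integral>\<^sup>+ x. ennreal (W (V x)) \<partial>lborel) + ennreal \<tau>) + gsq s0 UNIV V" unfolding w_def by (intro add_mono \<phi>)
  also have "\<dots> = profile_en W s0 UNIV V + ennreal \<tau>" unfolding profile_en_def by (simp add: add_ac)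
  also have "\<dots> \<le> (ennreal (m + \<tau>) + ennreal \<tau>) + ennreal \<tau>" by (intro add_right_mono order_trans[OF V(6)]) (use U(4) in auto)
  also have "\<dots> = ennreal (m + 3 * \<tau>)" using m(2) \<tau> by (simp flip: ennreal_plus)
  finally have le: "w + gsq s0 UNIV \<phi> \<le> ennreal (m + 3 * \<tau>)" .
  have fin: "w + gsq s0 UNIV \<phi> < top" using le by (rule le_less_trans) simp
  have "(\<lambda>j. ennreal (scale_factor (\<epsilon> j) (s j)) * (w + gsq (s j) UNIV \<phi>)) \<longlonglongrightarrow> ennreal a * (w + gsq s0 UNIV \<phi>)"
    unfolding a_def using fin by (intro tendsto_mult_ennreal tendsto_ennrealI scale_lim tendsto_add tendsto_const transition_gsq_tendsto[OF t s0' s0(2) s_lim]) auto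
  moreover have "ennreal a * (w + gsq s0 UNIV \<phi>) < ennreal P"
  proof -
    have "ennreal a * (w + gsq s0 UNIV \<phi>) \<le> ennreal a * ennreal (m + 3 * \<tau>)" by (intro mult_left_mono le) auto
    also have "\<dots> = ennreal (a * (m + 3 * \<tau>))" using a m(2) \<tau> by (simp add: ennreal_mult)
    also have "\<dots> < ennreal P" using aP a m(2) \<tau> by (intro ennreal_lessI) (auto intro: le_less_trans[rotated])
    finally show ?thesis .
  qed
  ultimately have "\<forall>\<^sub>F j in sequentially. ennreal (scale_factor (\<epsilon> j) (s j)) * (w + gsq (s j) UNIV \<phi>) < ennreal P" by (rule order_tendstoD)
  then have ev: "\<forall>\<^sub>F j in sequentially. ennreal (scale_factor (\<epsilon> j) (s j)) * ((\<integral>\<^sup>+ x. ennreal (W (\<phi> x)) \<partial>lborel) + gsq (s j) {- (1 / \<epsilon> j)<..<1 / \<epsilon> j} \<phi>) \<le> ennreal P"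
  proof eventually_elim
    case (elim j)
    have "ennreal (scale_factor (\<epsilon> j) (s j)) * (w + gsq (s j) {- (1 / \<epsilon> j)<..<1 / \<epsilon> j} \<phi>) \<le> ennreal (scale_factor (\<epsilon> j) (s j)) * (w + gsq (s j) UNIV \<phi>)"
      by (intro mult_left_mono add_left_mono gsq_mono_set) auto
    then show ?case using elim unfolding w_def by simp
  qed
  show ?thesis by (rule that[OF transition_measurable[OF t] _ \<phi>(3,4,5) ev]) (use V in auto)
qed

subsection \<open>The upper bound\<close>

lemma step_fun_measurable:
  assumes J: "finite J" shows "step_fun \<sigma> J \<in> borel_measurable borel"
proof -
  have "step_fun \<sigma> J = (\<lambda>x. \<sigma> - 2 * (\<Sum>z\<in>J. step_fun \<sigma> J z * indicator {z<..} x))"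
  proof
    fix x
    have "(\<Sum>z\<in>J \<inter> {..<x}. step_fun \<sigma> J z) = (\<Sum>z\<in>J. step_fun \<sigma> J z * indicator {z<..} x)"
      by (rule sum.mono_neutral_cong_left) (use J in \<open>auto simp: indicator_def\<close>)
    then show "step_fun \<sigma> J x = \<sigma> - 2 * (\<Sum>z\<in>J. step_fun \<sigma> J z * indicator {z<..} x)" using step_fun_telescope[OF J, of \<sigma> x] by simp
  qed
  moreover have "(\<lambda>x. \<sigma> - 2 * (\<Sum>z\<in>J. step_fun \<sigma> J z * indicator {z<..} x)) \<in> borel_measurable borel" by measurable
  ultimately show ?thesis by simp
qed

text \<open>Sequences that are almost optimal for each \<open>k\<close> become one optimal sequence
  by letting \<open>k\<close> grow so slowly with \<open>j\<close> that the estimates for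
  \<open>k\<close> already hold at \<open>j\<close>.\<close>

lemma diagonal_recovery:
  fixes v :: "nat \<Rightarrow> nat \<Rightarrow> real \<Rightarrow> real"
  assumes conv: "\<And>k. conv_meas (v k) T" and T [measurable]: "T \<in> borel_measurable borel" and v [measurable]: "\<And>k j. v k j \<in> borel_measurable borel"
    and ev: "\<And>k. \<forall>\<^sub>F j in sequentially. F j (v k j) \<le> ennreal (b k)" and dec: "decseq b" and b: "b \<longlonglongrightarrow> B"
  shows "\<exists>v'. (\<forall>j. v' j \<in> borel_measurable borel) \<and> conv_meas v' T \<and> limsup (\<lambda>j. F j (v' j)) \<le> ennreal B"
proof -
  define \<delta> where "\<delta> k = 1 / real (Suc k)" for k
  have \<delta>: "0 < \<delta> k" for k by (simp add: \<delta>_def)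
  have \<delta>dec: "\<delta> k' \<le> \<delta> k" if "k \<le> k'" for k k' using that by (simp add: \<delta>_def frac_le)
  have "\<exists>N. \<forall>j\<ge>N. F j (v k j) \<le> ennreal (b k) \<and> emeasure lborel {x \<in> {0<..<1}. \<bar>v k j x - T x\<bar> > \<delta> k} < ennreal (\<delta> k)" for k
  proof -
    have "(\<lambda>j. emeasure lborel {x \<in> {0<..<1}. \<bar>v k j x - T x\<bar> > \<delta> k}) \<longlonglongrightarrow> 0" using conv[of k] \<delta>[of k] unfolding conv_meas_def by blast
    then have "\<forall>\<^sub>F j in sequentially. emeasure lborel {x \<in> {0<..<1}. \<bar>v k j x - T x\<bar> > \<delta> k} < ennreal (\<delta> k)" using \<delta>[of k] by (intro order_tendstoD(2)) auto
    with ev[of k] have "\<forall>\<^sub>F j in sequentially. F j (v k j) \<le> ennreal (b k) \<and> emeasure lborel {x \<in> {0<..<1}. \<bar>v k j x - T x\<bar> > \<delta> k} < ennreal (\<delta> k)" by eventually_elim simp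
    then show ?thesis unfolding eventually_sequentially .
  qed
  then obtain N where N: "\<And>k j. N k \<le> j \<Longrightarrow> F j (v k j) \<le> ennreal (b k)" "\<And>k j. N k \<le> j \<Longrightarrow> emeasure lborel {x \<in> {0<..<1}. \<bar>v k j x - T x\<bar> > \<delta> k} < ennreal (\<delta> k)"
    by metis
  \<comment> \<open>The inserted \<open>0\<close> only keeps the maximum defined; the estimates for
    the chosen index can fail only for the finitely many \<open>j\<close> below
    \<open>N 0\<close>.\<close>
  define \<kappa> where "\<kappa> j = Max (insert 0 {k. k \<le> j \<and> N k \<le> j})" for j
  have \<kappa>: "K \<le> \<kappa> j \<and> N (\<kappa> j) \<le> j" if "max K (N K) \<le> j" for K j
  proof -
    have fin: "finite (insert 0 {k. k \<le> j \<and> N k \<le> j})" by simp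
    have K: "K \<in> {k. k \<le> j \<and> N k \<le> j}" using that by simp
    have le: "K \<le> \<kappa> j" unfolding \<kappa>_def using K by (intro Max_ge fin) auto
    have "\<kappa> j \<in> insert 0 {k. k \<le> j \<and> N k \<le> j}" unfolding \<kappa>_def by (intro Max_in fin) auto
    then have "N (\<kappa> j) \<le> j" using le K by auto
    then show ?thesis using le by simp
  qed
  define v' where "v' j = v (\<kappa> j) j" for j
  have "conv_meas v' T" unfolding conv_meas_def
  proof (intro allI impI)
    fix d :: real assume d: "0 < d"
    show "(\<lambda>j. emeasure lborel {x \<in> {0<..<1}. d < \<bar>v' j x - T x\<bar>}) \<longlonglongrightarrow> 0"
    proof (rule order_tendstoI)
      fix a :: ennreal assume "0 < a"
      then obtain r :: real where r: "0 < r" "ennreal r < a" by (metis ennreal_less_zero_iff ennreal_0 dense ennreal_cases less_top_ennreal order_less_trans top_greatest not_less)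
      obtain K where K: "\<delta> K < min d r" using reals_Archimedean[of "min d r"] d r unfolding \<delta>_def by (auto simp: inverse_eq_divide)
      show "\<forall>\<^sub>F j in sequentially. emeasure lborel {x \<in> {0<..<1}. d < \<bar>v' j x - T x\<bar>} < a"
        unfolding eventually_sequentially
      proof (intro exI[of _ "max K (N K)"] allI impI)
        fix j assume j: "max K (N K) \<le> j"
        have dk: "\<delta> (\<kappa> j) \<le> \<delta> K" using \<kappa>[OF j] by (intro \<delta>dec) simp
        have "emeasure lborel {x \<in> {0<..<1}. d < \<bar>v' j x - T x\<bar>} \<le> emeasure lborel {x \<in> {0<..<1}. \<delta> (\<kappa> j) < \<bar>v (\<kappa> j) j x - T x\<bar>}"
          unfolding v'_def using dk K by (intro emeasure_mono) auto
        also have "\<dots> < ennreal (\<delta> (\<kappa> j))" using \<kappa>[OF j] by (intro N(2)) simp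
        also have "\<dots> \<le> ennreal r" using dk K by (intro ennreal_leI) simp
        finally show "emeasure lborel {x \<in> {0<..<1}. d < \<bar>v' j x - T x\<bar>} < a" using r(2) by simp
      qed
    qed simp
  qed
  moreover have "limsup (\<lambda>j. F j (v' j)) \<le> ennreal B"
  proof (rule LIMSEQ_le_const[OF tendsto_ennrealI[OF b]], intro exI[of _ 0] allI impI)
    fix K
    have "\<forall>\<^sub>F j in sequentially. F j (v' j) \<le> ennreal (b K)" unfolding eventually_sequentially
    proof (intro exI[of _ "max K (N K)"] allI impI)
      fix j assume j: "max K (N K) \<le> j"
      have "F j (v' j) \<le> ennreal (b (\<kappa> j))" unfolding v'_def using \<kappa>[OF j] by (intro N(1)) simp
      also have "\<dots> \<le> ennreal (b K)" using \<kappa>[OF j] dec by (intro ennreal_leI) (simp add: decseq_def)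
      finally show "F j (v' j) \<le> ennreal (b K)" .
    qed
    then show "limsup (\<lambda>j. F j (v' j)) \<le> ennreal (b K)" by (rule Limsup_bounded)
  qed
  ultimately show ?thesis by (intro exI[of _ v']) (auto simp: v'_def)
qed

lemma (in scales) near_optimal_profile:
  assumes W: "double_well W" and c: "limit_const W s0 = ennreal c" "0 \<le> c" and P: "c < P"
  obtains \<phi> R M where "\<phi> \<in> borel_measurable borel" "0 < R" "\<And>x. x \<le> - R \<Longrightarrow> \<phi> x = -1" "\<And>x. R \<le> x \<Longrightarrow> \<phi> x = (1::real)" "\<And>x. \<bar>\<phi> x\<bar> \<le> M"
    "\<forall>\<^sub>F j in sequentially. ennreal (scale_factor (\<epsilon> j) (s j)) * ((\<integral>\<^sup>+ x. ennreal (W (\<phi> x)) \<partial>lborel) + gsq (s j) {- (1 / \<epsilon> j)<..<1 / \<epsilon> j} \<phi>) \<le> ennreal P"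
proof (cases "s0 = 1/2")
  case True
  have "ennreal 8 = ennreal c" using c(1) True by (simp add: limit_const_def)
  then have c8: "c = 8" using c(2) by (simp only: ennreal_inj) 
  have "\<forall>\<^sub>F j in sequentially. ennreal (scale_factor (\<epsilon> j) (s j)) * ((\<integral>\<^sup>+ x. ennreal (W (ramp x)) \<partial>lborel) + gsq (s j) {- (1 / \<epsilon> j)<..<1 / \<epsilon> j} ramp) \<le> ennreal (8 + (P - 8))"
    by (rule half_profile[OF True W]) (use P c8 in simp)
  then show ?thesis by (intro that[of ramp 1 1]) (auto simp: max_def min_def)
next
  case False
  then have s0': "1/2 < s0" using s0 by simp
  have lc: "ennreal (2 * s0 - 1) * m_const W s0 = ennreal c" using c(1) False by (simp add: limit_const_def)
  have "m_const W s0 \<noteq> top"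
  proof
    assume "m_const W s0 = top"
    then show False using lc s0' by (simp add: ennreal_mult_top)
  qed
  then obtain m where m: "m_const W s0 = ennreal m" "0 \<le> m" by (cases "m_const W s0") auto
  have "ennreal ((2 * s0 - 1) * m) = ennreal c" using lc s0' m by (simp add: ennreal_mult)
  then have "(2 * s0 - 1) * m = c" using c(2) s0' m(2) by (simp add: ennreal_inj)
  then show ?thesis using sobolev_profile[OF s0' W m, of P] P that by blast
qed

text \<open>The order of the cases reflects \<open>0 * \<infinity> = 0\<close>: without jumps the
  constant sequence has zero energy, with jumps and an infinite constant any sequence will do, and
  only otherwise are profiles glued in.\<close>

lemma (in scales) recovery_sequence:
  assumes W: "double_well W" and w [measurable]: "w \<in> borel_measurable borel" and pm: "\<And>x. w x = 1 \<or> w x = -1" and J: "finite (ess_jumps w)"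
  shows "\<exists>v. (\<forall>j. v j \<in> borel_measurable borel) \<and> conv_meas v w \<and> limsup (\<lambda>j. loc_energy W (s j) (\<epsilon> j) {0<..<1} (v j)) \<le> limit_const W s0 * of_nat (card (ess_jumps w))"
proof -
  have W01: "W 1 = 0" "W (-1) = 0" using W unfolding double_well_def by blast+
  have J01: "ess_jumps w \<subseteq> {0<..<1}" by (auto simp: ess_jumps_def)
  obtain \<sigma> where \<sigma>: "\<sigma> = 1 \<or> \<sigma> = -1" "AE x in lborel. x \<in> {0<..<1} \<longrightarrow> w x = step_fun \<sigma> (ess_jumps w) x" by (rule finite_ess_jumps_step[OF w pm J])
  have const: "conv_meas (\<lambda>_. w) w" unfolding conv_meas_def by simp
  show ?thesis
  proof (cases "ess_jumps w = {}")
    case True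
    have ae: "AE x in lborel. x \<in> {0<..<1} \<longrightarrow> w x = \<sigma>" using \<sigma>(2) unfolding True step_fun_def by simp
    have "gsq r {0<..<1} (\<lambda>_. \<sigma>) = 0" for r unfolding gsq_def kern_def by simp
    then have "gsq r {0<..<1} w = 0" for r using gsq_cong_AE[OF ae] by simp
    moreover have "W (w t) = 0" for t using pm[of t] W01 by auto
    ultimately have "loc_energy W (s j) (\<epsilon> j) {0<..<1} w = 0" for j unfolding loc_energy_def by simp
    then show ?thesis using const w by (intro exI[of _ "\<lambda>_. w"]) (simp add: Limsup_const)
  next
    case ne: False
    show ?thesis
    proof (cases "limit_const W s0 = \<infinity>")
      case True
      then have "limit_const W s0 * of_nat (card (ess_jumps w)) = top" using J ne by (simp add: ennreal_top_mult)
      then show ?thesis using const w by (intro exI[of _ "\<lambda>_. w"]) simp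
    next
      case False
      then obtain c where c: "limit_const W s0 = ennreal c" "0 \<le> c" by (cases "limit_const W s0") auto
      define T where "T = step_fun \<sigma> (ess_jumps w)"
      define n where "n = real (card (ess_jumps w))"
      have Tm [measurable]: "T \<in> borel_measurable borel" unfolding T_def by (rule step_fun_measurable[OF J])
      \<comment> \<open>The first summand comes from profiles within \<open>1 / (k + 1)\<close> of
        the optimal cost at each jump, the second from the far interaction of the glued
        functions.\<close>
      define b where "b k = n * (c + 1 / real (Suc k)) + 1 / real (Suc k)" for k
      have "\<exists>v. (\<forall>j. v j \<in> borel_measurable borel) \<and> conv_meas v T \<and> (\<forall>\<^sub>F j in sequentially. loc_energy W (s j) (\<epsilon> j) {0<..<1} (v j) \<le> ennreal (b k))" for k
      proof -
        have "c < c + 1 / real (Suc k)" by simp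
        then obtain \<phi> R M where \<phi>: "\<phi> \<in> borel_measurable borel" "0 < R" "\<And>x. x \<le> - R \<Longrightarrow> \<phi> x = -1" "\<And>x. R \<le> x \<Longrightarrow> \<phi> x = (1::real)" "\<And>x. \<bar>\<phi> x\<bar> \<le> M"
          "\<forall>\<^sub>F j in sequentially. ennreal (scale_factor (\<epsilon> j) (s j)) * ((\<integral>\<^sup>+ x. ennreal (W (\<phi> x)) \<partial>lborel) + gsq (s j) {- (1 / \<epsilon> j)<..<1 / \<epsilon> j} \<phi>) \<le> ennreal (c + 1 / real (Suc k))"
          by (rule near_optimal_profile[OF W c]) blast
        have "0 \<le> c + 1 / real (Suc k)" using c(2) by simp
        from profile_recovery[OF W \<phi>(1,3,4,5,2) \<sigma>(1) J J01 this \<phi>(6)]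
        obtain v where v: "\<forall>j. v j \<in> borel_measurable borel" "conv_meas v T"
          "\<And>\<eta>. 0 < \<eta> \<Longrightarrow> \<forall>\<^sub>F j in sequentially. loc_energy W (s j) (\<epsilon> j) {0<..<1} (v j) \<le> ennreal (n * (c + 1 / real (Suc k)) + \<eta>)"
          unfolding T_def n_def by blast
        show ?thesis using v(1,2) v(3)[of "1 / real (Suc k)"] unfolding b_def by (intro exI[of _ v]) simp
      qed
      then obtain V where V: "\<And>k j. V k j \<in> borel_measurable borel" "\<And>k. conv_meas (V k) T"
        "\<And>k. \<forall>\<^sub>F j in sequentially. loc_energy W (s j) (\<epsilon> j) {0<..<1} (V k j) \<le> ennreal (b k)" by metis
      have n0: "0 \<le> n" unfolding n_def by simp
      have "decseq b" unfolding decseq_def b_def by (intro allI impI add_mono mult_left_mono n0 order_refl frac_le) auto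
      moreover have "b \<longlonglongrightarrow> n * c"
      proof -
        have "b \<longlonglongrightarrow> n * (c + 0) + 0" unfolding b_def using LIMSEQ_inverse_real_of_nat by (intro tendsto_intros) (simp_all add: inverse_eq_divide)
        then show ?thesis by simp
      qed
      ultimately obtain v where v: "\<forall>j. v j \<in> borel_measurable borel" "conv_meas v T" "limsup (\<lambda>j. loc_energy W (s j) (\<epsilon> j) {0<..<1} (v j)) \<le> ennreal (n * c)"
        using diagonal_recovery[of V T "\<lambda>j. loc_energy W (s j) (\<epsilon> j) {0<..<1}" b "n * c", OF V(2) Tm V(1) V(3)] by blast
      have [measurable]: "v j \<in> borel_measurable borel" for j using v(1) by blast
      have "emeasure lborel {x \<in> {0<..<1}. \<bar>v j x - w x\<bar> > \<delta>} = emeasure lborel {x \<in> {0<..<1}. \<bar>v j x - T x\<bar> > \<delta>}" for j \<delta>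
      proof (rule emeasure_eq_AE)
        show "AE x in lborel. x \<in> {x \<in> {0<..<1}. \<bar>v j x - w x\<bar> > \<delta>} \<longleftrightarrow> x \<in> {x \<in> {0<..<1}. \<bar>v j x - T x\<bar> > \<delta>}"
          using \<sigma>(2) by eventually_elim (auto simp: T_def)
        show "{x \<in> {0<..<1}. \<bar>v j x - w x\<bar> > \<delta>} \<in> sets lborel" "{x \<in> {0<..<1}. \<bar>v j x - T x\<bar> > \<delta>} \<in> sets lborel" by measurable
      qed
      then have "conv_meas v w" using v(2) unfolding conv_meas_def by simp
      moreover have "ennreal (n * c) = limit_const W s0 * of_nat (card (ess_jumps w))" unfolding c(1) n_def using c(2) by (simp add: ennreal_mult ennreal_of_nat_eq_real_of_nat mult.commute)
      ultimately show ?thesis using v(1,3) by (intro exI[of _ v]) simp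
    qed
  qed
qed

section \<open>From Borel representatives back to measurable functions\<close>

lemma energy_eq_loc_energy:
  assumes u': "u' \<in> borel_measurable borel" and ae: "AE x in lborel. x \<in> {0<..<1} \<longrightarrow> u x = u' x"
  shows "energy W s \<epsilon> u = loc_energy W s \<epsilon> {0<..<1} u'"
proof -
  have "(\<integral>\<^sup>+ t. ennreal (W (u t)) \<partial>lebesgue_on {0<..<1}) = (\<integral>\<^sup>+ t. ennreal (W (u t)) * indicator {0<..<1} t \<partial>lborel)"
    by (rule nn_integral_lebesgue_on) simp
  also have "\<dots> = (\<integral>\<^sup>+ t. ennreal (W (u' t)) * indicator {0<..<1} t \<partial>lborel)"
    by (rule nn_integral_cong_AE) (use ae in \<open>auto elim!: eventually_mono simp: indicator_def\<close>)
  finally show ?thesis unfolding energy_def loc_energy_def using gagliardo_sq_eq[OF _ u' ae, of s] by simp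
qed

text \<open>Subsets of \<open>(0,1)\<close> have finite measure, so \<open>measure\<close> and
  \<open>emeasure\<close> carry the same information, and passing to representatives changes the
  sets only by null sets.\<close>

lemma tendsto_in_measure_iff_conv_meas:
  assumes v: "\<And>j. v j \<in> borel_measurable (lebesgue_on {0<..<1})" and u: "u \<in> borel_measurable (lebesgue_on {0<..<1})"
    and v' [measurable]: "\<And>j. v' j \<in> borel_measurable borel" and u' [measurable]: "u' \<in> borel_measurable borel"
    and aev: "\<And>j. AE x in lborel. x \<in> {0<..<1} \<longrightarrow> v j x = v' j x" and aeu: "AE x in lborel. x \<in> {0<..<1} \<longrightarrow> u x = u' x"
  shows "tendsto_in_measure v u \<longleftrightarrow> conv_meas v' u'"
proof -
  define M :: "real measure" where "M = lebesgue_on {0<..<1}"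
  have sp: "space M = {0<..<1}" unfolding M_def by simp
  have [measurable]: "v j \<in> borel_measurable M" "u \<in> borel_measurable M" for j using v u unfolding M_def by auto
  have [measurable]: "v' j \<in> borel_measurable M" "u' \<in> borel_measurable M" for j unfolding M_def by (auto intro: borel_measurable_lebesgue_on)
  have AEM: "AE x in M. P x" if "AE x in lborel. x \<in> {0<..<1} \<longrightarrow> P x" for P using that unfolding M_def by (subst AE_lebesgue_on_iff) auto
  have "ennreal (measure M {x \<in> {0<..<1}. \<bar>v j x - u x\<bar> > \<delta>}) = emeasure lborel {x \<in> {0<..<1}. \<bar>v' j x - u' x\<bar> > \<delta>}" for j \<delta>
  proof -
    have S: "{x \<in> {0<..<1}. \<bar>v j x - u x\<bar> > \<delta>} \<in> sets M" "{x \<in> {0<..<1}. \<bar>v' j x - u' x\<bar> > \<delta>} \<in> sets M" unfolding sp[symmetric] by measurable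
    have B: "{x \<in> {0<..<1}. \<bar>v' j x - u' x\<bar> > \<delta>} \<in> sets borel" by measurable
    have "emeasure M {x \<in> {0<..<1}. \<bar>v j x - u x\<bar> > \<delta>} = emeasure M {x \<in> {0<..<1}. \<bar>v' j x - u' x\<bar> > \<delta>}"
      by (rule emeasure_eq_AE[OF _ S]) (use AEM[OF aev[of j]] AEM[OF aeu] in \<open>eventually_elim, simp\<close>)
    also have "\<dots> = emeasure lebesgue {x \<in> {0<..<1}. \<bar>v' j x - u' x\<bar> > \<delta>}" unfolding M_def by (rule emeasure_restrict_space) auto
    also have "\<dots> = emeasure lborel {x \<in> {0<..<1}. \<bar>v' j x - u' x\<bar> > \<delta>}" by (rule emeasure_lebesgue_borel[OF B])
    finally have eq: "emeasure M {x \<in> {0<..<1}. \<bar>v j x - u x\<bar> > \<delta>} = emeasure lborel {x \<in> {0<..<1}. \<bar>v' j x - u' x\<bar> > \<delta>}" .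
    have "emeasure lborel {x \<in> {0<..<1}. \<bar>v' j x - u' x\<bar> > \<delta>} \<le> emeasure lborel {0<..<1::real}" by (rule emeasure_mono) auto
    then have "emeasure M {x \<in> {0<..<1}. \<bar>v j x - u x\<bar> > \<delta>} \<noteq> top" unfolding eq by (auto simp: top_unique)
    then show ?thesis using emeasure_eq_ennreal_measure[of M] eq by simp
  qed
  then have "(\<lambda>j. measure M {x \<in> {0<..<1}. \<bar>v j x - u x\<bar> > \<delta>}) \<longlonglongrightarrow> 0 \<longleftrightarrow> (\<lambda>j. emeasure lborel {x \<in> {0<..<1}. \<bar>v' j x - u' x\<bar> > \<delta>}) \<longlonglongrightarrow> 0" for \<delta>
    using tendsto_ennreal_iff[of "\<lambda>j. measure M {x \<in> {0<..<1}. \<bar>v j x - u x\<bar> > \<delta>}" sequentially 0] by simp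
  then show ?thesis unfolding tendsto_in_measure_def conv_meas_def M_def by simp
qed

lemma (in scales) Gamma_limit:
  assumes W: "double_well W"
  shows "Gamma_converges (\<lambda>j. energy W (s j) (\<epsilon> j)) (\<lambda>u. limit_const W s0 * F0 u)"
  unfolding Gamma_converges_def
proof (intro ballI conjI allI impI)
  fix u v assume u: "u \<in> measurable_functions" and "(\<forall>j. v j \<in> measurable_functions) \<and> tendsto_in_measure v u"
  then have v: "\<And>j. v j \<in> measurable_functions" and conv: "tendsto_in_measure v u" by blast+
  have "\<exists>v'. v' \<in> borel_measurable borel \<and> (AE x in lborel. x \<in> {0<..<1} \<longrightarrow> v j x = v' x)" for j
    by (rule borel_rep_lebesgue_on[OF _ v[of j]]) auto
  then obtain v' where v': "\<And>j. v' j \<in> borel_measurable borel" "\<And>j. AE x in lborel. x \<in> {0<..<1} \<longrightarrow> v j x = v' j x" by metis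
  have en: "energy W (s j) (\<epsilon> j) (v j) = loc_energy W (s j) (\<epsilon> j) {0<..<1} (v' j)" for j by (rule energy_eq_loc_energy[OF v'])
  obtain u' where u': "u' \<in> borel_measurable borel" "AE x in lborel. x \<in> {0<..<1} \<longrightarrow> u x = u' x" by (rule borel_rep_lebesgue_on[OF _ u]) auto
  note [measurable] = u'(1)
  show "limit_const W s0 * F0 u \<le> liminf (\<lambda>j. energy W (s j) (\<epsilon> j) (v j))"
  proof (cases "AE x in lborel. x \<in> {0<..<1} \<longrightarrow> u' x = 1 \<or> u' x = -1")
    case True
    \<comment> \<open>A representative with values \<open>\<plusminus>1\<close> everywhere, as the
      counting of jump points assumes.\<close>
    define w where "w x = (if u' x = 1 then 1 else -1::real)" for x
    have w: "w \<in> borel_measurable borel" unfolding w_def by measurable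
    have pm: "w x = 1 \<or> w x = -1" for x unfolding w_def by simp
    have ae: "AE x in lborel. x \<in> {0<..<1} \<longrightarrow> u x = w x" using u'(2) True unfolding w_def by eventually_elim auto
    have "conv_meas v' w" using tendsto_in_measure_iff_conv_meas[OF v u v'(1) w v'(2) ae] conv by simp
    then show ?thesis unfolding en F0_eq_count[OF u w pm ae] by (intro liminf_inequality[OF W]) (use w pm v' in auto)
  next
    case False
    have "conv_meas v' u'" using tendsto_in_measure_iff_conv_meas[OF v u v'(1) u'(1) v'(2) u'(2)] conv by simp
    from liminf_not_pm1[OF W u'(1) v'(1) this False] show ?thesis unfolding en by simp
  qed
next
  fix u assume u: "u \<in> measurable_functions"
  have [simp]: "r \<in> borel_measurable borel \<Longrightarrow> r \<in> measurable_functions" for r by (rule borel_measurable_lebesgue_on)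
  show "\<exists>v. (\<forall>j. v j \<in> measurable_functions) \<and> tendsto_in_measure v u \<and> limsup (\<lambda>j. energy W (s j) (\<epsilon> j) (v j)) \<le> limit_const W s0 * F0 u"
  proof (cases "F0 u = \<infinity>")
    case True
    \<comment> \<open>Positivity of the constant is essential here, since
      \<open>0 * \<infinity>\<close> is \<open>0\<close>.\<close>
    have "limit_const W s0 * F0 u = \<infinity>" using True limit_const_pos[OF W s0(1)] by (simp add: ennreal_mult_top)
    moreover have "tendsto_in_measure (\<lambda>_. u) u" unfolding tendsto_in_measure_def by simp
    ultimately show ?thesis using u by (intro exI[of _ "\<lambda>_. u"]) simp
  next
    case False
    obtain u' where u': "u' \<in> borel_measurable borel" "AE x in lborel. x \<in> {0<..<1} \<longrightarrow> u x = u' x" by (rule borel_rep_lebesgue_on[OF _ u]) auto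
    note [measurable] = u'(1)
    have True: "AE x in lborel. x \<in> {0<..<1} \<longrightarrow> u x = 1 \<or> u x = -1" using F0_not_pm1 False by blast
    define w where "w x = (if u' x = 1 then 1 else -1::real)" for x
    have w: "w \<in> borel_measurable borel" unfolding w_def by measurable
    have pm: "w x = 1 \<or> w x = -1" for x unfolding w_def by simp
    have ae: "AE x in lborel. x \<in> {0<..<1} \<longrightarrow> u x = w x" using u'(2) True unfolding w_def by eventually_elim auto
    have F: "F0 u = emeasure (count_space UNIV) (ess_jumps w)" by (rule F0_eq_count[OF u w pm ae])
    then have J: "finite (ess_jumps w)" using False by (cases "finite (ess_jumps w)") (auto simp: emeasure_count_space)
    obtain v where v: "\<And>j. v j \<in> borel_measurable borel" "conv_meas v w" "limsup (\<lambda>j. loc_energy W (s j) (\<epsilon> j) {0<..<1} (v j)) \<le> limit_const W s0 * of_nat (card (ess_jumps w))"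
      using recovery_sequence[OF W w pm J] by blast
    have "tendsto_in_measure v u" using tendsto_in_measure_iff_conv_meas[of v u v w] v u w ae by simp
    moreover have "energy W (s j) (\<epsilon> j) (v j) = loc_energy W (s j) (\<epsilon> j) {0<..<1} (v j)" for j by (rule energy_eq_loc_energy[OF v(1)]) simp
    moreover have "F0 u = of_nat (card (ess_jumps w))" unfolding F using J by simp
    ultimately show ?thesis using v by (intro exI[of _ v]) simp
  qed
qed

theorem mainTheorem3:
  fixes W :: "real \<Rightarrow> real"
  assumes "double_well W"
  shows "(\<forall>s\<^sub>0 \<in> {1/2..<1}. regular_point W s\<^sub>0) \<and>
         (\<forall>s \<in> {1/2..<1}.
            Gamma_converges_at_0 (energy W s)
              (\<lambda>u. if s = 1/2 then 8 * F0 u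
                   else ennreal (2 * s - 1) * m_const W s * F0 u))"
proof (intro conjI ballI)
  fix s0 :: real assume s0: "s0 \<in> {1/2..<1}"
  have Gamma: "Gamma_converges (\<lambda>j. energy W (s j) (\<epsilon> j)) (\<lambda>u. limit_const W s0 * F0 u)"
    if "\<forall>j. s j \<in> {1/2..<1} \<and> \<epsilon> j \<in> {0<..<1}" "s \<longlonglongrightarrow> s0" "\<epsilon> \<longlonglongrightarrow> 0" for s \<epsilon> :: "nat \<Rightarrow> real"
  proof -
    interpret scales s \<epsilon> s0 by unfold_locales (use that s0 in auto)
    show ?thesis by (rule Gamma_limit[OF assms])
  qed
  \<comment> \<open>The limit obtained depends on the two sequences only through \<open>s0\<close>,
    so it is a common witness.\<close>
  show "regular_point W s0" unfolding regular_point_def using Gamma by blast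
next
  fix s :: real assume s: "s \<in> {1/2..<1}"
  have "(\<lambda>u. if s = 1/2 then 8 * F0 u else ennreal (2 * s - 1) * m_const W s * F0 u) = (\<lambda>u. limit_const W s * F0 u)"
    by (auto simp: limit_const_def)
  moreover have "Gamma_converges (\<lambda>j. energy W s (\<epsilon> j)) (\<lambda>u. limit_const W s * F0 u)"
    if "\<forall>j. \<epsilon> j \<in> {0<..<1}" "\<epsilon> \<longlonglongrightarrow> 0" for \<epsilon> :: "nat \<Rightarrow> real"
  proof -
    interpret scales "\<lambda>_. s" \<epsilon> s by unfold_locales (use that s in auto)
    show ?thesis by (rule Gamma_limit[OF assms])
  qed
  ultimately show "Gamma_converges_at_0 (energy W s) (\<lambda>u. if s = 1/2 then 8 * F0 u else ennreal (2 * s - 1) * m_const W s * F0 u)"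
    unfolding Gamma_converges_at_0_def by simp
qed


end
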